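(* Assume that $\rho + \delta -(1-\gamma)\left(r + \delta +\frac{\kappa^\top \kappa}{2\gamma }\right) >0$. Set $$b= 1-\tfrac{1}{\gamma},\qquad \nu := \frac{\gamma}{\rho + \delta -(1-\gamma) (r + \delta +\frac{\kappa^\top \kappa}{2\gamma })},\qquad \eta :=(1+ \delta k^{-b})\,\nu,\qquad \hat \eta:= (K^{-b}+ \delta k^{-b})\, \nu,$$ $$f(t):=(\hat \eta - \eta)\exp\left(-\frac{(\tau_R-t)^+}{\nu} \right) + \eta,\qquad F(t) := e^{-\frac{(\rho + \delta)t}{\gamma}}f(t),\qquad t\ge 0.$$ (1) For every $(t,w,x)\in[0,\infty)\times\mathbb R\times M_2$ with $\Gamma(t,w,x)\ge 0$, the value function satisfies $$V(t,w,x)= F(t)^{\gamma}\,\frac{\Gamma(t,w,x)^{1-\gamma}}{1-\gamma},$$ where for $\Gamma(t,w,x)=0$ the right-hand side is understood as $0$ if $\gamma\in(0,1)$ and as $-\infty$ if $\gamma>1$. (2) Let $(w,x)\in\mathbb R\times M_2$ with $\Gamma(0,w,x)\ge 0$ and take initial time $t=0$. Optimal strategies are given, for all $s\ge 0$, by $$\overline c_f(s)=K^{-bR(s)}f(s)^{-1}\Gamma^*(s),\qquad \overline B_f(s)=k^{-b}f(s)^{-1}\Gamma^*(s),$$ $$\overline\theta_f(s)=(\sigma\sigma^\top)^{-1}\,\frac{\mu-r\mathbf 1}{\gamma}\,\Gamma^*(s)-g(s)\,y(s)\,(\sigma^\top)^{-1}\sigma_y ,$$ where $$\Gamma^*(s)=W^*(s)+g(s)y(s)+\int_{-d}^0h(s,\zeta)\,y(s+\zeta)\,\mathrm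 d\zeta,\qquad s\ge 0,$$ $y$ is the labor income process, and the financial wealth $W^*$ is the solution of the wealth equation controlled by $(\overline c_f,\overline B_f,\overline \theta_f)$ (a closed-loop equation, since the controls depend on $W^*$ through $\Gamma^*$). (3) The optimal total wealth process $\Gamma^*$ has dynamics, for $s\ge 0$, $$\mathrm d\Gamma^*(s)=\Gamma^*(s)\Big(r+\delta+\tfrac1\gamma\kappa^\top\kappa-f(s)^{-1}\big(K^{-bR(s)}+\delta k^{-b}\big)\Big)\mathrm ds+\tfrac{1}{\gamma}\,\Gamma^*(s)\,\kappa^\top\,\mathrm dZ(s).$$
   Context: Let $Z$ be an $n$-dimensional standard Brownian motion on a probability space $(\Omega,\mathcal F,\mathbb P)$ and let $\mathbb F$ be the augmentation of its natural filtration. Parameters: $r\in\mathbb R$, $\mu\in\mathbb R^n$, $\sigma\in\mathbb R^{n\times n}$ invertible, $\delta>0$, $\rho>0$, $K>1$, $k>0$, $\gamma\in(0,1)\cup(1,\infty)$, $\tau_R>0$, $d>0$, $\mu_y\in\mathbb R$, $\sigma_y\in\mathbb R^n$, $\phi\in L^2(-d,0;\mathbb R)$; $\mathbf 1=(1,\dots,1)^\top\in\mathbb R^n$; $\kappa:=\sigma^{-1}(\mu-r\mathbf 1)$; $\beta:=r+\delta-\mu_y+\sigma_y^\top\kappa$, with the standing assumption $\beta>0$; $R(s):=\mathbb I_{\{\tau_R\le s\}}$. $M_2:=\mathbb R\times L^2(-d,0;\mathbb R)$; elements are written $x=(x_0,x_1)$; $\langle\cdot,\cdot\rangle$ is the inner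 product of $L^2(-d,0;\mathbb R)$. State equations with initial time $t\ge0$ and initial data $(w,x)\in\mathbb R\times M_2$, for $s\ge t$: $$\mathrm dW(s)=\big[(r+\delta)W(s)+\theta(s)^\top(\mu-r\mathbf 1)+(1-R(s))y(s)-c(s)-\delta B(s)\big]\mathrm ds+\theta(s)^\top\sigma\,\mathrm dZ(s),\quad W(t)=w,$$ $$\mathrm dy(s)=\Big[\mu_y y(s)+\int_{-d}^0\phi(\zeta)y(s+\zeta)\,\mathrm d\zeta\Big]\mathrm ds+y(s)\sigma_y^\top\mathrm dZ(s),\quad y(t)=x_0,\ y(t+\zeta)=x_1(\zeta)\text{ for }\zeta\in[-d,0).$$ Write $W^{w,x}(s;t,\pi)$ for the wealth under the control $\pi=(c,B,\theta)$, and $X(s)=(X_0(s),X_1(s))\in M_2$ with $X_0(s)=y(s)$, $X_1(s)(\zeta)=y(s+\zeta)$. $(g,h)$, with $g:[0,\infty)\to\mathbb R$ and $h:[0,\infty)\times[-d,0]\to\mathbb R$ continuous, is the unique continuous solution of $$g(t)=\mathbb I_{\{t<\tau_R\}}\int_t^{\tau_R}e^{-\beta(\tau-t)}(h(\tau,0)+1)\,\mathrm d\tau,\qquad h(t,\zeta)=\mathbb I_{\{t<\tau_R\}}\int_{(\zeta+t-\tau_R)\vee(-d)}^{\zeta}e^{-(r+\delta)(\zeta-\tau)}g(t+\zeta-\tau)\phi(\tau)\,\mathrm d\tau,$$ and $h(t):=h(t,\cdot)$. Set $\Gamma(t,w,x):=w+g(t)x_0+\langle h(t),x_1\rangle$.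 For $\Gamma(t,w,x)\ge0$, the admissible set $\Pi(t,w,x)$ consists of all $\mathbb F$-predictable $\pi=(c,B,\theta)$ on $[t,\infty)$ with $c,B\ge0$ real valued, $\theta$ $\mathbb R^n$-valued, $\mathbb E\int_t^T(c+B+|\theta|^2)\,\mathrm ds<\infty$ for all $T>t$, such that $\Gamma(s,W^{w,x}(s;t,\pi),X(s))\ge0$ for all $s\ge t$. The objective functional is $$J(t,w,x;\pi)=\mathbb E\int_t^{\infty}e^{-(\rho+\delta)s}\Big(\frac{(K^{R(s)}c(s))^{1-\gamma}}{1-\gamma}+\delta\frac{(kB(s))^{1-\gamma}}{1-\gamma}\Big)\mathrm ds,$$ and $V(t,w,x):=\sup_{\pi\in\Pi(t,w,x)}J(t,w,x;\pi)\in[-\infty,+\infty]$. A strategy $\overline\pi\in\Pi(0,w,x)$ is optimal (for initial time $0$) if $J(0,w,x;\overline\pi)=V(0,w,x)$. *)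

theory Defs
  imports "HOL-Probability.Probability"
begin

section \<open>Brownian motion and stochastic integration\<close>

definition natural_filtration ::
  "'a measure \<Rightarrow> (real \<Rightarrow> 'a \<Rightarrow> 'b::topological_space) \<Rightarrow> real \<Rightarrow> 'a measure" where
  "natural_filtration M Z t =
     sigma (space M) (\<Union>s\<in>{0..t}. {Z s -` A \<inter> space M | A. A \<in> sets borel})"

text \<open>All subsets of null sets are adjoined. If \<open>M\<close> is not complete they need not be
  \<open>M\<close>-measurable, and therefore expectations and probabilities are taken below with respect to
  \<open>completion M\<close>.\<close>

definition augmented_filtration ::
  "'a measure \<Rightarrow> (real \<Rightarrow> 'a \<Rightarrow> 'b::topological_space) \<Rightarrow> real \<Rightarrow> 'a measure" where
  "augmented_filtration M Z t =
     sigma (space M) (sets (natural_filtration M Z t) \<union> null_sets (completion M))"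

definition brownian_motion :: "'a measure \<Rightarrow> (real \<Rightarrow> 'a \<Rightarrow> real^'n) \<Rightarrow> bool" where
  "brownian_motion M Z \<longleftrightarrow>
     (\<forall>t\<ge>0. Z t \<in> borel_measurable M) \<and>
     (AE \<omega> in M. Z 0 \<omega> = 0) \<and>
     (AE \<omega> in M. continuous_on {0..} (\<lambda>t. Z t \<omega>)) \<and>
     (\<forall>s t. 0 \<le> s \<and> s < t \<longrightarrow>
        distributed M lborel (\<lambda>\<omega>. Z t \<omega> - Z s \<omega>)
          (\<lambda>x. ennreal (\<Prod>i\<in>UNIV. normal_density 0 (sqrt (t - s)) (x $ i))) \<and>
        prob_space.indep_set M (sets (natural_filtration M Z s))
          (sets (vimage_algebra (space M) (\<lambda>\<omega>. Z t \<omega> - Z s \<omega>) borel)))"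

text \<open>The predictable sigma-algebra on \<open>[t, \<infinity>) \<times> \<Omega>\<close>.\<close>

definition predictable_algebra ::
  "'a measure \<Rightarrow> (real \<Rightarrow> 'a measure) \<Rightarrow> real \<Rightarrow> (real \<times> 'a) measure" where
  "predictable_algebra M F t =
     sigma ({t..} \<times> space M)
       ({{t} \<times> A | A. A \<in> sets (F t)} \<union>
        {{s<..u} \<times> A | s u A. t \<le> s \<and> s \<le> u \<and> A \<in> sets (F s)})"

definition predictable ::
  "'a measure \<Rightarrow> (real \<Rightarrow> 'a measure) \<Rightarrow> real \<Rightarrow> (real \<Rightarrow> 'a \<Rightarrow> 'b::topological_space) \<Rightarrow> bool"
  where
  "predictable M F t H \<longleftrightarrow> (\<lambda>(s, \<omega>). H s \<omega>) \<in> borel_measurable (predictable_algebra M F t)"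

definition continuous_adapted ::
  "'a measure \<Rightarrow> (real \<Rightarrow> 'a measure) \<Rightarrow> real \<Rightarrow> (real \<Rightarrow> 'a \<Rightarrow> 'b::topological_space) \<Rightarrow> bool"
  where
  "continuous_adapted M F t X \<longleftrightarrow>
     (\<forall>s\<ge>t. X s \<in> borel_measurable (F s)) \<and>
     (\<forall>\<omega>\<in>space M. continuous_on {t..} (\<lambda>s. X s \<omega>))"

text \<open>The data \<open>m, p, \<xi>\<close> encode the process that equals \<open>\<xi> i\<close> on \<open>(p i, p (i + 1)]\<close>, \<open>i < m\<close>,
  and \<open>0\<close> elsewhere.\<close>

definition simple_process ::
  "'a measure \<Rightarrow> (real \<Rightarrow> 'a measure) \<Rightarrow> real \<Rightarrow>
   nat \<Rightarrow> (nat \<Rightarrow> real) \<Rightarrow> (nat \<Rightarrow> 'a \<Rightarrow> real^'n) \<Rightarrow> bool" where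
  "simple_process M F t m p \<xi> \<longleftrightarrow>
     t \<le> p 0 \<and>
     (\<forall>i<m. p i \<le> p (Suc i) \<and> \<xi> i \<in> borel_measurable (F (p i)) \<and>
            (\<exists>C. \<forall>\<omega>\<in>space M. norm (\<xi> i \<omega>) \<le> C))"

definition simple_value ::
  "nat \<Rightarrow> (nat \<Rightarrow> real) \<Rightarrow> (nat \<Rightarrow> 'a \<Rightarrow> real^'n) \<Rightarrow> real \<Rightarrow> 'a \<Rightarrow> real^'n" where
  "simple_value m p \<xi> s \<omega> = (\<Sum>i<m. indicator {p i<..p (Suc i)} s *\<^sub>R \<xi> i \<omega>)"

definition simple_integral ::
  "(real \<Rightarrow> 'a \<Rightarrow> real^'n) \<Rightarrow> nat \<Rightarrow> (nat \<Rightarrow> real) \<Rightarrow> (nat \<Rightarrow> 'a \<Rightarrow> real^'n) \<Rightarrow>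
   real \<Rightarrow> 'a \<Rightarrow> real" where
  "simple_integral Z m p \<xi> s \<omega> =
     (\<Sum>i<m. \<xi> i \<omega> \<bullet> (Z (min (p (Suc i)) s) \<omega> - Z (min (p i) s) \<omega>))"

definition vanishes_in_probability :: "'a measure \<Rightarrow> (nat \<Rightarrow> 'a \<Rightarrow> ennreal) \<Rightarrow> bool" where
  "vanishes_in_probability M D \<longleftrightarrow>
     (\<forall>\<epsilon>>0. (\<lambda>j. measure (completion M) {\<omega> \<in> space M. ennreal \<epsilon> \<le> D j \<omega>}) \<longlonglongrightarrow> 0)"

text \<open>\<open>ito_integral M F Z t H I\<close>: the process \<open>I\<close> is a continuous version of
  \<open>I(s) = \<integral>\<^sub>t\<^sup>s H(u)\<^sup>T dZ(u)\<close>, \<open>s \<ge> t\<close>. The integrand is predictable with almost surely locally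
  square integrable paths, and the integral is the limit in probability of the integrals of
  simple processes that approximate \<open>H\<close>; together with continuity this determines \<open>I\<close> up to
  indistinguishability.\<close>

definition ito_integral ::
  "'a measure \<Rightarrow> (real \<Rightarrow> 'a measure) \<Rightarrow> (real \<Rightarrow> 'a \<Rightarrow> real^'n) \<Rightarrow> real \<Rightarrow>
   (real \<Rightarrow> 'a \<Rightarrow> real^'n) \<Rightarrow> (real \<Rightarrow> 'a \<Rightarrow> real) \<Rightarrow> bool" where
  "ito_integral M F Z t H I \<longleftrightarrow>
     predictable M F t H \<and>
     (AE \<omega> in M. \<forall>s\<ge>t. (\<integral>\<^sup>+u\<in>{t..s}. ennreal ((norm (H u \<omega>))\<^sup>2) \<partial>lborel) < \<infinity>) \<and>
     continuous_adapted M F t I \<and>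
     (\<exists>m p \<xi>.
        (\<forall>j. simple_process M F t (m j) (p j) (\<xi> j)) \<and>
        (\<forall>s\<ge>t.
           vanishes_in_probability M (\<lambda>j \<omega>.
             \<integral>\<^sup>+u\<in>{t..s}. ennreal ((norm (simple_value (m j) (p j) (\<xi> j) u \<omega> - H u \<omega>))\<^sup>2)
               \<partial>lborel) \<and>
           vanishes_in_probability M (\<lambda>j \<omega>.
             ennreal \<bar>simple_integral Z (m j) (p j) (\<xi> j) s \<omega> - I s \<omega>\<bar>)))"

text \<open>\<open>dX(s) = a(s) ds + H(s)\<^sup>T dZ(s)\<close> for \<open>s \<ge> t\<close>, with \<open>X(t) = x\<close>.\<close>

definition ito_process ::
  "'a measure \<Rightarrow> (real \<Rightarrow> 'a measure) \<Rightarrow> (real \<Rightarrow> 'a \<Rightarrow> real^'n) \<Rightarrow> real \<Rightarrow> real \<Rightarrow>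
   (real \<Rightarrow> 'a \<Rightarrow> real) \<Rightarrow> (real \<Rightarrow> 'a \<Rightarrow> real^'n) \<Rightarrow> (real \<Rightarrow> 'a \<Rightarrow> real) \<Rightarrow> bool" where
  "ito_process M F Z t x a H X \<longleftrightarrow>
     continuous_adapted M F t X \<and>
     (\<exists>I. ito_integral M F Z t H I \<and>
        (AE \<omega> in M. \<forall>s\<ge>t.
           set_integrable lborel {t..s} (\<lambda>u. a u \<omega>) \<and>
           X s \<omega> = x + (LBINT u:{t..s}. a u \<omega>) + I s \<omega>))"


section \<open>The model\<close>

text \<open>Elements of \<open>L\<^sup>2(-d, 0)\<close> are given by Borel representatives, so elements of \<open>M\<^sub>2\<close> are pairs of
  a number and a function; nothing below depends on the representative.\<close>

definition L2_space :: "real \<Rightarrow> (real \<Rightarrow> real) set" where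
  "L2_space d = {f. set_borel_measurable lborel {-d..0} f \<and>
                    set_integrable lborel {-d..0} (\<lambda>\<zeta>. (f \<zeta>)\<^sup>2)}"

definition M2_space :: "real \<Rightarrow> (real \<times> (real \<Rightarrow> real)) set" where
  "M2_space d = UNIV \<times> L2_space d"

definition retired :: "real \<Rightarrow> real \<Rightarrow> real" where
  "retired \<tau>R s = (if \<tau>R \<le> s then 1 else 0)"

definition labor_income ::
  "'a measure \<Rightarrow> (real \<Rightarrow> 'a \<Rightarrow> real^'n) \<Rightarrow> real \<Rightarrow> real \<Rightarrow> real^'n \<Rightarrow> (real \<Rightarrow> real) \<Rightarrow>
   real \<Rightarrow> real \<times> (real \<Rightarrow> real) \<Rightarrow> (real \<Rightarrow> 'a \<Rightarrow> real) \<Rightarrow> bool" where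
  "labor_income M Z d \<mu>y \<sigma>y \<phi> t x y \<longleftrightarrow>
     (\<forall>\<omega>\<in>space M. \<forall>\<zeta>\<in>{-d..<0}. y (t + \<zeta>) \<omega> = snd x \<zeta>) \<and>
     ito_process M (augmented_filtration M Z) Z t (fst x)
       (\<lambda>s \<omega>. \<mu>y * y s \<omega> + (LBINT \<zeta>:{-d..0}. \<phi> \<zeta> * y (s + \<zeta>) \<omega>))
       (\<lambda>s \<omega>. y s \<omega> *\<^sub>R \<sigma>y)
       y"

definition wealth ::
  "'a measure \<Rightarrow> (real \<Rightarrow> 'a \<Rightarrow> real^'n) \<Rightarrow> real \<Rightarrow> real \<Rightarrow> real^'n \<Rightarrow> real^'n^'n \<Rightarrow> real \<Rightarrow>
   real \<Rightarrow> real \<Rightarrow> (real \<Rightarrow> 'a \<Rightarrow> real) \<Rightarrow>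
   (real \<Rightarrow> 'a \<Rightarrow> real) \<times> (real \<Rightarrow> 'a \<Rightarrow> real) \<times> (real \<Rightarrow> 'a \<Rightarrow> real^'n) \<Rightarrow>
   (real \<Rightarrow> 'a \<Rightarrow> real) \<Rightarrow> bool" where
  "wealth M Z r \<delta> \<mu> \<sigma> \<tau>R t w y = (\<lambda>(c, B, \<theta>) W.
     ito_process M (augmented_filtration M Z) Z t w
       (\<lambda>s \<omega>. (r + \<delta>) * W s \<omega> + \<theta> s \<omega> \<bullet> (\<mu> - r *\<^sub>R 1) + (1 - retired \<tau>R s) * y s \<omega>
               - c s \<omega> - \<delta> * B s \<omega>)
       (\<lambda>s \<omega>. \<theta> s \<omega> v* \<sigma>)
       W)"

definition gh_solution ::
  "real \<Rightarrow> real \<Rightarrow> real \<Rightarrow> real \<Rightarrow> real \<Rightarrow> (real \<Rightarrow> real) \<Rightarrow>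
   (real \<Rightarrow> real) \<Rightarrow> (real \<Rightarrow> real \<Rightarrow> real) \<Rightarrow> bool" where
  "gh_solution r \<delta> \<beta> \<tau>R d \<phi> g h \<longleftrightarrow>
     continuous_on {0..} g \<and>
     continuous_on ({0..} \<times> {-d..0}) (\<lambda>(t, \<zeta>). h t \<zeta>) \<and>
     (\<forall>t\<ge>0. g t =
        (if t < \<tau>R then LBINT \<tau>:{t..\<tau>R}. exp (- \<beta> * (\<tau> - t)) * (h \<tau> 0 + 1) else 0)) \<and>
     (\<forall>t\<ge>0. \<forall>\<zeta>\<in>{-d..0}. h t \<zeta> =
        (if t < \<tau>R
         then LBINT \<tau>:{max (\<zeta> + t - \<tau>R) (-d)..\<zeta>}.
                exp (- (r + \<delta>) * (\<zeta> - \<tau>)) * g (t + \<zeta> - \<tau>) * \<phi> \<tau>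
         else 0))"

definition total_wealth ::
  "real \<Rightarrow> (real \<Rightarrow> real) \<Rightarrow> (real \<Rightarrow> real \<Rightarrow> real) \<Rightarrow>
   real \<Rightarrow> real \<Rightarrow> real \<times> (real \<Rightarrow> real) \<Rightarrow> real" where
  "total_wealth d g h t w x = w + g t * fst x + (LBINT \<zeta>:{-d..0}. h t \<zeta> * snd x \<zeta>)"

definition admissible ::
  "'a measure \<Rightarrow> (real \<Rightarrow> 'a \<Rightarrow> real^'n) \<Rightarrow> real \<Rightarrow> real \<Rightarrow> real^'n \<Rightarrow> real^'n^'n \<Rightarrow> real \<Rightarrow>
   real \<Rightarrow> real \<Rightarrow> real^'n \<Rightarrow> (real \<Rightarrow> real) \<Rightarrow> (real \<Rightarrow> real) \<Rightarrow> (real \<Rightarrow> real \<Rightarrow> real) \<Rightarrow>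
   real \<Rightarrow> real \<Rightarrow> real \<times> (real \<Rightarrow> real) \<Rightarrow>
   ((real \<Rightarrow> 'a \<Rightarrow> real) \<times> (real \<Rightarrow> 'a \<Rightarrow> real) \<times> (real \<Rightarrow> 'a \<Rightarrow> real^'n)) set" where
  "admissible M Z r \<delta> \<mu> \<sigma> \<tau>R d \<mu>y \<sigma>y \<phi> g h t w x =
     {(c, B, \<theta>).
        predictable M (augmented_filtration M Z) t c \<and>
        predictable M (augmented_filtration M Z) t B \<and>
        predictable M (augmented_filtration M Z) t \<theta> \<and>
        (AE \<omega> in M. \<forall>s\<ge>t. 0 \<le> c s \<omega> \<and> 0 \<le> B s \<omega>) \<and>
        (\<forall>T>t. (\<integral>\<^sup>+\<omega>. (\<integral>\<^sup>+s\<in>{t..T}. ennreal (c s \<omega> + B s \<omega> + (norm (\<theta> s \<omega>))\<^sup>2) \<partial>lborel)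
                  \<partial>completion M) < \<infinity>) \<and>
        (\<exists>y W. labor_income M Z d \<mu>y \<sigma>y \<phi> t x y \<and>
               wealth M Z r \<delta> \<mu> \<sigma> \<tau>R t w y (c, B, \<theta>) W \<and>
               (AE \<omega> in M. \<forall>s\<ge>t.
                  0 \<le> total_wealth d g h s (W s \<omega>) (y s \<omega>, \<lambda>\<zeta>. y (s + \<zeta>) \<omega>)))}"

text \<open>The value at \<open>0\<close> has to be separated out because \<open>0 powr a = 0\<close> also for \<open>a < 0\<close>.\<close>

definition crra :: "real \<Rightarrow> real \<Rightarrow> ereal" where
  "crra \<gamma> a = (if a = 0 \<and> \<gamma> > 1 then -\<infinity> else ereal (a powr (1 - \<gamma>) / (1 - \<gamma>)))"

text \<open>The integrand has constant sign (that of \<open>1 - \<gamma>\<close>), so at least one of the two terms of the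
  difference is zero.\<close>

definition objective ::
  "'a measure \<Rightarrow> real \<Rightarrow> real \<Rightarrow> real \<Rightarrow> real \<Rightarrow> real \<Rightarrow> real \<Rightarrow> real \<Rightarrow>
   (real \<Rightarrow> 'a \<Rightarrow> real) \<times> (real \<Rightarrow> 'a \<Rightarrow> real) \<times> (real \<Rightarrow> 'a \<Rightarrow> real^'n) \<Rightarrow> ereal" where
  "objective M \<rho> \<delta> K k \<gamma> \<tau>R t = (\<lambda>(c, B, \<theta>).
     let U = (\<lambda>s \<omega>. ereal (exp (- (\<rho> + \<delta>) * s)) *
                 (crra \<gamma> (K powr retired \<tau>R s * c s \<omega>) + ereal \<delta> * crra \<gamma> (k * B s \<omega>)))
     in enn2ereal (\<integral>\<^sup>+\<omega>. (\<integral>\<^sup>+s\<in>{t..}. e2ennreal (U s \<omega>) \<partial>lborel) \<partial>completion M)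
        - enn2ereal (\<integral>\<^sup>+\<omega>. (\<integral>\<^sup>+s\<in>{t..}. e2ennreal (- U s \<omega>) \<partial>lborel) \<partial>completion M))"

definition value_function ::
  "'a measure \<Rightarrow> (real \<Rightarrow> 'a \<Rightarrow> real^'n) \<Rightarrow> real \<Rightarrow> real \<Rightarrow> real^'n \<Rightarrow> real^'n^'n \<Rightarrow> real \<Rightarrow>
   real \<Rightarrow> real \<Rightarrow> real^'n \<Rightarrow> (real \<Rightarrow> real) \<Rightarrow> (real \<Rightarrow> real) \<Rightarrow> (real \<Rightarrow> real \<Rightarrow> real) \<Rightarrow>
   real \<Rightarrow> real \<Rightarrow> real \<Rightarrow> real \<Rightarrow>
   real \<Rightarrow> real \<Rightarrow> real \<times> (real \<Rightarrow> real) \<Rightarrow> ereal" where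
  "value_function M Z r \<delta> \<mu> \<sigma> \<tau>R d \<mu>y \<sigma>y \<phi> g h \<rho> K k \<gamma> t w x =
     (SUP \<pi>\<in>admissible M Z r \<delta> \<mu> \<sigma> \<tau>R d \<mu>y \<sigma>y \<phi> g h t w x. objective M \<rho> \<delta> K k \<gamma> \<tau>R t \<pi>)"

text \<open>Optimality for initial time \<open>0\<close>.\<close>

definition optimal_strategy ::
  "'a measure \<Rightarrow> (real \<Rightarrow> 'a \<Rightarrow> real^'n) \<Rightarrow> real \<Rightarrow> real \<Rightarrow> real^'n \<Rightarrow> real^'n^'n \<Rightarrow> real \<Rightarrow>
   real \<Rightarrow> real \<Rightarrow> real^'n \<Rightarrow> (real \<Rightarrow> real) \<Rightarrow> (real \<Rightarrow> real) \<Rightarrow> (real \<Rightarrow> real \<Rightarrow> real) \<Rightarrow>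
   real \<Rightarrow> real \<Rightarrow> real \<Rightarrow> real \<Rightarrow>
   real \<Rightarrow> real \<times> (real \<Rightarrow> real) \<Rightarrow>
   (real \<Rightarrow> 'a \<Rightarrow> real) \<times> (real \<Rightarrow> 'a \<Rightarrow> real) \<times> (real \<Rightarrow> 'a \<Rightarrow> real^'n) \<Rightarrow> bool" where
  "optimal_strategy M Z r \<delta> \<mu> \<sigma> \<tau>R d \<mu>y \<sigma>y \<phi> g h \<rho> K k \<gamma> w x \<pi> \<longleftrightarrow>
     \<pi> \<in> admissible M Z r \<delta> \<mu> \<sigma> \<tau>R d \<mu>y \<sigma>y \<phi> g h 0 w x \<and>
     objective M \<rho> \<delta> K k \<gamma> \<tau>R 0 \<pi> =
       value_function M Z r \<delta> \<mu> \<sigma> \<tau>R d \<mu>y \<sigma>y \<phi> g h \<rho> K k \<gamma> 0 w x"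

end

theory Submission
 imports Defs
begin

text \<open>By the equations for \<open>g\<close> and \<open>h\<close> the total wealth \<open>X = W + g y + \<integral> h y\<close> has drift
 \<open>(r + \<delta>) X + \<kappa> \<bullet> H - c - \<delta> B\<close> and integrand \<open>H\<close>, so the delay disappears from the control problem.
 With the state price density \<open>D s = exp (- (r + \<delta>) (s - t)) * stoch_exp (- \<kappa>) t s\<close>, Girsanov's theorem and
 \<open>X \<ge> 0\<close> give the budget inequality \<open>E \<integral> D (c + \<delta> B) \<le> X t\<close>. The marginal utility of the candidate started
 from any \<open>x' > 0\<close> is a constant multiple of \<open>D\<close>, so concavity of the utility turns the budget inequality
 into an upper bound for the value; it is attained for \<open>x' = X t\<close>, and \<open>x' \<rightarrow> 0\<close> settles the case \<open>X t = 0\<close>.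

 No general Ito formula is needed: all processes that have to be identified as Ito processes are, up to
 absolutely continuous terms, products of a stochastic exponential and an absolutely continuous process,
 for which Riemann sums suffice. The labor income has this form because the delay equation can be solved
 path by path after division by the stochastic exponential. Moments and uniqueness follow from the Ito
 isometry and Gronwall's inequality.\<close>

text \<open>The definition of the Ito integral offers nothing but approximation in probability by
  simple processes, and conditional expectations are avoided throughout. Estimates are first proved
  for finite sums that are cut off before their energy passes a level; there the independence of the
  increments suffices. They are then carried over along almost surely convergent subsequences, with
  Fatou's lemma for bounds and weak L2 convergence for identities. The isometry comes out as an
  inequality with constant 3, which is enough for moments and uniqueness. Girsanov's theorem appears
  only as the vanishing of a mean weighted with the density at a fixed horizon, so no measure is
  changed. The budget inequality uses no product rule for the state price density and
  \<open>X\<close> either: \<open>X\<close> minus its martingale part is absolutely continuous, so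
  discounting is pathwise and the density enters at the horizon only. Two frictions recur: null sets
  added by augmentation may be foreign to \<open>M\<close>, so means refer to
  \<open>completion M\<close>, and Brownian paths are continuous only almost surely, so processes
  are replaced by versions with continuous paths, as \<open>continuous_adapted\<close>
  demands.\<close>

abbreviation "bm \<equiv> borel_measurable"
abbreviation "ind \<equiv> indicator"
abbreviation "sint \<equiv> set_integrable lborel"

abbreviation nn_lborel :: "('b::euclidean_space => ennreal) => ennreal" (binder "NL " 10)
 where "nn_lborel f \<equiv> nn_integral lborel f"

abbreviation NS :: "'b::euclidean_space set => ('b => ennreal) => ennreal"
 where "NS A f \<equiv> NL u. f u*ind A u"

abbreviation limseq :: "(nat => 'b::topological_space) => 'b => bool" (infixr "---->" 60)
 where "X ----> L \<equiv> X \<longlonglongrightarrow> L"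

lemmas sli_def = set_lebesgue_integral_def
lemmas measurable_eqI = measurable_cong[THEN iffD1, rotated]

section \<open>Gaussian moments\<close>

text \<open>Fubini for products over coordinates: \<open>lborel\<close> on \<open>real^'n\<close> is
  the image of the product measure indexed by \<open>Basis\<close>, and \<open>k\<close> translates
  a basis vector back into its coordinate.\<close>

lemma lborel_integral_prod:
 fixes f :: "'n::finite => real => real"
 assumes "!!i. integrable lborel (f i)"
 shows "integrable lborel (%x::real^'n. \<Prod>i\<in>UNIV. f i (x $ i))"
  and "(LINT x|(lborel :: (real^'n) measure). (\<Prod>i\<in>UNIV. f i (x $ i))) = (\<Prod>i\<in>UNIV. LINT x|lborel. f i x)"
proof -
 interpret product_sigma_finite "%_::real^'n. lborel :: real measure"
  by standard
 let ?B = "Basis :: (real^'n) set"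
 define k :: "real^'n => 'n" where "k b = (THE i. b = axis i 1)" for b
 have k: "k (axis i 1) = i" for i
  unfolding k_def by (rule the_equality) (auto simp: axis_eq_axis)
 have Beq: "?B = range (%i. axis i 1)"
  by (auto simp: Basis_vec_def)
 have inj: "inj (%i::'n. axis i (1::real))"
  by (auto simp: inj_on_def axis_eq_axis)
 have [measurable]: "f i : bm borel" for i
  using assms[of i] by simp
 have [measurable]: "(%x::real^'n. \<Prod>i\<in>UNIV. f i (x $ i)) : bm borel"
  by measurable
 have 1: "(\<Prod>i\<in>UNIV. f i ((\<Sum>b\<in>?B. x b *\<^sub>R b) $ i)) = (\<Prod>b\<in>?B. f (k b) (x b))" for x
 proof -
  have "(\<Sum>b\<in>?B. x b *\<^sub>R b) $ i = x (axis i 1)" for i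
  proof -
   have "(\<Sum>b\<in>?B. x b *\<^sub>R b) $ i = (\<Sum>b\<in>?B. x b *\<^sub>R b) \<bullet> axis i 1"
    by (simp add: inner_axis)
   also have "... = x (axis i 1)"
    by (rule inner_sum_left_Basis) (auto simp: Beq)
   finally show ?thesis .
  qed
  thus ?thesis
   unfolding Beq by (simp add: prod.reindex[OF inj] k)
 qed
 have 2: "integrable (\<Pi>\<^sub>M b\<in>?B. lborel) (%x. \<Prod>b\<in>?B. f (k b) (x b))"
  by (rule product_integrable_prod) (use assms in auto)
 show "integrable lborel (%x::real^'n. \<Prod>i\<in>UNIV. f i (x $ i))"
  unfolding lborel_eq[where 'a="real^'n"]
  by (subst integrable_distr_eq) (use 1 2 in "auto simp del: prod_constant")
 have "(LINT x|(lborel :: (real^'n) measure). (\<Prod>i\<in>UNIV. f i (x $ i)))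
   = (LINT x|(\<Pi>\<^sub>M b\<in>?B. lborel). (\<Prod>b\<in>?B. f (k b) (x b)))"
  unfolding lborel_eq[where 'a="real^'n"]
  by (subst integral_distr) (use 1 in auto)
 also have "... = (\<Prod>b\<in>?B. LINT x|lborel. f (k b) x)"
  by (rule product_integral_prod) (use assms in auto)
 also have "... = (\<Prod>i\<in>UNIV. LINT x|lborel. f i x)"
  unfolding Beq by (simp add: prod.reindex[OF inj] k)
 finally show "(LINT x|(lborel :: (real^'n) measure). (\<Prod>i\<in>UNIV. f i (x $ i))) = (\<Prod>i\<in>UNIV. LINT x|lborel. f i x)" .
qed

text \<open>Completing the square: an exponential tilt of the centred normal density shifts its mean
  to \<open>a * s^2\<close>, so exponential moments reduce to mass and mean of a normal law.\<close>

lemma normal_density_exp_shift: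
 assumes "s > 0"
 shows "normal_density 0 s x*exp (a*x) = exp (a^2 * s^2/2)*normal_density (a * s^2) s x"
proof -
 have "- (x - 0)\<^sup>2/(2 * s^2)+a*x = a^2 * s^2/2 + - (x - a * s^2)\<^sup>2/(2 * s^2)"
  using assms by (simp add: field_simps power2_eq_square)
 hence "exp (- (x - 0)\<^sup>2/(2 * s^2))*exp (a*x)
   = exp (a^2 * s^2/2)*exp (- (x - a * s^2)\<^sup>2/(2 * s^2))"
  by (metis exp_add)
 thus ?thesis
  unfolding normal_density_def by simp
qed

lemma normal_exp_moments:
 assumes "s > 0"
 shows "has_bochner_integral lborel (%x. normal_density 0 s x*exp (a*x)) (exp (a^2 * s^2/2))"
  and "has_bochner_integral lborel (%x. normal_density 0 s x*exp (a*x)*x) (a * s^2*exp (a^2 * s^2/2))"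
  and "has_bochner_integral lborel (%x. normal_density 0 s x*x^2) (s^2)"
proof -
 show "has_bochner_integral lborel (%x. normal_density 0 s x*exp (a*x)) (exp (a^2 * s^2/2))"
  unfolding normal_density_exp_shift[OF assms]
  using has_bochner_integral_mult_right[where x=1 and c="exp (a^2 * s^2/2)" and f="normal_density (a * s^2) s" and M=lborel]
   assms by (auto simp: has_bochner_integral_iff)
 show "has_bochner_integral lborel (%x. normal_density 0 s x*exp (a*x)*x) (a * s^2*exp (a^2 * s^2/2))"
  unfolding normal_density_exp_shift[OF assms]
  using has_bochner_integral_mult_right[OF normal_moment_nz_1[OF assms, of "a * s^2"], of "exp (a^2 * s^2/2)"]
  by (simp add: mult_ac)
 show "has_bochner_integral lborel (%x. normal_density 0 s x*x^2) (s^2)"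
  using normal_moment_even[OF assms, of 0 1] by (simp add: power2_eq_square)
qed

text \<open>The density of \<open>Z t - Z s\<close> with \<open>v = t - s\<close>.\<close>

abbreviation gauss_density :: "real => real^'n => real" where
 "gauss_density v x \<equiv> (\<Prod>i\<in>UNIV. normal_density 0 (sqrt v) (x $ i))"

text \<open>The moments behind the stochastic calculus below: the first gives stochastic
  exponentials mean one, the second is the drift that Girsanov's theorem produces, the third is the
  isometry.\<close>

lemma gauss_moments:
 fixes a :: "real^'n"
 assumes v: "v > 0"
 shows "has_bochner_integral lborel (%x. gauss_density v x*exp (a \<bullet> x)) (exp ((a \<bullet> a) * v/2))"
  and "has_bochner_integral lborel (%x. gauss_density v x*(exp (a \<bullet> x)*(x $ j))) (a $ j * v * exp ((a \<bullet> a) * v/2))"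
  and "has_bochner_integral lborel (%x. gauss_density v x*((x $ i)*(x $ j))) (if i = j then v else 0)"
proof -
 let ?s = "sqrt v"
 have s: "?s > 0" "?s^2 = v" using v by auto
 note m = normal_exp_moments[OF s(1), unfolded s(2)]
 note m = m[THEN integrable.intros] m[THEN has_bochner_integral_integral_eq]
 have ex: "exp (a \<bullet> x) = (\<Prod>i\<in>UNIV. exp (a $ i*x $ i))" for x :: "real^'n"
  by (simp add: inner_vec_def exp_sum)
 have aa: "(\<Prod>i\<in>UNIV. exp ((a $ i)^2 * v/2)) = exp ((a \<bullet> a) * v/2)"
  by (simp add: inner_vec_def exp_sum[symmetric] sum_distrib_right sum_divide_distrib power2_eq_square)
 show "has_bochner_integral lborel (%x. gauss_density v x*exp (a \<bullet> x)) (exp ((a \<bullet> a) * v/2))"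
  unfolding ex prod.distrib[symmetric] has_bochner_integral_iff
  using lborel_integral_prod[where f="%i x. normal_density 0 ?s x*exp (a $ i*x)"] m aa by simp
 \<comment> \<open>Powers of single coordinates are written with the default factor 1 in the other
   coordinates, so that the integrand stays a product over all of them.\<close>
 let ?f = "%i x. normal_density 0 ?s x*exp (a $ i*x)*(if i = j then x else 1)"
 have 1: "gauss_density v x*(exp (a \<bullet> x)*(x $ j)) = (\<Prod>i\<in>UNIV. ?f i (x $ i))" for x
  unfolding prod.distrib ex by (simp add: prod.delta)
 have i1: "integrable lborel (?f i)" for i
  using m(1,2)[of "a $ i"] by (cases "i = j") auto
 have i2: "(LINT x|lborel. ?f i x) = exp ((a $ i)^2 * v/2)*(if i = j then a $ j * v else 1)" for i
  using m(4,5)[of "a $ i"] by (cases "i = j") auto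
 show "has_bochner_integral lborel (%x. gauss_density v x*(exp (a \<bullet> x)*(x $ j))) (a $ j * v * exp ((a \<bullet> a) * v/2))"
  unfolding 1 has_bochner_integral_iff
  using lborel_integral_prod[where f="?f"] i1 unfolding i2 prod.distrib aa by simp
 let ?g = "%l x. normal_density 0 ?s x*(if l = i then x else 1)*(if l = j then x else 1)"
 have 2: "gauss_density v x*((x $ i)*(x $ j)) = (\<Prod>l\<in>UNIV. ?g l (x $ l))" for x
  unfolding prod.distrib by (simp add: prod.delta)
 have i3: "integrable lborel (?g l)" for l
  using m(1,2)[of "0"] m(3) by (cases "l = j"; cases "l = i") (auto simp: power2_eq_square mult_ac)
 have i4: "(LINT x|lborel. ?g l x) = (if l = i then if l = j then v else 0 else if l = j then 0 else 1)" for l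
  using m(4,5)[of "0"] m(6) by (cases "l = j"; cases "l = i") (auto simp: power2_eq_square mult_ac)
 have 3: "(\<Prod>l\<in>UNIV. (if l = i then if l = j then v else 0 else if l = j then 0 else 1)) = (if i = j then v else 0)"
 proof (cases "i = j")
  case True
  hence "(\<Prod>l\<in>UNIV. (if l = i then if l = j then v else 0 else if l = j then 0 else 1)) = (\<Prod>l\<in>UNIV. if l = i then v else 1)"
   by (intro prod.cong) auto
  thus ?thesis using True by (simp only: prod.delta finite_class.finite_UNIV) simp
 next
  case False thus ?thesis by (intro trans[OF prod_zero]) auto
 qed
 show "has_bochner_integral lborel (%x. gauss_density v x*((x $ i)*(x $ j))) (if i = j then v else 0)"
  unfolding 2 has_bochner_integral_iff
  using lborel_integral_prod[where f="?g"] i3 unfolding i4 3 by simp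
qed

section \<open>The augmented Brownian filtration\<close>

locale brownian = prob_space M for M :: "'a measure" +
 fixes Z :: "real => 'a => real^'n"
 assumes bm: "brownian_motion M Z"
begin

abbreviation "P \<equiv> completion M"
abbreviation "F \<equiv> augmented_filtration M Z"
abbreviation "vanish \<equiv> vanishes_in_probability M"
abbreviation "cadapted \<equiv> continuous_adapted M F"
abbreviation "pred \<equiv> predictable M F"
abbreviation "palg \<equiv> predictable_algebra M F"
abbreviation "itoint \<equiv> ito_integral M F Z"
abbreviation "itoproc \<equiv> ito_process M F Z"
abbreviation "sval m p xi j \<equiv> simple_value (m j) (p j) (xi j)"
abbreviation "sitg m p xi j \<equiv> simple_integral Z (m j) (p j) (xi j)"
abbreviation "sproc t m p xi j \<equiv> simple_process M F t (m j) (p j) (xi j)"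
abbreviation "LxP \<equiv> lborel \<Otimes>\<^sub>M P"
abbreviation "BxP \<equiv> borel \<Otimes>\<^sub>M P"
abbreviation "BxF s \<equiv> borel \<Otimes>\<^sub>M F s"

abbreviation nn_P :: "('a => ennreal) => ennreal" (binder "NP " 10)
 where "nn_P f \<equiv> nn_integral P f"

sublocale P: prob_space P
 by (rule prob_space_completion)

sublocale P: complete_measure P
 by (rule completion.complete_measure_axioms)

lemma Z_measurable [measurable]: "0 <= t ==> Z t : bm M"
 using bm by (simp add: brownian_motion_def)

lemma AE_P_iff: "(AE x in P. Q x) \<longleftrightarrow> (AE x in M. Q x)"
 by (rule AE_completion_iff)

lemma natural_gen_subset:
 "(\<Union>s\<in>{0..t}. {Z s -` A \<inter> space M | A. A : sets borel}) \<subseteq> sets M"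
 by (auto intro!: measurable_sets Z_measurable)

lemma space_natural [simp]: "space (natural_filtration M Z t) = space M"
 unfolding natural_filtration_def by (rule space_measure_of) (auto dest: sets.sets_into_space)

lemma sets_natural: "sets (natural_filtration M Z t) =
  sigma_sets (space M) (\<Union>s\<in>{0..t}. {Z s -` A \<inter> space M | A. A : sets borel})"
 unfolding natural_filtration_def by (rule sets_measure_of) (auto dest: sets.sets_into_space)

lemma sets_natural_subset: "sets (natural_filtration M Z t) \<subseteq> sets M"
 unfolding sets_natural using natural_gen_subset by (rule sets.sigma_sets_subset)

lemma aug_gen_subset: "sets (natural_filtration M Z t) \<union> null_sets P \<subseteq> sets P"
 using sets_natural_subset by auto

lemma aug_gen_Pow: "sets (natural_filtration M Z t) \<union> null_sets P \<subseteq> Pow (space M)"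
 using order_trans[OF aug_gen_subset sets.space_closed[of P]] by (simp only: space_completion)

lemma space_F [simp]: "space (F t) = space M"
 unfolding augmented_filtration_def by (rule space_measure_of) (rule aug_gen_Pow)

lemma sets_F: "sets (F t) = sigma_sets (space M) (sets (natural_filtration M Z t) \<union> null_sets P)"
 unfolding augmented_filtration_def by (rule sets_measure_of) (rule aug_gen_Pow)

lemma sets_F_subset: "sets (F t) \<subseteq> sets P"
 unfolding sets_F using sets.sigma_sets_subset[OF aug_gen_subset] by simp

lemma natural_mono: "s <= t ==> sets (natural_filtration M Z s) \<subseteq> sets (natural_filtration M Z t)"
 unfolding sets_natural by (intro sigma_sets_mono' UN_mono) auto

lemma F_mono: "s <= t ==> sets (F s) \<subseteq> sets (F t)"
 unfolding sets_F using natural_mono[of s t] by (intro sigma_sets_mono') auto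

lemma null_F: "N : null_sets P ==> N : sets (F t)"
 unfolding sets_F by auto

lemma F_subalg: "s <= t ==> subalgebra (F t) (F s)"
 by (simp add: subalgebra_def F_mono)

lemma F_subalg_P: "subalgebra P (F s)"
 by (simp add: subalgebra_def sets_F_subset)

lemma measurable_F_mono: "f : F s \<rightarrow>\<^sub>M N ==> s <= t ==> f : F t \<rightarrow>\<^sub>M N"
 by (rule measurable_from_subalg[OF F_subalg])

lemma measurable_F_P: "f : F s \<rightarrow>\<^sub>M N ==> f : P \<rightarrow>\<^sub>M N"
 by (rule measurable_from_subalg[OF F_subalg_P])

lemma Z_F: "0 <= s ==> s <= t ==> Z s : bm (F t)"
proof (rule measurableI)
 fix A :: "(real^'n) set" assume *: "0 <= s" "s <= t" "A : sets borel"
 hence "Z s -` A \<inter> space M : sets (natural_filtration M Z t)"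
  unfolding sets_natural by (intro sigma_sets.Basic UN_I[of s]) auto
 thus "Z s -` A \<inter> space (F t) : sets (F t)"
  unfolding sets_F by auto
qed auto

text \<open>Every subset of a null set belongs to each \<open>F t\<close>, so changing a function on
  a null set keeps it adapted, however irregular the change. Versions with better paths rely on
  this.\<close>

lemma F_AE_eq:
 assumes f: "f : bm (F t)" and eq: "AE x in M. f x = g x"
 shows "g : bm (F t)"
proof (rule measurableI)
 fix A :: "'b set" assume A: "A : sets borel"
 let ?N = "{x : space M. f x ~= g x}"
 have "?N : null_sets P"
  using iffD1[OF completion.AE_iff_null_sets AE_completion[OF eq]] by simp
 hence sub: "B : sets (F t)" if "B \<subseteq> ?N" for B
  by (rule null_F[OF completion.complete2[OF that]])
 have eq: "g -` A \<inter> space M = (f -` A \<inter> space M - (f -` A \<inter> space M \<inter> ?N)) \<union> (g -` A \<inter> space M \<inter> ?N)"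
  by auto
 have "f -` A \<inter> space M : sets (F t)"
  using measurable_sets[OF f A] by simp
 hence "g -` A \<inter> space M : sets (F t)"
  by (subst eq) (rule sets.Un[OF sets.Diff[OF _ sub] sub]; simp)
 thus "g -` A \<inter> space (F t) : sets (F t)" by simp
qed auto

text \<open>This carries the independence of the increments over to the augmented filtration.\<close>

lemma F_approx:
 assumes "A : sets (F t)"
 shows "EX A0:sets (natural_filtration M Z t). (A - A0) \<union> (A0 - A) : null_sets P"
 using assms unfolding sets_F
proof induction
 case (Basic a)
 thus ?case
 proof
  assume "a : sets (natural_filtration M Z t)"
  thus ?thesis by (intro bexI[of _ a]) auto
 next
  assume "a : null_sets P"
  thus ?thesis by (intro bexI[of _ "{}"]) auto
 qed
next
 case Empty
 thus ?case by (intro bexI[of _ "{}"]) auto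
next
 case (Compl a)
 then obtain A0 where A0: "A0\<in>sets (natural_filtration M Z t)" "(a - A0) \<union> (A0 - a) : null_sets P"
  by blast
 have 1: "space M - A0 : sets (natural_filtration M Z t)"
  using A0 by (metis sets.compl_sets space_natural)
 have 2: "(space M - a - (space M - A0)) \<union> (space M - A0 - (space M - a)) \<subseteq> (a - A0) \<union> (A0 - a)"
  by auto
 show ?case
  by (intro bexI[OF _ 1] completion.complete2[OF 2 A0(2)])
next
 case (Union a)
 hence "ALL i. EX A0. A0 : sets (natural_filtration M Z t) & (a i - A0) \<union> (A0 - a i) : null_sets P"
  by blast
 then obtain A0 where A0: "!!i. A0 i : sets (natural_filtration M Z t)"
   "!!i. (a i - A0 i) \<union> (A0 i - a i) : null_sets P"
  by metis
 have 1: "(\<Union>i::nat. A0 i) : sets (natural_filtration M Z t)"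
  using A0 by auto
 have 2: "(\<Union>i. a i) - (\<Union>i. A0 i) \<union> ((\<Union>i. A0 i) - (\<Union>i. a i)) \<subseteq> (\<Union>i. (a i - A0 i) \<union> (A0 i - a i))"
  by auto
 show ?case
  by (intro bexI[OF _ 1] completion.complete2[OF 2 null_sets_UN]) (use A0(2) in auto)
qed

lemma incr_measurable [measurable]:
 "0 <= s ==> s <= t ==> (%w. Z t w - Z s w) : bm M"
 by (intro borel_measurable_diff Z_measurable) auto

text \<open>By \<open>F_approx\<close> an event of \<open>F s\<close> agrees up to a null set with
  one of the natural filtration, and the product formula sees only probabilities.\<close>

lemma indep_incr:
 assumes s: "0 <= s" "s < t"
 shows "P.indep_set (sets (F s)) (sets (vimage_algebra (space M) (%w. Z t w - Z s w) borel))"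
proof -
 let ?V = "sets (vimage_algebra (space M) (%w. Z t w - Z s w) borel)"
 have ind: "indep_set (sets (natural_filtration M Z s)) ?V"
  using bm s by (auto simp: brownian_motion_def)
 have VM: "?V \<subseteq> sets M"
  unfolding sets_vimage_algebra2[of "%w. Z t w - Z s w" "space M" borel, simplified]
  using s by (auto intro!: measurable_sets incr_measurable)
 show ?thesis
 proof (rule P.indep_setI)
  show "sets (F s) \<subseteq> P.events" by (rule sets_F_subset)
  show "?V \<subseteq> P.events" using VM by auto
  fix a b assume a: "a : sets (F s)" and b: "b : ?V"
  obtain A0 where A0: "A0\<in>sets (natural_filtration M Z s)" "(a - A0) \<union> (A0 - a) : null_sets P"
   using F_approx[OF a] by blast
  have aP: "a : sets P" "A0 : sets P" "b : sets P" "A0 : sets M" "b : sets M"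
  proof -
   show "a : sets P" using sets_F_subset a by blast
   show A0M: "A0 : sets M" using sets_natural_subset A0(1) by blast
   show bM: "b : sets M" using VM b by blast
   show "A0 : sets P" using A0M by (rule sets_completionI_sets)
   show "b : sets P" using bM by (rule sets_completionI_sets)
  qed
  have nn: "AE x in P. x \<notin> (a - A0) \<union> (A0 - a)"
   by (rule AE_not_in[OF A0(2)])
  have ae1: "AE x in P. x : a \<inter> b \<longleftrightarrow> x : A0 \<inter> b" and ae2: "AE x in P. x : A0 \<longleftrightarrow> x : a"
   by (rule AE_mp[OF nn], rule AE_I2, blast)+
  have "P.prob (a \<inter> b) = P.prob (A0 \<inter> b)"
   by (rule measure_eq_AE[OF ae1 sets.Int[OF aP(1,3)] sets.Int[OF aP(2,3)]])
  also have "... = prob (A0 \<inter> b)"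
   by (rule measure_completion[OF sets.Int[OF aP(4,5)]])
  also have "... = prob A0*prob b"
   using indep_setD[OF ind A0(1) b] .
  also have "prob A0 = P.prob A0"
   by (rule measure_completion[OF aP(4), symmetric])
  also have "P.prob A0 = P.prob a"
   by (rule measure_eq_AE[OF ae2 aP(2,1)])
  also have "prob b = P.prob b"
   by (rule measure_completion[OF aP(5), symmetric])
  finally show "P.prob (a \<inter> b) = P.prob a*P.prob b" .
 qed
qed

lemma indep_expectation:
 fixes f :: "'a => real" and g :: "real^'n => real"
 assumes s: "0 <= s" "s < t"
  and f: "f : bm (F s)" "integrable P f"
  and g [measurable]: "g : bm borel" and gi: "integrable P (%w. g (Z t w - Z s w))"
 shows "integrable P (%w. f w*g (Z t w - Z s w))"
  and "(LINT w|P. f w*g (Z t w - Z s w)) = (LINT w|P. f w)*(LINT w|P. g (Z t w - Z s w))"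
proof -
 let ?D = "%w. Z t w - Z s w"
 have "P.indep_var borel f borel (%w. g (?D w))"
  unfolding P.indep_var_eq
 proof (intro conjI)
  show "P.random_variable borel f" using f(1) by (rule measurable_F_P)
  show "P.random_variable borel (%w. g (?D w))"
   using s by (intro measurable_completion) simp
  have 1: "sigma_sets (space P) {f -` A \<inter> space P | A. A : sets borel} \<subseteq> sets (F s)"
   using measurable_sets[OF f(1)] sets.sigma_sets_subset[of "{f -` A \<inter> space P | A. A : sets borel}" "F s"] by auto
  let ?V = "vimage_algebra (space M) ?D borel"
  have V: "?D : ?V \<rightarrow>\<^sub>M borel" by (rule measurable_vimage_algebra1) auto
  have "(%w. g (?D w)) : ?V \<rightarrow>\<^sub>M borel"
   using measurable_compose[OF V g] .
  hence 2: "sigma_sets (space P) {(%w. g (?D w)) -` A \<inter> space P | A. A : sets borel} \<subseteq> sets ?V"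
   using measurable_sets[of "%w. g (?D w)" ?V borel]
    sets.sigma_sets_subset[of "{(%w. g (?D w)) -` A \<inter> space P | A. A : sets borel}" ?V] by auto
  from indep_incr[OF s]
  show "P.indep_set (sigma_sets (space P) {f -` A \<inter> space P | A. A : sets borel})
    (sigma_sets (space P) {(%w. g (?D w)) -` A \<inter> space P | A. A : sets borel})"
   unfolding P.indep_set_def
   by (rule P.indep_sets_mono_sets) (use 1 2 in "auto split: bool.split")
 qed
 from P.indep_var_integrable[OF this f(2) gi] P.indep_var_lebesgue_integral[OF this f(2) gi]
 show "integrable P (%w. f w*g (Z t w - Z s w))"
  and "(LINT w|P. f w*g (Z t w - Z s w)) = (LINT w|P. f w)*(LINT w|P. g (Z t w - Z s w))"
  by simp_all
qed

section \<open>Moments of the increments\<close>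

lemma incr_bochner:
 fixes g :: "real^'n => real"
 assumes s: "0 <= s" "s < t" and g [measurable]: "g : bm borel"
  and h: "has_bochner_integral lborel (%x. gauss_density (t - s) x*g x) c"
 shows "integrable P (%w. g (Z t w - Z s w))" and "(LINT w|P. g (Z t w - Z s w)) = c"
proof -
 have d: "distributed M lborel (%w. Z t w - Z s w) (%x. ennreal (gauss_density (t - s) x))"
  using bm s by (auto simp: brownian_motion_def)
 have nn: "0 <= gauss_density (t - s) x" for x :: "real^'n"
  by (simp add: prod_nonneg)
 have i: "integrable M (%w. g (Z t w - Z s w))"
  using distributed_integrable[OF d, of g] h nn by (simp add: has_bochner_integral_iff)
 have "(LINT w|M. g (Z t w - Z s w)) = c"
  using distributed_integral[OF d, of g] h nn by (simp add: has_bochner_integral_iff)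
 thus "integrable P (%w. g (Z t w - Z s w))" and "(LINT w|P. g (Z t w - Z s w)) = c"
  using i s by (simp_all add: integrable_completion integral_completion)
qed

lemma incr_exp:
 assumes s: "0 <= s" "s <= t"
 shows "integrable P (%w. exp (a \<bullet> (Z t w - Z s w)))"
  and "(LINT w|P. exp (a \<bullet> (Z t w - Z s w))) = exp ((a \<bullet> a)*(t - s)/2)"
proof -
 have *: "integrable P (%w. exp (a \<bullet> (Z t w - Z s w))) \<and>
   (LINT w|P. exp (a \<bullet> (Z t w - Z s w))) = exp ((a \<bullet> a)*(t - s)/2)"
 proof (cases "s < t")
  case True
  hence v: "0 < t - s" by simp
  have m: "(%x::real^'n. exp (a \<bullet> x)) : bm borel"
   by measurable
  show ?thesis
   using incr_bochner[OF s(1) True m gauss_moments(1)[OF v]] by (rule conjI)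
 next
  case False
  hence "s = t" using s by simp
  thus ?thesis by (simp add: prob_space)
 qed
 show "integrable P (%w. exp (a \<bullet> (Z t w - Z s w)))"
  using * by blast
 show "(LINT w|P. exp (a \<bullet> (Z t w - Z s w))) = exp ((a \<bullet> a)*(t - s)/2)"
  using * by blast
qed

lemma incr_exp_inner:
 assumes s: "0 <= s" "s <= t"
 shows "integrable P (%w. exp (a \<bullet> (Z t w - Z s w))*(Z t w - Z s w) $ j)"
  and "(LINT w|P. exp (a \<bullet> (Z t w - Z s w))*(Z t w - Z s w) $ j)
   = a $ j*(t - s)*exp ((a \<bullet> a)*(t - s)/2)"
proof -
 have *: "integrable P (%w. exp (a \<bullet> (Z t w - Z s w))*(Z t w - Z s w) $ j) \<and>
   (LINT w|P. exp (a \<bullet> (Z t w - Z s w))*(Z t w - Z s w) $ j) = a $ j*(t - s)*exp ((a \<bullet> a)*(t - s)/2)"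
 proof (cases "s < t")
  case True
  hence v: "0 < t - s" by simp
  have m: "(%x::real^'n. exp (a \<bullet> x)*x $ j) : bm borel"
   by measurable
  show ?thesis
   using incr_bochner[OF s(1) True m gauss_moments(2)[OF v]] by (rule conjI)
 next
  case False
  hence "s = t" using s by simp
  thus ?thesis by (simp add: prob_space)
 qed
 show "integrable P (%w. exp (a \<bullet> (Z t w - Z s w))*(Z t w - Z s w) $ j)"
  using * by blast
 show "(LINT w|P. exp (a \<bullet> (Z t w - Z s w))*(Z t w - Z s w) $ j) = a $ j*(t - s)*exp ((a \<bullet> a)*(t - s)/2)"
  using * by blast
qed

lemma incr_cov:
 assumes s: "0 <= s" "s <= t"
 shows "integrable P (%w. (Z t w - Z s w) $ i*(Z t w - Z s w) $ j)"
  and "(LINT w|P. (Z t w - Z s w) $ i*(Z t w - Z s w) $ j) = (if i = j then t - s else 0)"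
proof -
 have *: "integrable P (%w. (Z t w - Z s w) $ i*(Z t w - Z s w) $ j) \<and>
   (LINT w|P. (Z t w - Z s w) $ i*(Z t w - Z s w) $ j) = (if i = j then t - s else 0)"
 proof (cases "s < t")
  case True
  hence v: "0 < t - s" by simp
  have m: "(%x::real^'n. x $ i*x $ j) : bm borel"
   by measurable
  show ?thesis
   using incr_bochner[OF s(1) True m gauss_moments(3)[OF v]] by (rule conjI)
 next
  case False
  hence "s = t" using s by simp
  thus ?thesis by (simp add: prob_space)
 qed
 show "integrable P (%w. (Z t w - Z s w) $ i*(Z t w - Z s w) $ j)"
  using * by blast
 show "(LINT w|P. (Z t w - Z s w) $ i*(Z t w - Z s w) $ j) = (if i = j then t - s else 0)"
  using * by blast
qed

lemma incr_mean:
 assumes s: "0 <= s" "s <= t"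
 shows "integrable P (%w. (Z t w - Z s w) $ j)"
  and "(LINT w|P. (Z t w - Z s w) $ j) = 0"
 using incr_exp_inner[OF s, of 0 j] by simp_all

end

section \<open>Stochastic exponentials and Ito sums\<close>

lemma mono_le_upto:
 fixes q :: "nat => real"
 assumes "!!i. i < m ==> q i <= q (Suc i)" "i <= j" "j <= m"
 shows "q i <= q j"
 using assms(2,3)
proof (induction j rule: dec_induct)
 case (step n)
 thus ?case using assms(1)[of n] by auto
qed simp

lemma borel_measurable_vec_nth: "(%x::real^'n. x $ j) : bm borel"
 by measurable

context brownian
begin

text \<open>Brownian motion gives independence only for \<open>s < t\<close>; for
  \<open>s = t\<close> the increment is zero and \<open>g\<close> of it is a constant. Admitting
  equality spares a case distinction on grids with repeated points.\<close>

lemma indep_expectation':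
 fixes f :: "'a => real" and g :: "real^'n => real"
 assumes s: "0 <= s" "s <= t"
  and f: "f : bm (F s)" "integrable P f"
  and g: "g : bm borel" and gi: "integrable P (%w. g (Z t w - Z s w))"
 shows "integrable P (%w. f w*g (Z t w - Z s w))"
  and "(LINT w|P. f w*g (Z t w - Z s w)) = (LINT w|P. f w)*(LINT w|P. g (Z t w - Z s w))"
proof -
 have *: "integrable P (%w. f w*g (Z t w - Z s w)) \<and>
   (LINT w|P. f w*g (Z t w - Z s w)) = (LINT w|P. f w)*(LINT w|P. g (Z t w - Z s w))"
 proof (cases "s < t")
  case True
  thus ?thesis
   using indep_expectation[OF s(1) True f g gi] by simp
 next
  case False
  thus ?thesis using s f by (simp add: prob_space)
 qed
 thus "integrable P (%w. f w*g (Z t w - Z s w))"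
  and "(LINT w|P. f w*g (Z t w - Z s w)) = (LINT w|P. f w)*(LINT w|P. g (Z t w - Z s w))"
  by blast+
qed

lemma incr_F:
 "0 <= s ==> s <= t ==> t <= u ==> (%w. Z t w - Z s w) : bm (F u)"
 by (intro borel_measurable_diff Z_F) auto

text \<open>The Doleans exponential of \<open>a \<bullet> Z\<close> started at time
  \<open>t\<close>. The explicit formula makes the multiplication rule hold on every path, not just
  almost surely.\<close>

definition stoch_exp :: "real^'n => real => real => 'a => real" where
 "stoch_exp a t s w = exp (a \<bullet> (Z s w - Z t w) - (a \<bullet> a)*(s - t)/2)"

lemma stoch_exp_pos [simp]: "0 < stoch_exp a t s w"
 by (simp add: stoch_exp_def)

lemma stoch_exp_nonneg [simp]: "0 <= stoch_exp a t s w"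
 by (simp add: stoch_exp_def)

lemma stoch_exp_neq_0 [simp]: "stoch_exp a t s w ~= 0"
 by (simp add: stoch_exp_def)

lemma stoch_exp_same [simp]: "stoch_exp a t t w = 1"
 by (simp add: stoch_exp_def)

lemma stoch_exp_mult: "stoch_exp a t s w * stoch_exp a s u w = stoch_exp a t u w"
 unfolding stoch_exp_def exp_add[symmetric]
 by (rule arg_cong[where f=exp]) (simp add: inner_diff_right field_simps)

lemma stoch_exp_F: "0 <= t ==> t <= s ==> s <= u ==> stoch_exp a t s : bm (F u)"
 unfolding stoch_exp_def by (intro borel_measurable_exp[THEN measurable_compose_rev] borel_measurable_diff
   borel_measurable_inner borel_measurable_const incr_F)

lemma stoch_exp_P [measurable]: "0 <= t ==> t <= s ==> stoch_exp a t s : bm P"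
 using stoch_exp_F[of t s s a] by (intro measurable_F_P) auto

lemma stoch_exp_incr:
 "stoch_exp a t s w = exp (a \<bullet> (Z s w - Z t w))*exp (- ((a \<bullet> a)*(s - t)/2))"
 unfolding stoch_exp_def exp_add[symmetric] by simp

lemma stoch_exp_integrable:
 assumes "0 <= t" "t <= s"
 shows "integrable P (stoch_exp a t s)" "(LINT w|P. stoch_exp a t s w) = 1"
 using incr_exp[OF assms, of a] unfolding stoch_exp_incr
 by (simp_all add: exp_minus_inverse)

text \<open>Powers are again stochastic exponentials up to a deterministic factor, so every moment
  follows from the mean being one.\<close>

lemma stoch_exp_powr:
 "stoch_exp a t s w powr p = stoch_exp (p *\<^sub>R a) t s w*exp ((p^2 - p)/2*(a \<bullet> a)*(s - t))"
 unfolding stoch_exp_def exp_add[symmetric]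
 by (simp add: powr_def exp_add[symmetric] field_simps power2_eq_square)

lemma stoch_exp_square:
 "(stoch_exp a t s w)^2 = stoch_exp (2 *\<^sub>R a) t s w*exp ((a \<bullet> a)*(s - t))"
 using stoch_exp_powr[of a t s w 2] by (simp add: powr_numeral)

lemma stoch_exp_square_integrable:
 assumes "0 <= t" "t <= s"
 shows "integrable P (%w. (stoch_exp a t s w)^2)"
  "(LINT w|P. (stoch_exp a t s w)^2) = exp ((a \<bullet> a)*(s - t))"
 unfolding stoch_exp_square using stoch_exp_integrable[OF assms, of "2 *\<^sub>R a"] by simp_all

text \<open>The martingale property tested against an integrable \<open>X\<close> known at time
  \<open>s\<close>, which stands in for a conditional expectation.\<close>

lemma stoch_exp_martingale:
 assumes "0 <= s" "s <= T" and X: "X : bm (F s)" "integrable P X"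
 shows "integrable P (%w. X w * stoch_exp a s T w)"
  "(LINT w|P. X w * stoch_exp a s T w) = (LINT w|P. X w)"
proof -
 let ?g = "%x. exp (a \<bullet> x)*exp (- ((a \<bullet> a)*(T - s)/2))"
 have g: "?g : bm borel" by measurable
 have i: "integrable P (%w. ?g (Z T w - Z s w))" "(LINT w|P. ?g (Z T w - Z s w)) = 1"
  using stoch_exp_integrable[OF assms(1,2), of a] unfolding stoch_exp_incr by simp_all
 show "integrable P (%w. X w * stoch_exp a s T w)"
  "(LINT w|P. X w * stoch_exp a s T w) = (LINT w|P. X w)"
  using indep_expectation'[OF assms(1,2) X g i(1)] i(2) unfolding stoch_exp_incr by simp_all
qed

lemma stoch_exp_step:
 assumes "0 <= s" "s <= T" and X: "X : bm (F s)" "integrable P X"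
 shows "integrable P (%w. X w*(stoch_exp a s T w*(Z T w - Z s w) $ j))"
  "(LINT w|P. X w*(stoch_exp a s T w*(Z T w - Z s w) $ j)) = (LINT w|P. X w)*(a $ j*(T - s))"
proof -
 let ?g = "%x. exp (a \<bullet> x)*x $ j*exp (- ((a \<bullet> a)*(T - s)/2))"
 have g: "?g : bm borel" by measurable
 have i: "integrable P (%w. ?g (Z T w - Z s w))" "(LINT w|P. ?g (Z T w - Z s w)) = a $ j*(T - s)"
  using incr_exp_inner[OF assms(1,2), of a j] by (simp_all add: exp_minus_inverse)
 show "integrable P (%w. X w*(stoch_exp a s T w*(Z T w - Z s w) $ j))"
  "(LINT w|P. X w*(stoch_exp a s T w*(Z T w - Z s w) $ j)) = (LINT w|P. X w)*(a $ j*(T - s))"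
  using indep_expectation'[OF assms(1,2) X g i(1)] i(2) unfolding stoch_exp_incr
  by (simp_all add: mult_ac)
qed

lemma bounded_integrable:
 fixes f :: "'a => real"
 assumes "f : bm (F s)" "!!w. w : space M ==> abs (f w) <= C"
 shows "integrable P f"
 by (rule P.integrable_const_bound[where B=C]) (use assms in "auto intro: measurable_F_P")

lemma bounded_mult_integrable:
 fixes f X :: "'a => real"
 assumes "f : bm P" "!!w. w : space M ==> abs (f w) <= C" "integrable P X"
 shows "integrable P (%w. X w*f w)"
proof (rule Bochner_Integration.integrable_bound[where f="%w. C*X w"])
 show "integrable P (%w. C*X w)" using assms by auto
 show "(%w. X w*f w) : bm P" using assms by auto
 show "AE w in P. norm (X w*f w) <= norm (C*X w)"
 proof (rule AE_I2)
  fix w assume "w : space P"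
  hence "abs (f w) <= abs C" using assms(2)[of w] by auto
  thus "norm (X w*f w) <= norm (C*X w)"
   using mult_left_mono[of "abs (f w)" "abs C" "abs (X w)"] by (simp add: abs_mult mult.commute)
 qed
qed

text \<open>Split the density over \<open>[t,s]\<close>, \<open>[s,u]\<close> and
  \<open>[u,T]\<close>: the last factor drops out by the martingale property, the middle one turns
  the increment into its tilted mean \<open>(u - s) *\<^sub>R a\<close>, and the first is known at
  time \<open>s\<close>, as is \<open>ze\<close>.\<close>

lemma girsanov_step:
 fixes ze :: "'a => real^'n"
 assumes t: "0 <= t" "t <= s" "s <= u" "u <= T"
  and z: "ze : bm (F s)" "!!w. w : space M ==> norm (ze w) <= C"
 shows "integrable P (%w. stoch_exp a t T w*(ze w \<bullet> (Z u w - Z s w)))"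
  and "(LINT w|P. stoch_exp a t T w*(ze w \<bullet> (Z u w - Z s w)))
    = (LINT w|P. stoch_exp a t T w*((a \<bullet> ze w)*(u - s)))"
  and "integrable P (%w. stoch_exp a t T w*((a \<bullet> ze w)*(u - s)))"
proof -
 have s0: "0 <= s" "s <= T" "0 <= u" "t <= T" using t by auto
 define X where "X j w = stoch_exp a t s w * ze w $ j" for j w
 have zj: "(%w. ze w $ j) : bm (F s)" for j
  by (rule measurable_compose[OF z(1) borel_measurable_vec_nth])
 have XF: "X j : bm (F s)" for j
  unfolding X_def using stoch_exp_F[OF t(1,2) order_refl] zj by (rule borel_measurable_times)
 have Xi: "integrable P (X j)" for j
  unfolding X_def
  by (rule bounded_mult_integrable[where C=C, OF measurable_F_P[OF zj]])
    (use z(2) stoch_exp_integrable[OF t(1,2)] component_le_norm_cart order_trans in "blast+")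
 define Y where "Y j w = X j w*(stoch_exp a s u w*(Z u w - Z s w) $ j)" for j w
 have Y: "integrable P (Y j)" "(LINT w|P. Y j w) = (LINT w|P. X j w)*(a $ j*(u - s))" for j
  unfolding Y_def using stoch_exp_step[OF s0(1) t(3) XF[of j] Xi[of j], where a=a and j=j] by simp_all
 have YF: "Y j : bm (F u)" for j
  unfolding Y_def
  by (intro borel_measurable_times measurable_F_mono[OF XF t(3)] stoch_exp_F s0 t order_refl
    measurable_compose[OF incr_F[OF s0(1) t(3) order_refl] borel_measurable_vec_nth])
 have 1: "stoch_exp a t T w*(ze w \<bullet> (Z u w - Z s w)) = (\<Sum>j\<in>UNIV. Y j w * stoch_exp a u T w)" for w
  unfolding stoch_exp_mult[of a t s w T, symmetric] stoch_exp_mult[of a s u w T, symmetric] Y_def X_def inner_vec_def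
  by (simp add: sum_distrib_left mult_ac)
 have 2: "stoch_exp a t T w*((a \<bullet> ze w)*(u - s)) = (\<Sum>j\<in>UNIV. X j w * stoch_exp a s T w*(a $ j*(u - s)))" for w
  unfolding stoch_exp_mult[of a t s w T, symmetric] X_def inner_vec_def
  by (simp add: sum_distrib_left sum_distrib_right mult_ac)
 note i1 = stoch_exp_martingale[OF s0(3) t(4) YF Y(1), where a=a]
 note i2 = stoch_exp_martingale[OF s0(1,2) XF Xi, where a=a]
 show "integrable P (%w. stoch_exp a t T w*(ze w \<bullet> (Z u w - Z s w)))"
  unfolding 1 using i1 by auto
 show "integrable P (%w. stoch_exp a t T w*((a \<bullet> ze w)*(u - s)))"
  unfolding 2 using i2 by auto
 show "(LINT w|P. stoch_exp a t T w*(ze w \<bullet> (Z u w - Z s w)))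
    = (LINT w|P. stoch_exp a t T w*((a \<bullet> ze w)*(u - s)))"
  unfolding 1 2 using i1 i2 Y by simp
qed

lemma incr_indep:
 assumes "0 <= s" "s <= T" and X: "X : bm (F s)" "integrable P X"
 shows "integrable P (%w. X w*(Z T w - Z s w) $ j)"
  "(LINT w|P. X w*(Z T w - Z s w) $ j) = 0"
  "integrable P (%w. X w*((Z T w - Z s w) $ i*(Z T w - Z s w) $ j))"
  "(LINT w|P. X w*((Z T w - Z s w) $ i*(Z T w - Z s w) $ j)) = (LINT w|P. X w)*(if i = j then T - s else 0)"
proof -
 have m: "(%x::real^'n. x $ j) : bm borel" "(%x::real^'n. x $ i*x $ j) : bm borel"
  by measurable
 note 1 = indep_expectation'[OF assms(1,2) X m(1) incr_mean(1)[OF assms(1,2)]]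
 note 2 = indep_expectation'[OF assms(1,2) X m(2) incr_cov(1)[OF assms(1,2)]]
 show "integrable P (%w. X w*(Z T w - Z s w) $ j)"
  "integrable P (%w. X w*((Z T w - Z s w) $ i*(Z T w - Z s w) $ j))"
  by (fact 1 2)+
 show "(LINT w|P. X w*(Z T w - Z s w) $ j) = 0"
  unfolding 1 incr_mean(2)[OF assms(1,2)] by simp
 show "(LINT w|P. X w*((Z T w - Z s w) $ i*(Z T w - Z s w) $ j)) = (LINT w|P. X w)*(if i = j then T - s else 0)"
  unfolding 2 incr_cov(2)[OF assms(1,2)] by simp
qed

text \<open>Expand the square: the cross term vanishes because the increment has mean zero and is
  independent of \<open>F s\<close>, and the covariances contribute only on the diagonal.\<close>

lemma ito_step:
 fixes ze :: "'a => real^'n" and S :: "'a => real"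
 assumes t: "0 <= s" "s <= u"
  and z: "ze : bm (F s)" "!!w. w : space M ==> norm (ze w) <= C"
  and S: "S : bm (F s)" "integrable P (%w. (S w)^2)"
 shows "integrable P (%w. (S w + ze w \<bullet> (Z u w - Z s w))^2)"
  and "(LINT w|P. (S w + ze w \<bullet> (Z u w - Z s w))^2)
    = (LINT w|P. (S w)^2)+(LINT w|P. (norm (ze w))^2*(u - s))"
proof -
 have zj: "(%w. ze w $ j) : bm (F s)" for j
  by (rule measurable_compose[OF z(1) borel_measurable_vec_nth])
 have zb: "w : space M ==> abs (ze w $ j) <= C" for w j
  using z(2)[of w] component_le_norm_cart[of "ze w" j] by auto
 have Si: "integrable P S"
  by (rule P.square_integrable_imp_integrable) (use S measurable_F_P in auto)
 have Szi: "integrable P (%w. S w * ze w $ j)" for j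
  by (rule bounded_mult_integrable[OF measurable_F_P[OF zj] zb Si])
 have SzF: "(%w. S w * ze w $ j) : bm (F s)" for j
  by (intro borel_measurable_times S zj)
 have zzF: "(%w. ze w $ i * ze w $ j) : bm (F s)" for i j
  by (intro borel_measurable_times zj)
 have zzi: "integrable P (%w. ze w $ i * ze w $ j)" for i j
  by (rule bounded_mult_integrable[OF measurable_F_P[OF zj] zb bounded_integrable[OF zj zb]])
 let ?D = "%w. Z u w - Z s w"
 have eq: "(S w + ze w \<bullet> ?D w)^2 = (S w)^2 + (\<Sum>j\<in>UNIV. 2*((S w * ze w $ j)*?D w $ j))
   + (\<Sum>i\<in>UNIV. \<Sum>j\<in>UNIV. (ze w $ i * ze w $ j)*(?D w $ i*?D w $ j))" for w
 proof -
  have "(ze w \<bullet> ?D w)^2 = (\<Sum>i\<in>UNIV. \<Sum>j\<in>UNIV. (ze w $ i * ze w $ j)*(?D w $ i*?D w $ j))"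
   unfolding inner_vec_def power2_eq_square sum_product by (simp add: mult_ac)
  moreover have "2*S w*(ze w \<bullet> ?D w) = (\<Sum>j\<in>UNIV. 2*((S w * ze w $ j)*?D w $ j))"
   unfolding inner_vec_def by (simp add: sum_distrib_left algebra_simps)
  ultimately show ?thesis by (simp add: power2_sum)
 qed
 note A = incr_indep[OF t SzF Szi] and B = incr_indep[OF t zzF zzi]
 show "integrable P (%w. (S w + ze w \<bullet> ?D w)^2)"
  unfolding eq by (intro Bochner_Integration.integrable_add Bochner_Integration.integrable_sum
   Bochner_Integration.integrable_mult_right S(2) A(1) B(3))
 have nz: "(LINT w|P. (norm (ze w))^2*(u - s)) = (\<Sum>i\<in>UNIV. \<Sum>j\<in>UNIV. (LINT w|P. ze w $ i * ze w $ j)*(if i = j then u - s else 0))"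
 proof -
  have "(norm (ze w))^2 = (\<Sum>i\<in>UNIV. ze w $ i * ze w $ i)" for w
   by (simp add: power2_norm_eq_inner inner_vec_def)
  thus ?thesis
   using zzi by (simp add: sum.delta sum_distrib_right if_distrib cong: if_cong)
 qed
 show "(LINT w|P. (S w + ze w \<bullet> ?D w)^2) = (LINT w|P. (S w)^2)+(LINT w|P. (norm (ze w))^2*(u - s))"
  unfolding eq nz using S(2) A B
  by (simp add: Bochner_Integration.integral_add Bochner_Integration.integral_sum)
qed

section \<open>Adapted sums against Brownian increments\<close>

definition ito_sum :: "nat => (nat => real) => (nat => 'a => real^'n) => 'a => real" where
 "ito_sum m q ze w = (\<Sum>i<m. ze i w \<bullet> (Z (q (Suc i)) w - Z (q i) w))"

text \<open>Adaptedness and square integrability are carried along in the induction because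
  \<open>ito_step\<close> demands them of the partial sum.\<close>

lemma ito_sum_isometry:
 assumes q: "0 <= q 0" "!!i. i < m ==> q i <= q (Suc i)"
  and z: "!!i. i < m ==> ze i : bm (F (q i))"
   "!!i. i < m ==> EX C. ALL w:space M. norm (ze i w) <= C"
 shows "0 <= q m & ito_sum m q ze : bm (F (q m)) & integrable P (%w. (ito_sum m q ze w)^2) \<and>
  (LINT w|P. (ito_sum m q ze w)^2) = (\<Sum>i<m. LINT w|P. (norm (ze i w))^2*(q (Suc i) - q i))"
 using assms
proof (induction m)
 case 0
 thus ?case by (simp add: ito_sum_def)
next
 case (Suc m)
 have IH: "0 <= q m" "ito_sum m q ze : bm (F (q m))" "integrable P (%w. (ito_sum m q ze w)^2)"
  "(LINT w|P. (ito_sum m q ze w)^2) = (\<Sum>i<m. LINT w|P. (norm (ze i w))^2*(q (Suc i) - q i))"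
  using Suc by (auto simp: less_Suc_eq)
 obtain C where C: "ALL w:space M. norm (ze m w) <= C" using Suc.prems(4) by blast
 have qm: "q m <= q (Suc m)" using Suc.prems by auto
 have zm: "ze m : bm (F (q m))" using Suc.prems by auto
 note step = ito_step[OF IH(1) qm zm _ IH(2,3), of C]
 have eq: "ito_sum (Suc m) q ze = (%w. ito_sum m q ze w + ze m w \<bullet> (Z (q (Suc m)) w - Z (q m) w))"
  by (simp add: ito_sum_def fun_eq_iff)
 have "ito_sum (Suc m) q ze : bm (F (q (Suc m)))"
  unfolding eq
  by (intro borel_measurable_add borel_measurable_inner measurable_F_mono[OF IH(2) qm] measurable_F_mono[OF zm qm]
    incr_F IH qm order_refl)
 thus ?case
  unfolding eq using step C IH qm by simp
qed

lemma ito_sum_girsanov: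
 assumes t: "0 <= t" "t <= q 0" and q: "!!i. i < m ==> q i <= q (Suc i)" "q m <= T"
  and z: "!!i. i < m ==> ze i : bm (F (q i))"
   "!!i. i < m ==> EX C. ALL w:space M. norm (ze i w) <= C"
 shows "integrable P (%w. stoch_exp a t T w*(ito_sum m q ze w - (\<Sum>i<m. (a \<bullet> ze i w)*(q (Suc i) - q i))))"
  and "(LINT w|P. stoch_exp a t T w*(ito_sum m q ze w - (\<Sum>i<m. (a \<bullet> ze i w)*(q (Suc i) - q i)))) = 0"
proof -
 have mono: "i <= j ==> j <= m ==> q i <= q j" for i j
  by (rule mono_le_upto[of m]) (use q in auto)
 have *: "integrable P (%w. stoch_exp a t T w*(ze i w \<bullet> (Z (q (Suc i)) w - Z (q i) w))) \<and>
   integrable P (%w. stoch_exp a t T w*((a \<bullet> ze i w)*(q (Suc i) - q i))) \<and>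
   (LINT w|P. stoch_exp a t T w*(ze i w \<bullet> (Z (q (Suc i)) w - Z (q i) w)))
    = (LINT w|P. stoch_exp a t T w*((a \<bullet> ze i w)*(q (Suc i) - q i)))" if "i < m" for i
 proof -
  obtain C where C: "ALL w:space M. norm (ze i w) <= C" using z(2) \<open>i < m\<close> by blast
  have 1: "t <= q i" using mono[of 0 i] t that by auto
  have 2: "q (Suc i) <= T" using mono[of "Suc i" m] q(2) that by auto
  show ?thesis
   using girsanov_step[OF t(1) 1 q(1)[OF that] 2 z(1)[OF that], of C a] C by blast
 qed
 have eq: "stoch_exp a t T w*(ito_sum m q ze w - (\<Sum>i<m. (a \<bullet> ze i w)*(q (Suc i) - q i)))
   = (\<Sum>i<m. stoch_exp a t T w*(ze i w \<bullet> (Z (q (Suc i)) w - Z (q i) w)) - stoch_exp a t T w*((a \<bullet> ze i w)*(q (Suc i) - q i)))" for w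
  unfolding ito_sum_def by (simp add: right_diff_distrib sum_distrib_left sum_subtractf)
 show "integrable P (%w. stoch_exp a t T w*(ito_sum m q ze w - (\<Sum>i<m. (a \<bullet> ze i w)*(q (Suc i) - q i))))"
  unfolding eq by (intro Bochner_Integration.integrable_sum Bochner_Integration.integrable_diff) (use * in auto)
 have "(LINT w|P. (\<Sum>i<m. stoch_exp a t T w*(ze i w \<bullet> (Z (q (Suc i)) w - Z (q i) w)) - stoch_exp a t T w*((a \<bullet> ze i w)*(q (Suc i) - q i))))
   = (\<Sum>i<m. LINT w|P. (stoch_exp a t T w*(ze i w \<bullet> (Z (q (Suc i)) w - Z (q i) w)) - stoch_exp a t T w*((a \<bullet> ze i w)*(q (Suc i) - q i))))"
  by (rule Bochner_Integration.integral_sum) (use * in auto)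
 also have "... = 0"
  by (rule sum.neutral) (use * in "auto simp: Bochner_Integration.integral_diff")
 finally show "(LINT w|P. stoch_exp a t T w*(ito_sum m q ze w - (\<Sum>i<m. (a \<bullet> ze i w)*(q (Suc i) - q i)))) = 0"
  unfolding eq .
qed

text \<open>Stopping an Ito sum before its quadratic variation exceeds \<open>eta\<close>: the stopped coefficients
 are still adapted since \<open>\<Sum>\<^sub>k\<^sub><=\<^sub>i\<close> only involves the past.\<close>

definition stopped :: "real => (nat => real) => (nat => 'a => real^'n) => nat => 'a => real^'n" where
 "stopped eta q ze i w = (if (\<Sum>k\<le>i. (norm (ze k w))^2*(q (Suc k) - q k)) <= eta then ze i w else 0)"

lemma stopped_eq:
 assumes "!!i. i < m ==> q i <= q (Suc i)" "(\<Sum>k<m. (norm (ze k w))^2*(q (Suc k) - q k)) <= eta" "i < m"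
 shows "stopped eta q ze i w = ze i w"
proof -
 have "(\<Sum>k\<le>i. (norm (ze k w))^2*(q (Suc k) - q k)) <= (\<Sum>k<m. (norm (ze k w))^2*(q (Suc k) - q k))"
  by (rule sum_mono2) (use assms in auto)
 thus ?thesis using assms by (simp add: stopped_def)
qed

lemma stopped_variation:
 assumes "!!i. i < m ==> q i <= q (Suc i)" "0 <= eta"
 shows "(\<Sum>k<m. (norm (stopped eta q ze k w))^2*(q (Suc k) - q k))
   <= min (\<Sum>k<m. (norm (ze k w))^2*(q (Suc k) - q k)) eta"
proof -
 have 1: "(\<Sum>k<m. (norm (stopped eta q ze k w))^2*(q (Suc k) - q k))
   <= (\<Sum>k<m. (norm (ze k w))^2*(q (Suc k) - q k))"
  by (rule sum_mono) (use assms in "auto simp: stopped_def intro!: mult_nonneg_nonneg")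
 have "(\<Sum>k<m. (norm (stopped eta q ze k w))^2*(q (Suc k) - q k)) <= eta"
  using assms(1)
 proof (induction m)
  case 0
  thus ?case using assms(2) by simp
 next
  case (Suc m)
  show ?case
  proof (cases "(\<Sum>k\<le>m. (norm (ze k w))^2*(q (Suc k) - q k)) <= eta")
   case True
   have "(\<Sum>k<Suc m. (norm (stopped eta q ze k w))^2*(q (Suc k) - q k))
    <= (\<Sum>k<Suc m. (norm (ze k w))^2*(q (Suc k) - q k))"
    by (rule sum_mono) (use Suc.prems in "auto simp: stopped_def intro!: mult_nonneg_nonneg")
   with True show ?thesis by (simp add: lessThan_Suc_atMost)
  next
   case False
   hence "stopped eta q ze m w = 0" by (simp add: stopped_def)
   thus ?thesis using Suc by simp
  qed
 qed
 with 1 show ?thesis by simp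
qed

lemma stopped_F:
 assumes q: "!!i. i < m ==> q i <= q (Suc i)"
  and z: "!!i. i < m ==> ze i : bm (F (q i))" and i: "i < m"
 shows "stopped eta q ze i : bm (F (q i))"
proof -
 have mono: "j <= i ==> q j <= q i" for j
  using i
 proof (induction i)
  case 0 thus ?case by simp
 next
  case (Suc i)
  thus ?case using q[of i] by (cases "j = Suc i") (auto intro: order_trans)
 qed
 have [measurable]: "ze k : bm (F (q i))" if "k <= i" for k
  using z[of k] mono[OF that] i that by (auto intro: measurable_F_mono)
 have [measurable]: "(%w. \<Sum>k\<le>i. (norm (ze k w))^2*(q (Suc k) - q k)) : bm (F (q i))"
  by measurable
 show ?thesis
  unfolding stopped_def by measurable
qed

end

section \<open>Predictable processes\<close>

context brownian
begin

lemma predictable_gen_Pow: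
 "({{t} \<times> A | A. A : sets (F t)} \<union> {{s<..u} \<times> A | s u A. t <= s & s <= u & A : sets (F s)})
  \<subseteq> Pow ({t..} \<times> space M)"
 using sets.sets_into_space[where M="F _"] by fastforce

lemma space_predictable [simp]: "space (palg t) = {t..} \<times> space M"
 unfolding predictable_algebra_def by (rule space_measure_of[OF predictable_gen_Pow])

lemma sets_predictable: "sets (palg t) = sigma_sets ({t..} \<times> space M)
  ({{t} \<times> A | A. A : sets (F t)} \<union> {{s<..u} \<times> A | s u A. t <= s & s <= u & A : sets (F s)})"
 unfolding predictable_algebra_def by (rule sets_measure_of[OF predictable_gen_Pow])

lemma predictable_alt:
 "pred t H \<longleftrightarrow> (%x. H (fst x) (snd x)) : bm (palg t)"
 by (simp add: predictable_def split_beta')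

text \<open>The identity from the product sigma-algebra over \<open>S\<close> into the predictable
  one is measurable, which is checked on generators. Choosing \<open>S = {t..T}\<close> and
  \<open>G = F T\<close> gives progressive measurability, \<open>S = {t..}\<close> and
  \<open>G = P\<close> joint measurability.\<close>

lemma predictable_joint:
 fixes H :: "real => 'a => 'b::topological_space"
 assumes H: "pred t H" and G: "space G = space M"
  and S: "S : sets borel" "S \<subseteq> {t..}"
  and sub: "!!s u. t <= s ==> u : S ==> s <= u ==> sets (F s) \<subseteq> sets G"
 shows "(%x. if fst x : S then H (fst x) (snd x) else c) : bm (borel \<Otimes>\<^sub>M G)"
proof -
 let ?R = "restrict_space (borel \<Otimes>\<^sub>M G) (S \<times> space M)"
 have SM: "S \<times> space M : sets (borel \<Otimes>\<^sub>M G)"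
  using S(1) G by (metis pair_measureI sets.top)
 have space_R: "space ?R = S \<times> space M"
  by (auto simp: space_restrict_space space_pair_measure G)
 have prod: "B \<times> A : sets ?R" if "B : sets borel" "B \<subseteq> S" "A : sets G" for B A
  using SM that sets.sets_into_space[OF that(3)] by (auto simp: sets_restrict_space_iff G)
 have id: "(%x. x) : measurable ?R (palg t)"
  unfolding predictable_algebra_def
 proof (rule measurable_measure_of[OF predictable_gen_Pow])
  show "(%x. x) : space ?R \<rightarrow> {t..} \<times> space M" using space_R S(2) by auto
  fix y assume "y : {{t} \<times> A | A. A : sets (F t)} \<union> {{s<..u} \<times> A | s u A. t <= s & s <= u & A : sets (F s)}"
  then consider (a) A where "y = {t} \<times> A" "A : sets (F t)"
   | (b) s u A where "y = {s<..u} \<times> A" "t <= s" "A : sets (F s)" by auto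
  thus "(%x. x) -` y \<inter> space ?R : sets ?R"
  proof cases
   case a
   have "(%x. x) -` y \<inter> space ?R = ({t} \<inter> S) \<times> A"
    using a sets.sets_into_space[OF a(2)] unfolding space_R by auto
   thus ?thesis
    using prod[of "{t} \<inter> S" A] sub[of t t] a(2) S(1) by (cases "t : S") auto
  next
   case b
   have eq: "(%x. x) -` y \<inter> space ?R = ({s<..u} \<inter> S) \<times> A"
    using b sets.sets_into_space[OF b(3)] unfolding space_R by auto
   show ?thesis
   \<comment> \<open>The section \<open>A\<close> belongs to \<open>F s\<close>; if \<open>S\<close>
     contains some time after \<open>s\<close>, then \<open>sub\<close> puts it into
     \<open>G\<close>, and otherwise the set is empty.\<close>
   proof (cases "{s<..u} \<inter> S = {}")
    case False
    then obtain v where "v : S" "s < v" by auto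
    hence "A : sets G" using sub[of s v] b by auto
    thus ?thesis unfolding eq by (intro prod) (use S(1) in auto)
   next
    case True
    thus ?thesis unfolding eq by simp
   qed
  qed
 qed
 have "(%x. H (fst x) (snd x)) : bm ?R"
  using measurable_compose[OF id H[unfolded predictable_alt]] by simp
 hence "(%x. if x : S \<times> space M then H (fst x) (snd x) else c) : bm (borel \<Otimes>\<^sub>M G)"
  by (subst measurable_restrict_space_iff[symmetric])
    (use SM sets.Int_space_eq2[OF SM] in auto)
 thus ?thesis
  by (rule measurable_eqI) (auto simp: space_pair_measure G)
qed

lemma predictable_progressive:
 assumes "pred t H" "0 <= t"
 shows "(%x. if fst x : {t..T} then H (fst x) (snd x) else c) : bm (BxF T)"
 by (rule predictable_joint[OF assms(1)]) (auto simp: subset_iff intro: F_mono[THEN subsetD])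

lemma predictable_P:
 assumes "pred t H" "0 <= t"
 shows "(%x. if fst x : {t..} then H (fst x) (snd x) else c) : bm (BxP)"
 by (rule predictable_joint[OF assms(1)]) (auto simp: subset_iff intro: sets_F_subset[THEN subsetD])

lemma pred_joint_P:
 fixes H :: "real => 'a => 'b::{topological_space, zero}"
 assumes "pred t H" "0 <= t"
 shows "(%x. if fst x : {t..} then H (fst x) (snd x) else 0) : bm (LxP)"
 by (rule measurable_compose[OF _ predictable_P[OF assms]]) (auto intro!: measurable_Pair)

lemma predictable_section:
 assumes "pred t H" "0 <= t" "t <= s"
 shows "H s : bm (F s)"
proof -
 have "(%w. (s, w)) : F s \<rightarrow>\<^sub>M BxF s" by measurable
 from measurable_compose[OF this predictable_progressive[OF assms(1,2), of s undefined]]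
 show ?thesis using assms(3) by simp
qed

lemma predictable_path:
 assumes "pred t H" "0 <= t" "w : space M"
 shows "(%s. if s : {t..} then H s w else c) : bm borel"
proof -
 have "(%s. (s, w)) : borel \<rightarrow>\<^sub>M BxP"
  by (rule measurable_Pair2') (use assms(3) in simp)
 from measurable_compose[OF this predictable_P[OF assms(1,2), of c]]
 show ?thesis by (simp cong: if_cong)
qed

text \<open>Sampling at the left end of dyadic cells is predictable, since the cells have the
  half-open form of the generators, and it converges to \<open>X\<close> by continuity of the
  paths.\<close>

lemma cadapted_pred:
 fixes X :: "real => 'a => 'b::metric_space"
 assumes X: "cadapted t X"
 shows "pred t X"
proof -
 let ?P = "palg t"
 define gr where "gr n k = t + real k/2 ^ n" for n k :: nat
 \<comment> \<open>Ceiling minus one rather than floor: the cells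
   \<open>{gr n k<..gr n (Suc k)}\<close> are open on the left, so a grid point belongs to the cell
   before it. Time \<open>t\<close> lies in no cell and is sampled separately.\<close>
 define K where "K n s = nat (\<lceil>(s - t)*2 ^ n\<rceil> - 1)" for n :: nat and s
 have XF: "X s : bm (F s)" if "t <= s" for s
  using X that by (auto simp: continuous_adapted_def)
 have Kiff: "K n s = k \<longleftrightarrow> s : {gr n k<..gr n (Suc k)}" if "t < s" for n s k
 proof -
  have pos: "0 < \<lceil>(s - t)*2 ^ n\<rceil>" using that by (simp add: zero_less_ceiling)
  have "K n s = k \<longleftrightarrow> \<lceil>(s - t)*2 ^ n\<rceil> = int k + 1" unfolding K_def using pos by auto
  also have "... \<longleftrightarrow> real k < (s - t)*2 ^ n & (s - t)*2 ^ n <= real k + 1"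
   by (auto simp: ceiling_eq_iff)
  also have "... \<longleftrightarrow> s : {gr n k<..gr n (Suc k)}"
   unfolding gr_def by (auto simp: field_simps)
  finally show ?thesis .
 qed
 have gr_ge: "t <= gr n k" for n k unfolding gr_def by simp
 have gr_mono: "gr n k <= gr n (Suc k)" for n k unfolding gr_def by (simp add: divide_right_mono)
 have "(%x. if fst x = t then X t (snd x) else X (gr n (K n (fst x))) (snd x)) : bm ?P" (is "?f n : _") for n
 proof (rule measurableI)
  fix A :: "'b set" assume A: "A : sets borel"
  let ?B = "%s. X s -` A \<inter> space M"
  have B: "?B s : sets (F s)" if "t <= s" for s
   using measurable_sets[OF XF[OF that] A] by simp
  have "?f n -` A \<inter> space ?P = {t} \<times> ?B t \<union> (\<Union>k. {gr n k<..gr n (Suc k)} \<times> ?B (gr n k))"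
  proof (intro set_eqI iffI)
   fix x assume x: "x : ?f n -` A \<inter> space ?P"
   show "x : {t} \<times> ?B t \<union> (\<Union>k. {gr n k<..gr n (Suc k)} \<times> ?B (gr n k))"
   proof (cases "fst x = t")
    case True thus ?thesis using x by (cases x) auto
   next
    case False
    hence "t < fst x" using x by (cases x) auto
    hence "fst x : {gr n (K n (fst x))<..gr n (Suc (K n (fst x)))}" using Kiff by blast
    thus ?thesis using x False by (cases x) auto
   qed
  next
   fix x assume "x : {t} \<times> ?B t \<union> (\<Union>k. {gr n k<..gr n (Suc k)} \<times> ?B (gr n k))"
   then consider "x : {t} \<times> ?B t" | k where "x : {gr n k<..gr n (Suc k)} \<times> ?B (gr n k)" by auto
   thus "x : ?f n -` A \<inter> space ?P"
   proof cases
    case 1 thus ?thesis by auto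
   next
    case (2 k)
    hence tx: "t < fst x" using gr_ge[of n k] by auto
    hence "K n (fst x) = k" using 2 Kiff by auto
    thus ?thesis using 2 tx by auto
   qed
  qed
  moreover have "{t} \<times> ?B t : sets ?P"
   unfolding sets_predictable by (intro sigma_sets.Basic) (use B in auto)
  moreover have "{gr n k<..gr n (Suc k)} \<times> ?B (gr n k) : sets ?P" for k
   unfolding sets_predictable
   by (intro sigma_sets.Basic UnI2 CollectI exI[of _ "gr n k"] exI[of _ "gr n (Suc k)"] exI[of _ "?B (gr n k)"])
     (use B gr_ge gr_mono in auto)
  ultimately show "?f n -` A \<inter> space ?P : sets ?P" by auto
 qed auto
 hence "(%x. X (fst x) (snd x)) : bm ?P"
 proof (rule borel_measurable_LIMSEQ_metric)
  fix x assume "x : space ?P"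
  then obtain s w where x: "x = (s, w)" "t <= s" "w : space M" by (cases x) auto
  show "(%n. ?f n x) ----> X (fst x) (snd x)"
  proof (cases "s = t")
   case True thus ?thesis using x by simp
  next
   case False
   hence ts: "t < s" using x by simp
   have b: "gr n (K n s) < s & s <= gr n (K n s)+1/2 ^ n" for n
    using Kiff[OF ts, of n "K n s"] by (auto simp: gr_def add_divide_distrib)
   have lim: "(%n. gr n (K n s)) ----> s"
   proof (rule tendsto_sandwich)
    show "(%n. s - 1/2 ^ n) ----> s"
     using tendsto_diff[OF tendsto_const LIMSEQ_inverse_realpow_zero[of 2], of s] by (simp add: divide_inverse)
    show "\<forall>\<^sub>F n in sequentially. s - 1/2 ^ n <= gr n (K n s)"
     "\<forall>\<^sub>F n in sequentially. gr n (K n s) <= s"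
     using b by (auto intro!: always_eventually simp: algebra_simps less_imp_le)
   qed auto
   have "continuous_on {t..} (%s. X s w)" using X x by (auto simp: continuous_adapted_def)
   hence "(%n. X (gr n (K n s)) w) ----> X s w"
    by (rule continuous_on_tendsto_compose[OF _ lim]) (use x gr_ge in auto)
   thus ?thesis using x ts by simp
  qed
 qed
 thus ?thesis unfolding predictable_alt .
qed

lemma predictable_deterministic:
 fixes c :: "real => 'b::topological_space"
 assumes "c : bm borel"
 shows "pred t (%s w. c s)"
proof -
 have "pred t (%s w. s)"
  by (rule cadapted_pred) (auto simp: continuous_adapted_def)
 thus ?thesis
  unfolding predictable_alt using assms by (rule measurable_compose)
qed

section \<open>Adaptedness of time integrals\<close>

abbreviation qvar :: "(real => 'a => real^'n) => real => real => 'a => ennreal" where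
 "qvar H t s w \<equiv> (NS {t..s} (%u. ennreal ((norm (H u w))^2)))"

lemma nn_integral_F:
 fixes f :: "real => 'a => ennreal"
 assumes "(%x. f (fst x) (snd x)) : bm (borel \<Otimes>\<^sub>M G)"
 shows "(%w. (NL u. f u w)) : bm G"
proof -
 have "(%x. (snd x, fst x)) : G \<Otimes>\<^sub>M lborel \<rightarrow>\<^sub>M borel \<Otimes>\<^sub>M G" by measurable
 from measurable_compose[OF this assms]
 have "(%(w, u). f u w) : bm (G \<Otimes>\<^sub>M lborel)" by (simp add: split_beta')
 thus ?thesis by measurable
qed

lemma lebesgue_integral_F:
 fixes f :: "real => 'a => real"
 assumes "(%x. f (fst x) (snd x)) : bm (borel \<Otimes>\<^sub>M G)"
 shows "(%w. LINT u|lborel. f u w) : bm G"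
proof -
 have "(%x. (snd x, fst x)) : G \<Otimes>\<^sub>M lborel \<rightarrow>\<^sub>M borel \<Otimes>\<^sub>M G" by measurable
 from measurable_compose[OF this assms]
 have "(%(w, u). f u w) : bm (G \<Otimes>\<^sub>M lborel)" by (simp add: split_beta')
 thus ?thesis by measurable
qed

lemma qvar_F:
 assumes "pred t H" "0 <= t"
 shows "qvar H t s : bm (F s)"
proof (rule nn_integral_F)
 note [measurable] = predictable_progressive[OF assms, of s 0]
 have "(%x. ennreal ((norm (if fst x : {t..s} then H (fst x) (snd x) else 0))^2)) : bm (BxF s)"
  by measurable
 thus "(%x. ennreal ((norm (H (fst x) (snd x)))^2)*ind {t..s} (fst x)) : bm (BxF s)"
  by (rule measurable_eqI) (auto simp: indicator_def)
qed

lemma set_integral_F: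
 fixes a :: "real => 'a => real"
 assumes "pred t a" "0 <= t"
 shows "(%w. LBINT u:{t..s}. a u w) : bm (F s)"
 unfolding sli_def
proof (rule lebesgue_integral_F)
 note [measurable] = predictable_progressive[OF assms, of s 0]
 have "(%x. (if fst x : {t..s} then a (fst x) (snd x) else 0)) : bm (BxF s)"
  by measurable
 thus "(%x. ind {t..s} (fst x) *\<^sub>R a (fst x) (snd x)) : bm (BxF s)"
  by (rule measurable_eqI) (auto simp: indicator_def)
qed

lemma predictable_set_borel:
 fixes H :: "real => 'a => 'b::real_normed_vector"
 assumes "pred t H" "0 <= t" "w : space M"
 shows "set_borel_measurable lborel {t..s} (%u. H u w)"
proof -
 note [measurable] = predictable_path[OF assms, of 0]
 have "(%u. if u : {..s} then (if u : {t..} then H u w else 0) else 0) : bm lborel"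
  by measurable
 thus ?thesis
  unfolding set_borel_measurable_def
  by (rule measurable_eqI) (auto simp: indicator_def)
qed

end

section \<open>Convergence in probability\<close>

lemma set_nn_integral_power2_le:
 fixes f :: "real => ennreal"
 assumes [measurable]: "(%u. f u*ind {t..s} u) : bm borel" and "t <= s"
 shows "(NS {t..s} (%u. f u))^2 <= ennreal (s - t)*(NS {t..s} (%u. (f u)^2))"
proof -
 have "(NL u. (f u*ind {t..s} u)*ind {t..s} u)^2
  <= (NL u. (f u*ind {t..s} u)^2)*(NL u. (ind {t..s} u)^2)"
  by (rule Cauchy_Schwarz_nn_integral) auto
 moreover have "(NL u. (f u*ind {t..s} u)*ind {t..s} u) = (NS {t..s} (%u. f u))"
  by (intro nn_integral_cong) (auto simp: indicator_def)
 moreover have "(NL u. (f u*ind {t..s} u)^2) = (NS {t..s} (%u. (f u)^2))"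
  by (intro nn_integral_cong) (auto simp: indicator_def)
 moreover have "(NL u. (ind {t..s} u)^2) = ennreal (s - t)"
 proof -
  have "(NL u. (ind {t..s} u)^2) = (NL u. ind {t..s} u)"
   by (intro nn_integral_cong) (auto simp: indicator_def)
  thus ?thesis using assms(2) by simp
 qed
 ultimately show ?thesis by (simp add: mult.commute)
qed

text \<open>Splits a product for a weak limit: the first summand is dominated by
  \<open>m*y^2\<close> whatever \<open>x\<close> is, the second is small in mean for large
  \<open>m\<close> if \<open>x\<close> is bounded in L2.\<close>

lemma abs_mult_le_truncate:
 fixes y x :: real
 assumes "0 < m"
 shows "abs (y*x) <= min (abs (y*x)) (m*y^2)+x^2/m"
proof (cases "abs x <= m*abs y")
 case True
 hence "abs (y*x) <= abs y*(m*abs y)" by (simp add: abs_mult mult_left_mono)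
 also have "... = m*y^2" by (simp add: power2_eq_square abs_mult_self_eq mult_ac)
 finally have "min (abs (y*x)) (m*y^2) = abs (y*x)" by simp
 thus ?thesis using assms by simp
next
 case False
 hence "abs y <= abs x/m" using assms by (simp add: field_simps)
 hence "abs (y*x) <= abs x/m*abs x" by (simp only: abs_mult) (rule mult_right_mono, auto)
 also have "... = x^2/m" by (simp add: power2_eq_square abs_mult_self_eq)
 finally show ?thesis using assms by (simp add: add_increasing)
qed

lemma abs_mult_le_squares: "abs (y*x) <= x^2 + y^2" for x y :: real
proof -
 have "2*(abs x*abs y) <= x^2 + y^2" using sum_squares_bound[of "abs x" "abs y"] by simp
 moreover have "0 <= abs x*abs y" "abs (y*x) = abs x*abs y" by (simp_all add: abs_mult)
 ultimately show ?thesis by linarith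
qed

text \<open>Fatou's lemma for the squares.\<close>

lemma (in prob_space) L2_bounded_AE_limit:
 fixes X :: "nat => 'a => real"
 assumes [measurable]: "!!k. X k : bm M" "X' : bm M"
  and X2: "!!k. integrable M (%w. (X k w)^2)" "!!k. (LINT w|M. (X k w)^2) <= C"
  and lim: "AE w in M. (%k. X k w) ----> X' w"
 shows "integrable M (%w. (X' w)^2)" "(LINT w|M. (X' w)^2) <= C"
proof -
 have C0: "0 <= C" using X2(2)[of 0] by (rule order_trans[rotated]) simp
 have "(\<integral>\<^sup>+w. ennreal ((X' w)^2) \<partial>M) = (\<integral>\<^sup>+w. liminf (%k. ennreal ((X k w)^2)) \<partial>M)"
 proof (rule nn_integral_cong_AE)
  show "AE w in M. ennreal ((X' w)^2) = liminf (%k. ennreal ((X k w)^2))"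
   using lim
  proof eventually_elim
   case (elim w)
   hence "(%k. ennreal ((X k w)^2)) ----> ennreal ((X' w)^2)"
    by (intro tendsto_ennrealI tendsto_power)
   thus ?case using lim_imp_Liminf sequentially_bot by metis
  qed
 qed
 also have "... <= liminf (%k. \<integral>\<^sup>+w. ennreal ((X k w)^2) \<partial>M)"
  by (rule nn_integral_liminf) simp
 also have "... <= ennreal C"
 proof (rule Liminf_le)
  show "\<forall>\<^sub>F k in sequentially. (\<integral>\<^sup>+w. ennreal ((X k w)^2) \<partial>M) <= ennreal C"
   using X2 by (auto intro!: always_eventually simp: nn_integral_eq_integral ennreal_leI)
 qed simp
 finally have *: "(\<integral>\<^sup>+w. ennreal ((X' w)^2) \<partial>M) <= ennreal C" .
 hence "(\<integral>\<^sup>+w. ennreal ((X' w)^2) \<partial>M) < \<infinity>"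
  using le_less_trans ennreal_less_top infinity_ennreal_def by metis
 thus i: "integrable M (%w. (X' w)^2)"
  by (intro integrableI_nonneg) auto
 show "(LINT w|M. (X' w)^2) <= C"
  using * C0 by (simp add: nn_integral_eq_integral[OF i])
qed

lemma (in finite_measure) integrable_mult_L2:
 fixes X Y :: "'a => real"
 assumes "X : bm M" "Y : bm M" "integrable M (%w. (X w)^2)" "integrable M (%w. (Y w)^2)"
 shows "integrable M (%w. Y w*X w)"
proof (rule Bochner_Integration.integrable_bound[where f="%w. (X w)^2 + (Y w)^2"])
 have "abs (Y w*X w) <= (X w)^2 + (Y w)^2" for w
  by (rule abs_mult_le_squares)
 thus "AE w in M. norm (Y w*X w) <= norm ((X w)^2 + (Y w)^2)" by simp
qed (use assms in auto)

text \<open>An L2-bounded sequence that converges almost surely converges weakly: by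
  \<open>abs_mult_le_truncate\<close> a dominated part tends to zero and the rest is at most
  \<open>4*C/m\<close>. Identities pass to the limit in this way where no strong convergence is
  available.\<close>

lemma (in prob_space) L2_bounded_weak_limit:
 fixes X :: "nat => 'a => real"
 assumes X [measurable]: "!!k. X k : bm M" "X' : bm M" "Y : bm M"
  and X2: "!!k. integrable M (%w. (X k w)^2)" "!!k. (LINT w|M. (X k w)^2) <= C"
  and lim: "AE w in M. (%k. X k w) ----> X' w"
  and Y2: "integrable M (%w. (Y w)^2)"
 shows "(%k. LINT w|M. Y w*X k w) ----> (LINT w|M. Y w*X' w)"
proof -
 note X'2 = L2_bounded_AE_limit[OF X(1,2) X2 lim]
 have C0: "0 <= C" using X2(2)[of 0] by (rule order_trans[rotated]) simp
 define D where "D k w = X k w - X' w" for k w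
 have [measurable]: "D k : bm M" for k unfolding D_def by measurable
 have Dle: "(D k w)^2 <= 2*(X k w)^2 + 2*(X' w)^2" for k w
  unfolding D_def using sum_squares_bound[of "X k w" "- X' w"] by (simp add: power2_diff)
 have Db: "integrable M (%w. 2*(X k w)^2 + 2*(X' w)^2)" for k
  using X2(1)[of k] X'2(1) by simp
 have D2: "integrable M (%w. (D k w)^2)" for k
  by (rule Bochner_Integration.integrable_bound[OF Db[of k]]) (use Dle[of k] in auto)
 have D2le: "(LINT w|M. (D k w)^2) <= 4*C" for k
 proof -
  have "(LINT w|M. (D k w)^2) <= (LINT w|M. 2*(X k w)^2 + 2*(X' w)^2)"
   by (rule integral_mono[OF D2 Db]) (rule Dle)
  also have "... = 2*(LINT w|M. (X k w)^2)+2*(LINT w|M. (X' w)^2)"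
   using X2(1)[of k] X'2(1) by simp
  also have "... <= 4*C" using X2(2)[of k] X'2(2) by simp
  finally show ?thesis .
 qed
 have YX: "integrable M (%w. Y w*X k w)" for k by (intro integrable_mult_L2 X X2 Y2)
 have YX': "integrable M (%w. Y w*X' w)" by (intro integrable_mult_L2 X X'2 Y2)
 have YD: "integrable M (%w. Y w*D k w)" for k
  unfolding D_def right_diff_distrib using YX YX' by auto
 show ?thesis
 proof (rule LIMSEQ_I)
  fix e :: real assume e: "0 < e"
  \<comment> \<open>The differences \<open>D k\<close> have second moment at most
    \<open>4*C\<close>, so this makes the remainder of the truncation less than \<open>e/2\<close>;
    the \<open>+ 1\<close> keeps \<open>m\<close> positive for \<open>C = 0\<close>.\<close>
  define m where "m = 8*(C + 1)/e"
  have m: "0 < m" using e C0 by (simp add: m_def)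
  have mC: "4*C/m < e/2" unfolding m_def using e C0 by (simp add: field_simps)
  have tr: "integrable M (%w. min (abs (Y w*D k w)) (m*(Y w)^2))" for k
   by (rule Bochner_Integration.integrable_bound[where f="%w. m*(Y w)^2"]) (use Y2 m in auto)
  have "(%k. LINT w|M. min (abs (Y w*D k w)) (m*(Y w)^2)) ----> (LINT w|M. 0)"
  proof (rule integral_dominated_convergence[where w="%w. m*(Y w)^2"])
   show "AE w in M. (%k. min (abs (Y w*D k w)) (m*(Y w)^2)) ----> 0"
    using lim
   proof eventually_elim
    case (elim w)
    have "(%k. min (abs (Y w*(X k w - X' w))) (m*(Y w)^2)) ----> min (abs (Y w*(X' w - X' w))) (m*(Y w)^2)"
     by (intro tendsto_min tendsto_rabs tendsto_mult tendsto_diff tendsto_const elim)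
    thus ?case unfolding D_def using m by (simp add: min_absorb1)
   qed
  qed (use Y2 m in auto)
  hence "\<forall>\<^sub>F k in sequentially. (LINT w|M. min (abs (Y w*D k w)) (m*(Y w)^2)) < e/2"
   using e by (intro order_tendstoD(2)[where y=0]) auto
  then obtain k0 where k0: "!!k. k0 <= k ==> (LINT w|M. min (abs (Y w*D k w)) (m*(Y w)^2)) < e/2"
   by (auto simp: eventually_sequentially)
  show "EX no. ALL k>=no. norm ((LINT w|M. Y w*X k w) - (LINT w|M. Y w*X' w)) < e"
  proof (intro exI[of _ k0] allI impI)
   fix k assume k: "k0 <= k"
   have "(LINT w|M. Y w*X k w) - (LINT w|M. Y w*X' w) = (LINT w|M. Y w*D k w)"
    unfolding D_def right_diff_distrib using YX YX' by simp
   also have "norm ... <= (LINT w|M. abs (Y w*D k w))"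
    using integral_norm_bound[of M "%w. Y w*D k w"] by simp
   also have "... <= (LINT w|M. min (abs (Y w*D k w)) (m*(Y w)^2)+(D k w)^2/m)"
    by (rule integral_mono) (use YD tr D2 abs_mult_le_truncate[OF m] in auto)
   also have "... = (LINT w|M. min (abs (Y w*D k w)) (m*(Y w)^2))+(LINT w|M. (D k w)^2)/m"
    using tr[of k] D2[of k] by simp
   also have "... < e/2 + e/2"
    using k0[OF k] D2le[of k] m mC divide_right_mono[OF D2le[of k], of m] by linarith
   finally show "norm ((LINT w|M. Y w*X k w) - (LINT w|M. Y w*X' w)) < e" by simp
  qed
 qed
qed

context brownian
begin

lemma vanish_le:
 assumes "!!j. D j : bm P" "!!j. D' j : bm P" "!!j w. w : space M ==> D' j w <= ennreal C*D j w" and C: "0 < C"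
  and "vanish D"
 shows "vanish D'"
 unfolding vanishes_in_probability_def
proof (intro allI impI)
 fix e :: real assume e: "0 < e"
 note [measurable] = assms(1,2)
 have "(%j. P.prob {w : space M. ennreal (e/C) <= D j w}) ----> 0"
  using assms(5) e C by (auto simp: vanishes_in_probability_def)
 thus "(%j. P.prob {w : space M. ennreal e <= D' j w}) ----> 0"
 proof (rule Lim_null_comparison[rotated])
  have "{w : space M. ennreal e <= D' j w} \<subseteq> {w : space M. ennreal (e/C) <= D j w}" for j
  proof safe
   fix w assume w: "w : space M" "ennreal e <= D' j w"
   show "ennreal (e/C) <= D j w"
   proof (rule ccontr)
    assume "\<not> ennreal (e/C) <= D j w"
    hence "D j w < ennreal (e/C)" by simp
    hence "ennreal C*D j w < ennreal C*ennreal (e/C)"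
     using C by (intro ennreal_mult_strict_left_mono) auto
    also have "... = ennreal e" using e C by (subst ennreal_mult[symmetric]) auto
    finally show False using w assms(3)[of w j] by simp
   qed
  qed
  moreover have "{w : space P. ennreal (e/C) <= D j w} : sets P" for j by measurable
  ultimately show "\<forall>\<^sub>F j in sequentially. norm (P.prob {w : space M. ennreal e <= D' j w}) <= P.prob {w : space M. ennreal (e/C) <= D j w}"
   by (auto intro!: always_eventually P.finite_measure_mono)
 qed
qed

lemma vanish_add:
 assumes D [measurable]: "!!j. D j : bm P" "!!j. D' j : bm P"
  and v: "vanish D" "vanish D'"
 shows "vanish (%j w. D j w + D' j w)"
 unfolding vanishes_in_probability_def
proof (intro allI impI)
 fix e :: real assume e: "0 < e"
 have "(%j. P.prob {w : space M. ennreal (e/2) <= D j w} + P.prob {w : space M. ennreal (e/2) <= D' j w}) ----> 0 + 0"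
  by (rule tendsto_add) (use v e in "auto simp: vanishes_in_probability_def")
 thus "(%j. P.prob {w : space M. ennreal e <= D j w + D' j w}) ----> 0"
  unfolding add_0
 proof (rule Lim_null_comparison[rotated])
  have "P.prob {w : space M. ennreal e <= D j w + D' j w} <=
    P.prob {w : space M. ennreal (e/2) <= D j w} + P.prob {w : space M. ennreal (e/2) <= D' j w}" for j
  proof -
   have m: "{w : space P. ennreal (e/2) <= D j w} : sets P" "{w : space P. ennreal (e/2) <= D' j w} : sets P"
    by measurable
   have "{w : space M. ennreal e <= D j w + D' j w} \<subseteq>
    {w : space M. ennreal (e/2) <= D j w} \<union> {w : space M. ennreal (e/2) <= D' j w}"
   proof safe
    fix w assume w: "ennreal e <= D j w + D' j w" "\<not> ennreal (e/2) <= D' j w"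
    show "ennreal (e/2) <= D j w"
    proof (rule ccontr)
     assume "\<not> ennreal (e/2) <= D j w"
     hence "D j w + D' j w < ennreal (e/2)+ennreal (e/2)"
      using w by (intro add_strict_mono) auto
     also have "... = ennreal e" using e by (simp add: ennreal_plus[symmetric] del: ennreal_plus)
     finally show False using w by simp
    qed
   qed
   hence "P.prob {w : space M. ennreal e <= D j w + D' j w} <=
    P.prob ({w : space M. ennreal (e/2) <= D j w} \<union> {w : space M. ennreal (e/2) <= D' j w})"
    by (rule P.finite_measure_mono) (use m in auto)
   also have "... <= P.prob {w : space M. ennreal (e/2) <= D j w} + P.prob {w : space M. ennreal (e/2) <= D' j w}"
    by (rule measure_Un_le) (use m in auto)
   finally show ?thesis .
  qed
  thus "\<forall>\<^sub>F j in sequentially. norm (P.prob {w : space M. ennreal e <= D j w + D' j w}) <=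
    P.prob {w : space M. ennreal (e/2) <= D j w} + P.prob {w : space M. ennreal (e/2) <= D' j w}"
   by simp
 qed
qed

lemma AE_vanish:
 assumes D [measurable]: "!!j. D j : bm P" and ae: "AE w in M. (%j. D j w) ----> 0"
 shows "vanish D"
 unfolding vanishes_in_probability_def
proof (intro allI impI)
 fix e :: real assume e: "0 < e"
 have m: "{w : space P. ennreal e <= D j w} : sets P" for j by measurable
 have "(%j. LINT w|P. ind {w : space P. ennreal e <= D j w} w :: real) ----> (LINT w|P. 0)"
 proof (rule integral_dominated_convergence[where w="%_. 1"])
  show "AE w in P. (%j. ind {w : space P. ennreal e <= D j w} w :: real) ----> 0"
   using AE_completion[OF ae]
  proof eventually_elim
   case (elim w)
   hence "\<forall>\<^sub>F j in sequentially. D j w < ennreal e"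
    using e by (intro order_tendstoD(2)) auto
   hence "\<forall>\<^sub>F j in sequentially. ind {w : space P. ennreal e <= D j w} w = (0::real)"
    by eventually_elim (auto simp: indicator_def)
   thus ?case by (rule tendsto_eventually)
  qed
 qed (use m in "auto split: split_indicator")
 moreover have "{w : space M. ennreal e <= D j w} \<inter> space M = {w : space M. ennreal e <= D j w}" for j by auto
 ultimately show "(%j. P.prob {w : space M. ennreal e <= D j w}) ----> 0"
  using m by simp
qed

text \<open>Truncated at 1, convergence in probability becomes L1 convergence, which has an almost
  surely convergent subsequence; the truncation is inactive once the values are below 1.\<close>

lemma vanish_subseq:
 assumes D [measurable]: "!!j. D j : bm P" and v: "vanish D"
 shows "EX r::nat => nat. strict_mono r & (AE w in M. (%j. D (r j) w) ----> 0)"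
proof -
 define u where "u j w = enn2real (min (D j w) 1)" for j w
 have [measurable]: "u j : bm P" for j unfolding u_def by measurable
 have u01: "0 <= u j w" "u j w <= 1" for j w
  unfolding u_def by (auto intro: enn2real_leI)
 have ui: "integrable P (u j)" for j
  by (rule P.integrable_const_bound[where B=1]) (use u01 in auto)
 have ule: "u j w <= e + ind {w : space P. ennreal e <= D j w} w" if "0 < e" "w : space P" for e j w
 proof (cases "ennreal e <= D j w")
  case True thus ?thesis using u01(2)[of j w] that by simp
 next
  case False
  hence "min (D j w) 1 <= ennreal e" by (simp add: min.coboundedI1)
  hence "u j w <= e" unfolding u_def using that by (intro enn2real_leI) auto
  thus ?thesis by (simp add: indicator_def)
 qed
 have m: "{w : space P. ennreal e <= D j w} : sets P" for j e by measurable
 have ii: "integrable P (ind {w : space P. ennreal e <= D j w} :: _ => real)" for j e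
  by (rule P.integrable_const_bound[where B=1]) (use m in auto)
 have "(%j. LINT w|P. norm (u j w)) ----> 0"
 proof (rule LIMSEQ_I)
  fix e :: real assume e: "0 < e"
  have "(%j. P.prob {w : space M. ennreal (e/2) <= D j w}) ----> 0"
   using v e by (auto simp: vanishes_in_probability_def)
  hence "\<forall>\<^sub>F j in sequentially. P.prob {w : space M. ennreal (e/2) <= D j w} < e/2"
   using e by (intro order_tendstoD(2)) auto
  then obtain j0 where j0: "!!j. j0 <= j ==> P.prob {w : space M. ennreal (e/2) <= D j w} < e/2"
   by (auto simp: eventually_sequentially)
  show "EX no. ALL j>=no. norm ((LINT w|P. norm (u j w)) - 0) < e"
  proof (intro exI[of _ j0] allI impI)
   fix j assume j: "j0 <= j"
   have "(LINT w|P. u j w) <= (LINT w|P. e/2 + ind {w : space P. ennreal (e/2) <= D j w} w)"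
    by (rule integral_mono) (use ui ii ule e in "auto simp del: space_completion")
   also have "... = e/2 + P.prob {w : space M. ennreal (e/2) <= D j w}"
   proof -
    have "{w : space M. ennreal (e/2) <= D j w} \<inter> space M = {w : space M. ennreal (e/2) <= D j w}" by auto
    thus ?thesis
     using m ii[of "e/2" j] by (subst Bochner_Integration.integral_add) (simp_all add: prob_space)
   qed
   also have "... < e" using j0[OF j] by simp
   finally show "norm ((LINT w|P. norm (u j w)) - 0) < e" using u01 by simp
  qed
 qed
 from tendsto_L1_AE_subseq[OF ui this] obtain r :: "nat => nat" where r: "strict_mono r" "AE w in P. (%j. u (r j) w) ----> 0"
  by blast
 have "AE w in P. (%j. D (r j) w) ----> 0"
  using r(2)
 proof eventually_elim
  case (elim w)
  have fin: "min (D j w) 1 < top" for j by (simp add: min_less_iff_disj)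
  have "(%j. ennreal (u (r j) w)) ----> ennreal 0" using elim by (rule tendsto_ennrealI)
  hence "(%j. min (D (r j) w) 1) ----> 0" unfolding u_def using fin by simp
  hence "\<forall>\<^sub>F j in sequentially. min (D (r j) w) 1 < 1" by (intro order_tendstoD(2)) auto
  hence "\<forall>\<^sub>F j in sequentially. min (D (r j) w) 1 = D (r j) w"
   by eventually_elim (auto simp: min_def split: if_splits)
  thus ?case
   using \<open>(%j. min (D (r j) w) 1) ----> 0\<close> by (rule Lim_transform_eventually[rotated])
 qed
 thus ?thesis using r(1) by (auto simp: AE_P_iff)
qed

end

section \<open>Simple processes\<close>

context brownian
begin

text \<open>The intervals are disjoint, so at most one summand is active and any \<open>G\<close>
  with \<open>G 0 = 0\<close> passes through the sum. The squared norm and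
  \<open>%x. a \<bullet> x\<close> are the cases of interest.\<close>

lemma simple_value_apply:
 fixes G :: "real^'n => real"
 assumes "!!i. i < m ==> p i <= p (Suc i)" "G 0 = 0"
 shows "G (simple_value m p xi u w) = (\<Sum>i<m. ind {p i<..p (Suc i)} u*G (xi i w))"
 using assms(1)
proof (induction m)
 case 0
 thus ?case using assms(2) by (simp add: simple_value_def)
next
 case (Suc m)
 hence IH: "G (simple_value m p xi u w) = (\<Sum>i<m. ind {p i<..p (Suc i)} u*G (xi i w))"
  by auto
 show ?case
 proof (cases "u : {p m<..p (Suc m)}")
  case True
  have 0: "ind {p i<..p (Suc i)} u = (0::real)" if "i < m" for i
   using mono_le_upto[of m p "Suc i" m] that Suc.prems True by (auto simp: indicator_def)
  hence "simple_value m p xi u w = 0" "(\<Sum>i<m. ind {p i<..p (Suc i)} u*G (xi i w)) = 0"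
   by (simp_all add: simple_value_def)
  thus ?thesis using True by (simp add: simple_value_def)
 next
  case False
  hence "ind {p m<..p (Suc m)} u = (0::real)" by (simp add: indicator_def)
  thus ?thesis using IH by (simp add: simple_value_def)
 qed
qed

lemma simple_value_integral:
 fixes G :: "real^'n => real"
 assumes p: "t <= p 0" "!!i. i < m ==> p i <= p (Suc i)" and G: "G 0 = 0"
 shows "sint {t..s} (%u. G (simple_value m p xi u w))"
  and "(LBINT u:{t..s}. G (simple_value m p xi u w)) = (\<Sum>i<m. G (xi i w)*(min (p (Suc i)) s - min (p i) s))"
proof -
 have pt: "t <= p i" if "i < m" for i using mono_le_upto[of m p 0 i] p that by fastforce
 have app: "G (simple_value m p xi u w) = (\<Sum>i<m. ind {p i<..p (Suc i)} u*G (xi i w))" for u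
  by (rule simple_value_apply) (use p G in auto)
 have eq: "ind {t..s} u *\<^sub>R G (simple_value m p xi u w)
   = (\<Sum>i<m. G (xi i w)*ind {min (p i) s<..min (p (Suc i)) s} u)" for u
  unfolding app real_scaleR_def sum_distrib_left
 proof (rule sum.cong[OF refl])
  fix i assume "i : {..<m}"
  hence "t <= p i" using pt by auto
  thus "ind {t..s} u*(ind {p i<..p (Suc i)} u*G (xi i w)) =
    G (xi i w)*ind {min (p i) s<..min (p (Suc i)) s} u"
   by (auto simp: indicator_def)
 qed
 have m: "min (p i) s <= min (p (Suc i)) s" if "i < m" for i using p(2)[OF that] by auto
 show "sint {t..s} (%u. G (simple_value m p xi u w))"
  unfolding set_integrable_def eq
  by (intro Bochner_Integration.integrable_sum integrable_mult_right integrable_real_indicator)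
   (use m in auto)
 have i: "integrable lborel (%u. G (xi i w)*ind {min (p i) s<..min (p (Suc i)) s} u)" if "i < m" for i
  by (intro integrable_mult_right integrable_real_indicator) (use m that in auto)
 show "(LBINT u:{t..s}. G (simple_value m p xi u w)) = (\<Sum>i<m. G (xi i w)*(min (p (Suc i)) s - min (p i) s))"
  unfolding sli_def eq
  by (subst Bochner_Integration.integral_sum) (use i m in auto)
qed

lemma simple_qvar:
 assumes p: "t <= p 0" "!!i. i < m ==> p i <= p (Suc i)"
 shows "qvar (simple_value m p xi) t s w = ennreal (\<Sum>i<m. (norm (xi i w))^2*(min (p (Suc i)) s - min (p i) s))"
proof -
 have "qvar (simple_value m p xi) t s w = (NL u. ennreal (ind {t..s} u *\<^sub>R (norm (simple_value m p xi u w))\<^sup>2))"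
  by (intro nn_integral_cong) (auto simp: indicator_def)
 also have "... = ennreal (LBINT u:{t..s}. (norm (simple_value m p xi u w))^2)"
  unfolding sli_def
  using simple_value_integral(1)[of t p m "%x. (norm x)^2" s xi w] p
  by (intro nn_integral_eq_integral) (auto simp: set_integrable_def)
 also have "(LBINT u:{t..s}. (norm (simple_value m p xi u w))^2) = (\<Sum>i<m. (norm (xi i w))^2*(min (p (Suc i)) s - min (p i) s))"
  by (rule simple_value_integral(2)) (use p in auto)
 finally show ?thesis .
qed

lemma simple_processD:
 assumes "simple_process M F t m p xi"
 shows "t <= p 0" "!!i. i < m ==> p i <= p (Suc i)" "!!i. i < m ==> xi i : bm (F (p i))"
  "!!i. i < m ==> EX C. ALL w:space M. norm (xi i w) <= C" "!!i. i <= m ==> t <= p i"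
proof -
 show *: "t <= p 0" "!!i. i < m ==> p i <= p (Suc i)" "!!i. i < m ==> xi i : bm (F (p i))"
  "!!i. i < m ==> EX C. ALL w:space M. norm (xi i w) <= C"
  using assms by (auto simp: simple_process_def)
 show "t <= p i" if "i <= m" for i
  using mono_le_upto[of m p 0 i, OF *(2)] that *(1) by auto
qed

lemma simple_value_joint:
 assumes "simple_process M F t m p xi"
 shows "(%x. simple_value m p xi (fst x) (snd x)) : bm (BxP)"
proof -
 have [measurable]: "xi i : bm P" if "i < m" for i
  using simple_processD(3)[OF assms that] by (rule measurable_F_P)
 show ?thesis
  unfolding simple_value_def
  by (intro borel_measurable_sum borel_measurable_scaleR) (auto intro!: measurable_compose[OF measurable_fst] measurable_compose[OF measurable_snd])
qed

lemma simple_integral_P: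
 assumes "simple_process M F t m p xi" "0 <= t" "t <= s"
 shows "simple_integral Z m p xi s : bm P"
proof -
 have [measurable]: "xi i : bm P" if "i < m" for i
  using simple_processD(3)[OF assms(1) that] by (rule measurable_F_P)
 have [measurable]: "Z (min (p i) s) : bm P" if "i <= m" for i
  using simple_processD(5)[OF assms(1) that] assms by (intro measurable_completion Z_measurable) auto
 show ?thesis
  unfolding simple_integral_def
  by (intro borel_measurable_sum borel_measurable_inner borel_measurable_diff) auto
qed

text \<open>The interface between simple processes and estimates: \<open>V\<close> is the energy up
  to \<open>s\<close>, while \<open>N\<close> and \<open>K a\<close> are the integral and its
  Girsanov drift, stopped at energy \<open>eta\<close>. They agree with the originals where
  \<open>V w <= eta\<close>, and their second moments are controlled by
  \<open>min (V w) eta\<close>, whatever the bounds of the coefficients.\<close>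

lemma stopped_simple:
 assumes sp: "simple_process M F t m p xi" and t: "0 <= t" "t <= s" and eta: "0 <= eta"
 obtains N :: "'a => real" and K :: "real^'n => 'a => real" and V :: "'a => real" where
  "N : bm P" "V : bm P" "!!a. K a : bm P"
  "!!w. 0 <= V w" "!!w. qvar (simple_value m p xi) t s w = ennreal (V w)"
  "!!w. V w <= eta ==> N w = simple_integral Z m p xi s w"
  "!!a w. V w <= eta ==> K a w = (LBINT u:{t..s}. a \<bullet> simple_value m p xi u w)"
  "integrable P (%w. (N w)^2)" "integrable P (%w. min (V w) eta)"
  "(LINT w|P. (N w)^2) <= (LINT w|P. min (V w) eta)"
  "!!a w. (K a w)^2 <= (a \<bullet> a)*(s - t)*min (V w) eta"
  "!!a T. s <= T ==> (LINT w|P. stoch_exp a t T w*(N w - K a w)) = 0"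
proof -
 note spD = simple_processD[OF sp]
 define q where "q i = min (p i) s" for i
 \<comment> \<open>On the grid cut at \<open>s\<close>, a coefficient with \<open>p i > s\<close>
   would have to be known already at time \<open>s\<close>. Its cell has length zero there, so it is
   replaced by 0.\<close>
 define ze where "ze i w = (if p i < s then xi i w else 0)" for i w
 have q: "q i <= q (Suc i)" if "i < m" for i using spD(2)[OF that] by (auto simp: q_def)
 have qt: "t <= q i" if "i <= m" for i using spD(5)[OF that] t by (simp add: q_def)
 have qs: "q i <= s" for i by (simp add: q_def)
 have zF: "ze i : bm (F (q i))" if "i < m" for i
  using spD(3)[OF that] by (cases "p i < s") (auto simp: ze_def[abs_def] q_def)
 have zb: "EX C. ALL w:space M. norm (ze i w) <= C" if i: "i < m" for i
 proof -
  obtain C where C: "ALL w:space M. norm (xi i w) <= C" using spD(4)[OF i] by blast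
  thus ?thesis by (intro exI[of _ "max C 0"]) (auto simp: ze_def intro: le_max_iff_disj[THEN iffD2])
 qed
 have Gz: "G (xi i w)*(min (p (Suc i)) s - min (p i) s) = G (ze i w)*(q (Suc i) - q i)"
  if "i < m" for G :: "real^'n => real" and i w
  using spD(2)[OF that] by (auto simp: ze_def q_def)
 have Zz: "xi i w \<bullet> (Z (min (p (Suc i)) s) w - Z (min (p i) s) w) = ze i w \<bullet> (Z (q (Suc i)) w - Z (q i) w)"
  if "i < m" for i w
  using spD(2)[OF that] by (auto simp: ze_def q_def min_def)
 define V where "V w = (\<Sum>i<m. (norm (ze i w))^2*(q (Suc i) - q i))" for w
 define st where "st = stopped eta q ze"
 have stF: "st i : bm (F (q i))" if "i < m" for i
  unfolding st_def by (rule stopped_F[of m q ze, OF q zF that])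
 have stb: "EX C. ALL w:space M. norm (st i w) <= C" if i: "i < m" for i
 proof -
  obtain C where C: "ALL w:space M. norm (ze i w) <= C" using zb[OF i] by blast
  thus ?thesis by (intro exI[of _ "max C 0"]) (auto simp: st_def stopped_def intro: le_max_iff_disj[THEN iffD2])
 qed
 define N where "N = ito_sum m q st"
 define K where "K a w = (\<Sum>i<m. (a \<bullet> st i w)*(q (Suc i) - q i))" for a w
 have stP [measurable]: "st i : bm P" if "i < m" for i using stF[OF that] by (rule measurable_F_P)
 have zP [measurable]: "ze i : bm P" if "i < m" for i using zF[OF that] by (rule measurable_F_P)
 have var: "(\<Sum>k<m. (norm (st k w))^2*(q (Suc k) - q k)) <= min (V w) eta" for w
  unfolding st_def V_def by (rule stopped_variation[where m=m and q=q, OF q eta])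
 have q0: "0 <= q 0" using qt[of 0] t by simp
 note iso = ito_sum_isometry[of q m st, OF q0 q stF stb]
 have Vm [measurable]: "V : bm P"
  unfolding V_def by (intro borel_measurable_sum borel_measurable_times borel_measurable_power borel_measurable_norm) auto
 have V0: "0 <= V w" for w
  unfolding V_def by (rule sum_nonneg) (use q in auto)
 have Vi: "integrable P (%w. min (V w) eta)"
 proof -
  have "norm (min (V w) eta) <= eta" for w
  proof -
   have "0 <= min (V w) eta" using V0[of w] eta by simp
   thus ?thesis by simp
  qed
  thus ?thesis by (intro P.integrable_const_bound[where B=eta]) auto
 qed
 show thesis
 proof (rule that[of N V K])
  show "V : bm P" "!!w. 0 <= V w" "integrable P (%w. min (V w) eta)" by (fact Vm V0 Vi)+
  show "N : bm P" unfolding N_def using iso by (auto intro: measurable_F_P)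
  show "K a : bm P" for a
   unfolding K_def by (intro borel_measurable_sum borel_measurable_times borel_measurable_inner) auto
  show "qvar (simple_value m p xi) t s w = ennreal (V w)" for w
   unfolding V_def using simple_qvar[where t=t and p=p and m=m and xi=xi and s=s and w=w, OF spD(1,2)] Gz[of _ "%x. (norm x)^2" w] by simp
  show "N w = simple_integral Z m p xi s w" if "V w <= eta" for w
  proof -
   have "st i w = ze i w" if "i < m" for i
    unfolding st_def by (rule stopped_eq[where m=m]) (use q that \<open>V w <= eta\<close> in "auto simp: V_def")
   thus ?thesis unfolding N_def ito_sum_def simple_integral_def using Zz by simp
  qed
  show "K a w = (LBINT u:{t..s}. a \<bullet> simple_value m p xi u w)" if "V w <= eta" for a w
  proof -
   have "st i w = ze i w" if "i < m" for i
    unfolding st_def by (rule stopped_eq[where m=m]) (use q that \<open>V w <= eta\<close> in "auto simp: V_def")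
   thus ?thesis
    unfolding K_def using simple_value_integral(2)[of t p m "%x. a \<bullet> x" s xi w, OF spD(1,2)] Gz[of _ "%x. a \<bullet> x" w] by simp
  qed
  show "integrable P (%w. (N w)^2)" unfolding N_def using iso by auto
  have sti: "integrable P (%w. (norm (st i w))^2*(q (Suc i) - q i))" if i: "i < m" for i
  proof -
   obtain C where C: "ALL w:space M. norm (st i w) <= C" using stb[OF i] by blast
   have "integrable P (%w. (norm (st i w))^2)"
    by (rule P.integrable_const_bound[where B="C^2"]) (use C i in "auto intro!: power_mono")
   thus ?thesis by simp
  qed
  have "(LINT w|P. (N w)^2) = (\<Sum>i<m. LINT w|P. (norm (st i w))^2*(q (Suc i) - q i))"
   unfolding N_def using iso by auto
  also have "... = (LINT w|P. (\<Sum>i<m. (norm (st i w))^2*(q (Suc i) - q i)))"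
   by (rule Bochner_Integration.integral_sum[symmetric]) (use sti in auto)
  also have "... <= (LINT w|P. min (V w) eta)"
   by (rule integral_mono) (use sti Vi var in auto)
  finally show "(LINT w|P. (N w)^2) <= (LINT w|P. min (V w) eta)" .
  show "(K a w)^2 <= (a \<bullet> a)*(s - t)*min (V w) eta" for a w
  proof -
   \<comment> \<open>Cauchy-Schwarz with the cell lengths as weights; their sum is at most
     \<open>s - t\<close>.\<close>
   have "K a w = (\<Sum>i<m. sqrt (q (Suc i) - q i)*(sqrt (q (Suc i) - q i)*(a \<bullet> st i w)))"
    unfolding K_def by (rule sum.cong) (use q in "auto simp: mult.assoc[symmetric]")
   hence "(K a w)^2 <= (\<Sum>i<m. (sqrt (q (Suc i) - q i))^2)*(\<Sum>i<m. (sqrt (q (Suc i) - q i)*(a \<bullet> st i w))^2)"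
    by (simp only: Cauchy_Schwarz_ineq_sum)
   also have "(\<Sum>i<m. (sqrt (q (Suc i) - q i))^2) = (\<Sum>i<m. q (Suc i) - q i)"
    by (rule sum.cong) (use q in auto)
   also have "... = q m - q 0" by (rule sum_lessThan_telescope)
   also have "(\<Sum>i<m. (sqrt (q (Suc i) - q i)*(a \<bullet> st i w))^2) = (\<Sum>i<m. (q (Suc i) - q i)*(a \<bullet> st i w)^2)"
    by (rule sum.cong) (use q in "auto simp: power_mult_distrib")
   also have "(q m - q 0) * ... <= (s - t)*(\<Sum>i<m. (q (Suc i) - q i)*((a \<bullet> a)*(norm (st i w))^2))"
   proof (rule mult_mono)
    show "q m - q 0 <= s - t" using qt[of 0] qs[of m] by simp
    show "(\<Sum>i<m. (q (Suc i) - q i)*(a \<bullet> st i w)^2) <= (\<Sum>i<m. (q (Suc i) - q i)*((a \<bullet> a)*(norm (st i w))^2))"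
     by (rule sum_mono) (use q Cauchy_Schwarz_ineq[of a] in "auto simp: power2_norm_eq_inner intro!: mult_left_mono")
   qed (use t q in "auto intro!: sum_nonneg")
   also have "... = (a \<bullet> a)*(s - t)*(\<Sum>i<m. (norm (st i w))^2*(q (Suc i) - q i))"
    by (simp add: sum_distrib_left mult_ac)
   also have "... <= (a \<bullet> a)*(s - t)*min (V w) eta"
    by (rule mult_left_mono[OF var]) (use t in auto)
   finally show ?thesis .
  qed
  show "(LINT w|P. stoch_exp a t T w*(N w - K a w)) = 0" if "s <= T" for a T
   unfolding N_def K_def
   by (rule ito_sum_girsanov(2)) (use t qt[of 0] q stF stb qs[of m] that in auto)
 qed
qed

text \<open>Two simple processes are combined on a common grid. The coefficient of a fine cell is
  the value at its right end, because the cells on which \<open>simple_value\<close> is constant are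
  closed on the right.\<close>

lemma simple_refine:
 assumes sp: "simple_process M F t m p xi"
  and q: "!!i. i < n ==> q i <= q (Suc i)" "t <= q 0" and sub: "p ` {..m} \<subseteq> q ` {..n}"
 defines "xi' \<equiv> %i. simple_value m p xi (q (Suc i))"
 shows "simple_process M F t n q xi'"
  and "simple_value n q xi' u w = simple_value m p xi u w"
  and "simple_integral Z n q xi' s w = simple_integral Z m p xi s w"
proof -
 note spD = simple_processD[OF sp]
 have "ALL k:{..m}. EX j<=n. p k = q j" using sub by fastforce
 then obtain ix where ix: "!!k. k <= m ==> ix k <= n" "!!k. k <= m ==> p k = q (ix k)"
  by (metis atMost_iff)
 have qm: "i <= j ==> j <= n ==> q i <= q j" for i j
  using mono_le_upto[of n q i j] q by blast
 \<comment> \<open>\<open>ix\<close> picks some index of \<open>p k\<close> on the fine grid.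
   Indices can be compared in place of values across a cell of positive length, but not in general,
   since the fine grid may repeat points.\<close>
 have less: "p k < q (Suc i) \<longleftrightarrow> ix k <= i" if "q i < q (Suc i)" "i < n" "k <= m" for i k
  using that ix(1,2)[OF that(3)] qm[of "Suc i" "ix k"] qm[of "ix k" i] by (metis Suc_leI less_imp_le not_le order.strict_trans1 less_le_not_le)
 have lesse: "p k <= q i" if "p k < q (Suc i)" "i < n" "k <= m" for i k
  using that ix(1,2)[OF that(3)] qm[of "Suc i" "ix k"] qm[of "ix k" i] by (metis Suc_leI less_imp_le not_le)
 have ind: "(ind {p k<..p (Suc k)} (q (Suc i)) :: real) = (if ix k <= i & i < ix (Suc k) then 1 else 0)"
  if "q i < q (Suc i)" "i < n" "k < m" for i k
  using less[OF that(1,2), of k] less[OF that(1,2), of "Suc k"] that(3)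
   lesse[of "Suc k" i] that(1,2)
  by (auto simp: indicator_def not_le not_less) 
 show "simple_process M F t n q xi'"
  unfolding simple_process_def
 proof (intro conjI allI impI)
  fix i assume i: "i < n"
  show "xi' i : bm (F (q i))"
   unfolding xi'_def simple_value_def
  proof (rule borel_measurable_sum)
   fix k assume k: "k : {..<m}"
   show "(%w. ind {p k<..p (Suc k)} (q (Suc i)) *\<^sub>R xi k w) : bm (F (q i))"
   proof (cases "q (Suc i) : {p k<..p (Suc k)}")
    case True
    hence "p k <= q i" using lesse[of k i] i k by auto
    hence "xi k : bm (F (q i))" using spD(3)[of k] k by (auto intro: measurable_F_mono)
    thus ?thesis using True by simp
   qed simp
  qed
  have "EX C. ALL k<m. ALL w:space M. norm (xi k w) <= C k"
  proof -
   from spD(4) have "ALL k. EX C. k < m --> (ALL w:space M. norm (xi k w) <= C)" by blast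
   thus ?thesis by (rule choice[THEN exE]) blast
  qed
  then obtain C where C: "ALL k<m. ALL w:space M. norm (xi k w) <= C k" by blast
  show "EX C. ALL w:space M. norm (xi' i w) <= C"
  proof (intro exI ballI)
   fix w assume w: "w : space M"
   show "norm (xi' i w) <= (\<Sum>k<m. C k)"
    unfolding xi'_def simple_value_def
   proof (rule sum_norm_le)
    fix k assume "k : {..<m}"
    hence "norm (xi k w) <= C k" using C w by auto
    thus "norm (ind {p k<..p (Suc k)} (q (Suc i)) *\<^sub>R xi k w) <= C k"
     using norm_ge_zero[of "xi k w"] by (auto simp: indicator_def simp del: norm_ge_zero)
   qed
  qed
 qed (use q in auto)
 show "simple_value n q xi' u w = simple_value m p xi u w"
 proof (cases "EX i<n. u : {q i<..q (Suc i)}")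
  case True
  then obtain i where i: "i < n" "q i < u" "u <= q (Suc i)" by auto
  have "simple_value n q xi' u w = xi' i w"
  proof -
   have "(ind {q j<..q (Suc j)} u :: real) = (if j = i then 1 else 0)" if "j < n" for j
    using that i qm[of "Suc j" i] qm[of "Suc i" j] by (cases j i rule: linorder_cases) (auto simp: indicator_def)
   hence "simple_value n q xi' u w = (\<Sum>j<n. (if j = i then 1 else 0) *\<^sub>R xi' j w)"
    unfolding simple_value_def by (intro sum.cong) auto
   also have "... = xi' i w" using i by (simp add: if_distrib[of "%c. c *\<^sub>R _"] cong: if_cong)
   finally show ?thesis .
  qed
  moreover have "simple_value m p xi u w = xi' i w"
   unfolding xi'_def simple_value_def
  proof (rule sum.cong[OF refl])
   fix k assume "k : {..<m}"
   hence k: "k <= m" "Suc k <= m" by auto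
   have "p k < u \<longleftrightarrow> p k < q (Suc i)" using i lesse[of k i] k by auto
   moreover have "u <= p (Suc k) \<longleftrightarrow> q (Suc i) <= p (Suc k)" using i lesse[of "Suc k" i] k by fastforce
   ultimately show "ind {p k<..p (Suc k)} u *\<^sub>R xi k w = ind {p k<..p (Suc k)} (q (Suc i)) *\<^sub>R xi k w"
    by (simp add: indicator_def)
  qed
  ultimately show ?thesis by simp
 next
  case False
  have ex: "EX i<n. u : {q i<..q (Suc i)}" if "q 0 < u" "u <= q j" "j <= n" for j
   using that
  proof (induction j)
   case (Suc j)
   thus ?case by (cases "u <= q j") (auto intro!: exI[of _ j])
  qed simp
  have "u \<notin> {p k<..p (Suc k)}" if k: "k < m" for k
  proof
   assume u: "u : {p k<..p (Suc k)}"
   have "q 0 <= p k" using ix[of k] k qm[of 0 "ix k"] by auto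
   thus False using False ex[of "ix (Suc k)"] u ix[of "Suc k"] k by auto
  qed
  hence "simple_value m p xi u w = 0" by (simp add: simple_value_def)
  moreover have "simple_value n q xi' u w = 0" using False by (auto simp: simple_value_def intro!: sum.neutral)
  ultimately show ?thesis by simp
 qed
 show "simple_integral Z n q xi' s w = simple_integral Z m p xi s w"
 proof -
  let ?Z = "%x. Z (min x s) w"
  let ?d = "%i. ?Z (q (Suc i)) - ?Z (q i)"
  have "simple_integral Z n q xi' s w = (\<Sum>i<n. \<Sum>k<m. xi k w \<bullet> (ind {p k<..p (Suc k)} (q (Suc i)) *\<^sub>R ?d i))"
   unfolding simple_integral_def xi'_def simple_value_def by (simp add: inner_sum_left)
  also have "... = (\<Sum>k<m. xi k w \<bullet> (\<Sum>i<n. ind {p k<..p (Suc k)} (q (Suc i)) *\<^sub>R ?d i))"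
   by (subst sum.swap) (simp add: inner_sum_right)
  also have "... = (\<Sum>k<m. xi k w \<bullet> (?Z (p (Suc k)) - ?Z (p k)))"
  proof (intro sum.cong refl arg_cong[where f="%v. _ \<bullet> v"])
   fix k assume "k : {..<m}"
   hence k: "k < m" "k <= m" "Suc k <= m" by auto
   have "(\<Sum>i<n. ind {p k<..p (Suc k)} (q (Suc i)) *\<^sub>R ?d i) = (\<Sum>i<n. if i : {ix k..<ix (Suc k)} then ?d i else 0)"
   proof (rule sum.cong[OF refl])
    fix i assume i: "i : {..<n}"
    show "ind {p k<..p (Suc k)} (q (Suc i)) *\<^sub>R ?d i = (if i : {ix k..<ix (Suc k)} then ?d i else 0)"
    proof (cases "q i < q (Suc i)")
     case True
     thus ?thesis using ind[OF True, of k] i k by auto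
    next
     case False
     hence "q i = q (Suc i)" using q(1)[of i] i by auto
     thus ?thesis by simp
    qed
   qed
   also have "... = (\<Sum>i\<in>{ix k..<ix (Suc k)}. ?d i)"
   proof -
    have "{..<n} \<inter> {ix k..<ix (Suc k)} = {ix k..<ix (Suc k)}" using ix(1)[OF k(3)] by auto
    thus ?thesis using sum.inter_restrict[of "{..<n}" ?d "{ix k..<ix (Suc k)}"] by (simp only: finite_lessThan)
   qed
   also have "... = ?Z (p (Suc k)) - ?Z (p k)"
   proof (cases "ix k <= ix (Suc k)")
    case True
    thus ?thesis using sum_Suc_diff'[OF True, of "%i. ?Z (q i)"] ix(2) k by simp
   next
    \<comment> \<open>Indices out of order can only mean that the two points coincide; the empty sum
      and the increment are then both zero.\<close>
    case False
    hence "p (Suc k) <= p k" using qm[of "ix (Suc k)" "ix k"] ix k by auto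
    hence "p (Suc k) = p k" using spD(2)[OF k(1)] by simp
    thus ?thesis using False by simp
   qed
   finally show "(\<Sum>i<n. ind {p k<..p (Suc k)} (q (Suc i)) *\<^sub>R ?d i) = ?Z (p (Suc k)) - ?Z (p k)" .
  qed
  finally show ?thesis unfolding simple_integral_def .
 qed
qed

text \<open>The sorted list of all partition points of both processes is a common
  refinement.\<close>

lemma simple_lincomb:
 assumes sp: "simple_process M F t m p xi" "simple_process M F t m' p' xi'"
 obtains n q ze where "simple_process M F t n q ze"
  "!!u w. simple_value n q ze u w = simple_value m p xi u w + c *\<^sub>R simple_value m' p' xi' u w"
  "!!s w. simple_integral Z n q ze s w = simple_integral Z m p xi s w + c * simple_integral Z m' p' xi' s w"
proof -
 define S where "S = p ` {..m} \<union> p' ` {..m'}"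
 have fin: "finite S" and ne: "S ~= {}" by (auto simp: S_def)
 define l where "l = sorted_list_of_set S"
 have l: "set l = S" "sorted l" "l ~= []" unfolding l_def using fin ne by auto
 define n where "n = length l - 1"
 define q where "q i = l ! i" for i
 have len: "length l = Suc n" using l(3) by (simp add: n_def)
 have S: "q ` {..n} = S"
  unfolding l(1)[symmetric] q_def set_conv_nth len by (auto simp: less_Suc_eq_le)
 have q1: "q i <= q (Suc i)" if "i < n" for i
  unfolding q_def using l(2) that len by (intro sorted_nth_mono) auto
 have q0: "t <= q 0"
 proof -
  have "q 0 : S" using S by auto
  thus ?thesis using simple_processD(5)[OF sp(1)] simple_processD(5)[OF sp(2)] by (auto simp: S_def)
 qed
 have sub: "p ` {..m} \<subseteq> q ` {..n}" "p' ` {..m'} \<subseteq> q ` {..n}" unfolding S by (auto simp: S_def)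
 let ?x = "%i. simple_value m p xi (q (Suc i))" and ?x' = "%i. simple_value m' p' xi' (q (Suc i))"
 note r = simple_refine[OF sp(1) q1 q0 sub(1)] and r' = simple_refine[OF sp(2) q1 q0 sub(2)]
 show thesis
 proof
  let ?y = "%i w. ?x i w + c *\<^sub>R ?x' i w"
  show "simple_process M F t n q ?y"
   unfolding simple_process_def
  proof (intro conjI allI impI)
   fix i assume i: "i < n"
   show "?y i : bm (F (q i))"
    by (intro borel_measurable_add borel_measurable_scaleR borel_measurable_const
      simple_processD(3)[OF r(1) i] simple_processD(3)[OF r'(1) i])
   obtain C C' where "ALL w:space M. norm (?x i w) <= C" "ALL w:space M. norm (?x' i w) <= C'"
    using simple_processD(4)[OF r(1) i] simple_processD(4)[OF r'(1) i] by blast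
   thus "EX C. ALL w:space M. norm (?y i w) <= C"
    by (intro exI[of _ "C + abs c*C'"] ballI norm_triangle_mono) (auto intro!: mult_left_mono)
  qed (use q1 q0 in auto)
  show "simple_value n q ?y u w = simple_value m p xi u w + c *\<^sub>R simple_value m' p' xi' u w" for u w
  proof -
   have "simple_value n q ?y u w = simple_value n q ?x u w + c *\<^sub>R simple_value n q ?x' u w"
    by (simp only: simple_value_def[of n q] scaleR_add_right sum.distrib scaleR_sum_right scaleR_scaleR mult.commute)
   also note r(2)[of u w] also note r'(2)[of u w]
   finally show ?thesis .
  qed
  show "simple_integral Z n q ?y s w = simple_integral Z m p xi s w + c * simple_integral Z m' p' xi' s w" for s w
  proof -
   have "simple_integral Z n q ?y s w = simple_integral Z n q ?x s w + c * simple_integral Z n q ?x' s w"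
    by (simp only: simple_integral_def[of Z n q] inner_add_left inner_scaleR_left sum.distrib sum_distrib_left)
   also note r(3)[of s w] also note r'(3)[of s w]
   finally show ?thesis .
  qed
 qed
qed

end

section \<open>Properties of the Ito integral\<close>

text \<open>Cauchy-Schwarz on one path: the drift \<open>a \<bullet> h\<close> is controlled by the
  energy, so convergence in energy carries over to the Girsanov drift.\<close>

lemma path_drift_bound:
 fixes h :: "real => real^'n"
 assumes m: "set_borel_measurable lborel {t..s} h" and ts: "t <= s"
  and fin: "(NS {t..s} (%u. ennreal ((norm (h u))^2))) < \<infinity>"
 shows "sint {t..s} (%u. a \<bullet> h u)"
  and "ennreal ((LBINT u:{t..s}. a \<bullet> h u)^2) <= ennreal ((a \<bullet> a)*(s - t))*(NS {t..s} (%u. ennreal ((norm (h u))^2)))"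
proof -
 have m1 [measurable]: "(%u. ind {t..s} u *\<^sub>R h u) : bm lborel"
  using m by (simp add: set_borel_measurable_def)
 have m2: "(%u. ennreal (abs (a \<bullet> h u))*ind {t..s} u) : bm borel"
 proof -
  have "(%u. ennreal (norm (a \<bullet> (ind {t..s} u *\<^sub>R h u)))) : bm lborel" by measurable
  moreover have "(%u. ennreal (norm (a \<bullet> (ind {t..s} u *\<^sub>R h u)))) = (%u. ennreal (abs (a \<bullet> h u))*ind {t..s} u)"
   by (auto simp: fun_eq_iff indicator_def)
  ultimately show ?thesis by (simp only: measurable_lborel1 measurable_lborel2)
 qed
 have sq: "(NS {t..s} (%u. ennreal (abs (a \<bullet> h u))))^2 <= ennreal ((a \<bullet> a)*(s - t))*(NS {t..s} (%u. ennreal ((norm (h u))^2)))"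
 proof -
  have m3: "(%u. ennreal ((norm (h u))^2)*ind {t..s} u) : bm lborel"
  proof -
   have "(%u. ennreal ((norm (ind {t..s} u *\<^sub>R h u))^2)) : bm lborel" by measurable
   thus ?thesis by (rule measurable_eqI) (auto simp: indicator_def)
  qed
  have "(NS {t..s} (%u. ennreal (abs (a \<bullet> h u))))^2 <= ennreal (s - t)*(NS {t..s} (%u. (ennreal (abs (a \<bullet> h u)))^2))"
   by (rule set_nn_integral_power2_le[OF m2 ts])
  also have "(NS {t..s} (%u. (ennreal (abs (a \<bullet> h u)))^2)) <= (NL u. ennreal (a \<bullet> a)*(ennreal ((norm (h u))^2)*ind {t..s} u))"
  proof (rule nn_integral_mono)
   fix u
   have "(a \<bullet> h u)^2 <= (a \<bullet> a)*(norm (h u))^2"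
    using Cauchy_Schwarz_ineq[of a "h u"] by (simp add: power2_norm_eq_inner)
   thus "(ennreal (abs (a \<bullet> h u)))^2*ind {t..s} u <= ennreal (a \<bullet> a)*(ennreal ((norm (h u))^2)*ind {t..s} u)"
    by (auto simp: indicator_def ennreal_power ennreal_mult[symmetric] intro!: ennreal_leI)
  qed
  also have "... = ennreal (a \<bullet> a)*(NS {t..s} (%u. ennreal ((norm (h u))^2)))"
   by (rule nn_integral_cmult[OF m3])
  finally show ?thesis
   using ts by (simp add: ennreal_mult mult.assoc mult.left_commute mult_left_mono)
 qed
 have lt: "(NS {t..s} (%u. ennreal (abs (a \<bullet> h u)))) < \<infinity>"
 proof -
  have "ennreal ((a \<bullet> a)*(s - t))*(NS {t..s} (%u. ennreal ((norm (h u))^2))) < \<infinity>"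
   using fin by (simp add: ennreal_mult_less_top)
  with sq have "(NS {t..s} (%u. ennreal (abs (a \<bullet> h u))))^2 < \<infinity>" by (rule le_less_trans)
  thus ?thesis by (simp add: power2_eq_square ennreal_mult_less_top) (auto simp: less_top)
 qed
 show i: "sint {t..s} (%u. a \<bullet> h u)"
  unfolding set_integrable_def
 proof (rule integrableI_bounded)
  have "(%u. a \<bullet> (ind {t..s} u *\<^sub>R h u)) : bm lborel" by measurable
  thus "(%u. ind {t..s} u *\<^sub>R (a \<bullet> h u)) : bm lborel" by simp
  have "(NL u. ennreal (norm (ind {t..s} u *\<^sub>R (a \<bullet> h u)))) = (NS {t..s} (%u. ennreal (abs (a \<bullet> h u))))"
   by (intro nn_integral_cong) (auto simp: indicator_def)
  thus "(NL u. ennreal (norm (ind {t..s} u *\<^sub>R (a \<bullet> h u)))) < \<infinity>" using lt by simp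
 qed
 have "ennreal (abs (LBINT u:{t..s}. a \<bullet> h u)) <= (NL u. ennreal (norm (ind {t..s} u *\<^sub>R (a \<bullet> h u))))"
  unfolding sli_def
  using integral_norm_bound_ennreal[OF i[unfolded set_integrable_def]] by simp
 also have "... = (NS {t..s} (%u. ennreal (abs (a \<bullet> h u))))"
  by (intro nn_integral_cong) (auto simp: indicator_def)
 finally have "(ennreal (abs (LBINT u:{t..s}. a \<bullet> h u)))^2 <= (NS {t..s} (%u. ennreal (abs (a \<bullet> h u))))^2"
  by (rule power_mono) simp
 with sq show "ennreal ((LBINT u:{t..s}. a \<bullet> h u)^2) <= ennreal ((a \<bullet> a)*(s - t))*(NS {t..s} (%u. ennreal ((norm (h u))^2)))"
  by (simp add: ennreal_power)
qed

text \<open>Applied with \<open>a\<close> the energy of the integrand and \<open>b\<close> twice the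
  approximation error: the error keeps its truncation and vanishes by dominated convergence, leaving
  the factor 3 of \<open>ito_local_isometry\<close>.\<close>

lemma min_add_le_ennreal:
 fixes a b e :: ennreal
 shows "min (2*a + b) (3*e) <= 3*min a e + min b (3*e)"
proof (cases "a <= e")
 case True
 have "min (2*a + b) (3*e) <= 2*a + min b (3*e)"
  by (cases "b <= 3*e") (auto simp: min_def add_increasing)
 also have "... <= 3*a + min b (3*e)"
  by (intro add_right_mono mult_right_mono) auto
 finally show ?thesis using True by (simp add: min_def)
next
 case False
 hence "min a e = e" by (simp add: min_def)
 thus ?thesis by (simp add: add_increasing2 min.coboundedI2)
qed

lemma min_add_le_ennreal':
 fixes a b e :: ennreal
 shows "min (a + b) e <= a + min b e"
 by (cases "b <= e") (auto simp: min_def add_increasing)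

context brownian
begin

lemma qvar_diff_joint:
 assumes "simple_process M F t m p xi" "pred t H" "0 <= t"
 shows "(%x. ennreal ((norm (simple_value m p xi (fst x) (snd x) - H (fst x) (snd x)))^2)*ind {t..s} (fst x))
  : bm (BxP)"
proof -
 note [measurable] = simple_value_joint[OF assms(1)] predictable_P[OF assms(2,3), of 0]
 have "(%x. ennreal ((norm (simple_value m p xi (fst x) (snd x) - (if fst x : {t..} then H (fst x) (snd x) else 0)))^2)*ind {t..s} (fst x))
  : bm (BxP)"
  by measurable
 thus ?thesis by (rule measurable_eqI) (auto simp: indicator_def)
qed

lemma qvar_diff_P:
 assumes "simple_process M F t m p xi" "pred t H" "0 <= t"
 shows "qvar (%u w. simple_value m p xi u w - H u w) t s : bm P"
 by (rule nn_integral_F) (rule qvar_diff_joint[OF assms])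

lemma qvar_simple_le:
 assumes "simple_process M F t m p xi" "pred t H" "0 <= t" "w : space M"
 shows "qvar (simple_value m p xi) t s w <= 2*qvar H t s w + 2*qvar (%u w. simple_value m p xi u w - H u w) t s w"
proof -
 have "(%u. (u, w)) : borel \<rightarrow>\<^sub>M BxP"
  by (rule measurable_Pair2') (use assms in simp)
 from measurable_compose[OF this qvar_diff_joint[OF assms(1,2,3), of s]]
 have m1: "(%u. ennreal ((norm (simple_value m p xi u w - H u w))^2)*ind {t..s} u) : bm lborel"
  by simp
 have m2: "(%u. ennreal ((norm (H u w))^2)*ind {t..s} u) : bm lborel"
 proof -
  have [measurable]: "(%u. ind {t..s} u *\<^sub>R H u w) : bm lborel"
   using predictable_set_borel[OF assms(2,3,4), of s] by (simp add: set_borel_measurable_def)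
  have "(%u. ennreal ((norm (ind {t..s} u *\<^sub>R H u w))^2)) : bm lborel" by measurable
  thus ?thesis by (rule measurable_eqI) (auto simp: indicator_def)
 qed
 have "qvar (simple_value m p xi) t s w
  <= (NL u. 2*(ennreal ((norm (H u w))^2)*ind {t..s} u)
    + 2*(ennreal ((norm (simple_value m p xi u w - H u w))^2)*ind {t..s} u))"
 proof (rule nn_integral_mono)
  fix u
  let ?x = "simple_value m p xi u w" and ?y = "H u w"
  have "(norm ?x)^2 <= (norm ?y + norm (?x - ?y))^2"
   by (rule power_mono) (metis add.commute norm_triangle_sub, simp)
  also have "... <= 2*(norm ?y)^2 + 2*(norm (?x - ?y))^2"
   using sum_squares_bound[of "norm ?y" "norm (?x - ?y)"] by (simp add: power2_sum)
  finally have "ennreal ((norm ?x)^2) <= ennreal (2*(norm ?y)^2 + 2*(norm (?x - ?y))^2)" by (rule ennreal_leI)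
  also have "... = 2*ennreal ((norm ?y)^2)+2*ennreal ((norm (?x - ?y))^2)"
   by (simp add: ennreal_mult)
  finally show "ennreal ((norm ?x)^2)*ind {t..s} u <= 2*(ennreal ((norm ?y)^2)*ind {t..s} u)
    + 2*(ennreal ((norm (?x - ?y))^2)*ind {t..s} u)"
   by (auto simp: indicator_def)
 qed
 also have "... = 2*qvar H t s w + 2*qvar (%u w. simple_value m p xi u w - H u w) t s w"
  using m1 m2 by (simp add: nn_integral_add nn_integral_cmult)
 finally show ?thesis .
qed

lemma ito_integralD:
 assumes "itoint t H I"
 shows "pred t H" "cadapted t I"
  "AE w in M. ALL s>=t. qvar H t s w < \<infinity>"
 using assms by (auto simp: ito_integral_def)

lemma cadapted_F: "cadapted t X ==> t <= s ==> X s : bm (F s)"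
 by (auto simp: continuous_adapted_def)

lemma cadapted_P: "cadapted t X ==> t <= s ==> X s : bm P"
 by (rule measurable_F_P[OF cadapted_F])

text \<open>One subsequence has to serve the energy and the value at \<open>s\<close> at once, so it
  is extracted from the sum of both errors.\<close>

lemma ito_integral_approx:
 assumes I: "itoint t H I" and t: "0 <= t" "t <= s"
 obtains m p xi where "!!j. sproc t m p xi j"
  "AE w in M. (%j. qvar (%u w. sval m p xi j u w - H u w) t s w) ----> 0"
  "AE w in M. (%j. sitg m p xi j s w) ----> I s w"
proof -
 note ID = ito_integralD[OF I]
 obtain m p xi where A: "ALL j. sproc t m p xi j"
  "ALL s>=t. vanish (%j. qvar (%u w. sval m p xi j u w - H u w) t s) \<and>
   vanish (%j w. ennreal (abs (sitg m p xi j s w - I s w)))"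
  using I unfolding ito_integral_def by blast
 have sp: "!!j. sproc t m p xi j"
  and v1: "vanish (%j. qvar (%u w. sval m p xi j u w - H u w) t s)"
  and v2: "vanish (%j w. ennreal (abs (sitg m p xi j s w - I s w)))"
  using A t by blast+
 let ?D = "%j. qvar (%u w. sval m p xi j u w - H u w) t s"
 let ?E = "%j w. ennreal (abs (sitg m p xi j s w - I s w))"
 have D: "?D j : bm P" for j by (rule qvar_diff_P[OF sp ID(1) t(1)])
 have [measurable]: "I s : bm P" using cadapted_P[OF ID(2) t(2)] .
 have [measurable]: "sitg m p xi j s : bm P" for j
  by (rule simple_integral_P[OF sp t])
 have E: "?E j : bm P" for j by measurable
 obtain r where r: "strict_mono r" "AE w in M. (%j. ?D (r j) w + ?E (r j) w) ----> 0"
  using vanish_subseq[OF borel_measurable_add[OF D E] vanish_add[OF D E v1 v2]] by blast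
 show thesis
 proof (rule that[of "m \<circ> r" "p \<circ> r" "xi \<circ> r"])
  show "simple_process M F t ((m \<circ> r) j) ((p \<circ> r) j) ((xi \<circ> r) j)" for j by (simp add: sp)
  show "AE w in M. (%j. qvar (%u w. simple_value ((m \<circ> r) j) ((p \<circ> r) j) ((xi \<circ> r) j) u w - H u w) t s w) ----> 0"
   using r(2)
  proof eventually_elim
   case (elim w)
   have "(%j. ?D (r j) w) ----> 0"
    by (rule tendsto_sandwich[OF _ _ tendsto_const elim]) (auto simp: add_increasing2)
   thus ?case by simp
  qed
  show "AE w in M. (%j. simple_integral Z ((m \<circ> r) j) ((p \<circ> r) j) ((xi \<circ> r) j) s w) ----> I s w"
   using r(2)
  proof eventually_elim
   case (elim w)
   have "(%j. ?E (r j) w) ----> 0"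
    by (rule tendsto_sandwich[OF _ _ tendsto_const elim]) (auto simp: add_increasing)
   hence "(%j. abs (simple_integral Z (m (r j)) (p (r j)) (xi (r j)) s w - I s w)) ----> 0"
    by (subst (asm) ennreal_tendsto_0_iff) auto
   thus ?case
    by (simp add: tendsto_rabs_zero_iff LIM_zero_iff)
  qed
 qed
qed

text \<open>On the event that the energy is below \<open>eta\<close>, stopping the approximants is
  eventually invisible, so Fatou's lemma bounds the square of \<open>I s\<close> by the stopped
  second moments. The event takes the place of integrability of \<open>H\<close>.\<close>

lemma ito_local_isometry:
 assumes I: "itoint t H I" and t: "0 <= t" "t <= s" and eta: "0 <= eta"
 shows "(NP w. ennreal ((I s w)^2)*ind {w : space M. qvar H t s w < ennreal eta} w)
  <= 3*(NP w. min (qvar H t s w) (ennreal eta))"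
proof -
 note ID = ito_integralD[OF I]
 obtain m p xi where sp: "!!j. sproc t m p xi j"
  and D0: "AE w in M. (%j. qvar (%u w. sval m p xi j u w - H u w) t s w) ----> 0"
  and I0: "AE w in M. (%j. sitg m p xi j s w) ----> I s w"
  using ito_integral_approx[OF I t] by blast
 let ?D = "%j. qvar (%u w. sval m p xi j u w - H u w) t s"
 have ex: "EX N. N : bm P \<and>
   (ALL w. qvar (sval m p xi j) t s w <= ennreal (3 * eta) --> N w = sitg m p xi j s w) \<and>
   (NP w. ennreal ((N w)^2)) <= (NP w. min (qvar (sval m p xi j) t s w) (ennreal (3 * eta)))" for j
 proof -
  \<comment> \<open>Energy of \<open>H\<close> below \<open>eta\<close> and error below
    \<open>eta/2\<close> keep the energy of the approximant below \<open>2*eta + 2*(eta/2)\<close>,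
    hence the level \<open>3 * eta\<close>.\<close>
  have eta3: "0 <= 3 * eta" using eta by simp
  obtain N K V where N: "N : bm P" "!!w. 0 <= V w" "!!w. qvar (sval m p xi j) t s w = ennreal (V w)"
   "!!w. V w <= 3 * eta ==> N w = sitg m p xi j s w"
   "integrable P (%w. (N w)^2)" "integrable P (%w. min (V w) (3 * eta))"
   "(LINT w|P. (N w)^2) <= (LINT w|P. min (V w) (3 * eta))"
   by (rule stopped_simple[OF sp[of j] t eta3]) (rule that, assumption+)
  show ?thesis
  proof (intro exI[of _ N] conjI allI impI)
   show "(NP w. ennreal ((N w)^2)) <= (NP w. min (qvar (sval m p xi j) t s w) (ennreal (3 * eta)))"
    unfolding N(3) using N(5,6,7) N(2) eta
    by (simp add: nn_integral_eq_integral min_ennreal ennreal_leI)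
  qed (use N eta in auto)
 qed
 from choice[OF allI[OF ex]] obtain N where N0: "ALL j. N j : bm P \<and>
   (ALL w. qvar (sval m p xi j) t s w <= ennreal (3 * eta) --> N j w = sitg m p xi j s w) \<and>
   (NP w. ennreal ((N j w)^2)) <= (NP w. min (qvar (sval m p xi j) t s w) (ennreal (3 * eta)))" ..
 have N [measurable]: "!!j. N j : bm P"
  and NI: "!!j w. qvar (sval m p xi j) t s w <= ennreal (3 * eta) ==> N j w = sitg m p xi j s w"
  and N2: "!!j. (NP w. ennreal ((N j w)^2)) <= (NP w. min (qvar (sval m p xi j) t s w) (ennreal (3 * eta)))"
  using N0 by blast+
 have Dm [measurable]: "?D j : bm P" for j by (rule qvar_diff_P[OF sp ID(1) t(1)])
 have Hm [measurable]: "qvar H t s : bm P" by (rule measurable_F_P[OF qvar_F[OF ID(1) t(1)]])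
 have e3: "ennreal (3 * eta) = 3*ennreal eta" using eta by (simp add: ennreal_mult)
 have "(NP w. ennreal ((I s w)^2)*ind {w : space M. qvar H t s w < ennreal eta} w)
  <= (NP w. liminf (%j. ennreal ((N j w)^2)))"
 proof (rule nn_integral_mono_AE)
  show "AE w in P. ennreal ((I s w)^2)*ind {w : space M. qvar H t s w < ennreal eta} w
    <= liminf (%j. ennreal ((N j w)^2))"
   using AE_completion[OF D0] AE_completion[OF I0] AE_space
  proof eventually_elim
   case (elim w)
   show ?case
   proof (cases "qvar H t s w < ennreal eta")
    case True
    hence "0 < ennreal eta" by (rule le_less_trans[rotated]) simp
    hence eta0: "0 < eta" by simp
    have "\<forall>\<^sub>F j in sequentially. ?D j w < ennreal (eta/2)"
     using elim(1) eta0 by (intro order_tendstoD(2)) auto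
    hence "\<forall>\<^sub>F j in sequentially. sitg m p xi j s w = N j w"
    proof eventually_elim
     case (elim j)
     have "qvar (sval m p xi j) t s w <= 2*qvar H t s w + 2*?D j w"
      by (rule qvar_simple_le[OF sp ID(1) t(1)]) (use \<open>w : space P\<close> in simp)
     also have "... <= 2*ennreal eta + 2*ennreal (eta/2)"
      using True elim by (intro add_mono mult_left_mono) auto
     also have "... = ennreal (3 * eta)"
     proof -
      have "2*ennreal x = ennreal (2*x)" if "0 <= x" for x
       using that by (simp add: ennreal_mult)
      thus ?thesis using eta by (simp add: ennreal_plus[symmetric] del: ennreal_plus)
     qed
     finally show ?case using NI by simp
    qed
    hence "(%j. N j w) ----> I s w"
     by (rule Lim_transform_eventually[OF elim(2)])
    hence "(%j. ennreal ((N j w)^2)) ----> ennreal ((I s w)^2)"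
     by (intro tendsto_ennrealI tendsto_power)
    hence "liminf (%j. ennreal ((N j w)^2)) = ennreal ((I s w)^2)"
     by (rule lim_imp_Liminf[OF sequentially_bot])
    thus ?thesis by (simp add: indicator_def)
   qed (simp add: indicator_def)
  qed
 qed
 also have "... <= liminf (%j. (NP w. ennreal ((N j w)^2)))"
  by (rule nn_integral_liminf) simp
 also have "... <= liminf (%j. 3*(NP w. min (qvar H t s w) (ennreal eta))+(NP w. min (2*?D j w) (3*ennreal eta)))"
 proof (rule Liminf_mono, rule always_eventually, rule allI)
  fix j
  have "(NP w. ennreal ((N j w)^2)) <= (NP w. 3*min (qvar H t s w) (ennreal eta)+min (2*?D j w) (3*ennreal eta))"
  proof (rule order_trans[OF N2], rule nn_integral_mono)
   fix w assume "w : space P"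
   hence "qvar (sval m p xi j) t s w <= 2*qvar H t s w + 2*?D j w"
    by (intro qvar_simple_le[OF sp ID(1) t(1)]) simp
   hence "min (qvar (sval m p xi j) t s w) (ennreal (3 * eta)) <= min (2*qvar H t s w + 2*?D j w) (3*ennreal eta)"
    unfolding e3 by (rule min.mono) simp
   also have "... <= 3*min (qvar H t s w) (ennreal eta)+min (2*?D j w) (3*ennreal eta)"
    by (rule min_add_le_ennreal)
   finally show "min (qvar (sval m p xi j) t s w) (ennreal (3 * eta)) <= 3*min (qvar H t s w) (ennreal eta)+min (2*?D j w) (3*ennreal eta)" .
  qed
  also have "... = 3*(NP w. min (qvar H t s w) (ennreal eta))+(NP w. min (2*?D j w) (3*ennreal eta))"
   by (subst nn_integral_add) (auto simp: nn_integral_cmult)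
  finally show "(NP w. ennreal ((N j w)^2)) <= 3*(NP w. min (qvar H t s w) (ennreal eta))+(NP w. min (2*?D j w) (3*ennreal eta))" .
 qed
 also have "... = 3*(NP w. min (qvar H t s w) (ennreal eta))"
 proof -
  have "(%j. (NP w. min (2*?D j w) (3*ennreal eta))) ----> (NP w. 0)"
  proof (rule nn_integral_dominated_convergence[where w="%_. 3*ennreal eta"])
   show "(NP x. 3*ennreal eta) < \<infinity>" by (simp add: emeasure_space_1 ennreal_mult_less_top)
   show "AE w in P. (%j. min (2*?D j w) (3*ennreal eta)) ----> 0"
    using AE_completion[OF D0]
   proof eventually_elim
    case (elim w)
    have "(%j. 2*?D j w) ----> 2*0" by (rule ennreal_tendsto_cmult[OF _ elim]) simp
    hence "(%j. min (2*?D j w) (3*ennreal eta)) ----> min (2*0) (3*ennreal eta)"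
     by (intro tendsto_min tendsto_const)
    thus ?case by simp
   qed
  qed auto
  hence "(%j. 3*(NP w. min (qvar H t s w) (ennreal eta))+(NP w. min (2*?D j w) (3*ennreal eta)))
   ----> 3*(NP w. min (qvar H t s w) (ennreal eta))+0"
   by (intro tendsto_add tendsto_const) simp
  thus ?thesis using lim_imp_Liminf[OF sequentially_bot] by fastforce
 qed
 finally show ?thesis .
qed

end

lemma path_qvar_add:
 fixes x y :: "real => real^'n"
 assumes "set_borel_measurable lborel S x" "set_borel_measurable lborel S y"
 shows "(NS S (%u. ennreal ((norm (x u + c *\<^sub>R y u))^2)))
  <= ennreal (2 + 2*c^2)*((NS S (%u. ennreal ((norm (x u))^2)))+(NS S (%u. ennreal ((norm (y u))^2))))"
proof -
 have m: "(%u. ennreal ((norm (z u))^2)*ind S u) : bm lborel" if "set_borel_measurable lborel S z" for z :: "real => real^'n"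
 proof -
  have [measurable]: "(%u. ind S u *\<^sub>R z u) : bm lborel" using that by (simp add: set_borel_measurable_def)
  have "(%u. ennreal ((norm (ind S u *\<^sub>R z u))^2)) : bm lborel" by measurable
  thus ?thesis by (rule measurable_eqI) (auto simp: indicator_def)
 qed
 have "(NS S (%u. ennreal ((norm (x u + c *\<^sub>R y u))^2)))
  <= (NL u. ennreal (2 + 2*c^2)*(ennreal ((norm (x u))^2)*ind S u + ennreal ((norm (y u))^2)*ind S u))"
 proof (rule nn_integral_mono)
  fix u
  have "(norm (x u + c *\<^sub>R y u))^2 <= (norm (x u)+abs c*norm (y u))^2"
   by (rule power_mono) (metis norm_scaleR norm_triangle_ineq, simp)
  also have "... <= 2*(norm (x u))^2 + 2*(c^2*(norm (y u))^2)"
   using sum_squares_bound[of "norm (x u)" "abs c*norm (y u)"] by (simp add: power2_sum power_mult_distrib)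
  also have "... <= (2 + 2*c^2)*((norm (x u))^2 + (norm (y u))^2)"
   by (simp add: algebra_simps)
  finally have "ennreal ((norm (x u + c *\<^sub>R y u))^2) <= ennreal (2 + 2*c^2)*(ennreal ((norm (x u))^2)+ennreal ((norm (y u))^2))"
   by (simp add: ennreal_mult[symmetric] ennreal_plus[symmetric] ennreal_leI del: ennreal_plus)
  thus "ennreal ((norm (x u + c *\<^sub>R y u))^2)*ind S u
   <= ennreal (2 + 2*c^2)*(ennreal ((norm (x u))^2)*ind S u + ennreal ((norm (y u))^2)*ind S u)"
   by (auto simp: indicator_def)
 qed
 also have "... = ennreal (2 + 2*c^2)*((NS S (%u. ennreal ((norm (x u))^2)))+(NS S (%u. ennreal ((norm (y u))^2))))"
  using m[OF assms(1)] m[OF assms(2)] by (simp add: nn_integral_add nn_integral_cmult)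
 finally show ?thesis .
qed

context brownian
begin

lemma simple_set_borel: "set_borel_measurable lborel {t..s} (%u. simple_value m p xi u w)"
 unfolding set_borel_measurable_def simple_value_def by measurable

text \<open>The level of \<open>ito_local_isometry\<close> runs through the naturals; the events
  exhaust the space up to a null set because the energy is finite almost surely.\<close>

lemma ito_square_integral_le:
 assumes I: "itoint t H I" and t: "0 <= t" "t <= s"
 shows "(NP w. ennreal ((I s w)^2)) <= 3*(NP w. qvar H t s w)"
proof -
 note ID = ito_integralD[OF I]
 have Hm [measurable]: "qvar H t s : bm P" by (rule measurable_F_P[OF qvar_F[OF ID(1) t(1)]])
 have Im [measurable]: "I s : bm P" using cadapted_P[OF ID(2) t(2)] .
 let ?f = "%n w. ennreal ((I s w)^2)*ind {w : space P. qvar H t s w < ennreal (real n)} w"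
 have "(NP w. ennreal ((I s w)^2)) = (NP w. liminf (%n. ?f n w))"
 proof (rule nn_integral_cong_AE)
  show "AE w in P. ennreal ((I s w)^2) = liminf (%n. ?f n w)"
   using AE_completion[OF ID(3)] AE_space
  proof eventually_elim
   case (elim w)
   hence fin: "qvar H t s w < \<infinity>" using t by auto
   have "\<forall>\<^sub>F n in sequentially. qvar H t s w < ennreal (real n)"
   proof -
    obtain n0 where n0: "qvar H t s w < of_nat n0"
     using ennreal_Ex_less_of_nat[of "qvar H t s w"] fin by auto
    show ?thesis
     unfolding eventually_sequentially
    proof (intro exI[of _ n0] allI impI)
     fix n assume "n0 <= n"
     thus "qvar H t s w < ennreal (real n)"
      by (intro less_le_trans[OF n0[unfolded ennreal_of_nat_eq_real_of_nat] ennreal_leI]) simp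
    qed
   qed
   hence "\<forall>\<^sub>F n in sequentially. ?f n w = ennreal ((I s w)^2)"
    by eventually_elim (use elim in "auto simp: indicator_def")
   hence "(%n. ?f n w) ----> ennreal ((I s w)^2)" by (rule tendsto_eventually)
   thus ?case by (rule lim_imp_Liminf[OF sequentially_bot, symmetric])
  qed
 qed
 also have "... <= liminf (%n. (NP w. ?f n w))"
  by (rule nn_integral_liminf) measurable
 also have "... <= 3*(NP w. qvar H t s w)"
 proof (rule Liminf_le)
  show "\<forall>\<^sub>F n in sequentially. (NP w. ?f n w) <= 3*(NP w. qvar H t s w)"
  proof (rule always_eventually, rule allI)
   fix n
   have "(NP w. ?f n w) <= 3*(NP w. min (qvar H t s w) (ennreal (real n)))"
    using ito_local_isometry[OF I t, of "real n"] by simp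
   also have "... <= 3*(NP w. qvar H t s w)"
    by (intro mult_left_mono nn_integral_mono) auto
   finally show "(NP w. ?f n w) <= 3*(NP w. qvar H t s w)" .
  qed
 qed simp
 finally show ?thesis .
qed

lemma ito_square_integrable:
 assumes I: "itoint t H I" and t: "0 <= t" "t <= s"
  and fin: "(NP w. qvar H t s w) <= ennreal B" "0 <= B"
 shows "integrable P (%w. (I s w)^2)" "(LINT w|P. (I s w)^2) <= 3*B"
proof -
 have Im [measurable]: "I s : bm P" using cadapted_P[OF ito_integralD(2)[OF I] t(2)] .
 have "3*(NP w. qvar H t s w) <= 3*ennreal B" by (rule mult_left_mono[OF fin(1)]) simp
 also have "... = ennreal (3*B)" using fin(2) by (simp add: ennreal_mult)
 finally have le: "(NP w. ennreal ((I s w)^2)) <= ennreal (3*B)"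
  using ito_square_integral_le[OF I t] by (rule order_trans[rotated])
 hence "(NP w. ennreal ((I s w)^2)) < \<infinity>"
  using le_less_trans[OF le ennreal_less_top] by simp
 thus i: "integrable P (%w. (I s w)^2)"
  by (intro integrableI_nonneg) auto
 show "(LINT w|P. (I s w)^2) <= 3*B"
  using le fin(2) by (simp add: nn_integral_eq_integral[OF i])
qed

text \<open>Girsanov's theorem in integrated form.\<close>

lemma ito_girsanov:
 fixes a :: "real^'n"
 assumes I: "itoint t H I" and t: "0 <= t" "t <= s" "s <= T"
  and fin: "(NP w. qvar H t s w) <= ennreal B" "0 <= B"
 defines "R \<equiv> %w. I s w - (LBINT u:{t..s}. a \<bullet> H u w)"
 shows "R : bm P" "integrable P (%w. (R w)^2)"
  "(LINT w|P. (R w)^2) <= (2 + 2*(a \<bullet> a)*(s - t))*(2*B + 1)"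
  "(LINT w|P. stoch_exp a t T w*R w) = 0"
proof -
 note ID = ito_integralD[OF I]
 obtain m p xi where sp: "!!j. sproc t m p xi j"
  and D0: "AE w in M. (%j. qvar (%u w. sval m p xi j u w - H u w) t s w) ----> 0"
  and I0: "AE w in M. (%j. sitg m p xi j s w) ----> I s w"
  using ito_integral_approx[OF I t(1,2)] by blast
 let ?sv = "%j. sval m p xi j"
 let ?D = "%j. qvar (%u w. ?sv j u w - H u w) t s"
 let ?C = "(2 + 2*(a \<bullet> a)*(s - t))*(2*B + 1)"
 have Dm [measurable]: "?D j : bm P" for j by (rule qvar_diff_P[OF sp ID(1) t(1)])
 have Hm [measurable]: "qvar H t s : bm P" by (rule measurable_F_P[OF qvar_F[OF ID(1) t(1)]])
 have Im [measurable]: "I s : bm P" using cadapted_P[OF ID(2) t(2)] .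
 have aH: "pred t (%u w. a \<bullet> H u w)"
  using ID(1) unfolding predictable_alt by (intro borel_measurable_inner) auto
 have Km: "(%w. LBINT u:{t..s}. a \<bullet> H u w) : bm P"
  by (rule measurable_F_P[OF set_integral_F[OF aH t(1)]])
 show Rm [measurable]: "R : bm P" unfolding R_def using Im Km by (rule borel_measurable_diff)
 \<comment> \<open>For each level \<open>k\<close> an approximant far enough out is stopped at
   energy \<open>k\<close>. Far enough means that twice its error, truncated at \<open>k\<close>,
   has mean below 1; this bounds the mean of the truncated energy by \<open>2*B + 1\<close>,
   uniformly in \<open>k\<close>.\<close>
 have ex: "EX R'. R' : bm P & integrable P (%w. (R' w)^2) & (LINT w|P. (R' w)^2) <= ?C \<and>
   (LINT w|P. stoch_exp a t T w*R' w) = 0 \<and>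
   (EX j>=k. ALL w. qvar (?sv j) t s w <= ennreal (real k) -->
     R' w = sitg m p xi j s w - (LBINT u:{t..s}. a \<bullet> ?sv j u w))" for k :: nat
 proof -
  have "(%j. (NP w. min (2*?D j w) (ennreal (real k)))) ----> (NP w. 0)"
  proof (rule nn_integral_dominated_convergence[where w="%_. ennreal (real k)"])
   show "(NP x. ennreal (real k)) < \<infinity>" by (simp add: emeasure_space_1)
   show "AE w in P. (%j. min (2*?D j w) (ennreal (real k))) ----> 0"
    using AE_completion[OF D0]
   proof eventually_elim
    case (elim w)
    have "(%j. 2*?D j w) ----> 2*0" by (rule ennreal_tendsto_cmult[OF _ elim]) simp
    hence "(%j. min (2*?D j w) (ennreal (real k))) ----> min (2*0) (ennreal (real k))"
     by (intro tendsto_min tendsto_const)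
    thus ?case by simp
   qed
  qed auto
  hence "\<forall>\<^sub>F j in sequentially. (NP w. min (2*?D j w) (ennreal (real k))) < 1"
   by (intro order_tendstoD(2)) auto
  with eventually_ge_at_top[of k] have "\<forall>\<^sub>F j in sequentially. k <= j & (NP w. min (2*?D j w) (ennreal (real k))) < 1"
   by (rule eventually_conj)
  then obtain j where j: "k <= j" "(NP w. min (2*?D j w) (ennreal (real k))) < 1"
   by (auto simp: eventually_sequentially)
  obtain N K V where N: "N : bm P" "V : bm P" "!!a. K a : bm P"
   "!!w. 0 <= V w" "!!w. qvar (?sv j) t s w = ennreal (V w)"
   "!!w. V w <= real k ==> N w = sitg m p xi j s w"
   "!!a w. V w <= real k ==> K a w = (LBINT u:{t..s}. a \<bullet> ?sv j u w)"
   "integrable P (%w. (N w)^2)" "integrable P (%w. min (V w) (real k))"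
   "(LINT w|P. (N w)^2) <= (LINT w|P. min (V w) (real k))"
   "!!a w. (K a w)^2 <= (a \<bullet> a)*(s - t)*min (V w) (real k)"
   "!!a T. s <= T ==> (LINT w|P. stoch_exp a t T w*(N w - K a w)) = 0"
   by (rule stopped_simple[OF sp[of j] t(1,2) of_nat_0_le_iff[of k]]) (rule that, assumption+)
  note [measurable] = N(1,2,3)
  have EV: "(LINT w|P. min (V w) (real k)) <= 2*B + 1"
  proof -
   have "ennreal (LINT w|P. min (V w) (real k)) = (NP w. min (qvar (?sv j) t s w) (ennreal (real k)))"
    unfolding N(5) using N(4,9) by (simp add: nn_integral_eq_integral min_ennreal)
   also have "... <= (NP w. 2*qvar H t s w + min (2*?D j w) (ennreal (real k)))"
   proof (rule nn_integral_mono)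
    fix w assume "w : space P"
    hence "qvar (?sv j) t s w <= 2*qvar H t s w + 2*?D j w"
     by (intro qvar_simple_le[OF sp ID(1) t(1)]) simp
    hence "min (qvar (?sv j) t s w) (ennreal (real k)) <= min (2*qvar H t s w + 2*?D j w) (ennreal (real k))"
     by (rule min.mono) simp
    also have "... <= 2*qvar H t s w + min (2*?D j w) (ennreal (real k))" by (rule min_add_le_ennreal')
    finally show "min (qvar (?sv j) t s w) (ennreal (real k)) <= 2*qvar H t s w + min (2*?D j w) (ennreal (real k))" .
   qed
   also have "... = 2*(NP w. qvar H t s w)+(NP w. min (2*?D j w) (ennreal (real k)))"
    by (subst nn_integral_add) (auto simp: nn_integral_cmult)
   also have "... <= 2*ennreal B + 1"
    using fin j(2) by (intro add_mono mult_left_mono) auto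
   also have "... = ennreal (2*B + 1)"
    using fin(2) by (simp add: ennreal_mult)
   finally show ?thesis using fin(2) by (subst (asm) ennreal_le_iff) auto
  qed
  define R' where "R' w = N w - K a w" for w
  have [measurable]: "R' : bm P" unfolding R'_def by measurable
  let ?G = "%w. 2*(N w)^2 + 2*((a \<bullet> a)*(s - t)*min (V w) (real k))"
  have R'le: "(R' w)^2 <= ?G w" for w
  proof -
   have "(R' w)^2 <= 2*(N w)^2 + 2*(K a w)^2"
    unfolding R'_def using sum_squares_bound[of "N w" "- K a w"] by (simp add: power2_diff)
   also have "... <= ?G w" using N(11)[of a w] by simp
   finally show ?thesis .
  qed
  have Gi: "integrable P ?G" using N(8,9) by simp
  have R'i: "integrable P (%w. (R' w)^2)"
   by (rule Bochner_Integration.integrable_bound[OF Gi]) (use R'le order_trans[OF _ abs_ge_self] in auto)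
  have "(LINT w|P. (R' w)^2) <= (LINT w|P. ?G w)"
   by (rule integral_mono[OF R'i Gi R'le])
  also have "... = 2*(LINT w|P. (N w)^2)+2*((a \<bullet> a)*(s - t)*(LINT w|P. min (V w) (real k)))"
   using N(8,9) by simp
  also have "... <= 2*(2*B + 1)+2*((a \<bullet> a)*(s - t)*(2*B + 1))"
   using N(10) EV t by (intro add_mono mult_left_mono mult_nonneg_nonneg) auto
  also have "... = ?C" by (simp add: algebra_simps)
  finally have R'C: "(LINT w|P. (R' w)^2) <= ?C" .
  show ?thesis
  proof (intro exI[of _ R'] conjI exI[of _ j] allI impI R'C R'i j(1))
   show "(LINT w|P. stoch_exp a t T w*R' w) = 0" unfolding R'_def using N(12)[OF t(3)] .
   fix w assume "qvar (?sv j) t s w <= ennreal (real k)"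
   hence "V w <= real k" unfolding N(5) by (subst (asm) ennreal_le_iff) auto
   thus "R' w = sitg m p xi j s w - (LBINT u:{t..s}. a \<bullet> ?sv j u w)"
    unfolding R'_def using N(6,7) by simp
  qed simp
 qed
 from choice[OF allI[OF ex]] obtain R' where R'0: "ALL k. R' k : bm P & integrable P (%w. (R' k w)^2) & (LINT w|P. (R' k w)^2) <= ?C \<and>
   (LINT w|P. stoch_exp a t T w*R' k w) = 0 \<and>
   (EX j>=k. ALL w. qvar (?sv j) t s w <= ennreal (real k) -->
     R' k w = sitg m p xi j s w - (LBINT u:{t..s}. a \<bullet> ?sv j u w))" ..
 have R': "R' k : bm P" "integrable P (%w. (R' k w)^2)" "(LINT w|P. (R' k w)^2) <= ?C"
   "(LINT w|P. stoch_exp a t T w*R' k w) = 0"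
   "EX j. j >= k & (ALL w. qvar (?sv j) t s w <= ennreal (real k) -->
     R' k w = sitg m p xi j s w - (LBINT u:{t..s}. a \<bullet> ?sv j u w))" for k
  using R'0 by blast+
 from choice[OF allI[OF R'(5)]] obtain j where j0: "ALL k. j k >= k & (ALL w. qvar (?sv (j k)) t s w <= ennreal (real k) -->
     R' k w = simple_integral Z (m (j k)) (p (j k)) (xi (j k)) s w - (LBINT u:{t..s}. a \<bullet> ?sv (j k) u w))" ..
 have jlim: "filterlim j sequentially sequentially"
  using j0 by (intro filterlim_at_top_mono[OF filterlim_ident]) auto
 \<comment> \<open>Since \<open>j k >= k\<close>, the errors tend to zero along \<open>j\<close>;
   since the energy of the path is finite, the level \<open>k\<close> is eventually not reached.
   Then \<open>R' k\<close> is the unstopped expression, which converges to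
   \<open>R\<close>.\<close>
 have lim: "AE w in P. (%k. R' k w) ----> R w"
  using AE_completion[OF D0] AE_completion[OF I0] AE_completion[OF ID(3)] AE_space
 proof eventually_elim
  case (elim w)
  hence w: "w : space M" by simp
  have fin: "qvar H t s w < \<infinity>" using elim(3) t by auto
  have D: "(%k. ?D (j k) w) ----> 0" using elim(1) jlim by (rule filterlim_compose)
  have SI: "(%k. simple_integral Z (m (j k)) (p (j k)) (xi (j k)) s w) ----> I s w"
   using elim(2) jlim by (rule filterlim_compose)
  have Hb: "set_borel_measurable lborel {t..s} (%u. H u w)" by (rule predictable_set_borel[OF ID(1) t(1) w])
  have svb: "set_borel_measurable lborel {t..s} (%u. ?sv i u w)" for i
   unfolding set_borel_measurable_def simple_value_def by measurable
  have db: "set_borel_measurable lborel {t..s} (%u. ?sv i u w - H u w)" for i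
   using svb[of i] Hb unfolding set_borel_measurable_def scaleR_diff_right by (rule borel_measurable_diff)
  have Hi: "sint {t..s} (%u. a \<bullet> H u w)"
   by (rule path_drift_bound(1)[OF Hb t(2)]) (use fin in simp)
  have ev1: "\<forall>\<^sub>F k in sequentially. ?D (j k) w < 1" using D by (intro order_tendstoD(2)) auto
  have K: "(%k. LBINT u:{t..s}. a \<bullet> ?sv (j k) u w) ----> (LBINT u:{t..s}. a \<bullet> H u w)"
  proof -
   have "(%k. ennreal (((LBINT u:{t..s}. a \<bullet> ?sv (j k) u w) - (LBINT u:{t..s}. a \<bullet> H u w))^2)) ----> 0"
   proof (rule tendsto_sandwich[OF _ _ tendsto_const])
    show "\<forall>\<^sub>F k in sequentially. ennreal (((LBINT u:{t..s}. a \<bullet> ?sv (j k) u w) - (LBINT u:{t..s}. a \<bullet> H u w))^2)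
      <= ennreal ((a \<bullet> a)*(s - t))*?D (j k) w"
     using ev1
    proof eventually_elim
     case (elim k)
     have f: "(NS {t..s} (%u. ennreal ((norm (?sv (j k) u w - H u w))^2))) < \<infinity>"
      using elim by (rule less_trans) simp
     have si: "sint {t..s} (%u. a \<bullet> ?sv (j k) u w)"
     proof -
      have "sint {t..s} (%u. a \<bullet> (?sv (j k) u w - H u w)+a \<bullet> H u w)"
       by (intro set_integral_add Hi path_drift_bound(1)[OF db t(2) f])
      thus ?thesis by (simp add: inner_diff_right)
     qed
     have "(LBINT u:{t..s}. a \<bullet> ?sv (j k) u w) - (LBINT u:{t..s}. a \<bullet> H u w) = (LBINT u:{t..s}. a \<bullet> (?sv (j k) u w - H u w))"
      unfolding inner_diff_right by (rule set_integral_diff(2)[OF si Hi, symmetric])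
     thus ?case using path_drift_bound(2)[OF db t(2) f, of a] by simp
    qed
    have "(%k. ennreal ((a \<bullet> a)*(s - t))*?D (j k) w) ----> ennreal ((a \<bullet> a)*(s - t))*0"
     by (rule ennreal_tendsto_cmult[OF _ D]) simp
    thus "(%k. ennreal ((a \<bullet> a)*(s - t))*?D (j k) w) ----> 0" by simp
   qed simp
   hence "(%k. ((LBINT u:{t..s}. a \<bullet> ?sv (j k) u w) - (LBINT u:{t..s}. a \<bullet> H u w))^2) ----> 0"
    by (subst (asm) ennreal_tendsto_0_iff) auto
   hence "(%k. sqrt (((LBINT u:{t..s}. a \<bullet> ?sv (j k) u w) - (LBINT u:{t..s}. a \<bullet> H u w))^2)) ----> sqrt 0"
    by (rule tendsto_real_sqrt)
   thus ?thesis by (simp add: tendsto_rabs_zero_iff LIM_zero_iff)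
  qed
  have "\<forall>\<^sub>F k in sequentially. 2*qvar H t s w + 2 < ennreal (real k)"
  proof -
   have "2*qvar H t s w + 2 < top" using fin by (auto simp: ennreal_mult_less_top)
   from ennreal_Ex_less_of_nat[OF this] obtain n0 where n0: "2*qvar H t s w + 2 < of_nat n0" ..
   show ?thesis
    unfolding eventually_sequentially
   proof (intro exI[of _ n0] allI impI)
    fix n assume "n0 <= n"
    thus "2*qvar H t s w + 2 < ennreal (real n)"
     by (intro less_le_trans[OF n0[unfolded ennreal_of_nat_eq_real_of_nat] ennreal_leI]) simp
   qed
  qed
  with ev1 have "\<forall>\<^sub>F k in sequentially. simple_integral Z (m (j k)) (p (j k)) (xi (j k)) s w - (LBINT u:{t..s}. a \<bullet> ?sv (j k) u w) = R' k w"
  proof eventually_elim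
   case (elim k)
   have "qvar (?sv (j k)) t s w <= 2*qvar H t s w + 2*?D (j k) w"
    by (rule qvar_simple_le[OF sp ID(1) t(1) w])
   also have "... <= 2*qvar H t s w + 2*1"
    using elim by (intro add_left_mono mult_left_mono) auto
   also have "... <= ennreal (real k)" using elim by simp
   finally show ?case using j0 by simp
  qed
  thus ?case
   unfolding R_def by (rule Lim_transform_eventually[OF tendsto_diff[OF SI K]])
 qed
 show "integrable P (%w. (R w)^2)" "(LINT w|P. (R w)^2) <= ?C"
  using P.L2_bounded_AE_limit[OF R'(1) Rm R'(2,3) lim] by auto
 \<comment> \<open>The \<open>R' k\<close> are bounded in L2 and converge almost surely, which is
   enough against the square-integrable density.\<close>
 have "(%k. LINT w|P. stoch_exp a t T w*R' k w) ----> (LINT w|P. stoch_exp a t T w*R w)"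
  by (rule P.L2_bounded_weak_limit[OF R'(1) Rm _ R'(2,3) lim])
    (use t stoch_exp_square_integrable[of t T a] in auto)
 thus "(LINT w|P. stoch_exp a t T w*R w) = 0"
  unfolding R'(4) by (simp add: LIMSEQ_const_iff)
qed

section \<open>Linearity of the Ito integral\<close>

lemma ito_integral_lincomb:
 assumes I: "itoint t H I" and I': "itoint t H' I'" and t: "0 <= t"
 shows "itoint t (%s w. H s w + c *\<^sub>R H' s w) (%s w. I s w + c*I' s w)"
proof -
 note ID = ito_integralD[OF I] and ID' = ito_integralD[OF I']
 obtain m p xi where sp: "!!j. sproc t m p xi j"
  and v: "!!s. t <= s ==> vanish (%j. qvar (%u w. sval m p xi j u w - H u w) t s)"
   "!!s. t <= s ==> vanish (%j w. ennreal (abs (sitg m p xi j s w - I s w)))"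
  using I unfolding ito_integral_def by blast
 obtain m' p' xi' where sp': "!!j. simple_process M F t (m' j) (p' j) (xi' j)"
  and v': "!!s. t <= s ==> vanish (%j. qvar (%u w. simple_value (m' j) (p' j) (xi' j) u w - H' u w) t s)"
   "!!s. t <= s ==> vanish (%j w. ennreal (abs (simple_integral Z (m' j) (p' j) (xi' j) s w - I' s w)))"
  using I' unfolding ito_integral_def by blast
 have ex: "EX x. simple_process M F t (fst x) (fst (snd x)) (snd (snd x)) \<and>
  (ALL u w. simple_value (fst x) (fst (snd x)) (snd (snd x)) u w = sval m p xi j u w + c *\<^sub>R simple_value (m' j) (p' j) (xi' j) u w) \<and>
  (ALL s w. simple_integral Z (fst x) (fst (snd x)) (snd (snd x)) s w = sitg m p xi j s w + c * simple_integral Z (m' j) (p' j) (xi' j) s w)" for j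
 proof -
  obtain n q ze where "simple_process M F t n q ze"
   "!!u w. simple_value n q ze u w = sval m p xi j u w + c *\<^sub>R simple_value (m' j) (p' j) (xi' j) u w"
   "!!s w. simple_integral Z n q ze s w = sitg m p xi j s w + c * simple_integral Z (m' j) (p' j) (xi' j) s w"
   using simple_lincomb[OF sp[of j] sp'[of j]] by blast
  thus ?thesis by (intro exI[of _ "(n, q, ze)"]) simp
 qed
 from choice[OF allI[OF ex]] obtain x where x0: "ALL j. simple_process M F t (fst (x j)) (fst (snd (x j))) (snd (snd (x j))) \<and>
  (ALL u w. simple_value (fst (x j)) (fst (snd (x j))) (snd (snd (x j))) u w = sval m p xi j u w + c *\<^sub>R simple_value (m' j) (p' j) (xi' j) u w) \<and>
  (ALL s w. simple_integral Z (fst (x j)) (fst (snd (x j))) (snd (snd (x j))) s w = sitg m p xi j s w + c * simple_integral Z (m' j) (p' j) (xi' j) s w)" ..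
 define n q ze where "n j = fst (x j)" and "q j = fst (snd (x j))" and "ze j = snd (snd (x j))" for j
 have sq: "sproc t n q ze j"
  and sqv: "sval n q ze j u w = sval m p xi j u w + c *\<^sub>R simple_value (m' j) (p' j) (xi' j) u w"
  and sqi: "sitg n q ze j s w = sitg m p xi j s w + c * simple_integral Z (m' j) (p' j) (xi' j) s w" for j u s w
  using x0 unfolding n_def q_def ze_def by blast+
 have pr: "pred t (%s w. H s w + c *\<^sub>R H' s w)"
  using ID(1) ID'(1) unfolding predictable_alt by (intro borel_measurable_add borel_measurable_scaleR) auto
 have c2: "0 < 2 + 2*c^2" by (simp add: add_pos_nonneg)
 show ?thesis
  unfolding ito_integral_def
 proof (intro conjI)
  show "AE w in M. ALL s>=t. qvar (%s w. H s w + c *\<^sub>R H' s w) t s w < \<infinity>"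
   using ID(3) ID'(3) AE_space
  proof eventually_elim
   case (elim w)
   show ?case
   proof (intro allI impI)
    fix s assume s: "t <= s"
    have "qvar (%s w. H s w + c *\<^sub>R H' s w) t s w <= ennreal (2 + 2*c^2)*(qvar H t s w + qvar H' t s w)"
     by (intro path_qvar_add predictable_set_borel[OF ID(1) t elim(3)] predictable_set_borel[OF ID'(1) t elim(3)])
    also have "... < \<infinity>" using elim s by (auto simp: ennreal_mult_less_top)
    finally show "qvar (%s w. H s w + c *\<^sub>R H' s w) t s w < \<infinity>" .
   qed
  qed
  show "cadapted t (%s w. I s w + c*I' s w)"
   using ID(2) ID'(2) unfolding continuous_adapted_def
   by (auto intro!: continuous_intros borel_measurable_add borel_measurable_times)
  show "EX m p xi. (ALL j. sproc t m p xi j) \<and>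
    (ALL s>=t. vanish (%j. qvar (%u w. sval m p xi j u w - (H u w + c *\<^sub>R H' u w)) t s) \<and>
      vanish (%j w. ennreal (abs (sitg m p xi j s w - (I s w + c*I' s w)))))"
  proof (intro exI[of _ n] exI[of _ q] exI[of _ ze] conjI allI impI sq)
   fix s assume s: "t <= s"
   note m1 = qvar_diff_P[OF sp ID(1) t, of _ s] and m2 = qvar_diff_P[OF sp' ID'(1) t, of _ s]
   show "vanish (%j. qvar (%u w. sval n q ze j u w - (H u w + c *\<^sub>R H' u w)) t s)"
   proof (rule vanish_le[OF borel_measurable_add[OF m1 m2] qvar_diff_P[OF sq pr t] _ c2 vanish_add[OF m1 m2 v(1)[OF s] v'(1)[OF s]]])
    fix j w assume w: "w : space M"
    have b: "set_borel_measurable lborel {t..s} (%u. sval m p xi j u w - H u w)"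
     "set_borel_measurable lborel {t..s} (%u. simple_value (m' j) (p' j) (xi' j) u w - H' u w)"
     using simple_set_borel[of t s "m j" "p j" "xi j" w] simple_set_borel[of t s "m' j" "p' j" "xi' j" w]
      predictable_set_borel[OF ID(1) t w, of s] predictable_set_borel[OF ID'(1) t w, of s]
     unfolding set_borel_measurable_def scaleR_diff_right by (auto intro: borel_measurable_diff)
    have "sval n q ze j u w - (H u w + c *\<^sub>R H' u w) =
     (sval m p xi j u w - H u w)+c *\<^sub>R (simple_value (m' j) (p' j) (xi' j) u w - H' u w)" for u
     unfolding sqv by (simp add: algebra_simps)
    thus "qvar (%u w. sval n q ze j u w - (H u w + c *\<^sub>R H' u w)) t s w
     <= ennreal (2 + 2*c^2)*(qvar (%u w. sval m p xi j u w - H u w) t s w + qvar (%u w. simple_value (m' j) (p' j) (xi' j) u w - H' u w) t s w)"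
     using path_qvar_add[OF b, of c] by (simp only:)
   qed
   have [measurable]: "I s : bm P" "I' s : bm P"
    "sitg m p xi j s : bm P"
    "simple_integral Z (m' j) (p' j) (xi' j) s : bm P"
    "sitg n q ze j s : bm P" for j
    using cadapted_P[OF ID(2) s] cadapted_P[OF ID'(2) s] simple_integral_P[OF sp t s]
     simple_integral_P[OF sp' t s] simple_integral_P[OF sq t s] by auto
   have e: "(%w. ennreal (abs (sitg m p xi j s w - I s w))) : bm P"
    "(%w. ennreal (abs (simple_integral Z (m' j) (p' j) (xi' j) s w - I' s w))) : bm P"
    "(%w. ennreal (abs (sitg n q ze j s w - (I s w + c*I' s w)))) : bm P" for j
    by measurable
   show "vanish (%j w. ennreal (abs (sitg n q ze j s w - (I s w + c*I' s w))))"
   proof (rule vanish_le[where C="1 + abs c", OF borel_measurable_add[OF e(1,2)] e(3) _ _ vanish_add[OF e(1,2) v(2)[OF s] v'(2)[OF s]]])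
    show "0 < 1 + abs c" by (simp add: add_pos_nonneg)
    fix j w
    let ?x = "sitg m p xi j s w - I s w" and ?y = "simple_integral Z (m' j) (p' j) (xi' j) s w - I' s w"
    have "sitg n q ze j s w - (I s w + c*I' s w) = ?x + c*?y"
     unfolding sqi by (simp add: algebra_simps)
    also have "abs (...) <= abs (?x)+abs c*abs (?y)" using abs_triangle_ineq[of ?x "c*?y"] by (simp add: abs_mult)
    also have "... <= (1 + abs c)*(abs (?x)+abs (?y))" by (simp add: algebra_simps)
    finally show "ennreal (abs (sitg n q ze j s w - (I s w + c*I' s w)))
     <= ennreal (1 + abs c)*(ennreal (abs (?x))+ennreal (abs (?y)))"
     by (simp add: ennreal_mult[symmetric] ennreal_plus[symmetric] ennreal_leI del: ennreal_plus)
   qed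
  qed
 qed (rule pr)
qed

end

section \<open>Absolutely continuous functions\<close>

lemma continuous_Icc_bounded:
 fixes c :: "real => real"
 assumes "continuous_on {t..s} c"
 obtains B where "0 <= B" "!!u. u : {t..s} ==> abs (c u) <= B"
proof -
 have "bounded (c ` {t..s})" by (intro compact_imp_bounded compact_continuous_image assms) simp
 then obtain B where "ALL x:c ` {t..s}. norm x <= B" unfolding bounded_iff ..
 thus thesis by (intro that[of "max B 0"]) (auto simp: le_max_iff_disj)
qed

lemma set_integrable_continuous_mult:
 fixes c w :: "real => real"
 assumes "continuous_on {t..s} c" "sint {t..s} w"
 shows "sint {t..s} (%u. c u*w u)"
proof -
 obtain B where B: "!!u. u : {t..s} ==> abs (c u) <= B" by (rule continuous_Icc_bounded[OF assms(1)]) blast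
 have m: "set_borel_measurable lborel {t..s} c"
  using borel_measurable_continuous_on_indicator[OF _ assms(1)] by (simp add: set_borel_measurable_def)
 show ?thesis
  unfolding set_integrable_def
 proof (rule Bochner_Integration.integrable_bound[where f="%u. B*(ind {t..s} u *\<^sub>R w u)"])
  show "integrable lborel (%u. B*(ind {t..s} u *\<^sub>R w u))"
   using assms(2) by (simp add: set_integrable_def)
  have "(%u. (ind {t..s} u *\<^sub>R c u)*(ind {t..s} u *\<^sub>R w u)) : bm lborel"
   using m assms(2) by (intro borel_measurable_times) (auto simp: set_borel_measurable_def set_integrable_def)
  thus "(%u. ind {t..s} u *\<^sub>R (c u*w u)) : bm lborel"
   by (rule measurable_eqI) (auto simp: indicator_def)
  show "AE u in lborel. norm (ind {t..s} u *\<^sub>R (c u*w u)) <= norm (B*(ind {t..s} u *\<^sub>R w u))"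
  proof (rule AE_I2)
   fix u
   have "u : {t..s} ==> abs (c u)*abs (w u) <= abs B*abs (w u)"
    using B[of u] by (intro mult_right_mono) auto
   thus "norm (ind {t..s} u *\<^sub>R (c u*w u)) <= norm (B*(ind {t..s} u *\<^sub>R w u))"
    by (auto simp: indicator_def abs_mult)
  qed
 qed
qed

lemma set_integral_split_at:
 fixes w :: "real => real"
 assumes "sint {a..c} w" "a <= b" "b <= c"
 shows "(LBINT u:{a..c}. w u) = (LBINT u:{a..b}. w u)+(LBINT u:{b..c}. w u)"
  "sint {a..b} w" "sint {b..c} w"
proof -
 show i: "sint {a..b} w" "sint {b..c} w"
  by (rule set_integrable_subset[OF assms(1)]; use assms in auto)+
 have i': "sint {b<..c} w"
  by (rule set_integrable_subset[OF i(2)]) auto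
 have "{a..c} = {a..b} \<union> {b<..c}" using assms by auto
 hence "(LBINT u:{a..c}. w u) = (LBINT u:{a..b}. w u)+(LBINT u:{b<..c}. w u)"
  using set_integral_Un[OF _ i(1) i'] by (simp add: ivl_disj_int)
 also have "(LBINT u:{b<..c}. w u) = (LBINT u:{b..c}. w u)"
  unfolding sli_def
 proof (rule integral_cong_AE)
  show "AE u in lborel. ind {b<..c} u *\<^sub>R w u = ind {b..c} u *\<^sub>R w u"
   using AE_lborel_singleton[of b] by eventually_elim (auto simp: indicator_def)
 qed (use i i' in "auto simp: set_integrable_def")
 finally show "(LBINT u:{a..c}. w u) = (LBINT u:{a..b}. w u)+(LBINT u:{b..c}. w u)" .
qed

lemma set_integral_sum_intervals:
 fixes w :: "real => real"
 assumes "!!i. i < m ==> q i <= q (Suc i)" "sint {q 0..q m} w"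
 shows "(LBINT u:{q 0..q m}. w u) = (\<Sum>i<m. LBINT u:{q i..q (Suc i)}. w u)"
 using assms
proof (induction m)
 case 0
 have "(LBINT u:{q 0..q 0}. w u) = 0"
  unfolding sli_def
 proof (rule integral_eq_zero_AE)
  show "AE u in lborel. ind {q 0..q 0} u *\<^sub>R w u = 0"
   using AE_lborel_singleton[of "q 0"] by eventually_elim (auto simp: indicator_def)
 qed
 thus ?case by simp
next
 case (Suc m)
 have "q 0 <= q m" "q m <= q (Suc m)" using mono_le_upto[of m q 0 m] Suc.prems by auto
 from set_integral_split_at[OF Suc.prems(2) this] Suc show ?case by simp
qed

text \<open>Riemann-Stieltjes sums against the indefinite integral of \<open>w\<close>: the error is
  the oscillation of \<open>c\<close> on a cell times the total variation. Sample points are free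
  because both ends of the cells are used later.\<close>

lemma riemann_sum_bound:
 fixes c w :: "real => real"
 assumes q: "!!i. i < m ==> q i <= q (Suc i)" and w: "sint {q 0..q m} w"
  and c: "continuous_on {q 0..q m} c" and tau: "!!i. i < m ==> tau i : {q i..q (Suc i)}"
  and e: "!!u v. u : {q 0..q m} ==> v : {q 0..q m} ==> abs (u - v) <= delta ==> abs (c u - c v) <= e"
  and delta: "!!i. i < m ==> q (Suc i) - q i <= delta"
 shows "abs ((\<Sum>i<m. c (tau i)*(LBINT u:{q i..q (Suc i)}. w u)) - (LBINT u:{q 0..q m}. c u*w u))
  <= e*(LBINT u:{q 0..q m}. abs (w u))"
proof -
 have qq: "q 0 <= q i" "q i <= q m" if "i <= m" for i
  using mono_le_upto[of m q 0 i] mono_le_upto[of m q i m] q that by auto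
 have sub: "{q i..q (Suc i)} \<subseteq> {q 0..q m}" if "i < m" for i using qq[of i] qq[of "Suc i"] that by auto
 have cw: "sint {q 0..q m} (%u. c u*w u)" by (rule set_integrable_continuous_mult[OF c w])
 have wa: "sint {q 0..q m} (%u. abs (w u))" using set_integrable_abs[OF w] .
 have wi: "sint {q i..q (Suc i)} w" "sint {q i..q (Suc i)} (%u. c u*w u)"
   "sint {q i..q (Suc i)} (%u. abs (w u))" if "i < m" for i
  using set_integrable_subset[OF w _ sub[OF that]] set_integrable_subset[OF cw _ sub[OF that]] set_integrable_subset[OF wa _ sub[OF that]] by auto
 have step: "abs (c (tau i)*(LBINT u:{q i..q (Suc i)}. w u) - (LBINT u:{q i..q (Suc i)}. c u*w u))
   <= e*(LBINT u:{q i..q (Suc i)}. abs (w u))" if i: "i < m" for i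
 proof -
  have "c (tau i)*(LBINT u:{q i..q (Suc i)}. w u) - (LBINT u:{q i..q (Suc i)}. c u*w u)
   = (LBINT u:{q i..q (Suc i)}. c (tau i)*w u - c u*w u)"
   using wi[OF i] by (subst set_integral_diff(2)) auto
  also have "abs (...) <= (LBINT u:{q i..q (Suc i)}. abs (c (tau i)*w u - c u*w u))"
   unfolding sli_def
   by (rule order_trans[OF integral_abs_bound]) (auto intro!: order_eq_refl Bochner_Integration.integral_cong simp: indicator_def)
  also have "... <= (LBINT u:{q i..q (Suc i)}. e*abs (w u))"
  proof (rule set_integral_mono)
   show "sint {q i..q (Suc i)} (%u. abs (c (tau i)*w u - c u*w u))"
    using wi[OF i] by (intro set_integrable_abs set_integral_diff(1)) auto
   show "sint {q i..q (Suc i)} (%u. e*abs (w u))" using wi[OF i] by auto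
   fix u assume u: "u : {q i..q (Suc i)}"
   have "abs (c (tau i) - c u) <= e"
    by (rule e) (use sub[OF i] u tau[OF i] delta[OF i] in auto)
   hence "abs (c (tau i) - c u)*abs (w u) <= e*abs (w u)" by (rule mult_right_mono) simp
   thus "abs (c (tau i)*w u - c u*w u) <= e*abs (w u)"
    by (simp add: abs_mult[symmetric] left_diff_distrib)
  qed
  finally show ?thesis by simp
 qed
 have "(LBINT u:{q 0..q m}. c u*w u) = (\<Sum>i<m. LBINT u:{q i..q (Suc i)}. c u*w u)"
  by (rule set_integral_sum_intervals[OF q cw])
 hence "abs ((\<Sum>i<m. c (tau i)*(LBINT u:{q i..q (Suc i)}. w u)) - (LBINT u:{q 0..q m}. c u*w u))
  = abs (\<Sum>i<m. c (tau i)*(LBINT u:{q i..q (Suc i)}. w u) - (LBINT u:{q i..q (Suc i)}. c u*w u))"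
  by (simp add: sum_subtractf)
 also have "... <= (\<Sum>i<m. e*(LBINT u:{q i..q (Suc i)}. abs (w u)))"
  by (rule order_trans[OF sum_abs sum_mono]) (use step in auto)
 also have "... = e*(LBINT u:{q 0..q m}. abs (w u))"
  using set_integral_sum_intervals[OF q wa] by (simp add: sum_distrib_left)
 finally show ?thesis .
qed

lemma compact_uniform_mod:
 fixes c :: "real => real"
 assumes "continuous_on {t..s} c" "0 < e"
 obtains delta where "0 < delta" "!!u v. u : {t..s} ==> v : {t..s} ==> abs (u - v) <= delta ==> abs (c u - c v) <= e"
proof -
 have "uniformly_continuous_on {t..s} c" by (rule compact_uniformly_continuous[OF assms(1)]) simp
 from this[unfolded uniformly_continuous_on_def, THEN spec, THEN mp, OF assms(2)]
 obtain d where d0: "0 < d" and d1: "ALL x:{t..s}. ALL x':{t..s}. dist x' x < d --> dist (c x') (c x) < e" by blast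
 have d: "0 < d" "!!u v. u : {t..s} ==> v : {t..s} ==> dist v u < d ==> dist (c v) (c u) < e"
  using d0 d1 by blast+
 show thesis
 proof (rule that[of "d/2"])
  fix u v assume uv: "u : {t..s}" "v : {t..s}" "abs (u - v) <= d/2"
  hence "dist u v < d" using d(1) by (simp add: dist_real_def)
  from d(2)[OF uv(2,1) this] show "abs (c u - c v) <= e" by (simp add: dist_real_def)
 qed (use d in auto)
qed

text \<open>\<open>f\<close> is an indefinite Lebesgue integral of \<open>f'\<close> from
  \<open>t\<close> on. As \<open>f'\<close> is a density and not a derivative, it may jump at the
  retirement date.\<close>

definition abs_cont :: "real => (real => real) => (real => real) => bool" where
 "abs_cont t f f' \<longleftrightarrow> (ALL s>=t. sint {t..s} f' & f s = f t + (LBINT u:{t..s}. f' u))"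

lemma abs_contD:
 assumes "abs_cont t f f'" "t <= s"
 shows "sint {t..s} f'" "f s = f t + (LBINT u:{t..s}. f' u)"
 using assms unfolding abs_cont_def by blast+

lemma abs_cont_shift:
 assumes "abs_cont t f f'" "t <= a"
 shows "abs_cont a f f'"
 unfolding abs_cont_def
proof (intro allI impI)
 fix s assume s: "a <= s"
 have i: "sint {t..s} f'" by (rule abs_contD(1)[OF assms(1)]) (use assms s in auto)
 from set_integral_split_at[OF i assms(2) s] abs_contD(2)[OF assms(1), of s] abs_contD(2)[OF assms] assms(2) s
 show "sint {a..s} f' & f s = f a + (LBINT u:{a..s}. f' u)" by simp
qed

lemma abs_cont_diff:
 assumes "abs_cont t f f'" "t <= a" "a <= s"
 shows "f s - f a = (LBINT u:{a..s}. f' u)"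
 using abs_contD(2)[OF abs_cont_shift[OF assms(1,2)] assms(3)] by simp

lemma abs_cont_continuous:
 assumes f: "abs_cont t f f'"
 shows "continuous_on {t..} f"
proof -
 have "continuous_on {t..s} f" for s
 proof (cases "t <= s")
  case True
  have i: "sint {t..s} f'" using abs_contD(1)[OF f True] .
  hence hk: "f' integrable_on {t..s}" by (rule set_borel_integral_eq_integral)
  have "continuous_on {t..s} (%x. f t + integral {t..x} f')"
   by (intro continuous_on_add continuous_on_const indefinite_integral_continuous_1 hk)
  moreover have "f x = f t + integral {t..x} f'" if "x : {t..s}" for x
  proof -
   have x: "t <= x" using that by simp
   show ?thesis
    unfolding abs_contD(2)[OF f x] set_borel_integral_eq_integral(2)[OF abs_contD(1)[OF f x]] ..
  qed
  ultimately show ?thesis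
   by (subst continuous_on_cong[OF refl, of _ f "%x. f t + integral {t..x} f'"]) 
 qed simp
 hence c: "continuous_on {t..s} f" for s .
 show ?thesis
 proof (rule continuous_on_eq_continuous_within[THEN iffD2], rule ballI)
  fix x assume x: "x : {t..}"
  have "continuous (at x within {t..x+1}) f" using c[of "x + 1"] x by (auto simp: continuous_on_eq_continuous_within)
  moreover have "at x within {t..x+1} = at x within {t..}"
   by (rule at_within_nhd[of _ "{x-1<..<x+1}"]) auto
  ultimately show "continuous (at x within {t..}) f" by simp
 qed
qed

lemma abs_cont_add:
 assumes "abs_cont t f f'" "abs_cont t g g'"
 shows "abs_cont t (%u. f u + g u) (%u. f' u + g' u)"
 unfolding abs_cont_def
proof (intro allI impI)
 fix s assume s: "t <= s"
 show "sint {t..s} (%u. f' u + g' u) & f s + g s = f t + g t + (LBINT u:{t..s}. f' u + g' u)"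
  using abs_contD[OF assms(1) s] abs_contD[OF assms(2) s] by (simp only: set_integral_add) simp
qed

lemma abs_cont_cmult:
 assumes "abs_cont t f f'"
 shows "abs_cont t (%u. c*f u) (%u. c*f' u)"
 unfolding abs_cont_def
proof (intro allI impI)
 fix s assume s: "t <= s"
 have "c*f s = c*f t + c*(LBINT u:{t..s}. f' u)"
  unfolding abs_contD(2)[OF assms s] by (simp add: distrib_left)
 thus "sint {t..s} (%u. c*f' u) & c*f s = c*f t + (LBINT u:{t..s}. c*f' u)"
  using abs_contD(1)[OF assms s] by simp
qed

lemma abs_cont_const: "abs_cont t (%u. c) (%u. 0)"
 by (simp add: abs_cont_def set_integrable_def sli_def)

lemma abs_cont_cong:
 assumes "abs_cont t f f'" "!!u. t <= u ==> f u = g u" "!!u. t <= u ==> f' u = g' u"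
 shows "abs_cont t g g'"
 unfolding abs_cont_def
proof (intro allI impI)
 fix s assume s: "t <= s"
 have "sint {t..s} f' = sint {t..s} g'"
  by (rule set_integrable_cong) (use assms(3) in auto)
 moreover have "(LBINT u:{t..s}. f' u) = (LBINT u:{t..s}. g' u)"
  by (rule set_lebesgue_integral_cong) (use assms(3) in auto)
 ultimately show "sint {t..s} g' & g s = g t + (LBINT u:{t..s}. g' u)"
  using abs_contD[OF assms(1) s] assms(2)[OF s] assms(2)[of t] by simp
qed

lemma abs_cont_C1:
 assumes "!!u. t <= u ==> (f has_real_derivative f' u) (at u)" "continuous_on {t..} f'"
 shows "abs_cont t f f'"
 unfolding abs_cont_def
proof (intro allI impI)
 fix s assume s: "t <= s"
 have c: "continuous_on {t..s} f'" using assms(2) by (rule continuous_on_subset) auto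
 have d: "(f has_vector_derivative f' x) (at x within {t..s})" if "x : {t..s}" for x
  using assms(1)[of x] that by (auto simp: has_real_derivative_iff_has_vector_derivative intro: has_vector_derivative_at_within)
 show "sint {t..s} f' & f s = f t + (LBINT u:{t..s}. f' u)"
  using integral_FTC_atLeastAtMost[OF s d c] borel_integrable_compact[OF _ c] by (auto simp: set_integrable_def sli_def)
qed

text \<open>Summation by parts is exact on every grid if one factor is sampled at the right ends and
  the other at the left ends; both Riemann sums converge to their integrals.\<close>

lemma abs_cont_mult:
 assumes f: "abs_cont t f f'" and g: "abs_cont t g g'"
 shows "abs_cont t (%u. f u*g u) (%u. f' u*g u + f u*g' u)"
 unfolding abs_cont_def
proof (intro allI impI)
 fix s assume s: "t <= s"
 have cf: "continuous_on {t..s} f" and cg: "continuous_on {t..s} g"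
  using abs_cont_continuous[OF f] abs_cont_continuous[OF g] by (auto elim: continuous_on_subset)
 note fi = abs_contD(1)[OF f s] and gi = abs_contD(1)[OF g s]
 have i1: "sint {t..s} (%u. f' u*g u)"
  using set_integrable_continuous_mult[OF cg fi] by (simp add: mult.commute)
 have i2: "sint {t..s} (%u. f u*g' u)" by (rule set_integrable_continuous_mult[OF cf gi])
 let ?D = "f s*g s - f t*g t - (LBINT u:{t..s}. g u*f' u) - (LBINT u:{t..s}. f u*g' u)"
 have *: "abs (?D) <= 0 + e" if e0: "0 < e" for e
 proof -
  define C where "C = (LBINT u:{t..s}. abs (f' u))+(LBINT u:{t..s}. abs (g' u))+1"
  have C: "0 <= (LBINT u:{t..s}. abs (f' u))" "0 <= (LBINT u:{t..s}. abs (g' u))"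
   by (auto simp: sli_def intro!: integral_nonneg_AE)
  hence C0: "0 < C" by (simp add: C_def)
  define e' where "e' = e/C"
  have e': "0 < e'" using e0 C0 by (simp add: e'_def)
  obtain d1 where d1: "0 < d1" "!!u v. u : {t..s} ==> v : {t..s} ==> abs (u - v) <= d1 ==> abs (f u - f v) <= e'"
   using compact_uniform_mod[OF cf e'] by blast
  obtain d2 where d2: "0 < d2" "!!u v. u : {t..s} ==> v : {t..s} ==> abs (u - v) <= d2 ==> abs (g u - g v) <= e'"
   using compact_uniform_mod[OF cg e'] by blast
  define delta where "delta = min d1 d2"
  have delta: "0 < delta" using d1 d2 by (simp add: delta_def)
  obtain m :: nat where m: "(s - t) / delta < real m" using reals_Archimedean2 by blast
  have "0 <= (s - t) / delta" using s delta by simp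
  hence m0: "0 < real m" using m by simp
  define q where "q i = t + (s - t)*real i/real m" for i
  have q0: "q 0 = t" and qm: "q m = s" using m0 by (auto simp: q_def)
  have qd: "q (Suc i) - q i = (s - t)/real m" for i using m0 by (simp add: q_def field_simps)
  have "0 <= (s - t)/real m" using s m0 by simp
  hence qs: "q i <= q (Suc i)" for i using qd[of i] by linarith
  have qdelta: "q (Suc i) - q i <= delta" for i unfolding qd using m m0 delta by (simp add: field_simps)
  have qt: "t <= q i" for i using s m0 by (simp add: q_def)
  have df: "(LBINT u:{q i..q (Suc i)}. f' u) = f (q (Suc i)) - f (q i)" "(LBINT u:{q i..q (Suc i)}. g' u) = g (q (Suc i)) - g (q i)" for i
   using abs_cont_diff[OF f qt qs] abs_cont_diff[OF g qt qs] by simp_all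
  have 1: "abs ((\<Sum>i<m. g (q (Suc i))*(f (q (Suc i)) - f (q i))) - (LBINT u:{t..s}. g u*f' u)) <= e'*(LBINT u:{t..s}. abs (f' u))"
   using riemann_sum_bound[of m q f' g "%i. q (Suc i)" delta e'] qs qdelta fi cg d2(2)
   unfolding df q0 qm by (auto simp: delta_def)
  have 2: "abs ((\<Sum>i<m. f (q i)*(g (q (Suc i)) - g (q i))) - (LBINT u:{t..s}. f u*g' u)) <= e'*(LBINT u:{t..s}. abs (g' u))"
   using riemann_sum_bound[of m q g' f "%i. q i" delta e'] qs qdelta gi cf d1(2)
   unfolding df q0 qm by (auto simp: delta_def)
  have 3: "(\<Sum>i<m. g (q (Suc i))*(f (q (Suc i)) - f (q i)))+(\<Sum>i<m. f (q i)*(g (q (Suc i)) - g (q i))) = f s*g s - f t*g t"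
  proof -
   have "(\<Sum>i<m. g (q (Suc i))*(f (q (Suc i)) - f (q i)))+(\<Sum>i<m. f (q i)*(g (q (Suc i)) - g (q i)))
    = (\<Sum>i<m. f (q (Suc i))*g (q (Suc i)) - f (q i)*g (q i))"
    unfolding sum.distrib[symmetric] by (intro sum.cong) (auto simp: algebra_simps)
   also have "... = f (q m)*g (q m) - f (q 0)*g (q 0)" by (rule sum_lessThan_telescope)
   finally show ?thesis unfolding q0 qm .
  qed
  have "abs (?D) <= e'*(LBINT u:{t..s}. abs (f' u))+e'*(LBINT u:{t..s}. abs (g' u))"
   using abs_triangle_ineq[of "(LBINT u:{t..s}. g u*f' u) - (\<Sum>i<m. g (q (Suc i))*(f (q (Suc i)) - f (q i)))"
     "(LBINT u:{t..s}. f u*g' u) - (\<Sum>i<m. f (q i)*(g (q (Suc i)) - g (q i)))"] 1 2 3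
   by argo
  also have "... <= e'*C" unfolding C_def using e' by (simp add: algebra_simps)
  also have "... = e" using C0 by (simp add: e'_def)
  finally show ?thesis by simp
 qed
 have "abs (?D) <= 0" by (rule field_le_epsilon) (rule *)
 hence "?D = 0" by simp
 thus "sint {t..s} (%u. f' u*g u + f u*g' u) \<and>
   f s*g s = f t*g t + (LBINT u:{t..s}. f' u*g u + f u*g' u)"
  using i1 i2 by (simp add: set_integral_add mult.commute)
qed

lemma abs_cont_exp: "abs_cont t (%u. exp (c*(u - a))) (%u. c*exp (c*(u - a)))"
 by (rule abs_cont_C1) (auto intro!: derivative_eq_intros continuous_intros)

section \<open>Products of stochastic exponentials with absolutely continuous processes\<close>

context brownian
begin

text \<open>Cross terms vanish because each \<open>g i\<close> of its increment has mean zero and is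
  independent of everything before, so the variances add up.\<close>

lemma orthogonal_sum:
 fixes T :: "nat => 'a => real" and g :: "nat => real^'n => real"
 assumes q: "0 <= q 0" "!!i. i < m ==> q i <= q (Suc i)"
  and T: "!!i. i < m ==> T i : bm (F (q i))" "!!i w. i < m ==> abs (T i w) <= R"
  and g: "!!i. i < m ==> g i : bm borel"
   "!!i. i < m ==> integrable P (%w. g i (Z (q (Suc i)) w - Z (q i) w))"
   "!!i. i < m ==> (LINT w|P. g i (Z (q (Suc i)) w - Z (q i) w)) = 0"
   "!!i. i < m ==> integrable P (%w. (g i (Z (q (Suc i)) w - Z (q i) w))^2)"
   "!!i. i < m ==> (LINT w|P. (g i (Z (q (Suc i)) w - Z (q i) w))^2) <= c i"
 defines "S \<equiv> %k w. \<Sum>i<k. T i w*g i (Z (q (Suc i)) w - Z (q i) w)"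
 shows "0 <= q m & S m : bm (F (q m)) & integrable P (%w. (S m w)^2) \<and>
  (LINT w|P. (S m w)^2) <= R^2*(\<Sum>i<m. c i)"
 using q T g
proof (induction m)
 case 0
 thus ?case by (simp add: S_def)
next
 case (Suc m)
 have IH: "0 <= q m" "S m : bm (F (q m))" "integrable P (%w. (S m w)^2)"
  "(LINT w|P. (S m w)^2) <= R^2*(\<Sum>i<m. c i)"
  using Suc by (auto simp: less_Suc_eq)
 have qm: "q m <= q (Suc m)" using Suc.prems by auto
 let ?D = "%w. Z (q (Suc m)) w - Z (q m) w"
 have Tm: "T m : bm (F (q m))" "!!w. abs (T m w) <= R" using Suc.prems by auto
 have gm: "g m : bm borel" "integrable P (%w. g m (?D w))" "(LINT w|P. g m (?D w)) = 0"
  "integrable P (%w. (g m (?D w))^2)" "(LINT w|P. (g m (?D w))^2) <= c m" using Suc.prems by auto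
 have g2: "(%x. (g m x)^2) : bm borel" using gm(1) by measurable
 have SP: "S m : bm P" using IH(2) by (rule measurable_F_P)
 have Si: "integrable P (S m)" by (rule P.square_integrable_imp_integrable[OF SP IH(3)])
 have STF: "(%w. S m w*T m w) : bm (F (q m))" by (rule borel_measurable_times[OF IH(2) Tm(1)])
 have STi: "integrable P (%w. S m w*T m w)"
  by (rule bounded_mult_integrable[OF measurable_F_P[OF Tm(1)] Tm(2) Si])
 have T2F: "(%w. (T m w)^2) : bm (F (q m))" using Tm(1) by measurable
 have T2le: "(T m w)^2 <= R^2" for w
  using power_mono[OF Tm(2)[of w], of 2] by simp
 have T2i: "integrable P (%w. (T m w)^2)"
  by (rule bounded_integrable[OF T2F, of "R^2"]) (use T2le in auto)
 note i1 = indep_expectation'[OF IH(1) qm STF STi gm(1,2)] and i2 = indep_expectation'[OF IH(1) qm T2F T2i g2 gm(4)]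
 have eq: "S (Suc m) = (%w. S m w + T m w*g m (?D w))" by (simp add: S_def fun_eq_iff)
 have sq: "(S (Suc m) w)^2 = (S m w)^2 + 2*(S m w*T m w*g m (?D w))+(T m w)^2*(g m (?D w))^2" for w
  unfolding eq by (simp add: power2_sum power_mult_distrib)
 have "S (Suc m) : bm (F (q (Suc m)))"
  unfolding eq
  by (intro borel_measurable_add borel_measurable_times measurable_F_mono[OF IH(2) qm] measurable_F_mono[OF Tm(1) qm]
    measurable_compose[OF incr_F gm(1)] IH qm order_refl)
 moreover have "integrable P (%w. (S (Suc m) w)^2)"
  unfolding sq using IH(3) i1(1) i2(1) by simp
 moreover have "(LINT w|P. (S (Suc m) w)^2) <= R^2*(\<Sum>i<Suc m. c i)"
 proof -
  have "(LINT w|P. (S (Suc m) w)^2) = (LINT w|P. (S m w)^2)+(LINT w|P. (T m w)^2)*(LINT w|P. (g m (?D w))^2)"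
   unfolding sq using IH(3) i1 i2 gm(3) by simp
  also have "(LINT w|P. (T m w)^2)*(LINT w|P. (g m (?D w))^2) <= R^2*c m"
  proof (rule mult_mono)
   have "(LINT w|P. (T m w)^2) <= (LINT w|P. R^2)" by (rule integral_mono[OF T2i]) (use T2le in auto)
   thus "(LINT w|P. (T m w)^2) <= R^2" by (simp add: prob_space)
  qed (use gm in auto)
  finally show ?thesis using IH(4) by (simp add: distrib_left)
 qed
 ultimately show ?case using IH(1) qm by simp
qed

text \<open>What an increment of a stochastic exponential, normalized to start at 1, contains over a
  time step \<open>\<Delta>\<close> beyond the Ito increment \<open>a \<bullet> x\<close>.\<close>

definition exp_rem :: "real^'n => real => real^'n => real" where
 "exp_rem a \<Delta> x = exp (a \<bullet> x - (a \<bullet> a) * \<Delta>/2) - 1 - a \<bullet> x"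

text \<open>With \<open>x = (a \<bullet> a)*(u - s)\<close> the second moment is exactly
  \<open>exp x - 1 - x\<close>, hence quadratic in the step: summed over a grid it is of the order
  of the mesh.\<close>

lemma exp_rem_moments:
 assumes s: "0 <= s" "s <= u" and small: "(a \<bullet> a)*(u - s) <= 1"
 shows "integrable P (%w. exp_rem a (u - s) (Z u w - Z s w))"
  "(LINT w|P. exp_rem a (u - s) (Z u w - Z s w)) = 0"
  "integrable P (%w. (exp_rem a (u - s) (Z u w - Z s w))^2)"
  "(LINT w|P. (exp_rem a (u - s) (Z u w - Z s w))^2) <= ((a \<bullet> a)*(u - s))^2"
proof -
 let ?D = "%w. Z u w - Z s w" and ?e = "stoch_exp a s u" and ?x = "(a \<bullet> a)*(u - s)"
 have eq: "exp_rem a (u - s) (?D w) = ?e w - 1 - a \<bullet> ?D w" for w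
  by (simp add: exp_rem_def stoch_exp_def)
 have z: "a \<bullet> ?D w = (\<Sum>j\<in>UNIV. a $ j*(?D w) $ j)" for w by (simp add: inner_vec_def)
 have z2: "(a \<bullet> ?D w)^2 = (\<Sum>i\<in>UNIV. \<Sum>j\<in>UNIV. (a $ i*a $ j)*((?D w) $ i*(?D w) $ j))" for w
  unfolding z power2_eq_square sum_product by (simp add: mult_ac)
 have ez: "?e w*(a \<bullet> ?D w) = (\<Sum>j\<in>UNIV. a $ j*(1*(?e w*(?D w) $ j)))" for w
  unfolding z by (simp add: sum_distrib_left mult_ac)
 note E = stoch_exp_integrable[OF s, of a] and E2 = stoch_exp_square_integrable[OF s, of a]
 have zi: "integrable P (%w. a \<bullet> ?D w)" "(LINT w|P. a \<bullet> ?D w) = 0"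
  unfolding z using incr_mean[OF s] by (auto simp del: vector_minus_component)
 have z2i: "integrable P (%w. (a \<bullet> ?D w)^2)" "(LINT w|P. (a \<bullet> ?D w)^2) = ?x"
 proof -
  show "integrable P (%w. (a \<bullet> ?D w)^2)"
   unfolding z2 using incr_cov(1)[OF s] by (auto simp del: vector_minus_component)
  have "(LINT w|P. (a \<bullet> ?D w)^2) = (\<Sum>i\<in>UNIV. \<Sum>j\<in>UNIV. (a $ i*a $ j)*(if i = j then u - s else 0))"
   unfolding z2 using incr_cov[OF s] by (simp add: Bochner_Integration.integral_sum del: vector_minus_component)
  also have "... = ?x" by (simp add: inner_vec_def sum_distrib_right if_distrib cong: if_cong)
  finally show "(LINT w|P. (a \<bullet> ?D w)^2) = ?x" .
 qed
 have ezi: "integrable P (%w. ?e w*(a \<bullet> ?D w))" "(LINT w|P. ?e w*(a \<bullet> ?D w)) = ?x"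
 proof -
  have one: "(LINT w|P. (1::real)) = 1" by (simp add: prob_space)
  have st: "integrable P (%w. 1*(?e w*(?D w) $ j))" "(LINT w|P. 1*(?e w*(?D w) $ j)) = a $ j*(u - s)" for j
   using stoch_exp_step[OF s borel_measurable_const P.integrable_const, of 1 a j] one
   by (simp_all only: mult_1)
  show "integrable P (%w. ?e w*(a \<bullet> ?D w))" unfolding ez using st(1) by (auto simp del: vector_minus_component mult_1)
  have "(LINT w|P. ?e w*(a \<bullet> ?D w)) = (\<Sum>j\<in>UNIV. a $ j*(a $ j*(u - s)))"
   unfolding ez using st by (simp add: Bochner_Integration.integral_sum del: vector_minus_component mult_1)
  also have "... = ?x" by (simp add: inner_vec_def sum_distrib_right mult.assoc)
  finally show "(LINT w|P. ?e w*(a \<bullet> ?D w)) = ?x" .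
 qed
 show "integrable P (%w. exp_rem a (u - s) (?D w))" unfolding eq using E zi by auto
 show "(LINT w|P. exp_rem a (u - s) (?D w)) = 0" unfolding eq using E zi by (simp add: prob_space)
 have sq: "(exp_rem a (u - s) (?D w))^2 = (?e w)^2 + 1 + (a \<bullet> ?D w)^2 - 2*?e w - 2*(?e w*(a \<bullet> ?D w))+2*(a \<bullet> ?D w)" for w
  unfolding eq by (simp add: power2_eq_square algebra_simps)
 show "integrable P (%w. (exp_rem a (u - s) (?D w))^2)"
  unfolding sq using E E2 zi z2i ezi by simp
 have "(LINT w|P. (exp_rem a (u - s) (?D w))^2) = exp ?x - 1 - ?x"
  unfolding sq using E E2 zi z2i ezi by (simp add: prob_space)
 also have "... <= ?x^2"
  using exp_bound[of ?x] small s by simp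
 finally show "(LINT w|P. (exp_rem a (u - s) (?D w))^2) <= ?x^2" .
qed

lemma simple_value_at:
 assumes "!!i. i < m ==> p i <= p (Suc i)" "i < m" "u : {p i<..p (Suc i)}"
 shows "simple_value m p xi u w = xi i w"
proof -
 have "(ind {p j<..p (Suc j)} u :: real) = (if j = i then 1 else 0)" if "j < m" for j
  using that assms mono_le_upto[of m p "Suc j" i] mono_le_upto[of m p "Suc i" j]
  by (cases j i rule: linorder_cases) (auto simp: indicator_def)
 hence "simple_value m p xi u w = (\<Sum>j<m. (if j = i then 1 else 0) *\<^sub>R xi j w)"
  unfolding simple_value_def by (intro sum.cong) auto
 also have "... = xi i w" using assms(2) by (simp add: if_distrib[of "%c. c *\<^sub>R _"] cong: if_cong)
 finally show ?thesis .
qed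

lemma simple_value_outside:
 assumes "!!i. i < m ==> u \<notin> {p i<..p (Suc i)}"
 shows "simple_value m p xi u w = 0"
 using assms by (auto simp: simple_value_def intro!: sum.neutral)

lemma AE_continuous_Z: "AE w in M. continuous_on {0..} (%t. Z t w)"
 using bm by (simp add: brownian_motion_def)

lemma stoch_exp_continuous:
 assumes "continuous_on {0..} (%t. Z t w)" "0 <= t"
 shows "continuous_on {t..} (%s. stoch_exp a t s w)"
 unfolding stoch_exp_def
 by (intro continuous_intros continuous_on_subset[OF assms(1)]) (use assms(2) in auto)

lemma qvar_diff_path:
 assumes "simple_process M F t m p xi" "pred t H" "0 <= t" "w : space M"
 shows "(%u. ennreal ((norm (simple_value m p xi u w - H u w))^2)*ind {t..s} u) : bm lborel"
proof -
 have "(%u. (u, w)) : borel \<rightarrow>\<^sub>M BxP"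
  by (rule measurable_Pair2') (use assms in simp)
 from measurable_compose[OF this qvar_diff_joint[OF assms(1,2,3), of s]] show ?thesis by simp
qed

text \<open>If \<open>X = L v\<close> with \<open>L = stoch_exp a t\<close> and \<open>v\<close> absolutely continuous, then
 \<open>dX = L dv + X a \<bullet> dZ\<close>. On the grid of mesh \<open>1/N\<^sup>4\<close> the Riemann sums of \<open>X a\<close>, truncated
 at level \<open>N\<close>, differ from the increments of \<open>L\<close> by an orthogonal sum of variance \<open>O(1/N^2)\<close>.\<close>

lemma ito_exp_product:
 fixes a :: "real^'n"
 assumes t: "0 <= t" and X: "cadapted t X" and I: "cadapted t I"
  and path: "AE w in M. EX v v'. abs_cont t v v' & (ALL s>=t. X s w = stoch_exp a t s w * v s) \<and>
   (ALL s>=t. I s w = X s w - X t w - (LBINT u:{t..s}. stoch_exp a t u w * v' u))"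
 shows "itoint t (%s w. X s w *\<^sub>R a) I"
proof -
 define N where "N j = real (Suc j)" for j
 define p where "p j i = t + real i/N j ^ 4" for j i
 \<comment> \<open>\<open>N^5\<close> cells of length \<open>1/N^4\<close> reach up to
   \<open>t + N\<close>, so every horizon is eventually covered.\<close>
 define m where "m j = Suc j ^ 5" for j
 \<comment> \<open>Simple processes must be bounded. The level \<open>N\<close> costs a factor
   \<open>N^2\<close> in the variance below, which the mesh \<open>1/N^4\<close> outweighs.\<close>
 define tr where "tr j x = max (- N j) (min x (N j))" for j and x :: real
 define xi where "xi j i w = tr j (X (p j i) w) *\<^sub>R a" for j i w
 have N1: "1 <= N j" for j by (simp add: N_def)
 hence N0: "0 < N j" for j using less_le_trans[OF zero_less_one] by blast
 have ptr: "abs (tr j x) <= N j" "abs (tr j x) <= abs x" for j x using N0[of j] by (auto simp: tr_def)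
 have tr_id: "tr j x = x" if "abs x <= N j" for j x using that by (auto simp: tr_def)
 have pt: "t <= p j i" for j i using N0[of j] by (simp add: p_def)
 have pS: "p j (Suc i) = p j i + 1/N j ^ 4" for j i using N0[of j] by (simp add: p_def field_simps)
 have pmono: "p j i <= p j (Suc i)" for j i using N0[of j] by (simp add: pS)
 have p0: "p j 0 = t" for j by (simp add: p_def)
 have pm: "p j (m j) = t + N j" for j
 proof -
  have "real (m j) = N j ^ 5" by (simp add: m_def N_def)
  also have "... = N j*N j ^ 4" by (simp add: power_Suc[symmetric] del: power_Suc)
  finally show ?thesis using N0[of j] by (simp add: p_def)
 qed
 have XF: "X s : bm (F s)" if "t <= s" for s using cadapted_F[OF X that] .
 have trb: "tr j : bm borel" for j unfolding tr_def by measurable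
 have TF: "(%w. tr j (X (p j i) w)) : bm (F (p j i))" for j i
  by (rule measurable_compose[OF XF[OF pt] trb])
 have sp: "sproc t m p xi j" for j
  unfolding simple_process_def
 proof (intro conjI allI impI pmono)
  show "t <= p j 0" by (rule pt)
  fix i
  show "xi j i : bm (F (p j i))"
   unfolding xi_def using TF[of j i] by (intro borel_measurable_scaleR) auto
  show "EX C. ALL w:space M. norm (xi j i w) <= C"
   by (intro exI[of _ "N j*norm a"]) (auto simp: xi_def intro!: mult_right_mono ptr)
 qed
 let ?H = "%s w. X s w *\<^sub>R a"
 have Hpr: "pred t ?H"
  using cadapted_pred[OF X] unfolding predictable_alt by (intro borel_measurable_scaleR) auto
 have Xbound: "EX B. ALL u:{t..s}. abs (X u w) <= B" if w: "w : space M" for w s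
 proof -
  have c: "continuous_on {t..s} (%u. X u w)" using X w by (auto simp: continuous_adapted_def intro: continuous_on_subset)
  show ?thesis by (rule continuous_Icc_bounded[OF c]) blast
 qed
 have cover: "EX i<m j. u : {p j i<..p j (Suc i)}" if "t < u" "u <= t + N j" for j u
 proof -
  have "EX i<k. u : {p j i<..p j (Suc i)}" if "u <= p j k" for k
   using that
  proof (induction k)
   case 0 thus ?case using \<open>t < u\<close> by (simp add: p0)
  next
   case (Suc k)
   thus ?case by (cases "u <= p j k") (auto intro: less_SucI)
  qed
  thus ?thesis using that(2) pm[of j] by auto
 qed
 have Nlarge: "\<forall>\<^sub>F j in sequentially. c <= N j" for c :: real
 proof -
  obtain k :: nat where "c <= real k" using real_arch_simple by blast
  thus ?thesis unfolding eventually_sequentially N_def by (intro exI[of _ k]) auto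
 qed
 have meshlim: "(%j. 1/N j ^ 4) ----> 0"
 proof -
  have "(%j. (inverse (real (Suc j))) ^ 4) ----> 0 ^ 4" by (intro tendsto_power LIMSEQ_inverse_real_of_nat)
  thus ?thesis by (simp add: N_def power_inverse divide_inverse)
 qed
 have svb: "norm (sval m p xi j u w) <= B*norm a"
  if "ALL u:{t..s}. abs (X u w) <= B" "u : {t..s}" for j u s B w
 proof (cases "EX i<m j. u : {p j i<..p j (Suc i)}")
  case True
  then obtain i where i: "i < m j" "u : {p j i<..p j (Suc i)}" by blast
  have "sval m p xi j u w = xi j i w" by (rule simple_value_at[OF pmono i])
  moreover have "abs (X (p j i) w) <= B" using that pt[of j i] i(2) by auto
  ultimately show ?thesis using ptr(2)[of j "X (p j i) w"] by (auto simp: xi_def intro!: mult_right_mono)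
 next
  case False
  hence "sval m p xi j u w = 0" by (intro simple_value_outside) auto
  moreover have "0 <= B" using that by (meson abs_ge_zero order_trans)
  ultimately show ?thesis by simp
 qed
 have v1: "AE w in M. (%j. qvar (%u w. sval m p xi j u w - ?H u w) t s w) ----> 0" for s
 proof (rule AE_I2)
  fix w assume w: "w : space M"
  obtain B where B: "ALL u:{t..s}. abs (X u w) <= B" using Xbound[OF w] by blast
  have c: "continuous_on {t..} (%u. X u w)" using X w by (auto simp: continuous_adapted_def)
  have "(%j. (NL u. ennreal ((norm (sval m p xi j u w - ?H u w))^2)*ind {t..s} u)) ----> (NL (u::real). 0)"
  proof (rule nn_integral_dominated_convergence[where w="%u. ennreal ((2*B*norm a)^2)*ind {t..s} u"
     and u="%j u. ennreal ((norm (sval m p xi j u w - ?H u w))^2)*ind {t..s} u" and u'="%_. 0"])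
   show "(%u. ennreal ((norm (sval m p xi j u w - ?H u w))^2)*ind {t..s} u) : bm lborel" for j
    by (rule qvar_diff_path[OF sp Hpr t w])
   show "AE u in lborel. ennreal ((norm (sval m p xi j u w - ?H u w))^2)*ind {t..s} u
     <= ennreal ((2*B*norm a)^2)*ind {t..s} u" for j
   proof (rule AE_I2)
    fix u
    have "norm (sval m p xi j u w - ?H u w) <= 2*B*norm a" if u: "u : {t..s}"
    proof -
     have "norm (?H u w) <= B*norm a" using B u by (auto intro!: mult_right_mono)
     thus ?thesis using norm_triangle_ineq4[of "sval m p xi j u w" "?H u w"] svb[OF B u, of j] by linarith
    qed
    thus "ennreal ((norm (sval m p xi j u w - ?H u w))^2)*ind {t..s} u
     <= ennreal ((2*B*norm a)^2)*ind {t..s} u"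
     by (auto simp: indicator_def intro!: ennreal_leI power_mono)
   qed
   show "(NL u. ennreal ((2*B*norm a)^2)*ind {t..s} u) < \<infinity>"
    by (simp add: nn_integral_cmult ennreal_mult_less_top emeasure_lborel_Icc_eq)
   show "AE u in lborel. (%j. ennreal ((norm (sval m p xi j u w - ?H u w))^2)*ind {t..s} u) ----> 0"
    using AE_lborel_singleton[of t]
   proof eventually_elim
    case (elim u)
    show ?case
    proof (cases "u : {t..s}")
     case True
     hence tu: "t < u" "u <= s" using elim by auto
     \<comment> \<open>The left end of the cell that contains \<open>u\<close>, with the default
       \<open>t\<close> as long as the grid does not reach \<open>u\<close>.\<close>
     define x where "x j = (if u <= t + N j then p j (SOME i. i < m j & u : {p j i<..p j (Suc i)}) else t)" for j
     have xs: "EX i<m j. u : {p j i<..p j (Suc i)} & x j = p j i" if "u <= t + N j" for j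
     proof -
      have "EX i. i < m j & u : {p j i<..p j (Suc i)}" using cover[OF tu(1) that] by blast
      from someI_ex[OF this] that show ?thesis by (auto simp: x_def)
     qed
     have xt: "t <= x j" for j by (simp add: x_def pt)
     have ev: "\<forall>\<^sub>F j in sequentially. u <= t + N j" using Nlarge[of "u - t"] by eventually_elim auto
     have xlim: "x ----> u"
     proof (rule tendsto_sandwich)
      show "(%j. u - 1/N j ^ 4) ----> u" using tendsto_diff[OF tendsto_const meshlim, of u] by simp
      show "\<forall>\<^sub>F j in sequentially. u - 1/N j ^ 4 <= x j"
       using ev by eventually_elim (use xs pS in fastforce)
      show "\<forall>\<^sub>F j in sequentially. x j <= u"
       using ev by eventually_elim (use xs in fastforce)
     qed simp
     have "(%j. X (x j) w) ----> X u w"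
      by (rule continuous_on_tendsto_compose[OF c xlim]) (use xt tu in auto)
     hence "(%j. ennreal ((norm (X (x j) w *\<^sub>R a - X u w *\<^sub>R a))^2)) ----> ennreal ((norm (X u w *\<^sub>R a - X u w *\<^sub>R a))^2)"
      by (intro tendsto_ennrealI tendsto_power tendsto_norm tendsto_diff tendsto_scaleR tendsto_const)
     moreover have "\<forall>\<^sub>F j in sequentially. ennreal ((norm (X (x j) w *\<^sub>R a - X u w *\<^sub>R a))^2)
       = ennreal ((norm (sval m p xi j u w - ?H u w))^2)*ind {t..s} u"
      using ev Nlarge[of B]
     proof eventually_elim
      case (elim j)
      obtain i where i: "i < m j" "u : {p j i<..p j (Suc i)}" "x j = p j i" using xs[OF elim(1)] by blast
      have "sval m p xi j u w = xi j i w" by (rule simple_value_at[OF pmono i(1,2)])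
      also have "... = X (x j) w *\<^sub>R a"
      proof -
       have "p j i : {t..s}" using pt[of j i] i(2) tu by auto
       hence "abs (X (p j i) w) <= N j" using B elim(2) by fastforce
       thus ?thesis by (simp add: xi_def tr_id i(3))
      qed
      finally show ?case using True by simp
     qed
     ultimately show ?thesis by (simp add: Lim_transform_eventually)
    qed simp
   qed
  qed simp_all
  thus "(%j. qvar (%u w. sval m p xi j u w - ?H u w) t s w) ----> 0" by simp
 qed
 have v2: "vanish (%j w. ennreal (abs (sitg m p xi j s w - I s w)))" if s: "t <= s" for s
 proof -
  define q where "q j i = min (p j i) s" for j i
  define T where "T j i w = (if p j i < s then tr j (X (p j i) w) else 0)" for j i w
  define B where "B j w = (\<Sum>i<m j. T j i w*exp_rem a (q j (Suc i) - q j i) (Z (q j (Suc i)) w - Z (q j i) w))" for j w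
  \<comment> \<open>Adding \<open>B\<close> completes each Brownian increment to a relative
    increment of the exponential, so \<open>A\<close> is the error of a Riemann sum and tends to
    zero on almost every path, while \<open>B\<close> tends to zero in L2.\<close>
  define A where "A j w = sitg m p xi j s w + B j w - I s w" for j w
  have qt: "t <= q j i" and qs: "q j i <= s" for j i using pt[of j i] s by (auto simp: q_def)
  have qmono: "q j i <= q j (Suc i)" for j i using pmono[of j i] by (auto simp: q_def)
  have qd: "q j (Suc i) - q j i <= 1/N j ^ 4" for j i
  proof -
   have "0 <= 1/N j ^ 4" using N0[of j] by simp
   thus ?thesis using pS[of j i] unfolding q_def by linarith
  qed
  have q0: "q j 0 = t" for j using s by (simp add: q_def p0)
  have SI: "sitg m p xi j s w = (\<Sum>i<m j. T j i w*(a \<bullet> (Z (q j (Suc i)) w - Z (q j i) w)))" for j w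
   unfolding simple_integral_def
  proof (rule sum.cong[OF refl])
   fix i
   show "xi j i w \<bullet> (Z (min (p j (Suc i)) s) w - Z (min (p j i) s) w) = T j i w*(a \<bullet> (Z (q j (Suc i)) w - Z (q j i) w))"
    using pmono[of j i] by (auto simp: xi_def T_def q_def min_def)
  qed
  have SB: "sitg m p xi j s w + B j w = (\<Sum>i<m j. T j i w*(stoch_exp a (q j i) (q j (Suc i)) w - 1))" for j w
   unfolding SI B_def sum.distrib[symmetric]
   by (intro sum.cong refl) (simp add: exp_rem_def stoch_exp_def algebra_simps)
  have TF': "T j i : bm (F (q j i))" for j i
   using TF[of j i] by (cases "p j i < s") (auto simp: T_def[abs_def] q_def)
  have Tb: "abs (T j i w) <= N j" for j i w using ptr(1)[of j "X (p j i) w"] N0[of j] by (simp add: T_def)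
  have BP [measurable]: "B j : bm P" for j
  proof -
   have "(%w. T j i w*exp_rem a (q j (Suc i) - q j i) (Z (q j (Suc i)) w - Z (q j i) w)) : bm P" for i
   proof (rule borel_measurable_times)
    show "T j i : bm P" by (rule measurable_F_P[OF TF'])
    have [measurable]: "(%w. Z (q j (Suc i)) w - Z (q j i) w) : bm P"
     using t qt[of j i] qmono[of j i] by (intro measurable_completion incr_measurable) auto
    show "(%w. exp_rem a (q j (Suc i) - q j i) (Z (q j (Suc i)) w - Z (q j i) w)) : bm P"
     unfolding exp_rem_def by measurable
   qed
   thus ?thesis unfolding B_def by (intro borel_measurable_sum) auto
  qed
  have [measurable]: "I s : bm P" "sitg m p xi j s : bm P" for j
   using cadapted_P[OF I s] simple_integral_P[OF sp t s] by auto
  have AP [measurable]: "A j : bm P" for j unfolding A_def by measurable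
  have "AE w in M. (%j. A j w) ----> 0"
   using path AE_continuous_Z AE_space
  proof eventually_elim
   case (elim w)
   then obtain v v' where v: "abs_cont t v v'" "!!s. t <= s ==> X s w = stoch_exp a t s w * v s"
    "!!s. t <= s ==> I s w = X s w - X t w - (LBINT u:{t..s}. stoch_exp a t u w * v' u)" by blast
   obtain Bd where Bd: "ALL u:{t..s}. abs (X u w) <= Bd" using Xbound[OF elim(3)] by blast
   let ?L = "%s. stoch_exp a t s w"
   have cL: "continuous_on {t..s} ?L"
    using stoch_exp_continuous[OF elim(2) t] by (rule continuous_on_subset) auto
   have vi: "sint {t..s} v'" by (rule abs_contD(1)[OF v(1) s])
   define C where "C = (LBINT u:{t..s}. abs (v' u))+1"
   have C: "0 < C" unfolding C_def by (auto simp: sli_def intro!: add_nonneg_pos integral_nonneg_AE)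
   show ?case
   proof (rule LIMSEQ_I)
    fix e :: real assume e: "0 < e"
    define e' where "e' = e/(2*C)"
    have e': "0 < e'" using e C by (simp add: e'_def)
    obtain d where d: "0 < d" "!!u v. u : {t..s} ==> v : {t..s} ==> abs (u - v) <= d ==> abs (?L u - ?L v) <= e'"
     using compact_uniform_mod[OF cL e'] by blast
    have "\<forall>\<^sub>F j in sequentially. 1/N j ^ 4 < d" using meshlim d(1) by (rule order_tendstoD(2))
    hence "\<forall>\<^sub>F j in sequentially. abs (A j w) < e"
     using Nlarge[of Bd] Nlarge[of "s - t"]
    proof eventually_elim
     case (elim j)
     have qm: "q j (m j) = s" using elim(3) pm[of j] by (simp add: q_def)
     have "(\<Sum>i<m j. T j i w*(stoch_exp a (q j i) (q j (Suc i)) w - 1))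
      = (\<Sum>i<m j. v (q j i)*(?L (q j (Suc i)) - ?L (q j i)))"
     proof (rule sum.cong[OF refl])
      fix i
      show "T j i w*(stoch_exp a (q j i) (q j (Suc i)) w - 1) = v (q j i)*(?L (q j (Suc i)) - ?L (q j i))"
      proof (cases "p j i < s")
       case True
       hence qp: "q j i = p j i" by (simp add: q_def)
       have "p j i : {t..s}" using pt[of j i] True by simp
       hence "abs (X (p j i) w) <= Bd" using Bd by blast
       hence "abs (X (p j i) w) <= N j" using elim(2) by linarith
       hence "T j i w = ?L (q j i) * v (q j i)" using True by (simp add: T_def tr_id v(2)[OF pt] qp)
       thus ?thesis
        unfolding stoch_exp_mult[of a t "q j i" w "q j (Suc i)", symmetric] by (simp add: algebra_simps)
      next
       case False
       hence "q j (Suc i) = q j i" using pmono[of j i] by (simp add: q_def)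
       thus ?thesis by simp
      qed
     qed
     \<comment> \<open>Summation by parts moves the increments from the rough path \<open>?L\<close>
       to the absolutely continuous \<open>v\<close>.\<close>
     also have "... = v s*?L s - v t*?L t - (\<Sum>i<m j. ?L (q j (Suc i))*(v (q j (Suc i)) - v (q j i)))"
     proof -
      have "(\<Sum>i<m j. v (q j i)*(?L (q j (Suc i)) - ?L (q j i)))+(\<Sum>i<m j. ?L (q j (Suc i))*(v (q j (Suc i)) - v (q j i)))
       = (\<Sum>i<m j. v (q j (Suc i))*?L (q j (Suc i)) - v (q j i)*?L (q j i))"
       unfolding sum.distrib[symmetric] by (intro sum.cong) (auto simp: algebra_simps)
      also have "... = v (q j (m j))*?L (q j (m j)) - v (q j 0)*?L (q j 0)"
       by (rule sum_lessThan_telescope)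
      finally show ?thesis unfolding qm q0 by linarith
     qed
     finally have A: "A j w = (LBINT u:{t..s}. ?L u * v' u) - (\<Sum>i<m j. ?L (q j (Suc i))*(v (q j (Suc i)) - v (q j i)))"
      unfolding A_def SB using v(2)[OF s] v(2)[of t] v(3)[OF s] by (simp add: mult.commute)
     have vd: "v (q j (Suc i)) - v (q j i) = (LBINT u:{q j i..q j (Suc i)}. v' u)" for i
      by (rule abs_cont_diff[OF v(1) qt qmono])
     have "abs ((\<Sum>i<m j. ?L (q j (Suc i))*(LBINT u:{q j i..q j (Suc i)}. v' u)) - (LBINT u:{q j 0..q j (m j)}. ?L u * v' u))
      <= e'*(LBINT u:{q j 0..q j (m j)}. abs (v' u))"
     proof (rule riemann_sum_bound[where delta=d])
      show "q j (Suc i) - q j i <= d" for i using qd[of j i] elim(1) by linarith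
     qed (use qmono vi cL d(2) in "auto simp: q0 qm")
     hence "abs (A j w) <= e'*(LBINT u:{t..s}. abs (v' u))"
      unfolding A vd q0 qm by (simp only: abs_minus_commute)
     also have "... <= e'*C" unfolding C_def using e' by (intro mult_left_mono) auto
     also have "... < e" using C e by (simp add: e'_def)
     finally show ?case .
    qed
    thus "EX no. ALL j>=no. norm (A j w - 0) < e" by (simp add: eventually_sequentially)
   qed
  qed
  hence "AE w in M. (%j. ennreal (abs (A j w))) ----> 0"
   by eventually_elim (subst ennreal_tendsto_0_iff, auto intro: tendsto_rabs_zero)
  hence vA: "vanish (%j w. ennreal (abs (A j w)))"
   by (intro AE_vanish) auto
  have B2: "\<forall>\<^sub>F j in sequentially. integrable P (%w. (B j w)^2) & (LINT w|P. (B j w)^2) <= (a \<bullet> a)^2*(s - t)/(N j)^2"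
   using Nlarge[of "a \<bullet> a"]
  proof eventually_elim
   case (elim j)
   have N4: "N j <= N j ^ 4" using N1[of j] power_increasing[of 1 4 "N j"] by simp
   have sm: "(a \<bullet> a)*(q j (Suc i) - q j i) <= 1" for i
   proof -
    have "(a \<bullet> a)*(q j (Suc i) - q j i) <= N j ^ 4*(1/N j ^ 4)"
     using elim N4 qd[of j i] qmono[of j i] N0[of j] by (intro mult_mono) auto
    thus ?thesis using N0[of j] by simp
   qed
   have q00: "0 <= q j i" for i using qt[of j i] t by simp
   note R = exp_rem_moments[OF q00 qmono sm]
   have "integrable P (%w. (B j w)^2) & (LINT w|P. (B j w)^2) <= (N j)^2*(\<Sum>i<m j. ((a \<bullet> a)*(q j (Suc i) - q j i))^2)"
   proof -
    have gb: "exp_rem a x : bm borel" for x unfolding exp_rem_def by measurable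
    show ?thesis
     using orthogonal_sum[where q="q j" and m="m j" and T="T j" and R="N j" and g="%i. exp_rem a (q j (Suc i) - q j i)"
      and c="%i. ((a \<bullet> a)*(q j (Suc i) - q j i))^2", OF q00 qmono TF' Tb gb R]
     unfolding B_def by blast
   qed
   moreover have "(N j)^2*(\<Sum>i<m j. ((a \<bullet> a)*(q j (Suc i) - q j i))^2) <= (a \<bullet> a)^2*(s - t)/(N j)^2"
   proof -
    have "(\<Sum>i<m j. ((a \<bullet> a)*(q j (Suc i) - q j i))^2) <= (\<Sum>i<m j. (a \<bullet> a)^2*(1/N j ^ 4)*(q j (Suc i) - q j i))"
    proof (rule sum_mono)
     fix i
     have "(q j (Suc i) - q j i)^2 <= 1/N j ^ 4*(q j (Suc i) - q j i)"
      unfolding power2_eq_square using qd[of j i] qmono[of j i] by (intro mult_right_mono) auto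
     thus "((a \<bullet> a)*(q j (Suc i) - q j i))^2 <= (a \<bullet> a)^2*(1/N j ^ 4)*(q j (Suc i) - q j i)"
      by (simp only: power_mult_distrib mult.assoc) (rule mult_left_mono, auto)
    qed
    also have "... = (a \<bullet> a)^2*(1/N j ^ 4)*(q j (m j) - q j 0)"
     unfolding sum_distrib_left[symmetric] by (simp only: sum_lessThan_telescope)
    also have "... <= (a \<bullet> a)^2*(1/N j ^ 4)*(s - t)"
     using qs[of j "m j"] by (intro mult_left_mono) (auto simp: q0)
    finally have "(N j)^2*(\<Sum>i<m j. ((a \<bullet> a)*(q j (Suc i) - q j i))^2) <= (N j)^2*((a \<bullet> a)^2*(1/N j ^ 4)*(s - t))"
     by (rule mult_left_mono) simp
    also have "... = (a \<bullet> a)^2*(s - t)/(N j)^2"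
     using N0[of j] by (simp add: field_simps power2_eq_square power4_eq_xxxx)
    finally show ?thesis .
   qed
   ultimately show ?case by linarith
  qed
  have vB: "vanish (%j w. ennreal (abs (B j w)))"
   unfolding vanishes_in_probability_def
  proof (intro allI impI)
   fix e :: real assume e: "0 < e"
   have lim: "(%j. (a \<bullet> a)^2*(s - t)/(N j)^2/e^2) ----> 0"
   proof -
    have "(%j. (a \<bullet> a)^2*(s - t)/e^2*(inverse (real (Suc j)))^2) ----> (a \<bullet> a)^2*(s - t)/e^2*0\<^sup>2"
     by (intro tendsto_mult tendsto_const tendsto_power LIMSEQ_inverse_real_of_nat)
    thus ?thesis by (simp add: N_def power_inverse divide_inverse mult_ac)
   qed
   have "\<forall>\<^sub>F j in sequentially. norm (P.prob {w : space M. ennreal e <= ennreal (abs (B j w))}) <= (a \<bullet> a)^2*(s - t)/(N j)^2/e^2"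
    using B2
   proof eventually_elim
    case (elim j)
    have "{w : space M. ennreal e <= ennreal (abs (B j w))} = {w : space P. e^2 <= (B j w)^2}"
     using e by (auto simp: abs_le_square_iff[symmetric])
    moreover have "P.prob {w : space P. e^2 <= (B j w)^2} <= (LINT w|P. (B j w)^2)/e^2"
     by (rule integral_Markov_inequality_measure[where A="{}"]) (use elim e in auto)
    moreover have "(LINT w|P. (B j w)^2)/e^2 <= (a \<bullet> a)^2*(s - t)/(N j)^2/e^2"
     using elim by (intro divide_right_mono) auto
    ultimately show ?case by simp
   qed
   thus "(%j. P.prob {w : space M. ennreal e <= ennreal (abs (B j w))}) ----> 0"
    by (rule Lim_null_comparison[OF _ lim])
  qed
  have m1: "(%w. ennreal (abs (A j w))) : bm P" "(%w. ennreal (abs (B j w))) : bm P"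
   "(%w. ennreal (abs (sitg m p xi j s w - I s w))) : bm P" for j by measurable
  show ?thesis
  proof (rule vanish_le[where C=1, OF borel_measurable_add[OF m1(1,2)] m1(3) _ _ vanish_add[OF m1(1,2) vA vB]])
   fix j w
   have "abs (sitg m p xi j s w - I s w) <= abs (A j w)+abs (B j w)"
    unfolding A_def by linarith
   thus "ennreal (abs (sitg m p xi j s w - I s w)) <= ennreal 1*(ennreal (abs (A j w))+ennreal (abs (B j w)))"
    by (simp add: ennreal_plus[symmetric] ennreal_leI del: ennreal_plus)
  qed simp
 qed
 show ?thesis
  unfolding ito_integral_def
 proof (intro conjI Hpr I)
  show "AE w in M. ALL s>=t. qvar ?H t s w < \<infinity>"
  proof (rule AE_I2, intro allI impI)
   fix w s assume w: "w : space M"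
   obtain B where B: "ALL u:{t..s}. abs (X u w) <= B" using Xbound[OF w] by blast
   have "qvar ?H t s w <= (NL u. ennreal ((B*norm a)^2)*ind {t..s} u)"
    by (rule nn_integral_mono) (use B in "auto simp: indicator_def intro!: ennreal_leI power_mono mult_right_mono")
   also have "... < \<infinity>" by (simp add: nn_integral_cmult ennreal_mult_less_top emeasure_lborel_Icc_eq)
   finally show "qvar ?H t s w < \<infinity>" .
  qed
  show "EX m p xi. (ALL j. sproc t m p xi j) \<and>
    (ALL s>=t. vanish (%j. qvar (%u w. sval m p xi j u w - ?H u w) t s) \<and>
      vanish (%j w. ennreal (abs (sitg m p xi j s w - I s w))))"
  proof (intro exI[of _ m] exI[of _ p] exI[of _ xi] conjI allI impI sp v2)
   fix s
   show "vanish (%j. qvar (%u w. sval m p xi j u w - ?H u w) t s)"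
    by (rule AE_vanish[OF qvar_diff_P[OF sp Hpr t] v1])
  qed
 qed
qed

end

section \<open>Moment bounds and uniqueness for linear equations\<close>

text \<open>The integrating factor is applied to the primitive \<open>Q\<close> of \<open>q\<close>,
  because \<open>q\<close> itself is merely integrable; the hypothesis then bounds \<open>q\<close>
  through \<open>Q\<close>.\<close>

lemma gronwall_integral:
 fixes q :: "real => real"
 assumes q: "sint {t..T} q" and K: "0 <= K0" "0 < K1"
  and le: "!!s. s : {t..T} ==> q s <= K0 + K1*(LBINT u:{t..s}. q u)" and s: "s : {t..T}"
 shows "q s <= K0*exp (K1*(s - t))"
proof -
 define q' where "q' u = (if u : {t..T} then q u else 0)" for u
 have qi: "sint {t..s} q'" for s
 proof -
  have "q' = (%u. ind {t..T} u *\<^sub>R q u)" by (auto simp: q'_def fun_eq_iff indicator_def)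
  hence "integrable lborel q'" using q by (simp add: set_integrable_def)
  thus ?thesis unfolding set_integrable_def by (rule integrable_mult_indicator[rotated]) simp
 qed
 define Q where "Q s = (LBINT u:{t..s}. q' u)" for s
 have Q0: "Q t = 0" unfolding Q_def using set_integral_sum_intervals[of 0 "%_. t"] qi[of t] by simp
 have Q: "abs_cont t Q q'" unfolding abs_cont_def using qi Q0 by (simp add: Q_def)
 have QL: "Q s = (LBINT u:{t..s}. q u)" if "s : {t..T}" for s
  unfolding Q_def by (rule set_lebesgue_integral_cong) (use that in "auto simp: q'_def")
 let ?e = "%u. exp (- K1*(u - t))"
 have "abs_cont t (%u. ?e u*Q u) (%u. - K1*?e u*Q u + ?e u*q' u)"
  by (rule abs_cont_mult[OF abs_cont_exp Q])
 from abs_contD[OF this, of s] have A: "sint {t..s} (%u. - K1*?e u*Q u + ?e u*q' u)"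
  "?e s*Q s = (LBINT u:{t..s}. - K1*?e u*Q u + ?e u*q' u)"
  using s Q0 by auto
 have B: "abs_cont t (%u. - (K0/K1)*?e u) (%u. - (K0/K1)*(- K1*?e u))"
  by (rule abs_cont_cmult[OF abs_cont_exp])
 from abs_contD[OF this, of s] have B: "sint {t..s} (%u. K0*?e u)"
  "(LBINT u:{t..s}. K0*?e u) = K0/K1 - K0/K1*?e s"
  using s K by auto
 have "?e s*Q s <= (LBINT u:{t..s}. K0*?e u)"
  unfolding A(2)
 proof (rule set_integral_mono[OF A(1) B(1)])
  fix u assume u: "u : {t..s}"
  have "q' u - K1*Q u <= K0" using le[of u] QL[of u] u s by (auto simp: q'_def)
  hence "?e u*(q' u - K1*Q u) <= ?e u*K0" by (rule mult_left_mono) simp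
  thus "- K1*?e u*Q u + ?e u*q' u <= K0*?e u" by (simp add: algebra_simps)
 qed
 hence "?e s*Q s <= K0/K1*(1 - ?e s)" unfolding B(2) by (simp add: algebra_simps)
 hence le1: "exp (K1*(s - t))*(?e s*Q s) <= exp (K1*(s - t))*(K0/K1*(1 - ?e s))"
  by (rule mult_left_mono) simp
 have Ee: "exp (K1*(s - t))*?e s = 1" by (simp add: exp_add[symmetric])
 have l: "exp (K1*(s - t))*(?e s*Q s) = Q s"
  by (simp only: mult.assoc[symmetric] Ee mult_1)
 have r: "exp (K1*(s - t))*(K0/K1*(1 - ?e s)) = K0/K1*(exp (K1*(s - t)) - exp (K1*(s - t))*?e s)"
 proof -
  have "E*(k*(1 - e)) = k*(E - E*e)" for E k e :: real by (simp add: algebra_simps)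
  thus ?thesis .
 qed
 from le1 have "Q s <= K0/K1*(exp (K1*(s - t)) - 1)" unfolding l r Ee .
 hence "K1*Q s <= K1*(K0/K1*(exp (K1*(s - t)) - 1))" using K by (intro mult_left_mono) auto
 also have "... = K0*(exp (K1*(s - t)) - 1)" using K by simp
 finally show ?thesis using le[OF s] QL[OF s] by (simp add: algebra_simps)
qed

lemma abs_cont_integral:
 assumes "!!s. t <= s ==> sint {t..s} w"
 shows "abs_cont t (%s. LBINT u:{t..s}. w u) w"
proof -
 have "(LBINT u:{t..t}. w u) = 0"
  using set_integral_sum_intervals[of 0 "%_. t" w] assms[of t] by simp
 thus ?thesis unfolding abs_cont_def using assms by simp
qed

lemma set_integral_singleton [simp]: "(LBINT u:{t}. w u) = (0::real)" for w :: "real => real"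
proof -
 have "AE u in lborel. ind {t} u *\<^sub>R w u = 0"
  using AE_lborel_singleton[of t] by eventually_elim (auto simp: indicator_def)
 thus ?thesis unfolding sli_def by (rule integral_eq_zero_AE)
qed

text \<open>Removing the part of the path after its energy has reached \<open>eta\<close>.\<close>

lemma energy_truncation:
 fixes x :: "real => real"
 assumes c: "continuous_on {t..} x" and s: "t <= s" and eta: "0 < eta"
 defines "V \<equiv> %s. LBINT u:{t..s}. (x u)^2"
 shows "(NS {t..s} (%u. ennreal ((x u)^2)*ind {u. V u < eta} u)) = ennreal (min (V s) eta)"
proof -
 have c2: "continuous_on {t..} (%u. (x u)^2)" by (intro continuous_intros c)
 have int: "sint {t..s} (%u. (x u)^2)" for s
  using borel_integrable_compact[of "{t..s}" "%u. (x u)^2"] continuous_on_subset[OF c2, of "{t..s}"]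
  by (auto simp: set_integrable_def)
 have V: "abs_cont t V (%u. (x u)^2)" unfolding V_def by (rule abs_cont_integral[OF int])
 have Vc: "continuous_on {t..} V" by (rule abs_cont_continuous[OF V])
 have Vt: "V t = 0" by (simp add: V_def)
 have mono: "V u <= V v" if "t <= u" "u <= v" for u v
 proof -
  have "0 <= (LBINT w:{u..v}. (x w)^2)" by (auto simp: sli_def intro!: integral_nonneg_AE)
  thus ?thesis using abs_cont_diff[OF V that] by simp
 qed
 have V0: "0 <= V u" if "t <= u" for u using mono[of t u] Vt that by simp
 have nn: "(NS {t..u} (%w. ennreal ((x w)^2))) = ennreal (V u)" for u
 proof -
  have "(NS {t..u} (%w. ennreal ((x w)^2))) = (NL w. ennreal (ind {t..u} w *\<^sub>R (x w)\<^sup>2))"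
   by (intro nn_integral_cong) (auto simp: indicator_def)
  also have "... = ennreal (V u)"
   unfolding V_def sli_def
   using int[of u] by (intro nn_integral_eq_integral) (auto simp: set_integrable_def)
  finally show ?thesis .
 qed
 have ivt: "EX u:{t..s}. V u = e" if "0 <= e" "e <= V s" for e
  using IVT'[of V t e s] continuous_on_subset[OF Vc, of "{t..s}"] that Vt s by auto
 show ?thesis
 proof (cases "V s < eta")
  case True
  have "(NS {t..s} (%u. ennreal ((x u)^2)*ind {u. V u < eta} u)) = (NS {t..s} (%w. ennreal ((x w)^2)))"
   by (intro nn_integral_cong) (use True le_less_trans[OF mono True] in "auto simp: indicator_def")
  thus ?thesis using True nn[of s] by (simp add: min_def)
 next
  case False
  show ?thesis
  proof (rule antisym)
   obtain u0 where u0: "u0 : {t..s}" "V u0 = eta" using ivt[of eta] eta False by auto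
   have "(NS {t..s} (%u. ennreal ((x u)^2)*ind {u. V u < eta} u)) <= (NS {t..u0} (%w. ennreal ((x w)^2)))"
   proof (rule nn_integral_mono)
    fix u
    have "u <= u0" if "V u < eta" "u : {t..s}"
    proof (rule ccontr)
     assume "\<not> u <= u0"
     hence "V u0 <= V u" using mono[of u0 u] u0 by auto
     thus False using that u0 by simp
    qed
    thus "ennreal ((x u)^2)*ind {u. V u < eta} u*ind {t..s} u <= ennreal ((x u)^2)*ind {t..u0} u"
     by (auto simp: indicator_def)
   qed
   also have "... = ennreal (min (V s) eta)" using u0 False nn[of u0] by (simp add: min_def)
   finally show "(NS {t..s} (%u. ennreal ((x u)^2)*ind {u. V u < eta} u)) <= ennreal (min (V s) eta)" .
   show "ennreal (min (V s) eta) <= (NS {t..s} (%u. ennreal ((x u)^2)*ind {u. V u < eta} u))"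
   \<comment> \<open>The level \<open>eta\<close> itself is excluded from the set; every smaller
     level \<open>e\<close> is attained at some time \<open>u1\<close>, up to which the energy stays
     below \<open>eta\<close>.\<close>
   proof (rule dense_le)
    fix y assume "y < ennreal (min (V s) eta)"
    moreover have "min (V s) eta = eta" using False by simp
    ultimately have y: "y < ennreal eta" by simp
    then obtain e where e: "y = ennreal e" "0 <= e" by (cases y) auto
    with y have "e < eta" by (simp add: ennreal_less_iff)
    then obtain u1 where u1: "u1 : {t..s}" "V u1 = e" using ivt[of e] e False by auto
    have "y = (NS {t..u1} (%w. ennreal ((x w)^2)))" using nn[of u1] u1 e by simp
    also have "... <= (NS {t..s} (%u. ennreal ((x u)^2)*ind {u. V u < eta} u))"
    proof (rule nn_integral_mono)
     fix u
     have "V u < eta" if "u : {t..u1}" using mono[of u u1] that u1 \<open>e < eta\<close> by auto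
     thus "ennreal ((x u)^2)*ind {t..u1} u <= ennreal ((x u)^2)*ind {u. V u < eta} u*ind {t..s} u"
      using u1 by (auto simp: indicator_def)
    qed
    finally show "y <= (NS {t..s} (%u. ennreal ((x u)^2)*ind {u. V u < eta} u))" .
   qed
  qed
 qed
qed

lemma set_integral_square_le:
 fixes w :: "real => real"
 assumes w: "sint {t..s} w" and b: "sint {t..s} b"
  and le: "!!u. u : {t..s} ==> (w u)^2 <= b u" and s: "t <= s"
 shows "(LBINT u:{t..s}. w u)^2 <= (s - t)*(LBINT u:{t..s}. b u)"
proof -
 have b0: "0 <= b u" if "u : {t..s}" for u using le[OF that] by (rule order_trans[OF zero_le_power2])
 have m: "(%u. ind {t..s} u *\<^sub>R w u) : bm lborel" using w by (simp add: set_integrable_def)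
 have "(%u. ennreal (abs (ind {t..s} u *\<^sub>R w u))) : bm lborel" using m by measurable
 hence m': "(%u. ennreal (abs (w u))*ind {t..s} u) : bm borel"
  by (simp only: measurable_lborel1 measurable_lborel2, subst measurable_cong[where g="%u. ennreal (abs (ind {t..s} u *\<^sub>R w u))"])
    (auto simp: indicator_def)
 have "ennreal (abs (LBINT u:{t..s}. w u)) <= (NL u. ennreal (norm (ind {t..s} u *\<^sub>R w u)))"
  unfolding sli_def
  using integral_norm_bound_ennreal[OF w[unfolded set_integrable_def]] by simp
 also have "... = (NS {t..s} (%u. ennreal (abs (w u))))"
  by (intro nn_integral_cong) (auto simp: indicator_def)
 finally have "(ennreal (abs (LBINT u:{t..s}. w u)))^2 <= (NS {t..s} (%u. ennreal (abs (w u))))^2"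
  by (rule power_mono) simp
 also have "... <= ennreal (s - t)*(NS {t..s} (%u. (ennreal (abs (w u)))^2))"
  by (rule set_nn_integral_power2_le[OF m' s])
 also have "(NS {t..s} (%u. (ennreal (abs (w u)))^2)) <= (NL u. ennreal (ind {t..s} u *\<^sub>R b u))"
  by (rule nn_integral_mono) (use le in "auto simp: indicator_def ennreal_power intro!: ennreal_leI")
 also have "... = ennreal (LBINT u:{t..s}. b u)"
  unfolding sli_def
  using b b0 by (intro nn_integral_eq_integral) (auto simp: set_integrable_def indicator_def)
 also have "ennreal (s - t)*ennreal (LBINT u:{t..s}. b u) = ennreal ((s - t)*(LBINT u:{t..s}. b u))"
  using s b0 by (intro ennreal_mult[symmetric]) (auto simp: sli_def indicator_def intro!: integral_nonneg_AE)
 finally have "ennreal ((LBINT u:{t..s}. w u)^2) <= ennreal ((s - t)*(LBINT u:{t..s}. b u))"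
  by (simp add: ennreal_power mult_left_mono)
 thus ?thesis
  using s b0 by (subst (asm) ennreal_le_iff)
   (auto simp: sli_def indicator_def intro!: mult_nonneg_nonneg integral_nonneg_AE)
qed

context brownian
begin

lemma cadapted_integral:
 fixes a :: "real => 'a => real"
 assumes a: "pred t a" and t: "0 <= t"
  and i: "!!w s. w : space M ==> t <= s ==> sint {t..s} (%u. a u w)"
 shows "cadapted t (%s w. LBINT u:{t..s}. a u w)"
 unfolding continuous_adapted_def
 using set_integral_F[OF a t] abs_cont_continuous[OF abs_cont_integral[OF i]] by auto

lemma cadapted_path:
 assumes "cadapted t X" "w : space M"
 shows "continuous_on {t..} (%s. X s w)"
 using assms by (auto simp: continuous_adapted_def)

lemma continuous_path_integrable:
 fixes x :: "real => real"
 assumes "continuous_on {t..} x"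
 shows "sint {t..s} x"
 using borel_integrable_compact[of "{t..s}" x] continuous_on_subset[OF assms, of "{t..s}"]
 by (auto simp: set_integrable_def)

text \<open>Gronwall's inequality needs a finite moment to start from. The moment is therefore
  restricted to the event that the energy \<open>V\<close> is below \<open>eta\<close>: by
  \<open>energy_truncation\<close> and Fubini the time integral of the restricted moments is the
  mean of \<open>min (V s w) eta\<close>, hence at most \<open>eta\<close>. The resulting bound does
  not depend on \<open>eta\<close>, which then tends to infinity.\<close>

lemma ito_moment_bound:
 fixes sigma0 :: "real^'n"
 assumes X: "itoproc t x a (%s w. X s w *\<^sub>R sigma0) X" and t: "0 <= t" "t <= T"
  and C: "0 <= C" "0 <= c0"
  and a: "AE w in M. ALL s:{t..T}. (a s w)^2 <= C*(c0 + (X s w)^2 + (LBINT u:{t..s}. (X u w)^2))"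
 shows "EX K>=0. (ALL s:{t..T}. (NP w. ennreal ((X s w)^2)) <= ennreal (K*(x^2 + c0)))"
proof -
 obtain I where I: "itoint t (%s w. X s w *\<^sub>R sigma0) I"
  and Xeq: "AE w in M. ALL s>=t. sint {t..s} (%u. a u w) & X s w = x + (LBINT u:{t..s}. a u w)+I s w"
  and XC: "cadapted t X"
  using X unfolding ito_process_def by blast
 define V where "V s w = (LBINT u:{t..s}. (X u w)^2)" for s w
 have Xp: "pred t X" by (rule cadapted_pred[OF XC])
 have X2p: "pred t (%s w. (X s w)^2)" using Xp unfolding predictable_alt by (rule borel_measurable_power)
 have cX: "continuous_on {t..} (%s. X s w)" if "w : space M" for w by (rule cadapted_path[OF XC that])
 have cX2: "continuous_on {t..} (%s. (X s w)^2)" if "w : space M" for w by (intro continuous_intros cX[OF that])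
 have X2i: "sint {t..s} (%u. (X u w)^2)" if "w : space M" for s w
  by (rule continuous_path_integrable[OF cX2[OF that]])
 have VC: "cadapted t V" unfolding V_def by (rule cadapted_integral[OF X2p t(1) X2i])
 have Vp: "pred t V" by (rule cadapted_pred[OF VC])
 have V0: "0 <= V s w" for s w unfolding V_def by (auto simp: sli_def intro!: integral_nonneg_AE)
 have Vmono: "V u w <= V s w" if "w : space M" "t <= u" "u <= s" for u s w
 proof -
  have "V s w = V u w + (LBINT u:{u..s}. (X u w)^2)"
   unfolding V_def by (rule set_integral_split_at(1)[OF X2i[OF that(1)] that(2,3)])
  thus ?thesis by (auto simp: sli_def intro!: integral_nonneg_AE)
 qed
 have qv: "qvar (%s w. X s w *\<^sub>R sigma0) t s w = ennreal ((norm sigma0)^2*V s w)" if "w : space M" for s w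
 proof -
  have "qvar (%s w. X s w *\<^sub>R sigma0) t s w = (NL u. ennreal (ind {t..s} u *\<^sub>R ((norm sigma0)^2*(X u w)^2)))"
   by (intro nn_integral_cong) (auto simp: indicator_def power_mult_distrib mult.commute)
  also have "... = ennreal (LBINT u:{t..s}. (norm sigma0)^2*(X u w)^2)"
   unfolding sli_def
  proof (rule nn_integral_eq_integral)
   have "sint {t..s} (%u. (norm sigma0)^2*(X u w)^2)" using X2i[OF that] by simp
   thus "integrable lborel (%u. ind {t..s} u *\<^sub>R ((norm sigma0)^2*(X u w)^2))" by (simp only: set_integrable_def)
  qed simp
  also have "... = ennreal ((norm sigma0)^2*V s w)" by (simp add: V_def)
  finally show ?thesis .
 qed
 define T' where "T' = T - t"
 have T'0: "0 <= T'" using t by (simp add: T'_def)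
 \<comment> \<open>The square of a sum of three terms costs a factor 3 each: \<open>A\<close>
   collects the data and \<open>B\<close> the energy, where \<open>9*(norm sigma0)^2\<close> is 3
   times the 3 of \<open>ito_local_isometry\<close>. The final 1 makes \<open>B\<close> positive for
   Gronwall.\<close>
 define A where "A = 3 + 3*T'^2*C"
 define B where "B = 3*T'*C*(1 + T')+9*(norm sigma0)^2 + 1"
 have A0: "0 <= A" using T'0 C by (simp add: A_def)
 have B0: "0 < B" using T'0 C by (auto simp: B_def intro!: add_nonneg_pos add_nonneg_nonneg mult_nonneg_nonneg)
 have XP [measurable]: "X s : bm P" if "t <= s" for s using cadapted_P[OF XC that] .
 have VP [measurable]: "V s : bm P" if "t <= s" for s using cadapted_P[OF VC that] .
 have IP [measurable]: "I s : bm P" if "t <= s" for s using cadapted_P[OF ito_integralD(2)[OF I] that] .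
 define E where "E eta s = (NP w. ennreal ((X s w)^2)*ind {w : space M. V s w < eta} w)" for eta s
 have key: "E eta s <= ennreal ((x^2 + c0)*A*exp (B*(s - t)))" if eta: "0 < eta" and s: "s : {t..T}" for eta s
 proof -
  define f where "f u w = (if u : {t..} then ennreal ((X u w)^2)*(if V u w < eta then 1 else 0) else 0)" for u w
  note [measurable] = predictable_P[OF X2p t(1), of 0] predictable_P[OF Vp t(1), of 0]
  have fm: "(%x. f (fst x) (snd x)) : bm (BxP)"
  proof -
   have "(%x. ennreal (if fst x : {t..} then (X (fst x) (snd x))\<^sup>2 else 0)*(if (if fst x : {t..} then V (fst x) (snd x) else 0) < eta then 1 else 0)) : bm (BxP)"
    by measurable
   thus ?thesis by (rule measurable_eqI) (auto simp: f_def)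
  qed
  have Ef: "E eta u = (NP w. f u w)" if "t <= u" for u
   unfolding E_def by (intro nn_integral_cong) (use that in "auto simp: f_def indicator_def")
  have pair: "pair_sigma_finite P (lborel :: real measure)" by (rule pair_sigma_finite.intro) unfold_locales
  interpret PL: pair_sigma_finite P "lborel :: real measure" by (rule pair)
  have fub: "(NP w. ennreal (min (V s w) eta)) = (NS {t..s} (%u. E eta u))" if s: "t <= s" for s
  proof -
   have "(NP w. ennreal (min (V s w) eta)) = (NP w. (NL u. f u w*ind {t..s} u))"
   proof (rule nn_integral_cong)
    fix w assume "w : space P"
    hence w: "w : space M" by simp
    have "ennreal (min (V s w) eta) = (NS {t..s} (%u. ennreal ((X u w)^2)*ind {u. V u w < eta} u))"
     unfolding V_def using energy_truncation[OF cX[OF w] s eta] by simp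
    also have "... = (NL u. f u w*ind {t..s} u)"
     by (intro nn_integral_cong) (auto simp: f_def indicator_def)
    finally show "ennreal (min (V s w) eta) = (NL u. f u w*ind {t..s} u)" .
   qed
   also have "... = (NL u. (NP w. f u w*ind {t..s} u))"
   proof (rule PL.Fubini'[symmetric])
    have "(%x. (snd x, fst x)) : P \<Otimes>\<^sub>M lborel \<rightarrow>\<^sub>M BxP" by measurable
    from measurable_compose[OF this fm]
    have [measurable]: "(%x. f (snd x) (fst x)) : bm (P \<Otimes>\<^sub>M lborel)" by simp
    have "(%x. f (snd x) (fst x)*ind {t..s} (snd x)) : bm (P \<Otimes>\<^sub>M lborel)" by measurable
    thus "(%(w, u). f u w*ind {t..s} u) : bm (P \<Otimes>\<^sub>M lborel)" by (simp add: split_beta')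
   qed
   also have "... = (NS {t..s} (%u. E eta u))"
   proof (rule nn_integral_cong)
    fix u
    show "(NP w. f u w*ind {t..s} u) = E eta u*ind {t..s} u"
     using Ef[of u] by (auto simp: indicator_def)
   qed
   finally show ?thesis .
  qed
  have step: "E eta s <= ennreal ((x^2 + c0)*A)+ennreal B*(NS {t..s} (%u. E eta u))" if s: "s : {t..T}" for s
  proof -
   have ts: "t <= s" "s - t <= T'" "0 <= s - t" using s by (auto simp: T'_def)
   let ?ind = "%w. ind {w : space M. V s w < eta} w"
   have "E eta s <= (NP w. ennreal ((x^2 + c0)*A)+ennreal (3*T'*C*(1 + T'))*ennreal (min (V s w) eta)
     + 3*(ennreal ((I s w)^2)*?ind w))"
    unfolding E_def
   proof (rule nn_integral_mono_AE)
    show "AE w in P. ennreal ((X s w)^2)*?ind w <= ennreal ((x^2 + c0)*A)+ennreal (3*T'*C*(1 + T'))*ennreal (min (V s w) eta)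
     + 3*(ennreal ((I s w)^2)*?ind w)"
     using AE_completion[OF Xeq] AE_completion[OF a] AE_space
    proof eventually_elim
     case (elim w)
     hence w: "w : space M" by simp
     show ?case
     proof (cases "V s w < eta")
      case True
      have ai: "sint {t..s} (%u. a u w)" and Xs: "X s w = x + (LBINT u:{t..s}. a u w)+I s w"
       using elim(1) ts by auto
      have bi1: "sint {t..s} (%u. C*(c0 + V s w))"
       by (rule continuous_path_integrable[OF continuous_on_const])
      have bi2: "sint {t..s} (%u. C*(X u w)^2)"
       by (rule continuous_path_integrable) (intro continuous_intros cX[OF w])
      note bi = set_integral_add(1)[OF bi1 bi2]
      have "(LBINT u:{t..s}. a u w)^2 <= (s - t)*(LBINT u:{t..s}. C*(c0 + V s w)+C*(X u w)^2)"
      proof (rule set_integral_square_le[OF ai bi _ ts(1)])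
       fix u assume u: "u : {t..s}"
       have "(a u w)^2 <= C*(c0 + (X u w)^2 + V u w)" using elim(2) u s by (auto simp: V_def)
       also have "... <= C*(c0 + (X u w)^2 + V s w)" using Vmono[OF w, of u s] u C by (intro mult_left_mono) auto
       finally show "(a u w)^2 <= C*(c0 + V s w)+C*(X u w)^2" by (simp add: algebra_simps)
      qed
      also have "(LBINT u:{t..s}. C*(c0 + V s w)+C*(X u w)^2) = (s - t)*(C*(c0 + V s w))+C*V s w"
      proof -
       have "(LBINT u:{t..s}. C*(c0 + V s w)) = (s - t)*(C*(c0 + V s w))"
        using ts by (simp add: sli_def)
       thus ?thesis
        unfolding set_integral_add(2)[OF bi1 bi2] by (simp add: V_def)
      qed
      also have "(s - t) * ... <= T'*(T'*(C*(c0 + V s w))+C*V s w)"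
       using ts C V0[of s w] T'0 by (intro mult_mono add_mono mult_right_mono add_nonneg_nonneg mult_nonneg_nonneg) auto
      finally have aa: "(LBINT u:{t..s}. a u w)^2 <= T'^2*C*c0 + T'*C*(1 + T')*V s w"
       by (simp add: algebra_simps power2_eq_square)
      have sq3: "(p + q + r)^2 <= 3*p^2 + 3*q^2 + 3*r^2" for p q r :: real
      proof -
       have "0 <= (p - q)^2 + (q - r)^2 + (p - r)^2" by simp
       thus ?thesis by (simp add: power2_eq_square algebra_simps)
      qed
      have "(X s w)^2 <= 3*x^2 + 3*(LBINT u:{t..s}. a u w)^2 + 3*(I s w)^2"
       unfolding Xs by (rule sq3)
      also have "... <= 3*x^2 + 3*(T'^2*C*c0 + T'*C*(1 + T')*V s w)+3*(I s w)^2"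
       using aa by simp
      also have "... <= (x^2 + c0)*A + (3*T'*C*(1 + T'))*V s w + 3*(I s w)^2"
      proof -
       have "(x^2 + c0)*A = 3*x^2 + 3*(T'^2*C*c0)+(3*c0 + 3*T'^2*C*x^2)"
        by (simp add: A_def algebra_simps)
       moreover have "0 <= 3*c0 + 3*T'^2*C*x^2" using C by (intro add_nonneg_nonneg mult_nonneg_nonneg) auto
       ultimately show ?thesis by (simp add: algebra_simps)
      qed
      finally have "ennreal ((X s w)^2) <= ennreal ((x^2 + c0)*A + (3*T'*C*(1 + T'))*V s w + 3*(I s w)^2)"
       by (rule ennreal_leI)
      also have "... = ennreal ((x^2 + c0)*A)+ennreal (3*T'*C*(1 + T'))*ennreal (V s w)+3*ennreal ((I s w)^2)"
       using A0 C T'0 V0[of s w] by (simp add: ennreal_plus ennreal_mult)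
      finally show ?thesis using True w by (simp add: indicator_def min_def)
     qed (simp add: indicator_def)
    qed
   qed
   also have "... = ennreal ((x^2 + c0)*A)+ennreal (3*T'*C*(1 + T'))*(NP w. ennreal (min (V s w) eta))
     + 3*(NP w. ennreal ((I s w)^2)*?ind w)"
   proof -
    have [measurable]: "{w : space M. V s w < eta} : sets P"
    proof -
     have "{w : space P. V s w < eta} : sets P" using VP[OF ts(1)] by measurable
     thus ?thesis by simp
    qed
    show ?thesis using ts by (simp add: nn_integral_add nn_integral_cmult emeasure_space_1)
   qed
   also have "(NP w. ennreal ((I s w)^2)*?ind w) <= ennreal (3*(norm sigma0)^2)*(NP w. ennreal (min (V s w) eta))"
   proof (cases "sigma0 = 0")
    \<comment> \<open>Without noise the event in \<open>ito_local_isometry\<close> would be empty,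
      as both sides of its strict inequality are zero.\<close>
    case True
    have "(NP w. ennreal ((I s w)^2)*?ind w) <= (NP w. ennreal ((I s w)^2))"
     by (rule nn_integral_mono) (auto simp: indicator_def)
    also have "... <= 3*(NP w. qvar (%s w. X s w *\<^sub>R sigma0) t s w)"
     by (rule ito_square_integral_le[OF I t(1) ts(1)])
    also have "... = 0" using True by simp
    finally show ?thesis by simp
   next
    case False
    define n where "n = (norm sigma0)^2"
    have n0: "0 < n" using False by (simp add: n_def)
    have "(NP w. ennreal ((I s w)^2)*?ind w)
     = (NP w. ennreal ((I s w)^2)*ind {w : space M. qvar (%s w. X s w *\<^sub>R sigma0) t s w < ennreal (n * eta)} w)"
    proof (rule nn_integral_cong)
     fix w assume "w : space P"
     hence w: "w : space M" by simp
     have "qvar (%s w. X s w *\<^sub>R sigma0) t s w < ennreal (n * eta) \<longleftrightarrow> V s w < eta"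
      unfolding qv[OF w] n_def[symmetric] using n0 V0[of s w] by (simp add: ennreal_less_iff)
     thus "ennreal ((I s w)^2)*?ind w = ennreal ((I s w)^2)*ind {w : space M. qvar (%s w. X s w *\<^sub>R sigma0) t s w < ennreal (n * eta)} w"
      using w by (simp add: indicator_def)
    qed
    also have "... <= 3*(NP w. min (qvar (%s w. X s w *\<^sub>R sigma0) t s w) (ennreal (n * eta)))"
     by (rule ito_local_isometry[OF I t(1) ts(1)]) (use n0 eta in simp)
    also have "(NP w. min (qvar (%s w. X s w *\<^sub>R sigma0) t s w) (ennreal (n * eta))) = (NP w. ennreal n*ennreal (min (V s w) eta))"
    proof (rule nn_integral_cong)
     fix w assume "w : space P"
     hence w: "w : space M" by simp
     show "min (qvar (%s w. X s w *\<^sub>R sigma0) t s w) (ennreal (n * eta)) = ennreal n*ennreal (min (V s w) eta)"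
      unfolding qv[OF w] n_def[symmetric] using n0 V0[of s w] eta
      by (simp add: min_ennreal ennreal_mult[symmetric] min_mult_distrib_left)
    qed
    also have "... = ennreal n*(NP w. ennreal (min (V s w) eta))"
     using ts by (intro nn_integral_cmult) measurable
    finally show ?thesis using n0 by (simp add: n_def ennreal_mult mult.assoc)
   qed
   finally have "E eta s <= ennreal ((x^2 + c0)*A)+ennreal (3*T'*C*(1 + T'))*(NP w. ennreal (min (V s w) eta))
     + 3*(ennreal (3*(norm sigma0)^2)*(NP w. ennreal (min (V s w) eta)))"
    by (simp add: add_mono mult_left_mono)
   also have "... = ennreal ((x^2 + c0)*A)+(ennreal (3*T'*C*(1 + T'))+3*ennreal (3*(norm sigma0)^2))*(NP w. ennreal (min (V s w) eta))"
    by (simp add: distrib_right add.assoc mult.assoc)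
   also have "ennreal (3*T'*C*(1 + T'))+3*ennreal (3*(norm sigma0)^2) <= ennreal B"
   proof -
    have "3*ennreal (3*(norm sigma0)^2) = ennreal (9*(norm sigma0)^2)"
     by (subst ennreal_numeral[symmetric], subst ennreal_mult[symmetric]) auto
    hence "ennreal (3*T'*C*(1 + T'))+3*ennreal (3*(norm sigma0)^2) = ennreal (3*T'*C*(1 + T')+9*(norm sigma0)^2)"
     using C T'0 by (simp add: ennreal_plus[symmetric] del: ennreal_plus)
    thus ?thesis by (simp add: B_def ennreal_leI)
   qed
   finally show ?thesis unfolding fub[OF ts(1)] by (simp add: mult_right_mono)
  qed
  have fin: "(NS {t..s} (%u. E eta u)) < \<infinity>" if "t <= s" for s
  proof -
   have "(NP w. ennreal (min (V s w) eta)) <= (NP w. ennreal eta)"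
    by (intro nn_integral_mono ennreal_leI) simp
   also have "... < \<infinity>" by (simp add: emeasure_space_1)
   finally show ?thesis unfolding fub[OF that] .
  qed
  have Efin: "E eta s < \<infinity>" if "s : {t..T}" for s
   using step[OF that] fin[of s] that by (auto simp: ennreal_mult_less_top elim!: le_less_trans)
  define q where "q u = enn2real (E eta u)" for u
  have q0: "0 <= q u" for u by (simp add: q_def)
  have Eq: "E eta s = ennreal (q s)" if "s : {t..T}" for s using Efin[OF that] by (simp add: q_def)
  have Em: "(%u. E eta u*ind {t..T} u) : bm lborel"
  proof -
   have fm': "(%(u, w). f u w) : bm (LxP)"
   proof -
    have "(%x. f (fst x) (snd x)) : bm (LxP)"
     using fm by (simp add: measurable_cong_sets[OF sets_pair_measure_cong[OF sets_lborel refl] refl])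
    thus ?thesis by (simp add: split_beta')
   qed
   have "(%u. (NP w. f u w)) : bm lborel"
    by (rule P.borel_measurable_nn_integral[OF fm'])
   hence "(%u. (NP w. f u w)*ind {t..T} u) : bm lborel" by measurable
   thus ?thesis by (rule measurable_eqI) (use Ef in "auto simp: indicator_def")
  qed
  have nnq: "(NL u. ennreal (ind {t..s} u *\<^sub>R q u)) = (NS {t..s} (%u. E eta u))" if "s <= T" for s
   by (intro nn_integral_cong) (use Eq that in "auto simp: indicator_def")
  have qi: "sint {t..T} q"
   unfolding set_integrable_def
  proof (rule integrableI_nonneg)
   have "(%u. enn2real (E eta u*ind {t..T} u)) : bm lborel" using Em by measurable
   thus "(%u. ind {t..T} u *\<^sub>R q u) : bm lborel"
    by (rule measurable_eqI) (auto simp: indicator_def q_def)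
   show "(NL u. ennreal (ind {t..T} u *\<^sub>R q u)) < \<infinity>" unfolding nnq[OF order_refl] by (rule fin[OF t(2)])
  qed (use q0 in auto)
  have qle: "q s <= (x^2 + c0)*A + B*(LBINT u:{t..s}. q u)" if s: "s : {t..T}" for s
  proof -
   have qis: "sint {t..s} q" by (rule set_integrable_subset[OF qi]) (use s in auto)
   have "(NS {t..s} (%u. E eta u)) = ennreal (LBINT u:{t..s}. q u)"
    unfolding sli_def nnq[symmetric, of s]
    using qis s q0 by (subst nnq[symmetric]) (auto simp: set_integrable_def intro!: nn_integral_eq_integral)
   hence "ennreal (q s) <= ennreal ((x^2 + c0)*A + B*(LBINT u:{t..s}. q u))"
    using step[OF s] Eq[OF s] A0 B0 C q0
    by (simp add: ennreal_plus ennreal_mult sli_def integral_nonneg_AE)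
   thus ?thesis
    using A0 B0 C q0 by (subst (asm) ennreal_le_iff) (auto simp: sli_def intro!: add_nonneg_nonneg mult_nonneg_nonneg integral_nonneg_AE)
  qed
  have "q s <= (x^2 + c0)*A*exp (B*(s - t))"
   by (rule gronwall_integral[OF qi _ B0 qle s]) (use A0 C in auto)
  thus ?thesis unfolding Eq[OF s] by (rule ennreal_leI)
 qed
 define K where "K = A*exp (B*T')"
 have K0: "0 <= K" using A0 by (simp add: K_def)
 have "(NP w. ennreal ((X s w)^2)) <= ennreal (K*(x^2 + c0))" if s: "s : {t..T}" for s
 proof -
  have ts: "t <= s" using s by simp
  let ?f = "%n w. ennreal ((X s w)^2)*ind {w : space P. V s w < real (Suc n)} w"
  have "(NP w. ennreal ((X s w)^2)) = (NP w. liminf (%n. ?f n w))"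
  proof (rule nn_integral_cong)
   fix w assume w: "w : space P"
   obtain n0 where n0: "V s w < real n0" using reals_Archimedean2 by blast
   have "\<forall>\<^sub>F n in sequentially. ?f n w = ennreal ((X s w)^2)"
    unfolding eventually_sequentially by (intro exI[of _ n0]) (use n0 w in "auto simp: indicator_def")
   hence "(%n. ?f n w) ----> ennreal ((X s w)^2)" by (rule tendsto_eventually)
   thus "ennreal ((X s w)^2) = liminf (%n. ?f n w)" by (rule lim_imp_Liminf[OF sequentially_bot, symmetric])
  qed
  also have "... <= liminf (%n. (NP w. ?f n w))"
   by (rule nn_integral_liminf) (use XP[OF ts] VP[OF ts] in measurable)
  also have "... <= ennreal (K*(x^2 + c0))"
  proof (rule Liminf_le)
   show "\<forall>\<^sub>F n in sequentially. (NP w. ?f n w) <= ennreal (K*(x^2 + c0))"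
   proof (rule always_eventually, rule allI)
    fix n
    have "(NP w. ?f n w) <= ennreal ((x^2 + c0)*A*exp (B*(s - t)))"
     using key[of "real (Suc n)" s] s by (simp add: E_def)
    also have "... <= ennreal (K*(x^2 + c0))"
    proof (rule ennreal_leI)
     have "exp (B*(s - t)) <= exp (B*T')" using s B0 by (simp add: T'_def)
     hence "(x^2 + c0)*A*exp (B*(s - t)) <= (x^2 + c0)*A*exp (B*T')"
      using A0 C by (intro mult_left_mono) auto
     thus "(x^2 + c0)*A*exp (B*(s - t)) <= K*(x^2 + c0)" by (simp add: K_def mult_ac)
    qed
    finally show "(NP w. ?f n w) <= ennreal (K*(x^2 + c0))" .
   qed
  qed simp
  finally show ?thesis .
 qed
 with K0 show ?thesis by blast
qed

text \<open>Countably many grid times have a common null set, and continuity of the paths does the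
  rest.\<close>

lemma AE_zero_process:
 assumes X: "cadapted t X" and z: "!!s. t <= s ==> AE w in M. X s w = (0::real)"
 shows "AE w in M. ALL s>=t. X s w = 0"
proof -
 have "AE w in M. ALL n k :: nat. X (t + real k/real (Suc n)) w = 0"
  unfolding AE_all_countable by (intro allI z) simp
 thus ?thesis
  using AE_space
 proof eventually_elim
  case (elim w)
  show ?case
  proof (intro allI impI)
   fix s assume s: "t <= s"
   define k where "k n = nat \<lfloor>(s - t)*real (Suc n)\<rfloor>" for n
   have kb: "real (k n) <= (s - t)*real (Suc n)" "(s - t)*real (Suc n) < real (k n)+1" for n
   proof -
    have f0: "0 <= \<lfloor>(s - t)*real (Suc n)\<rfloor>" using s by (simp add: mult_nonneg_nonneg)
    hence "real (k n) = of_int \<lfloor>(s - t)*real (Suc n)\<rfloor>" by (simp add: k_def)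
    thus "real (k n) <= (s - t)*real (Suc n)" "(s - t)*real (Suc n) < real (k n)+1" by linarith+
   qed
   have lim: "(%n. t + real (k n)/real (Suc n)) ----> s"
   proof (rule tendsto_sandwich)
    show "\<forall>\<^sub>F n in sequentially. s - inverse (real (Suc n)) <= t + real (k n)/real (Suc n)"
    proof (rule always_eventually, rule allI)
     fix n
     have "s - t <= (real (k n)+1)/real (Suc n)" using kb(2)[of n] by (simp add: pos_le_divide_eq less_imp_le del: of_nat_Suc)
     also have "... = real (k n)/real (Suc n)+inverse (real (Suc n))" by (simp add: add_divide_distrib inverse_eq_divide)
     finally show "s - inverse (real (Suc n)) <= t + real (k n)/real (Suc n)" by linarith
    qed
    show "\<forall>\<^sub>F n in sequentially. t + real (k n)/real (Suc n) <= s"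
    proof (rule always_eventually, rule allI)
     fix n
     have "real (k n)/real (Suc n) <= s - t" using kb(1)[of n] by (simp add: pos_divide_le_eq del: of_nat_Suc)
     thus "t + real (k n)/real (Suc n) <= s" by linarith
    qed
    show "(%n. s - inverse (real (Suc n))) ----> s"
     using tendsto_diff[OF tendsto_const LIMSEQ_inverse_real_of_nat, of s] by simp
   qed simp
   have "(%n. X (t + real (k n)/real (Suc n)) w) ----> X s w"
    by (rule continuous_on_tendsto_compose[OF cadapted_path[OF X elim(2)] lim]) (use s in auto)
   hence "(%n. 0) ----> X s w" using elim(1) by simp
   thus "X s w = 0" by (simp add: LIMSEQ_const_iff)
  qed
 qed
qed

text \<open>The bound of \<open>ito_moment_bound\<close> is proportional to the squared initial
  value plus \<open>c0\<close>, both zero here.\<close>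

lemma ito_linear_unique:
 assumes X: "itoproc t 0 a (%s w. X s w *\<^sub>R sigma0) X" and t: "0 <= t"
  and a: "!!T. t <= T ==> EX C>=0. AE w in M. ALL s:{t..T}. (a s w)^2 <= C*((X s w)^2 + (LBINT u:{t..s}. (X u w)^2))"
 shows "AE w in M. ALL s>=t. X s w = 0"
proof (rule AE_zero_process)
 show XC: "cadapted t X" using X by (simp add: ito_process_def)
 fix s assume s: "t <= s"
 obtain C where C: "0 <= C" "AE w in M. ALL u:{t..s}. (a u w)^2 <= C*((X u w)^2 + (LBINT v:{t..u}. (X v w)^2))"
  using a[OF s] by blast
 have "EX K>=0. (ALL u:{t..s}. (NP w. ennreal ((X u w)^2)) <= ennreal (K*(0\<^sup>2 + 0)))"
  by (rule ito_moment_bound[OF X t s C(1)]) (use C(2) in auto)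
 hence "(NP w. ennreal ((X s w)^2)) = 0" using s by auto
 hence "AE w in P. ennreal ((X s w)^2) = 0"
  by (subst (asm) nn_integral_0_iff_AE) (use cadapted_P[OF XC s] in auto)
 hence "AE w in P. X s w = 0" by eventually_elim auto
 thus "AE w in M. X s w = 0" by (simp add: AE_P_iff)
qed

end

section \<open>The delay term and the kernel functional\<close>

lemma integrable_indicator_Icc: "integrable lborel (ind {a..b} :: real => real)"
 by (rule integrable_real_indicator) (simp_all add: emeasure_lborel_Icc_eq)

locale delay_path =
 fixes t d :: real and phi x1 y :: "real => real"
 assumes t0: "0 <= t" and d0: "0 < d" and phi2: "phi : L2_space d" and x12: "x1 : L2_space d"
  and y_hist: "!!ze. ze : {-d..<0} ==> y (t + ze) = x1 ze" and y_cont: "continuous_on {t..} y"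
begin

definition phie :: "real => real" where "phie ze = ind {-d..0} ze * phi ze"

text \<open>\<open>Y\<close> continues the path by zero before \<open>t - d\<close>, and
  \<open>phie\<close> continues the kernel by zero outside \<open>{-d..0}\<close>. Both are Borel on
  the whole line, which turns the delay term into a convolution that translation invariance can
  handle.\<close>

definition Y :: "real => real" where
 "Y u = (if t <= u then y u else ind {-d..<0} (u - t)*x1 (u - t))"

definition delay :: "real => real" where "delay s = (LBINT ze:{-d..0}. phi ze*y (s + ze))"

lemma Y_eq: "t - d <= u ==> Y u = y u"
 using y_hist[of "u - t"] by (auto simp: Y_def indicator_def)

lemma Y_0: "u < t - d ==> Y u = 0"
 using d0 by (auto simp: Y_def indicator_def)

lemma phie_measurable [measurable]: "phie : bm borel"
 using phi2 by (simp add: L2_space_def set_borel_measurable_def phie_def[abs_def])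

lemma Y_measurable [measurable]: "Y : bm borel"
proof -
 have [measurable]: "(%ze. ind {-d..0} ze*x1 ze) : bm borel"
  using x12 by (simp add: L2_space_def set_borel_measurable_def)
 have c: "continuous_on UNIV (%u. y (max t u))"
  by (rule continuous_on_compose2[OF y_cont]) (auto intro!: continuous_intros)
 have [measurable]: "(%u. y (max t u)) : bm borel" by (rule borel_measurable_continuous_onI[OF c])
 have "(%u. if t <= u then y (max t u) else ind {..<0} (u - t)*(ind {-d..0} (u - t)*x1 (u - t))) : bm borel"
  by measurable
 thus ?thesis
  by (rule measurable_eqI) (auto simp: Y_def indicator_def max_def)
qed

lemma phie_square: "integrable lborel (%ze. (phie ze)^2)" "(LINT ze|lborel. (phie ze)^2) = (LBINT ze:{-d..0}. (phi ze)^2)"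
proof -
 have eq: "(phie ze)^2 = ind {-d..0} ze *\<^sub>R (phi ze)\<^sup>2" for ze by (auto simp: phie_def indicator_def)
 show "integrable lborel (%ze. (phie ze)^2)" "(LINT ze|lborel. (phie ze)^2) = (LBINT ze:{-d..0}. (phi ze)^2)"
  unfolding eq using phi2 by (auto simp: L2_space_def set_integrable_def sli_def)
qed

lemma integrable_from_square:
 fixes f :: "real => real"
 assumes [measurable]: "f : bm borel" and "integrable lborel (%u. (f u)^2)" and "!!u. u \<notin> {a..b} ==> f u = 0"
 shows "integrable lborel f"
proof (rule Bochner_Integration.integrable_bound[where f="%u. (f u)^2 + ind {a..b} u"])
 show "integrable lborel (%u. (f u)^2 + ind {a..b} u)" using assms(2) by (intro Bochner_Integration.integrable_add integrable_indicator_Icc)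
 have "abs (f u) <= (f u)^2 + ind {a..b} u" for u
 proof (cases "u : {a..b}")
  case True
  have "0 <= (abs (f u) - 1)^2" by simp
  hence "2*abs (f u) <= (f u)^2 + 1" by (simp add: power2_eq_square algebra_simps)
  thus ?thesis using True by simp
 qed (simp add: assms(3))
 thus "AE u in lborel. norm (f u) <= norm ((f u)^2 + ind {a..b} u)"
  by (intro AE_I2) (auto intro: order_trans[OF _ abs_ge_self])
qed simp

lemma phie_integrable: "integrable lborel phie"
 by (rule integrable_from_square[OF phie_measurable phie_square(1), of "-d" 0]) (simp add: phie_def indicator_def)

definition x1_norm :: real where "x1_norm = (LBINT ze:{-d..0}. (x1 ze)^2)"
definition phi_norm :: real where "phi_norm = (LBINT ze:{-d..0}. (phi ze)^2)"

lemma norms_nonneg: "0 <= x1_norm" "0 <= phi_norm"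
 by (auto simp: x1_norm_def phi_norm_def sli_def intro!: integral_nonneg_AE)

lemma Y_square:
 assumes s: "t <= s"
 shows "integrable lborel (%u. (ind {..s} u*Y u)^2)"
  "(LINT u|lborel. (ind {..s} u*Y u)^2) <= x1_norm + (LBINT u:{t..s}. (y u)^2)"
proof -
 have i1: "integrable lborel (%ze. ind {-d..0} ze *\<^sub>R (x1 ze)\<^sup>2)" using x12 by (simp add: L2_space_def set_integrable_def)
 have i2: "integrable lborel (%u. ind {t..s} u *\<^sub>R (y u)\<^sup>2)"
 proof -
  have "continuous_on {t..s} (%u. (y u)^2)" by (intro continuous_intros continuous_on_subset[OF y_cont]) auto
  from borel_integrable_compact[OF _ this] show ?thesis by simp
 qed
 have i3: "integrable lborel (%u. ind {-d..0} (- t + 1*u) *\<^sub>R (x1 (- t + 1*u))\<^sup>2)"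
  by (rule lborel_integrable_real_affine[OF i1]) simp
 have e3: "(LINT u|lborel. ind {-d..0} (- t + 1*u) *\<^sub>R (x1 (- t + 1*u))\<^sup>2) = x1_norm"
  unfolding x1_norm_def sli_def
  by (subst lborel_integral_real_affine[of 1 _ "-t"]) auto
 let ?G = "%u. ind {-d..0} (- t + 1*u) *\<^sub>R (x1 (- t + 1*u))\<^sup>2 + ind {t..s} u *\<^sub>R (y u)\<^sup>2"
 have le: "(ind {..s} u*Y u)^2 <= ?G u" for u
  by (auto simp: Y_def indicator_def power2_eq_square)
 have Gi: "integrable lborel ?G" by (rule Bochner_Integration.integrable_add[OF i3 i2])
 show i: "integrable lborel (%u. (ind {..s} u*Y u)^2)"
  by (rule Bochner_Integration.integrable_bound[OF Gi]) (use le order_trans[OF _ abs_ge_self] in auto)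
 have "(LINT u|lborel. (ind {..s} u*Y u)^2) <= (LINT u|lborel. ?G u)" by (rule integral_mono[OF i Gi le])
 also have "... = x1_norm + (LBINT u:{t..s}. (y u)^2)"
  unfolding Bochner_Integration.integral_add[OF i3 i2] e3 sli_def ..
 finally show "(LINT u|lborel. (ind {..s} u*Y u)^2) <= x1_norm + (LBINT u:{t..s}. (y u)^2)" .
qed

lemma delay_alt:
 assumes s: "t <= s"
 shows "delay s = (LINT ze|lborel. phie ze*Y (s + ze))" "delay s = (LINT u|lborel. phie (u - s)*Y u)"
proof -
 show 1: "delay s = (LINT ze|lborel. phie ze*Y (s + ze))"
  unfolding delay_def sli_def
  by (rule Bochner_Integration.integral_cong) (use s in "auto simp: phie_def indicator_def Y_eq")
 show "delay s = (LINT u|lborel. phie (u - s)*Y u)"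
  unfolding 1 by (subst lborel_integral_real_affine[of 1 _ "-s"]) auto
qed

text \<open>Cauchy-Schwarz gives a bound by the initial history plus the energy of the path, which
  is the shape of the drift hypothesis in \<open>ito_moment_bound\<close>.\<close>

lemma delay_integrable:
 assumes s: "t <= s"
 shows "integrable lborel (%u. phie (u - s)*Y u)"
  and "(delay s)^2 <= phi_norm*(x1_norm + (LBINT u:{t..s}. (y u)^2))"
proof -
 have phis: "integrable lborel (%u. (phie (u - s))^2)" "(LINT u|lborel. (phie (u - s))^2) = phi_norm"
 proof -
  have "integrable lborel (%u. (phie (- s + 1*u))^2)"
   by (rule lborel_integrable_real_affine[OF phie_square(1)]) simp
  thus "integrable lborel (%u. (phie (u - s))^2)" by simp
  show "(LINT u|lborel. (phie (u - s))^2) = phi_norm"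
   unfolding phi_norm_def phie_square(2)[symmetric] by (subst (2) lborel_integral_real_affine[of 1 _ "-s"]) auto
 qed
 note Ys = Y_square[OF s]
 have eq: "phie (u - s)*Y u = phie (u - s)*(ind {..s} u*Y u)" for u
  by (auto simp: phie_def indicator_def)
 show i: "integrable lborel (%u. phie (u - s)*Y u)"
  unfolding eq
 proof (rule Bochner_Integration.integrable_bound[OF Bochner_Integration.integrable_add[OF phis(1) Ys(1)]])
  show "AE u in lborel. norm (phie (u - s)*(ind {..s} u*Y u)) <= norm ((phie (u - s))^2 + (ind {..s} u*Y u)^2)"
  proof (rule AE_I2)
   fix u
   have "abs (phie (u - s)*(ind {..s} u*Y u)) <= (phie (u - s))^2 + (ind {..s} u*Y u)^2"
    using abs_mult_le_squares[of "phie (u - s)" "ind {..s} u*Y u"] by linarith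
   thus "norm (phie (u - s)*(ind {..s} u*Y u)) <= norm ((phie (u - s))^2 + (ind {..s} u*Y u)^2)"
    unfolding real_norm_def by (rule order_trans[OF _ abs_ge_self])
  qed
 qed measurable
 have "ennreal (abs (delay s)) <= (NL u. ennreal (abs (phie (u - s)*Y u)))"
  unfolding delay_alt(2)[OF s] using integral_norm_bound_ennreal[OF i] by simp
 also have "... = (NL u. ennreal (abs (phie (u - s)))*ennreal (abs (ind {..s} u*Y u)))"
  unfolding eq by (simp only: abs_mult[of "phie _"]) (simp add: ennreal_mult)
 finally have "(ennreal (abs (delay s)))^2 <= (NL u. ennreal (abs (phie (u - s)))*ennreal (abs (ind {..s} u*Y u)))^2"
  by (rule power_mono) simp
 also have "... <= (NL u. (ennreal (abs (phie (u - s))))^2)*(NL u. (ennreal (abs (ind {..s} u*Y u)))^2)"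
  by (rule Cauchy_Schwarz_nn_integral) measurable
 also have "... = ennreal phi_norm*ennreal (LINT u|lborel. (ind {..s} u*Y u)^2)"
  using phis Ys(1) by (simp add: ennreal_power nn_integral_eq_integral)
 also have "... <= ennreal phi_norm*ennreal (x1_norm + (LBINT u:{t..s}. (y u)^2))"
  by (intro mult_left_mono ennreal_leI Ys(2)) simp
 also have "... = ennreal (phi_norm*(x1_norm + (LBINT u:{t..s}. (y u)^2)))"
  using norms_nonneg by (intro ennreal_mult[symmetric]) (auto simp: sli_def intro!: add_nonneg_nonneg integral_nonneg_AE)
 finally show "(delay s)^2 <= phi_norm*(x1_norm + (LBINT u:{t..s}. (y u)^2))"
  using norms_nonneg by (subst (asm) ennreal_power, simp, subst (asm) ennreal_le_iff)
   (auto simp: sli_def intro!: mult_nonneg_nonneg add_nonneg_nonneg integral_nonneg_AE)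
qed

text \<open>As a parameter integral \<open>delay\<close> is measurable on \<open>{t..s}\<close>, and
  the bound of \<open>delay_integrable\<close> is uniform there since the energy increases in
  time.\<close>

lemma delay_set_integrable: "sint {t..s} delay"
proof -
 define B where "B = phi_norm*(x1_norm + (LBINT u:{t..s}. (y u)^2))"
 have m: "(%s. LINT u|lborel. phie (u - s)*Y u) : bm borel" by measurable
 show ?thesis
  unfolding set_integrable_def
 proof (rule Bochner_Integration.integrable_bound[where f="%u. ind {t..s} u*(1 + B)"])
  show "integrable lborel (%u. ind {t..s} u*(1 + B))" by (intro integrable_mult_left integrable_indicator_Icc)
  have "(%u. ind {t..s} u *\<^sub>R (LINT v|lborel. phie (v - u)*Y v)) : bm lborel" using m by measurable
  thus "(%u. ind {t..s} u *\<^sub>R delay u) : bm lborel"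
   by (rule measurable_eqI) (auto simp: indicator_def delay_alt(2))
  show "AE u in lborel. norm (ind {t..s} u *\<^sub>R delay u) <= norm (ind {t..s} u*(1 + B))"
  proof (rule AE_I2)
   fix u
   show "norm (ind {t..s} u *\<^sub>R delay u) <= norm (ind {t..s} u*(1 + B))"
   proof (cases "u : {t..s}")
    case True
    have si: "sint {t..s} (%u. (y u)^2)"
     by (rule borel_integrable_compact[folded set_integrable_def]) (auto intro!: continuous_intros continuous_on_subset[OF y_cont])
    have "(LBINT v:{t..s}. (y v)^2) = (LBINT v:{t..u}. (y v)^2)+(LBINT v:{u..s}. (y v)^2)"
     by (rule set_integral_split_at(1)[OF si]) (use True in auto)
    moreover have "0 <= (LBINT v:{u..s}. (y v)^2)" by (auto simp: sli_def intro!: integral_nonneg_AE)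
    ultimately have "(delay u)^2 <= B"
     unfolding B_def using norms_nonneg True
     by (intro order_trans[OF delay_integrable(2)] mult_left_mono) auto
    moreover have "abs (delay u) <= 1 + (delay u)^2"
     using abs_mult_le_squares[of 1 "delay u"] by simp
    ultimately have "abs (delay u) <= 1 + B" by linarith
    thus ?thesis using True by simp
   qed simp
  qed
 qed
qed

end

section \<open>The functional of past income given by the kernel \<open>h\<close>\<close>

locale kernel_path = delay_path +
 fixes g :: "real => real" and h :: "real => real => real" and r delta beta tauR :: real
 assumes gh: "gh_solution r delta beta tauR d phi g h"
begin

definition G :: "real => real" where "G q = ind {t..} q*(exp (- (r + delta)*q)*g q)"

lemma g_late: "tauR <= s ==> 0 <= s ==> g s = 0"
 using gh by (auto simp: gh_solution_def)

lemma g_cont: "continuous_on {0..} g"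
 using gh by (auto simp: gh_solution_def)

lemma G_measurable [measurable]: "G : bm borel"
proof -
 have c: "continuous_on UNIV (%u. g (max 0 u))"
  by (rule continuous_on_compose2[OF g_cont]) (auto intro!: continuous_intros)
 have [measurable]: "(%u. g (max 0 u)) : bm borel" by (rule borel_measurable_continuous_onI[OF c])
 have "(%q. ind {t..} q*(exp (- (r + delta)*q)*g (max 0 q))) : bm borel" by measurable
 thus ?thesis
  by (rule measurable_eqI) (use t0 in "auto simp: G_def indicator_def max_def")
qed

lemma G_bounded: "EX B>=0. ALL q. abs (G q) <= B"
proof -
 have c: "continuous_on {t..tauR} (%q. exp (- (r + delta)*q)*g q)"
  by (intro continuous_intros continuous_on_subset[OF g_cont]) (use t0 in auto)
 obtain B where B: "0 <= B" "!!q. q : {t..tauR} ==> abs (exp (- (r + delta)*q)*g q) <= B"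
  by (rule continuous_Icc_bounded[OF c]) blast
 have "abs (G q) <= B" for q
 proof (cases "q : {t..tauR}")
  case True
  thus ?thesis using B(2)[OF True] by (simp add: G_def)
 next
  case False
  hence "G q = 0" using g_late[of q] t0 by (auto simp: G_def indicator_def)
  thus ?thesis using B(1) by simp
 qed
 thus ?thesis using B(1) by blast
qed

text \<open>Substituting \<open>q = s + ze - tau\<close> gathers the discount factors into one that
  depends on \<open>q\<close> alone. The lower limit of the original integral becomes
  \<open>q <= tauR\<close> together with the support of \<open>phi\<close>, and these are taken over
  by \<open>G\<close> and \<open>phie\<close>.\<close>

lemma h_conv:
 assumes s: "t <= s" and z: "ze : {-d..0}"
 shows "exp (- (r + delta) * s)*h s ze = (LINT q|lborel. ind {s<..} q*(G q * phie (s + ze - q)))"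
proof (cases "s < tauR")
 case True
 have hs: "h s ze = (LBINT tau:{max (ze + s - tauR) (-d)..ze}. exp (- (r + delta)*(ze - tau))*g (s + ze - tau) * phi tau)"
  using gh s t0 z True by (auto simp: gh_solution_def)
 also have "... = (LINT q|lborel. ind {max (ze + s - tauR) (-d)..ze} (s + ze + (-1)*q) *\<^sub>R
   (exp (- (r + delta)*(ze - (s + ze + (-1)*q)))*g (s + ze - (s + ze + (-1)*q)) * phi (s + ze + (-1)*q)))"
  unfolding sli_def by (subst lborel_integral_real_affine[of "-1" _ "s + ze"]) auto
 finally have "exp (- (r + delta) * s)*h s ze = (LINT q|lborel. exp (- (r + delta) * s)*(ind {max (ze + s - tauR) (-d)..ze} (s + ze + (-1)*q) *\<^sub>R
   (exp (- (r + delta)*(ze - (s + ze + (-1)*q)))*g (s + ze - (s + ze + (-1)*q)) * phi (s + ze + (-1)*q))))"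
  by simp
 also have "... = (LINT q|lborel. ind {s<..} q*(G q * phie (s + ze - q)))"
 proof -
  let ?f = "%q. exp (- (r + delta) * s)*(ind {max (ze + s - tauR) (-d)..ze} (s + ze + (-1)*q) *\<^sub>R
   (exp (- (r + delta)*(ze - (s + ze + (-1)*q)))*g (s + ze - (s + ze + (-1)*q)) * phi (s + ze + (-1)*q)))"
  have eq: "?f q = ind {s..} q*(G q * phie (s + ze - q))" for q
  proof (cases "s <= q")
   case sq: True
   have e: "exp (- (r + delta) * s)*exp (- (r + delta)*(ze - (s + ze + (-1)*q))) = exp (- (r + delta)*q)"
    unfolding exp_add[symmetric] by (rule arg_cong[where f=exp]) (simp add: algebra_simps)
   have Gq: "G q = exp (- (r + delta)*q)*g q" using sq s by (simp add: G_def)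
   have ind: "ind {max (ze + s - tauR) (-d)..ze} (s + ze + (-1)*q) = (if q <= tauR & - d <= s + ze - q then 1 else 0 :: real)"
    using sq by (auto simp: indicator_def)
   have pe: "phie (s + ze - q) = (if - d <= s + ze - q then phi (s + ze - q) else 0)"
    using sq z by (auto simp: phie_def indicator_def)
   show ?thesis
   proof (cases "q <= tauR")
    case True
    have "?f q = (exp (- (r + delta) * s)*exp (- (r + delta)*(ze - (s + ze + (-1)*q))))*(ind {max (ze + s - tauR) (-d)..ze} (s + ze + (-1)*q)*(g q * phi (s + ze - q)))"
     by simp
    also have "... = ind {s..} q*(G q * phie (s + ze - q))"
     unfolding e ind Gq pe using True sq by simp
    finally show ?thesis .
   next
    case False
    hence "g q = 0" using g_late[of q] sq s t0 by auto
    thus ?thesis unfolding ind Gq using False by simp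
   qed
  next
   case False
   thus ?thesis by (auto simp: indicator_def)
  qed
  have "(LINT q|lborel. ?f q) = (LINT q|lborel. ind {s..} q*(G q * phie (s + ze - q)))" unfolding eq ..
  also have "... = (LINT q|lborel. ind {s<..} q*(G q * phie (s + ze - q)))"
  proof (rule integral_cong_AE)
   show "AE q in lborel. ind {s..} q*(G q * phie (s + ze - q)) = ind {s<..} q*(G q * phie (s + ze - q))"
    using AE_lborel_singleton[of s] by eventually_elim (auto simp: indicator_def)
  qed measurable
  finally show ?thesis .
 qed
 finally show ?thesis .
next
 case False
 hence "h s ze = 0" using gh s t0 z by (auto simp: gh_solution_def)
 moreover have "ind {s<..} q*(G q * phie (s + ze - q)) = 0" for q
  using g_late[of q] False s t0 by (auto simp: G_def indicator_def)
 ultimately show ?thesis by (simp only: Bochner_Integration.integral_zero mult_zero_right)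
qed

definition kernel :: "real => real" where "kernel s = (LBINT ze:{-d..0}. h s ze*y (s + ze))"

text \<open>For \<open>x = (u, q)\<close>, the contribution of income at time \<open>u\<close> to
  the discounted \<open>g q * delay q\<close>. One function serves all \<open>s\<close>; only the
  region of integration moves.\<close>

definition Psi :: "real \<times> real => real" where "Psi x = Y (fst x)*(G (snd x) * phie (fst x - snd x))"

lemma Psi_measurable [measurable]: "Psi : bm (lborel \<Otimes>\<^sub>M lborel)"
 unfolding Psi_def by measurable

lemma Psi_integrable: "integrable (lborel \<Otimes>\<^sub>M lborel) (%x. ind {..s} (fst x) * Psi x)"
proof -
 obtain B where B: "0 <= B" "!!q. abs (G q) <= B" using G_bounded by blast
 define s' where "s' = max s t"
 have Yi: "integrable lborel (%u. ind {..s'} u*Y u)"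
  by (rule integrable_from_square[OF _ Y_square(1), of s' "t - d" s']) (auto simp: s'_def indicator_def Y_0)
 have phii: "integrable lborel (%q. phie (u - q))" "(LINT q|lborel. abs (phie (u - q))) = (LINT ze|lborel. abs (phie ze))" for u
 proof -
  have "integrable lborel (%q. phie (u + (-1)*q))" by (rule lborel_integrable_real_affine[OF phie_integrable]) simp
  thus "integrable lborel (%q. phie (u - q))" by simp
  show "(LINT q|lborel. abs (phie (u - q))) = (LINT ze|lborel. abs (phie ze))"
   by (subst (2) lborel_integral_real_affine[of "-1" _ u]) auto
 qed
 have Gi: "integrable lborel (%q. G q * phie (u - q))" for u
  by (rule Bochner_Integration.integrable_bound[where f="%q. B * phie (u - q)"])
    (use phii(1) B in "auto simp: abs_mult intro!: mult_right_mono")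
 have Gle: "(LINT q|lborel. abs (G q * phie (u - q))) <= B*(LINT ze|lborel. abs (phie ze))" for u
 proof -
  have "(LINT q|lborel. abs (G q * phie (u - q))) <= (LINT q|lborel. B*abs (phie (u - q)))"
   by (rule integral_mono[OF integrable_abs[OF Gi] integrable_mult_right[OF integrable_abs[OF phii(1)]]])
     (use B in "auto simp: abs_mult intro!: mult_right_mono")
  thus ?thesis by (simp add: phii(2))
 qed
 have "integrable (lborel \<Otimes>\<^sub>M lborel) (%x. ind {..s'} (fst x) * Psi x)"
 proof (rule lborel_pair.Fubini_integrable)
  show "(%x. ind {..s'} (fst x) * Psi x) : bm (lborel \<Otimes>\<^sub>M lborel)" by measurable
  have n: "(LINT q|lborel. norm (ind {..s'} (fst (u, q)) * Psi (u, q))) = abs (ind {..s'} u*Y u)*(LINT q|lborel. abs (G q * phie (u - q)))" for u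
   by (simp add: Psi_def abs_mult mult.assoc)
  show "integrable lborel (%u. LINT q|lborel. norm (ind {..s'} (fst (u, q)) * Psi (u, q)))"
   unfolding n
  proof (rule Bochner_Integration.integrable_bound[where f="%u. abs (ind {..s'} u*Y u)*(B*(LINT ze|lborel. abs (phie ze)))"])
   show "integrable lborel (%u. abs (ind {..s'} u*Y u)*(B*(LINT ze|lborel. abs (phie ze))))"
    using Yi by (intro integrable_mult_left integrable_abs)
   show "AE u in lborel. norm (abs (ind {..s'} u*Y u)*(LINT q|lborel. abs (G q * phie (u - q)))) <= norm (abs (ind {..s'} u*Y u)*(B*(LINT ze|lborel. abs (phie ze))))"
   proof (rule AE_I2)
    fix u
    have "abs (LINT q|lborel. abs (G q * phie (u - q))) <= abs (B*(LINT ze|lborel. abs (phie ze)))"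
     using Gle[of u] by (simp add: abs_of_nonneg integral_nonneg_AE B)
    thus "norm (abs (ind {..s'} u*Y u)*(LINT q|lborel. abs (G q * phie (u - q)))) <= norm (abs (ind {..s'} u*Y u)*(B*(LINT ze|lborel. abs (phie ze))))"
     unfolding real_norm_def abs_mult[of "abs _"] by (intro mult_left_mono) auto
   qed
  qed measurable
  show "AE u in lborel. integrable lborel (%q. ind {..s'} (fst (u, q)) * Psi (u, q))"
   using Gi by (simp add: Psi_def mult.assoc)
 qed
 thus ?thesis
 proof (rule Bochner_Integration.integrable_bound)
  show "AE x in lborel \<Otimes>\<^sub>M lborel. norm (ind {..s} (fst x) * Psi x) <= norm (ind {..s'} (fst x) * Psi x)"
   by (rule AE_I2) (auto simp: s'_def indicator_def)
 qed measurable
qed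

lemma Psi_support: "Psi (u, q) ~= 0 ==> u <= q" "Psi (u, q) ~= 0 ==> t <= q" "Psi (u, q) ~= 0 ==> q - d <= u"
 by (auto simp: Psi_def phie_def G_def indicator_def split: if_splits)

lemma kernel_double:
 assumes s: "t <= s"
 shows "exp (- (r + delta) * s)*kernel s = (LINT x|(lborel \<Otimes>\<^sub>M lborel). ind {..s} (fst x)*ind {s<..} (snd x) * Psi x)"
proof -
 have i: "integrable (lborel \<Otimes>\<^sub>M lborel) (%x. ind {..s} (fst x)*ind {s<..} (snd x) * Psi x)"
  by (rule Bochner_Integration.integrable_bound[OF Psi_integrable[of s]]) (auto simp: indicator_def)
 have "exp (- (r + delta) * s)*kernel s = (LINT ze|lborel. exp (- (r + delta) * s)*(ind {-d..0} ze *\<^sub>R (h s ze*y (s + ze))))"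
  unfolding kernel_def sli_def by simp
 also have "... = (LINT ze|lborel. ind {-d..0} ze*(Y (s + ze)*(LINT q|lborel. ind {s<..} q*(G q * phie (s + ze - q)))))"
 proof (rule Bochner_Integration.integral_cong[OF refl])
  fix ze
  show "exp (- (r + delta) * s)*(ind {-d..0} ze *\<^sub>R (h s ze*y (s + ze)))
   = ind {-d..0} ze*(Y (s + ze)*(LINT q|lborel. ind {s<..} q*(G q * phie (s + ze - q))))"
  proof (cases "ze : {-d..0}")
   case True
   hence "Y (s + ze) = y (s + ze)" using s by (intro Y_eq) auto
   thus ?thesis using True h_conv[OF s True, symmetric] by simp
  qed simp
 qed
 also have "... = (LINT u|lborel. ind {-d..0} (u - s)*(Y u*(LINT q|lborel. ind {s<..} q*(G q * phie (u - q)))))"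
  by (subst lborel_integral_real_affine[of 1 _ "-s"]) auto
 also have "... = (LINT u|lborel. (LINT q|lborel. ind {..s} (fst (u, q))*ind {s<..} (snd (u, q)) * Psi (u, q)))"
 proof (rule Bochner_Integration.integral_cong[OF refl])
  fix u
  have "(LINT q|lborel. ind {..s} (fst (u, q))*ind {s<..} (snd (u, q)) * Psi (u, q))
   = (LINT q|lborel. ind {-d..0} (u - s)*(Y u*(ind {s<..} q*(G q * phie (u - q)))))"
  proof (rule Bochner_Integration.integral_cong[OF refl])
   fix q
   show "ind {..s} (fst (u, q))*ind {s<..} (snd (u, q)) * Psi (u, q)
    = ind {-d..0} (u - s)*(Y u*(ind {s<..} q*(G q * phie (u - q))))"
    by (auto simp: Psi_def phie_def indicator_def)
  qed
  thus "ind {-d..0} (u - s)*(Y u*(LINT q|lborel. ind {s<..} q*(G q * phie (u - q))))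
   = (LINT q|lborel. ind {..s} (fst (u, q))*ind {s<..} (snd (u, q)) * Psi (u, q))"
   by simp
 qed
 also have "... = (LINT x|(lborel \<Otimes>\<^sub>M lborel). ind {..s} (fst x)*ind {s<..} (snd x) * Psi x)"
  by (rule lborel_pair.integral_fst'[OF i])
 finally show ?thesis .
qed

text \<open>The discounted kernel is the integral of \<open>Psi\<close> over
  \<open>u <= s < q\<close>. From \<open>t\<close> to \<open>s\<close> this region gains the strip
  \<open>t < u <= s\<close> and loses the strip \<open>t < q <= s\<close>; integrating the first
  over \<open>q\<close> yields the term with \<open>h p 0\<close>, the second over \<open>u\<close>
  yields the delay term. Thus \<open>h\<close>, known only to be continuous, is never
  differentiated.\<close>

lemma kernel_increment:
 assumes s: "t <= s"
 shows "sint {t..s} (%p. exp (- (r + delta)*p)*(h p 0*y p - g p*delay p))" (is ?A)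
  and "exp (- (r + delta) * s)*kernel s = exp (- (r + delta)*t)*kernel t
   + (LBINT p:{t..s}. exp (- (r + delta)*p)*(h p 0*y p - g p*delay p))" (is ?B)
proof -
 let ?P = "lborel \<Otimes>\<^sub>M lborel :: (real \<times> real) measure"
 have i1: "integrable ?P (%x. ind {..s} (fst x)*ind {s<..} (snd x) * Psi x)"
  and i2: "integrable ?P (%x. ind {..t} (fst x)*ind {t<..} (snd x) * Psi x)"
  by (rule Bochner_Integration.integrable_bound[OF Psi_integrable[of s]]; use s in "auto simp: indicator_def")+
 have i3: "integrable ?P (%x. ind {t<..s} (fst x) * Psi x)"
  by (rule Bochner_Integration.integrable_bound[OF Psi_integrable[of s]]) (auto simp: indicator_def)
 have i4: "integrable ?P (%x. ind {t<..s} (snd x) * Psi x)"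
 proof (rule Bochner_Integration.integrable_bound[OF Psi_integrable[of s]])
  show "AE x in ?P. norm (ind {t<..s} (snd x) * Psi x) <= norm (ind {..s} (fst x) * Psi x)"
  proof (rule AE_I2)
   fix x :: "real \<times> real"
   show "norm (ind {t<..s} (snd x) * Psi x) <= norm (ind {..s} (fst x) * Psi x)"
    using Psi_support(1)[of "fst x" "snd x"] by (cases "Psi x = 0") (auto simp: indicator_def)
  qed
 qed measurable
 have "exp (- (r + delta) * s)*kernel s - exp (- (r + delta)*t)*kernel t
  = (LINT x|?P. ind {..s} (fst x)*ind {s<..} (snd x) * Psi x - ind {..t} (fst x)*ind {t<..} (snd x) * Psi x)"
  unfolding kernel_double[OF s] kernel_double[OF order_refl]
  by (rule Bochner_Integration.integral_diff[OF i1 i2, symmetric])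
 \<comment> \<open>On the support of \<open>Psi\<close> one has \<open>u <= q\<close>, so
   \<open>q <= s\<close> forces \<open>u <= s\<close>, which makes the two differences of indicators
   equal.\<close>
 also have "... = (LINT x|?P. ind {t<..s} (fst x) * Psi x - ind {t<..s} (snd x) * Psi x)"
 proof (rule Bochner_Integration.integral_cong[OF refl])
  fix x :: "real \<times> real"
  show "ind {..s} (fst x)*ind {s<..} (snd x) * Psi x - ind {..t} (fst x)*ind {t<..} (snd x) * Psi x
   = ind {t<..s} (fst x) * Psi x - ind {t<..s} (snd x) * Psi x"
   using Psi_support(1)[of "fst x" "snd x"] s by (cases "Psi x = 0") (auto simp: indicator_def)
 qed
 also have "... = (LINT x|?P. ind {t<..s} (fst x) * Psi x) - (LINT x|?P. ind {t<..s} (snd x) * Psi x)"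
  by (rule Bochner_Integration.integral_diff[OF i3 i4])
 finally have diff: "exp (- (r + delta) * s)*kernel s - exp (- (r + delta)*t)*kernel t
  = (LINT x|?P. ind {t<..s} (fst x) * Psi x) - (LINT x|?P. ind {t<..s} (snd x) * Psi x)" .
 define f1 where "f1 p = exp (- (r + delta)*p)*(h p 0*y p)" for p
 define f2 where "f2 p = exp (- (r + delta)*p)*(g p*delay p)" for p
 have e1: "(LINT q|lborel. ind {t<..s} (fst (u, q)) * Psi (u, q)) = ind {t<..s} u *\<^sub>R f1 u" for u
 proof (cases "u : {t<..s}")
  case True
  have "(LINT q|lborel. G q * phie (u - q)) = (LINT q|lborel. ind {u<..} q*(G q * phie (u + 0 - q)))"
  proof (rule integral_cong_AE)
   show "AE q in lborel. G q * phie (u - q) = ind {u<..} q*(G q * phie (u + 0 - q))"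
    using AE_lborel_singleton[of u] by eventually_elim (auto simp: indicator_def phie_def)
  qed measurable
  also have "... = exp (- (r + delta)*u)*h u 0" by (rule h_conv[symmetric]) (use True d0 in auto)
  finally show ?thesis using True by (simp add: Psi_def f1_def Y_def mult_ac)
 qed simp
 have e2: "(LINT u|lborel. ind {t<..s} (snd (u, q)) * Psi (u, q)) = ind {t<..s} q *\<^sub>R f2 q" for q
 proof (cases "q : {t<..s}")
  case True
  have "(LINT u|lborel. ind {t<..s} (snd (u, q)) * Psi (u, q)) = (LINT u|lborel. G q*(phie (u - q)*Y u))"
   using True by (simp add: Psi_def mult_ac)
  also have "... = G q*delay q" using True by (simp add: delay_alt(2))
  finally show ?thesis using True by (simp add: f2_def G_def)
 qed simp
 have j1: "integrable lborel (%u. ind {t<..s} u *\<^sub>R f1 u)" "(LINT x|?P. ind {t<..s} (fst x) * Psi x) = (LINT u|lborel. ind {t<..s} u *\<^sub>R f1 u)"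
  using lborel_pair.integrable_fst'[OF i3] lborel_pair.integral_fst'[OF i3] unfolding e1 by auto
 have i4': "integrable ?P (%(u, q). ind {t<..s} (snd (u, q)) * Psi (u, q))" using i4 by (simp add: split_beta')
 have j2: "integrable lborel (%q. ind {t<..s} q *\<^sub>R f2 q)" "(LINT x|?P. ind {t<..s} (snd x) * Psi x) = (LINT q|lborel. ind {t<..s} q *\<^sub>R f2 q)"
  using lborel_pair.integrable_snd[OF i4'] lborel_pair.integral_snd[OF i4'] unfolding e2 by (auto simp: split_beta')
 have j3: "integrable lborel (%u. ind {t<..s} u *\<^sub>R (f1 u - f2 u))"
  using Bochner_Integration.integrable_diff[OF j1(1) j2(1)] by (simp add: right_diff_distrib)
 have D: "exp (- (r + delta) * s)*kernel s - exp (- (r + delta)*t)*kernel t = (LINT u|lborel. ind {t<..s} u *\<^sub>R (f1 u - f2 u))"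
  unfolding diff j1(2) j2(2) Bochner_Integration.integral_diff[OF j1(1) j2(1), symmetric] by (simp add: right_diff_distrib)
 have ae: "AE u in lborel. ind {t<..s} u *\<^sub>R (f1 u - f2 u) = ind {t..s} u *\<^sub>R (f1 u - f2 u)"
  using AE_lborel_singleton[of t] by eventually_elim (auto simp: indicator_def)
 have f12: "exp (- (r + delta)*p)*(h p 0*y p - g p*delay p) = f1 p - f2 p" for p
  by (simp add: f1_def f2_def right_diff_distrib)
 have m: "(%u. ind {t..s} u *\<^sub>R (f1 u - f2 u)) : bm lborel"
 proof -
  have "(%u. ind {t<..s} u *\<^sub>R (f1 u - f2 u)+ind {t} u*(if t <= s then f1 t - f2 t else 0)) : bm lborel"
   using j3 by measurable
  thus ?thesis by (rule measurable_eqI) (auto simp: indicator_def)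
 qed
 show ?A
  unfolding set_integrable_def f12
  by (rule Bochner_Integration.integrable_cong_AE[THEN iffD1, OF _ m ae j3]) (use j3 in auto)
 have "(LINT u|lborel. ind {t<..s} u *\<^sub>R (f1 u - f2 u)) = (LINT u|lborel. ind {t..s} u *\<^sub>R (f1 u - f2 u))"
  by (rule integral_cong_AE[OF _ m ae]) (use j3 in auto)
 thus ?B
  using D unfolding sli_def f12 by simp
qed

lemma kernel_abs_cont: "abs_cont t kernel (%p. (r + delta)*kernel p + h p 0*y p - g p*delay p)"
proof -
 let ?c = "r + delta"
 have "abs_cont t (%s. exp (- ?c * s)*kernel s) (%p. exp (- ?c*p)*(h p 0*y p - g p*delay p))"
  unfolding abs_cont_def using kernel_increment by blast
 from abs_cont_mult[OF abs_cont_exp[of t ?c 0] this]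
 show ?thesis
 proof (rule abs_cont_cong)
  fix u
  have e: "exp (?c*(u - 0))*exp (- ?c*u) = 1" by (simp add: exp_add[symmetric] algebra_simps)
  have "exp (?c*(u - 0))*(exp (- ?c*u)*X) = X" for X
   by (simp only: mult.assoc[symmetric] e mult_1)
  thus "exp (?c*(u - 0))*(exp (- ?c*u)*kernel u) = kernel u"
   "?c*exp (?c*(u - 0))*(exp (- ?c*u)*kernel u)+exp (?c*(u - 0))*(exp (- ?c*u)*(h u 0*y u - g u*delay u))
    = ?c*kernel u + h u 0*y u - g u*delay u"
   by (simp_all only: mult.assoc)
 qed
qed

text \<open>Discounting with \<open>beta\<close> writes \<open>g\<close> as a tail integral of one
  function \<open>w\<close>, set to zero from retirement on; the density follows by undoing the
  discount.\<close>

lemma g_abs_cont: "abs_cont t g (%s. beta*g s - (if s < tauR then h s 0 + 1 else 0))"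
proof -
 define w where "w u = (if u < tauR then exp (- beta*u)*(h u 0 + 1) else 0)" for u
 have hc: "continuous_on {0..} (%u. h u 0)"
 proof -
  have c: "continuous_on ({0..} \<times> {-d..0}) (%x. h (fst x) (snd x))" using gh by (simp add: gh_solution_def split_beta')
  have "continuous_on {0..} (%u. (u, 0 :: real))" by (intro continuous_intros)
  moreover have "(%u. (u, 0 :: real)) ` {0..} \<subseteq> {0..} \<times> {-d..0}" using d0 by auto
  ultimately show ?thesis using continuous_on_compose2[OF c, of "{0..}" "%u. (u, 0)"] by simp
 qed
 have wc: "continuous_on {t..} (%u. exp (- beta*u)*(h u 0 + 1))"
  by (intro continuous_intros continuous_on_subset[OF hc]) (use t0 in auto)
 have wi: "sint {a..b} w" if "t <= a" for a b
 proof -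
  have c: "continuous_on {a..b} (%u. exp (- beta*u)*(h u 0 + 1))" by (rule continuous_on_subset[OF wc]) (use that in auto)
  have "integrable lborel (%u. ind {..<tauR} u *\<^sub>R (ind {a..b} u *\<^sub>R (exp (- beta*u)*(h u 0 + 1))))"
   by (rule integrable_mult_indicator[OF _ borel_integrable_compact[OF _ c]]) auto
  thus ?thesis unfolding set_integrable_def
   by (rule Bochner_Integration.integrable_cong[THEN iffD1, rotated 2]) (auto simp: w_def indicator_def)
 qed
 have gw: "exp (- beta * s)*g s = (LBINT u:{s..max s tauR}. w u)" if s: "t <= s" for s
 proof (cases "s < tauR")
  case True
  have "g s = (LBINT u:{s..tauR}. exp (- beta*(u - s))*(h u 0 + 1))"
   using gh s t0 True by (auto simp: gh_solution_def)
  hence "exp (- beta * s)*g s = (LBINT u:{s..tauR}. exp (- beta * s)*(exp (- beta*(u - s))*(h u 0 + 1)))" by simp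
  also have "... = (LINT u|lborel. ind {s..tauR} u *\<^sub>R (exp (- beta*u)*(h u 0 + 1)))"
   unfolding sli_def
  proof (rule Bochner_Integration.integral_cong[OF refl])
   fix u
   have "exp (- beta * s)*exp (- beta*(u - s)) = exp (- beta*u)"
    unfolding exp_add[symmetric] by (rule arg_cong[where f=exp]) (simp add: algebra_simps)
   thus "ind {s..tauR} u *\<^sub>R (exp (- beta * s)*(exp (- beta*(u - s))*(h u 0 + 1))) = ind {s..tauR} u *\<^sub>R (exp (- beta*u)*(h u 0 + 1))"
    by (simp only: mult.assoc[symmetric])
  qed
  also have "... = (LBINT u:{s..max s tauR}. w u)"
   unfolding sli_def
  proof (rule integral_cong_AE)
   have "continuous_on {s..tauR} (%u. exp (- beta*u)*(h u 0 + 1))" by (rule continuous_on_subset[OF wc]) (use s in auto)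
   thus "(%u. ind {s..tauR} u *\<^sub>R (exp (- beta*u)*(h u 0 + 1))) : bm lborel"
    using borel_integrable_compact[of "{s..tauR}" "%u. exp (- beta*u)*(h u 0 + 1)"] by auto
   show "(%u. ind {s..max s tauR} u *\<^sub>R w u) : bm lborel" using wi[OF s, of "max s tauR"] by (simp add: set_integrable_def)
   show "AE u in lborel. ind {s..tauR} u *\<^sub>R (exp (- beta*u)*(h u 0 + 1)) = ind {s..max s tauR} u *\<^sub>R w u"
    using AE_lborel_singleton[of tauR] by eventually_elim (use True in "auto simp: indicator_def w_def")
  qed
  finally show ?thesis .
 next
  case False
  hence "g s = 0" using g_late[of s] s t0 by auto
  thus ?thesis using False by simp
 qed
 have "abs_cont t (%s. exp (- beta * s)*g s) (%u. - w u)"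
  unfolding abs_cont_def
 proof (intro allI impI conjI)
  fix s assume s: "t <= s"
  show "sint {t..s} (%u. - w u)" using wi[of t s] by (simp add: set_integrable_def)
  \<comment> \<open>A common upper limit for the tail integrals at \<open>t\<close> and at
    \<open>s\<close>; beyond \<open>tauR\<close> the integrand is zero.\<close>
  define m where "m = max s tauR"
  have z: "(LBINT u:{a..b}. w u) = 0" if "tauR <= a" for a b
   unfolding sli_def by (rule integral_eq_zero_AE) (use that in "auto simp: w_def indicator_def")
  have ext: "(LBINT u:{a..max a tauR}. w u) = (LBINT u:{a..m}. w u)" if a: "t <= a" "a <= s" for a
  proof -
   have "(LBINT u:{a..m}. w u) = (LBINT u:{a..max a tauR}. w u)+(LBINT u:{max a tauR..m}. w u)"
    by (rule set_integral_split_at(1)[OF wi[OF a(1)]]) (use a in "auto simp: m_def")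
   thus ?thesis using z[of "max a tauR" m] by simp
  qed
  have "(LBINT u:{t..m}. w u) = (LBINT u:{t..s}. w u)+(LBINT u:{s..m}. w u)"
   by (rule set_integral_split_at(1)[OF wi]) (use s in "auto simp: m_def")
  moreover have "(LBINT u:{t..s}. - w u) = - (LBINT u:{t..s}. w u)" by (simp add: sli_def)
  ultimately show "exp (- beta * s)*g s = exp (- beta*t)*g t + (LBINT u:{t..s}. - w u)"
   unfolding gw[OF s] gw[OF order_refl] ext[OF s order_refl] ext[OF order_refl s] by simp
 qed
 from abs_cont_mult[OF abs_cont_exp[of t beta 0] this]
 show ?thesis
 proof (rule abs_cont_cong)
  fix u
  have e: "exp (beta*(u - 0))*exp (- beta*u) = 1" by (simp add: exp_add[symmetric] algebra_simps)
  have X: "exp (beta*(u - 0))*(exp (- beta*u)*X) = X" for X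
   by (simp only: mult.assoc[symmetric] e mult_1)
  show "exp (beta*(u - 0))*(exp (- beta*u)*g u) = g u" by (rule X)
  have "exp (beta*(u - 0)) * - w u = - (if u < tauR then h u 0 + 1 else 0)"
   using X[of "h u 0 + 1"] by (simp add: w_def)
  thus "beta*exp (beta*(u - 0))*(exp (- beta*u)*g u)+exp (beta*(u - 0)) * - w u = beta*g u - (if u < tauR then h u 0 + 1 else 0)"
   using X[of "g u"] by (simp only: mult.assoc)
 qed
qed

end

section \<open>The labor income equation\<close>

locale picard_delay =
 fixes t d x0 muy :: real and phi x1 L :: "real => real"
 assumes t0: "0 <= t" and d0: "0 < d" and phi2: "phi : L2_space d" and x12: "x1 : L2_space d"
  and L_cont: "continuous_on {t..} L" and L_pos: "!!u. 0 < L u"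
begin

text \<open>\<open>L\<close> is to be a path of the stochastic exponential, \<open>v\<close> the
  unknown quotient of income by \<open>L\<close>, and \<open>yv v\<close> the income path with its
  prescribed history.\<close>

definition yv :: "(real => real) => real => real" where
 "yv v u = (if t <= u then L u * v u else x1 (u - t))"

definition D :: "(real => real) => real => real" where
 "D v s = (LBINT ze:{-d..0}. phi ze*yv v (s + ze))"

definition rhs :: "(real => real) => real => real" where
 "rhs v u = muy * v u + D v u/L u"

definition T :: "(real => real) => real => real" where
 "T v s = x0 + (LBINT u:{t..s}. rhs v u)"

primrec pic :: "nat => real => real" where
 "pic 0 = (%_. x0)"
| "pic (Suc n) = T (pic n)"

lemma yv_cont: "continuous_on {t..} v ==> continuous_on {t..} (yv v)"
 by (subst continuous_on_cong[OF refl, of _ "yv v" "%u. L u * v u"])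
   (auto simp: yv_def intro!: continuous_intros L_cont)

lemma yv_path: "continuous_on {t..} v ==> delay_path t d phi x1 (yv v)"
 by unfold_locales (use t0 d0 phi2 x12 yv_cont in "auto simp: yv_def")

lemma D_delay: "continuous_on {t..} v ==> D v s = delay_path.delay d phi (yv v) s"
 using delay_path.delay_def[OF yv_path] by (simp add: D_def)

lemma rhs_integrable:
 assumes v: "continuous_on {t..} v"
 shows "sint {t..s} (rhs v)"
proof -
 interpret dp: delay_path t d phi x1 "yv v" by (rule yv_path[OF v])
 have c: "continuous_on {t..s} (%u. 1/L u)"
  by (intro continuous_intros continuous_on_subset[OF L_cont]) (use L_pos[THEN less_imp_neq] in "auto simp: eq_commute[of 0]")
 have "sint {t..s} (%u. 1/L u*dp.delay u)"
  by (rule set_integrable_continuous_mult[OF c dp.delay_set_integrable])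
 moreover have "sint {t..s} (%u. muy * v u)"
  by (rule borel_integrable_compact[folded set_integrable_def]) (auto intro!: continuous_intros continuous_on_subset[OF v])
 ultimately have "sint {t..s} (%u. muy * v u + 1/L u*dp.delay u)" by (intro set_integral_add)
 thus ?thesis by (simp add: rhs_def[abs_def] D_delay[OF v])
qed

lemma T_abs_cont: "continuous_on {t..} v ==> abs_cont t (T v) (rhs v)"
 using rhs_integrable by (auto simp: abs_cont_def T_def)

lemma T_cont: "continuous_on {t..} v ==> continuous_on {t..} (T v)"
 by (rule abs_cont_continuous[OF T_abs_cont])

lemma pic_cont: "continuous_on {t..} (pic n)"
 by (induction n) (auto intro: T_cont)

lemma L_bounds: "EX m>0. EX M>=0. ALL u:{t..S}. m <= L u & L u <= M"
proof (cases "t <= S")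
 case True
 have c: "continuous_on {t..S} L" by (rule continuous_on_subset[OF L_cont]) auto
 obtain a where a: "a : {t..S}" "ALL u:{t..S}. L a <= L u" using continuous_attains_inf[OF _ _ c] True by auto
 obtain b where b: "b : {t..S}" "ALL u:{t..S}. L u <= L b" using continuous_attains_sup[OF _ _ c] True by auto
 show ?thesis using a b L_pos[of a] L_pos[of b] by (intro exI[of _ "L a"] conjI exI[of _ "L b"]) auto
qed (auto intro!: exI[of _ 1])

text \<open>Lipschitz continuity in the supremum norm over the past: the histories of both
  candidates coincide and cancel, and \<open>L\<close> is bounded above and away from zero on a
  compact interval.\<close>

lemma rhs_diff:
 obtains C where "0 < C" "!!v w (beta::real) u. continuous_on {t..} v ==> continuous_on {t..} w ==> u : {t..S} ==>
   (!!q. q : {t..u} ==> abs (v q - w q) <= beta) ==> abs (rhs v u - rhs w u) <= C * beta"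
proof -
 obtain m M where mM: "0 < m" "0 <= M" "!!u. u : {t..S} ==> m <= L u" "!!u. u : {t..S} ==> L u <= M" using L_bounds[of S] by blast
 interpret d0: delay_path t d phi x1 "yv (%_. 0)" by (rule yv_path) simp
 define N where "N = (LINT ze|lborel. abs (d0.phie ze))"
 have N0: "0 <= N" by (simp add: N_def)
 define C where "C = abs (muy)+N*M/m + 1"
 have C0: "0 < C" using N0 mM(1,2) by (auto simp: C_def intro!: add_nonneg_pos add_nonneg_nonneg divide_nonneg_pos mult_nonneg_nonneg)
 show thesis
 proof (rule that[OF C0])
  fix v w and beta u :: real assume v: "continuous_on {t..} v" and w: "continuous_on {t..} w" and u: "u : {t..S}"
   and le: "!!q. q : {t..u} ==> abs (v q - w q) <= beta"
  have beta: "0 <= beta" using le[of u] u by auto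
  interpret dv: delay_path t d phi x1 "yv v" by (rule yv_path[OF v])
  interpret dw: delay_path t d phi x1 "yv w" by (rule yv_path[OF w])
  have ut: "t <= u" using u by simp
  have iv: "integrable lborel (%q. d0.phie (q - u)*dv.Y q)" and iw: "integrable lborel (%q. d0.phie (q - u)*dw.Y q)"
   using dv.delay_integrable(1)[OF ut] dw.delay_integrable(1)[OF ut] .
  have iphi: "integrable lborel (%q. abs (d0.phie (q - u)))" "(LINT q|lborel. abs (d0.phie (q - u))) = N"
  proof -
   have "integrable lborel (%q. d0.phie (- u + 1*q))" by (rule lborel_integrable_real_affine[OF d0.phie_integrable]) simp
   thus "integrable lborel (%q. abs (d0.phie (q - u)))" by simp
   show "(LINT q|lborel. abs (d0.phie (q - u))) = N" unfolding N_def
    by (subst (2) lborel_integral_real_affine[of 1 _ "-u"]) auto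
  qed
  have D1: "D v u - D w u = (LINT q|lborel. d0.phie (q - u)*dv.Y q - d0.phie (q - u)*dw.Y q)"
   unfolding D_delay[OF v] D_delay[OF w] dv.delay_alt(2)[OF ut] dw.delay_alt(2)[OF ut] by (rule Bochner_Integration.integral_diff[OF iv iw, symmetric])
  have "abs (D v u - D w u) <= (LINT q|lborel. abs (d0.phie (q - u)*dv.Y q - d0.phie (q - u)*dw.Y q))"
   unfolding D1 by (rule integral_abs_bound)
  also have "... <= (LINT q|lborel. abs (d0.phie (q - u))*(M * beta))"
  proof (rule integral_mono)
   show "integrable lborel (%q. abs (d0.phie (q - u)*dv.Y q - d0.phie (q - u)*dw.Y q))" using iv iw by auto
   show "integrable lborel (%q. abs (d0.phie (q - u))*(M * beta))" using iphi(1) by (rule integrable_mult_left)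
   fix q
   show "abs (d0.phie (q - u)*dv.Y q - d0.phie (q - u)*dw.Y q) <= abs (d0.phie (q - u))*(M * beta)"
   proof (cases "q <= u")
    case True
    have "abs (dv.Y q - dw.Y q) <= M * beta"
    proof (cases "t <= q")
     case tq: True
     have "abs (dv.Y q - dw.Y q) = L q*abs (v q - w q)"
      using tq L_pos[of q] by (simp add: dv.Y_def dw.Y_def yv_def right_diff_distrib[symmetric] abs_mult)
     also have "... <= M * beta" using tq True u mM(4)[of q] le[of q] L_pos[of q] mM(2) by (intro mult_mono) auto
     finally show ?thesis .
    next
     case False
     thus ?thesis using mM(2) beta by (simp add: dv.Y_def dw.Y_def)
    qed
    thus ?thesis by (simp add: right_diff_distrib[symmetric] abs_mult mult_left_mono)
   next
    case False
    hence "d0.phie (q - u) = 0" by (simp add: d0.phie_def)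
    thus ?thesis by simp
   qed
  qed
  also have "... = N*(M * beta)" using iphi by simp
  finally have Dle: "abs (D v u - D w u) <= N*(M * beta)" .
  have "abs (D v u/L u - D w u/L u) = abs (D v u - D w u)/L u" using L_pos[of u] by (simp add: diff_divide_distrib[symmetric])
  also have "... <= N*(M * beta)/m"
   using Dle mM(1,2) mM(3)[OF u] N0 beta by (intro frac_le) auto
  finally have 1: "abs (D v u/L u - D w u/L u) <= N*M/m * beta" by simp
  have 2: "abs (muy * v u - muy*w u) <= abs (muy) * beta"
   using le[of u] u by (simp add: right_diff_distrib[symmetric] abs_mult mult_left_mono)
  have "abs (rhs v u - rhs w u) <= abs (muy) * beta + N*M/m * beta"
   unfolding rhs_def using 1 2 by linarith
  also have "... <= C * beta" using beta by (simp add: C_def algebra_simps)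
  finally show "abs (rhs v u - rhs w u) <= C * beta" .
 qed
qed

lemma T_diff:
 assumes v: "continuous_on {t..} v" and w: "continuous_on {t..} w" and s: "t <= s"
  and b: "sint {t..s} b" "!!u. u : {t..s} ==> abs (rhs v u - rhs w u) <= b u"
 shows "abs (T v s - T w s) <= (LBINT u:{t..s}. b u)"
proof -
 have iv: "sint {t..s} (rhs v)" and iw: "sint {t..s} (rhs w)"
  using rhs_integrable[OF v] rhs_integrable[OF w] .
 have 1: "T v s - T w s = (LBINT u:{t..s}. rhs v u - rhs w u)" unfolding T_def using iv iw by simp
 have 2: "abs (LBINT u:{t..s}. rhs v u - rhs w u) <= (LBINT u:{t..s}. abs (rhs v u - rhs w u))"
  unfolding sli_def
  by (rule order_trans[OF integral_abs_bound]) (auto intro!: order_eq_refl Bochner_Integration.integral_cong simp: indicator_def)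
 have 3: "(LBINT u:{t..s}. abs (rhs v u - rhs w u)) <= (LBINT u:{t..s}. b u)"
 proof (rule set_integral_mono[OF _ b])
  have "sint {t..s} (%u. rhs v u - rhs w u)" by (rule set_integral_diff(1)[OF iv iw])
  thus "sint {t..s} (%u. abs (rhs v u - rhs w u))" by (rule set_integrable_abs)
 qed
 show ?thesis unfolding 1 by (rule order_trans[OF 2 3])
qed

text \<open>The factorial estimate of Picard iteration. The Lipschitz property is returned along
  with it, for the identification of the limit.\<close>

lemma pic_bound:
 obtains B C where "0 <= B" "0 < C" "!!n s. s : {t..S} ==> abs (pic (Suc n) s - pic n s) <= B*((C*(s - t)) ^ n/fact n)"
  "!!v w beta u. continuous_on {t..} v ==> continuous_on {t..} w ==> u : {t..S} ==>
   (!!q. q : {t..u} ==> abs (v q - w q) <= beta) ==> abs (rhs v u - rhs w u) <= C * beta"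
proof -
 obtain C where C: "0 < C" and rd: "!!v w beta u. continuous_on {t..} v ==> continuous_on {t..} w ==> u : {t..S} ==>
   (!!q. q : {t..u} ==> abs (v q - w q) <= beta) ==> abs (rhs v u - rhs w u) <= C * beta"
  by (rule rhs_diff[of S]) blast
 have "continuous_on {t..S} (%s. pic (Suc 0) s - pic 0 s)" by (intro continuous_intros continuous_on_subset[OF pic_cont]) auto
 then obtain B where B: "0 <= B" "!!s. s : {t..S} ==> abs (pic (Suc 0) s - pic 0 s) <= B"
  by (rule continuous_Icc_bounded) blast
 have "abs (pic (Suc n) s - pic n s) <= B*((C*(s - t)) ^ n/fact n)" if "s : {t..S}" for n s
  using that
 proof (induction n arbitrary: s)
  case 0
  thus ?case using B(2)[of s] by simp
 next
  case (Suc n)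
  let ?b = "%u. C*(B*((C*(u - t)) ^ n/fact n))"
  \<comment> \<open>The primitive of \<open>?b\<close> that vanishes at \<open>t\<close>, so
    integrating the bound for \<open>n\<close> gives the one for \<open>Suc n\<close>.\<close>
  let ?P = "%u. B*((C*(u - t)) ^ Suc n/fact (Suc n))"
  have ac: "abs_cont t ?P ?b"
  proof (rule abs_cont_C1)
   fix u
   have f: "(fact (Suc n) :: real) = real (Suc n)*fact n" by simp
   have "((%u. B*((C*(u - t)) ^ Suc n/fact (Suc n))) has_real_derivative B*((real (Suc n)*(C*(u - t)) ^ n*C)/fact (Suc n))) (at u)"
    by (rule derivative_eq_intros refl | simp)+
   moreover have "B*((real (Suc n)*(C*(u - t)) ^ n*C)/fact (Suc n)) = ?b u"
    unfolding f by (simp add: field_simps del: of_nat_Suc)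
   ultimately show "(?P has_real_derivative ?b u) (at u)" by (simp only:)
  qed (intro continuous_intros, simp)
  have "abs (T (pic (Suc n)) s - T (pic n) s) <= (LBINT u:{t..s}. ?b u)"
  proof (rule T_diff[OF pic_cont pic_cont])
   show "t <= s" using Suc.prems by simp
   show "sint {t..s} ?b" by (rule abs_contD(1)[OF ac]) (use Suc.prems in simp)
   fix u assume u: "u : {t..s}"
   show "abs (rhs (pic (Suc n)) u - rhs (pic n) u) <= ?b u"
   proof (rule rd[OF pic_cont pic_cont])
    show "u : {t..S}" using u Suc.prems by auto
    fix q assume q: "q : {t..u}"
    hence "abs (pic (Suc n) q - pic n q) <= B*((C*(q - t)) ^ n/fact n)" using u Suc.prems by (intro Suc.IH) auto
    also have "... <= B*((C*(u - t)) ^ n/fact n)"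
     using q C B by (intro mult_left_mono divide_right_mono power_mono) auto
    finally show "abs (pic (Suc n) q - pic n q) <= B*((C*(u - t)) ^ n/fact n)" .
   qed
  qed
  also have "(LBINT u:{t..s}. ?b u) = ?P s"
   using abs_contD(2)[OF ac, of s] Suc.prems by simp
  finally show ?case by simp
 qed
 from that[OF B(1) C this rd] show thesis by blast
qed

definition sol :: "real => real" where "sol s = lim (%n. pic n s)"

lemma pic_uniform: "uniform_limit {t..S} pic sol sequentially"
proof -
 obtain B C where B: "0 <= B" "0 < C" "!!n s. s : {t..S} ==> abs (pic (Suc n) s - pic n s) <= B*((C*(s - t)) ^ n/fact n)"
  by (rule pic_bound[of S]) blast
 let ?f = "%n s. pic (Suc n) s - pic n s"
 let ?M = "%n. B*((C*max 0 (S - t)) ^ n/fact n)"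
 have "uniform_limit {t..S} (%n s. \<Sum>i<n. ?f i s) (%s. suminf (%i. ?f i s)) sequentially"
 proof (rule Weierstrass_m_test)
  show "norm (?f n s) <= ?M n" if "s : {t..S}" for n s
  proof -
   have "abs (?f n s) <= B*((C*(s - t)) ^ n/fact n)" by (rule B(3)[OF that])
   also have "... <= ?M n" using that B by (intro mult_left_mono divide_right_mono power_mono) auto
   finally show ?thesis by simp
  qed
  show "summable ?M"
   using summable_exp[of "C*max 0 (S - t)"] by (intro summable_mult) (simp add: divide_inverse mult.commute)
 qed
 hence "uniform_limit {t..S} (%n s. x0 + (\<Sum>i<n. ?f i s)) (%s. x0 + suminf (%i. ?f i s)) sequentially"
  by (intro uniform_limit_add uniform_limit_const)
 moreover have "x0 + (\<Sum>i<n. ?f i s) = pic n s" for n s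
  using sum_lessThan_telescope[of "%n. pic n s" n] by simp
 ultimately have u: "uniform_limit {t..S} pic (%s. x0 + suminf (%i. ?f i s)) sequentially" by simp
 have "sol s = x0 + suminf (%i. ?f i s)" if "s : {t..S}" for s
  unfolding sol_def by (rule limI) (rule tendsto_uniform_limitI[OF u that])
 thus ?thesis by (intro uniform_limit_cong'[THEN iffD1, OF _ _ u]) auto
qed

lemma pic_tendsto: "t <= s ==> (%n. pic n s) ----> sol s"
 by (rule tendsto_uniform_limitI[OF pic_uniform[of s]]) simp

lemma sol_cont: "continuous_on {t..} sol"
proof -
 have c: "continuous_on {t..s} sol" for s
  by (rule uniform_limit_theorem[OF _ pic_uniform])
    (auto intro!: always_eventually continuous_on_subset[OF pic_cont])
 show ?thesis
 proof (rule continuous_on_eq_continuous_within[THEN iffD2], rule ballI)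
  fix x assume x: "x : {t..}"
  have "continuous (at x within {t..x+1}) sol" using c[of "x + 1"] x by (auto simp: continuous_on_eq_continuous_within)
  moreover have "at x within {t..x+1} = at x within {t..}"
   by (rule at_within_nhd[of _ "{x-1<..<x+1}"]) auto
  ultimately show "continuous (at x within {t..}) sol" by simp
 qed
qed

lemma sol_fixed:
 assumes s: "t <= s"
 shows "T sol s = sol s"
proof -
 obtain B C where C: "0 < C" and rd: "!!v w beta u. continuous_on {t..} v ==> continuous_on {t..} w ==> u : {t..s} ==>
   (!!q. q : {t..u} ==> abs (v q - w q) <= beta) ==> abs (rhs v u - rhs w u) <= C * beta"
  by (rule pic_bound[of s]) blast
 have "(%n. pic (Suc n) s) ----> T sol s"
 proof (rule LIMSEQ_I)
  fix e :: real assume e: "0 < e"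
  define beta where "beta = e/(2*(C*(s - t)+1))"
  have p: "0 < C*(s - t)+1" using C s by (intro add_nonneg_pos mult_nonneg_nonneg) auto
  have beta: "0 < beta" using e p by (simp add: beta_def)
  have "\<forall>\<^sub>F n in sequentially. ALL x:{t..s}. dist (pic n x) (sol x) < beta"
   using pic_uniform[of s] beta by (auto simp: uniform_limit_iff)
  then obtain N where "ALL n>=N. ALL x:{t..s}. dist (pic n x) (sol x) < beta"
   unfolding eventually_sequentially ..
  hence N: "!!n x. N <= n ==> x : {t..s} ==> dist (pic n x) (sol x) < beta" by blast
  show "EX no. ALL n>=no. norm (pic (Suc n) s - T sol s) < e"
  proof (intro exI[of _ N] allI impI)
   fix n assume n: "N <= n"
   have ci: "sint {t..s} (%u. C * beta)"
    by (rule borel_integrable_compact[folded set_integrable_def]) auto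
   have "abs (T (pic n) s - T sol s) <= (LBINT u:{t..s}. C * beta)"
   proof (rule T_diff[OF pic_cont sol_cont s ci])
    fix u assume u: "u : {t..s}"
    show "abs (rhs (pic n) u - rhs sol u) <= C * beta"
    proof (rule rd[OF pic_cont sol_cont u])
     fix q assume "q : {t..u}"
     hence "dist (pic n q) (sol q) < beta" using u by (intro N[OF n]) auto
     thus "abs (pic n q - sol q) <= beta" by (simp add: dist_real_def)
    qed
   qed
   also have "... = (C*(s - t)) * beta" using s by (simp add: sli_def)
   also have "... <= (C*(s - t)+1) * beta" using beta by (intro mult_right_mono) auto
   also have "... = e/2" unfolding beta_def using p by (subst times_divide_eq_right, subst mult.commute, subst mult_divide_mult_cancel_right) auto
   also have "... < e" using e by simp
   finally show "norm (pic (Suc n) s - T sol s) < e" by simp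
  qed
 qed
 moreover have "(%n. pic (Suc n) s) ----> sol s" using pic_tendsto[OF s] by (rule LIMSEQ_Suc)
 ultimately show ?thesis by (rule LIMSEQ_unique)
qed

lemma sol_abs_cont: "abs_cont t sol (rhs sol)"
 by (rule abs_cont_cong[OF T_abs_cont[OF sol_cont]]) (use sol_fixed in auto)

lemma sol_initial: "sol t = x0"
 using sol_fixed[of t] by (simp add: T_def)

end

context brownian
begin

lemma ito_process_lincomb:
 assumes X: "itoproc t x a H X" and X': "itoproc t x' a' H' X'" and t: "0 <= t"
 shows "itoproc t (x + c*x') (%s w. a s w + c*a' s w) (%s w. H s w + c *\<^sub>R H' s w) (%s w. X s w + c*X' s w)"
proof -
 obtain I where I: "cadapted t X" "itoint t H I"
  "AE w in M. ALL s>=t. sint {t..s} (%u. a u w) & X s w = x + (LBINT u:{t..s}. a u w)+I s w"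
  using X unfolding ito_process_def by blast
 obtain I' where I': "cadapted t X'" "itoint t H' I'"
  "AE w in M. ALL s>=t. sint {t..s} (%u. a' u w) & X' s w = x' + (LBINT u:{t..s}. a' u w)+I' s w"
  using X' unfolding ito_process_def by blast
 have "cadapted t (%s w. X s w + c*X' s w)"
  using I(1) I'(1) unfolding continuous_adapted_def
  by (auto intro!: continuous_intros borel_measurable_add borel_measurable_times)
 moreover have "AE w in M. ALL s>=t. sint {t..s} (%u. a u w + c*a' u w) \<and>
   X s w + c*X' s w = (x + c*x')+(LBINT u:{t..s}. a u w + c*a' u w)+(I s w + c*I' s w)"
  using I(3) I'(3)
 proof eventually_elim
  case (elim w)
  show ?case
  proof (intro allI impI conjI)
   fix s assume s: "t <= s"
   note e = elim(1)[rule_format, OF s] elim(2)[rule_format, OF s]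
   have i: "sint {t..s} (%u. a u w)" "sint {t..s} (%u. c*a' u w)"
    using e by (simp_all add: set_integrable_mult_right)
   show "sint {t..s} (%u. a u w + c*a' u w)" by (rule set_integral_add(1)[OF i])
   show "X s w + c*X' s w = (x + c*x')+(LBINT u:{t..s}. a u w + c*a' u w)+(I s w + c*I' s w)"
    using e set_integral_add(2)[OF i] by (simp add: algebra_simps)
  qed
 qed
 ultimately show ?thesis
  unfolding ito_process_def using ito_integral_lincomb[OF I(2) I'(2) t] by blast
qed

text \<open>\<open>ito_integral\<close> does not prescribe the value of \<open>I\<close> at
  \<open>t\<close>; it is almost surely zero by the second moment bound, because the energy over a
  single point is zero.\<close>

lemma ito_process_initial:
 assumes X: "itoproc t x a H X" and t: "0 <= t"
 shows "AE w in M. X t w = x"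
proof -
 obtain I where I: "itoint t H I" "AE w in M. ALL s>=t. sint {t..s} (%u. a u w) \<and>
   X s w = x + (LBINT u:{t..s}. a u w)+I s w"
  using X unfolding ito_process_def by blast
 have q: "qvar H t t w = 0" for w
 proof -
  have "(NS {t..t} (%u. ennreal ((norm (H u w))^2))) = (NL (u::real). 0)"
   by (rule nn_integral_cong_AE) (use AE_lborel_singleton[of t] in eventually_elim, simp)
  thus ?thesis by simp
 qed
 have "integrable P (%w. (I t w)^2)" "(LINT w|P. (I t w)^2) <= 3*0"
  by (rule ito_square_integrable[OF I(1) t order_refl, of 0]; simp only: q; simp)+
 moreover from this have "(LINT w|P. (I t w)^2) = 0"
  by (intro antisym Bochner_Integration.integral_nonneg) simp_all
 ultimately have "AE w in P. (I t w)^2 = 0"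
  by (subst (asm) integral_nonneg_eq_0_iff_AE) simp_all
 thus ?thesis
  using I(2) unfolding AE_P_iff by eventually_elim simp
qed

text \<open>Brownian paths are continuous only almost surely, whereas
  \<open>continuous_adapted\<close> asks for all paths. The value 1 on the exceptional paths keeps
  positivity, and augmentation keeps adaptedness.\<close>

lemma stoch_exp_version:
 assumes t: "0 <= t"
 obtains L where "cadapted t L" "!!s w. 0 < L s w" "!!w. L t w = 1"
  "AE w in M. ALL s. L s w = stoch_exp a t s w"
proof -
 define L where "L s w = (if continuous_on {0..} (%t. Z t w) then stoch_exp a t s w else 1)" for s w
 have ae: "AE w in M. ALL s. L s w = stoch_exp a t s w"
  using AE_continuous_Z by eventually_elim (simp add: L_def)
 have "L s : bm (F s)" if "t <= s" for s
  by (rule F_AE_eq[OF stoch_exp_F[OF t that order_refl]]) (use ae in eventually_elim, simp)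
 moreover have "continuous_on {t..} (%s. L s w)" for w
  by (cases "continuous_on {0..} (%t. Z t w)") (simp_all add: L_def stoch_exp_continuous t)
 ultimately have c: "cadapted t L" unfolding continuous_adapted_def by blast
 show thesis by (rule that[OF c _ _ ae]) (auto simp: L_def)
qed

end

section \<open>Labor income: measurability, moments, uniqueness, existence\<close>

locale labor = brownian M Z for M :: "'a measure" and Z :: "real => 'a => real^'n" +
 fixes t d muy x0 :: real and phi x1 :: "real => real" and sigmay :: "real^'n"
 assumes t0: "0 <= t" and d0: "0 < d" and phi2: "phi : L2_space d" and x12: "x1 : L2_space d"
begin

text \<open>What remains of \<open>labor_income\<close> without its equation; the Picard iterates,
  multiplied by the exponential, satisfy this much.\<close>

definition history :: "(real => 'a => real) => bool" where
 "history y \<longleftrightarrow> cadapted t y & (ALL w:space M. ALL ze:{-d..<0}. y (t + ze) w = x1 ze)"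

abbreviation "income \<equiv> labor_income M Z d muy sigmay phi t (x0, x1)"
abbreviation dly :: "(real => 'a => real) => real => 'a => real" where
 "dly y s w \<equiv> LBINT ze:{-d..0}. phi ze*y (s + ze) w"

lemma history_path: "history y ==> w : space M ==> delay_path t d phi x1 (%s. y s w)"
 using t0 d0 phi2 x12 cadapted_path[of t y w] by unfold_locales (auto simp: history_def)

lemma history_joint:
 assumes y: "history y" and s: "t <= s"
 shows "(%x. if fst x <= s then delay_path.Y t d x1 (%s. y s (snd x)) (fst x) else 0) : bm (BxF s)"
proof -
 have [measurable]: "(%ze. ind {-d..0} ze*x1 ze) : bm borel"
  using x12 by (simp add: L2_space_def set_borel_measurable_def)
 have p[measurable]: "(%x. if fst x : {t..s} then y (fst x) (snd x) else 0) : bm (BxF s)"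
  using y t0 by (intro predictable_progressive cadapted_pred) (auto simp: history_def)
 have "(%x. if fst x < t then ind {..<0} (fst x - t)*(ind {-d..0} (fst x - t)*x1 (fst x - t))
   else if fst x : {t..s} then y (fst x) (snd x) else 0) : bm (BxF s)"
  using p by measurable
 thus ?thesis
 proof (rule measurable_eqI)
  fix x :: "real \<times> 'a" assume "x : space (BxF s)"
  then interpret delay_path t d phi x1 "%s. y s (snd x)" by (intro history_path[OF y]) (auto simp: space_pair_measure)
  show "(if fst x < t then ind {..<0} (fst x - t)*(ind {-d..0} (fst x - t)*x1 (fst x - t))
   else if fst x : {t..s} then y (fst x) (snd x) else 0) = (if fst x <= s then Y (fst x) else 0)"
   using s by (auto simp: Y_def indicator_def)
 qed
qed

lemma weighted_history_F:
 assumes y: "history y" and s: "t <= s" and q: "set_borel_measurable lborel {-d..0} q"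
 shows "(%w. LBINT ze:{-d..0}. q ze*y (s + ze) w) : bm (F s)"
proof -
 let ?Y = "%x. if fst x <= s then delay_path.Y t d x1 (%s. y s (snd x)) (fst x) else 0"
 have [measurable]: "(%ze. ind {-d..0} ze*q ze) : bm borel"
  using q by (simp add: set_borel_measurable_def)
 have [measurable]: "(%x. (s + fst x, snd x)) : BxF s \<rightarrow>\<^sub>M BxF s" by measurable
 have [measurable]: "(%x. ?Y (s + fst x, snd x)) : bm (BxF s)"
  by (rule measurable_compose[OF _ history_joint[OF y s]]) measurable
 have "(%w. LINT ze|lborel. (ind {-d..0} ze*q ze)*?Y (s + ze, w)) : bm (F s)"
  by (rule lebesgue_integral_F) measurable
 thus ?thesis
 proof (rule measurable_eqI)
  fix w assume "w : space (F s)"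
  then interpret delay_path t d phi x1 "%s. y s w" by (intro history_path[OF y]) simp
  show "(LINT ze|lborel. (ind {-d..0} ze*q ze)*?Y (s + ze, w)) = (LBINT ze:{-d..0}. q ze*y (s + ze) w)"
   unfolding sli_def
   by (rule Bochner_Integration.integral_cong) (use s in "auto simp: indicator_def Y_eq")
 qed
qed

text \<open>Written as a convolution, the delay term is a parameter integral of a jointly measurable
  function. \<open>YY\<close> is cut off at \<open>s\<close>, so only information in
  \<open>F s\<close> enters.\<close>

lemma dly_joint:
 assumes y: "history y" and s: "t <= s"
 shows "(%x. if fst x : {t..s} then dly y (fst x) (snd x) else 0) : bm (BxF s)"
proof -
 define YY where "YY = (%x. if fst x <= s then delay_path.Y t d x1 (%s. y s (snd x)) (fst x) else 0)"
 \<comment> \<open>A dummy path with the right history, to have \<open>phie\<close> available before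
   any sample point is fixed.\<close>
 interpret d0: delay_path t d phi x1 "%u. if t <= u then 0 else x1 (u - t)"
  by unfold_locales (use t0 d0 phi2 x12 in "auto intro!: continuous_on_eq[OF continuous_on_const[of _ 0]]")
 note [measurable] = d0.phie_measurable
 have [measurable]: "(%x. YY (snd x, snd (fst x))) : bm ((BxF s) \<Otimes>\<^sub>M lborel)"
  by (rule measurable_compose[OF _ history_joint[OF y s, folded YY_def]]) measurable
 have "(%x. LINT u|lborel. d0.phie (u - fst x)*YY (u, snd x)) : bm (BxF s)"
  by (rule lborel.borel_measurable_lebesgue_integral) (simp add: split_beta, measurable)
 hence "(%x. if fst x : {t..s} then LINT u|lborel. d0.phie (u - fst x)*YY (u, snd x) else 0) : bm (BxF s)"
  by measurable
 thus ?thesis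
 proof (rule measurable_eqI)
  fix x :: "real \<times> 'a" assume "x : space (BxF s)"
  then interpret delay_path t d phi x1 "%s. y s (snd x)" by (intro history_path[OF y]) (auto simp: space_pair_measure)
  have "dly y (fst x) (snd x) = (LINT u|lborel. d0.phie (u - fst x)*YY (u, snd x))" if "fst x : {t..s}"
  proof -
   have "dly y (fst x) (snd x) = (LINT u|lborel. phie (u - fst x)*Y u)"
    using delay_alt(2)[of "fst x"] that by (simp add: delay_def)
   also have "... = (LINT u|lborel. d0.phie (u - fst x)*YY (u, snd x))"
    by (rule Bochner_Integration.integral_cong) (use that in "auto simp: phie_def indicator_def YY_def")
   finally show ?thesis .
  qed
  thus "(if fst x : {t..s} then LINT u|lborel. d0.phie (u - fst x)*YY (u, snd x) else 0) = (if fst x : {t..s} then dly y (fst x) (snd x) else 0)"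
   by simp
 qed
qed

text \<open>The quotient by \<open>B\<close> covers two uses: the exponential in the Picard step for
  the divided equation, and the constant 1 for the original drift.\<close>

lemma drift_F:
 assumes y: "history y" and s: "t <= s" and A: "cadapted t A" and B: "cadapted t B"
 shows "(%w. LBINT u:{t..s}. muy*A u w + dly y u w/B u w) : bm (F s)"
proof -
 have [measurable]: "(%x. if fst x : {t..s} then A (fst x) (snd x) else 0) : bm (BxF s)"
  "(%x. if fst x : {t..s} then B (fst x) (snd x) else 0) : bm (BxF s)"
  using A B t0 by (intro predictable_progressive cadapted_pred; simp)+
 note [measurable] = dly_joint[OF y s]
 have "(%w. LINT u|lborel. muy*(if u : {t..s} then A u w else 0)+(if u : {t..s} then dly y u w else 0)/(if u : {t..s} then B u w else 0))
  : bm (F s)"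
  by (rule lebesgue_integral_F) measurable
 thus ?thesis
  by (rule measurable_eqI)
   (auto simp: sli_def indicator_def intro!: Bochner_Integration.integral_cong)
qed

lemma labor_history:
 assumes "income y"
 shows "history y" "itoproc t x0 (%s w. muy*y s w + dly y s w) (%s w. y s w *\<^sub>R sigmay) y"
 using assms by (auto simp: labor_income_def history_def ito_process_def)

lemma dly_square:
 assumes "history y" "w : space M" "t <= s"
 shows "(dly y s w)^2 <= (LBINT ze:{-d..0}. (phi ze)^2)*((LBINT ze:{-d..0}. (x1 ze)^2)+(LBINT u:{t..s}. (y u w)^2))"
proof -
 interpret delay_path t d phi x1 "%s. y s w" by (rule history_path[OF assms(1,2)])
 show ?thesis using delay_integrable(2)[OF assms(3)] by (simp add: delay_def phi_norm_def x1_norm_def)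
qed

text \<open>The norm of the history plays the part of \<open>c0\<close> in
  \<open>ito_moment_bound\<close>.\<close>

lemma labor_moment:
 assumes y: "income y" and T: "t <= T"
 shows "EX K>=0. ALL s:{t..T}. (NP w. ennreal ((y s w)^2)) <= ennreal K"
proof -
 note h = labor_history[OF y]
 define N where "N = (LBINT ze:{-d..0}. (phi ze)^2)"
 define c0 where "c0 = (LBINT ze:{-d..0}. (x1 ze)^2)"
 have N: "0 <= N" "0 <= c0" by (auto simp: N_def c0_def sli_def intro!: integral_nonneg_AE)
 have "EX K>=0. ALL s:{t..T}. (NP w. ennreal ((y s w)^2)) <= ennreal (K*(x0^2 + c0))"
 proof (rule ito_moment_bound[OF h(2) t0 T, where C="2 * muy\<^sup>2 + 2*N"])
  show "AE w in M. ALL s:{t..T}. (muy*y s w + dly y s w)^2 <= (2 * muy\<^sup>2 + 2*N)*(c0 + (y s w)^2 + (LBINT u:{t..s}. (y u w)^2))"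
  proof (rule AE_I2, rule ballI)
   fix w s assume w: "w : space M" "s : {t..T}"
   define J where "J = (LBINT u:{t..s}. (y u w)^2)"
   have J: "0 <= J" by (auto simp: J_def sli_def intro!: integral_nonneg_AE)
   have d: "(dly y s w)^2 <= N*(c0 + J)" using dly_square[OF h(1) w(1), of s] w(2) by (simp add: N_def c0_def J_def)
   have "(muy*y s w + dly y s w)^2 <= 2*(muy*y s w)^2 + 2*(dly y s w)^2"
    using sum_squares_bound[of "muy*y s w" "dly y s w"] by (simp add: power2_sum)
   also have "... <= 2 * muy\<^sup>2*(y s w)^2 + 2*(N*(c0 + J))" using d by (simp add: power_mult_distrib)
   also have "... <= (2 * muy\<^sup>2 + 2*N)*(c0 + (y s w)^2 + J)"
    using N J by (simp add: algebra_simps)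
   finally show "(muy*y s w + dly y s w)^2 <= (2 * muy\<^sup>2 + 2*N)*(c0 + (y s w)^2 + (LBINT u:{t..s}. (y u w)^2))"
    by (simp add: J_def)
  qed
 qed (use N in auto)
 then obtain K where "0 <= K" "ALL s:{t..T}. (NP w. ennreal ((y s w)^2)) <= ennreal (K*(x0^2 + c0))" by blast
 thus ?thesis using N by (intro exI[of _ "K*(x0^2 + c0)"]) auto
qed

text \<open>The difference of two paths with the same history is a delay path with history zero, so
  the term with \<open>x1\<close> disappears from the bound.\<close>

lemma dly_diff:
 assumes y: "history y" and y': "history y'" and w: "w : space M" and s: "t <= s"
 shows "(dly y s w - dly y' s w)^2 <= (LBINT ze:{-d..0}. (phi ze)^2)*(LBINT u:{t..s}. (y u w - y' u w)^2)"
proof -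
 interpret y: delay_path t d phi x1 "%s. y s w" by (rule history_path[OF y w])
 interpret y': delay_path t d phi x1 "%s. y' s w" by (rule history_path[OF y' w])
 interpret e: delay_path t d phi "%_. 0" "%s. y s w - y' s w"
  by unfold_locales (use t0 d0 phi2 y.y_hist y'.y_hist y.y_cont y'.y_cont in "auto simp: L2_space_def set_borel_measurable_def set_integrable_def intro!: continuous_intros")
 have Y: "y.Y u - y'.Y u = e.Y u" for u by (simp add: y.Y_def y'.Y_def e.Y_def)
 have "y.delay s - y'.delay s = (LINT u|lborel. y.phie (u - s)*y.Y u - y.phie (u - s)*y'.Y u)"
  unfolding y.delay_alt(2)[OF s] y'.delay_alt(2)[OF s]
  by (rule Bochner_Integration.integral_diff[OF y.delay_integrable(1)[OF s] y'.delay_integrable(1)[OF s], symmetric])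
 also have "... = e.delay s" unfolding e.delay_alt(2)[OF s] by (simp only: Y[symmetric] right_diff_distrib)
 finally show ?thesis
  using e.delay_integrable(2)[OF s] by (simp add: y.delay_def y'.delay_def e.phi_norm_def e.x1_norm_def)
qed

lemma labor_unique:
 assumes y: "income y" and y': "income y'"
 shows "AE w in M. ALL s>=t. y s w = y' s w"
proof -
 note h = labor_history[OF y] and h' = labor_history[OF y']
 let ?e = "%s w. y s w + (-1)*y' s w"
 let ?a = "%s w. (muy*y s w + dly y s w)+(-1)*(muy*y' s w + dly y' s w)"
 define N where "N = (LBINT ze:{-d..0}. (phi ze)^2)"
 have N: "0 <= N" by (auto simp: N_def sli_def intro!: integral_nonneg_AE)
 have "(%s w. y s w *\<^sub>R sigmay + (-1) *\<^sub>R (y' s w *\<^sub>R sigmay)) = (%s w. ?e s w *\<^sub>R sigmay)"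
  by (simp add: fun_eq_iff scaleR_left_diff_distrib)
 hence "itoproc t (x0 + (-1)*x0) ?a (%s w. ?e s w *\<^sub>R sigmay) ?e"
  using ito_process_lincomb[OF h(2) h'(2) t0, of "-1"] by (simp only:)
 hence p: "itoproc t 0 ?a (%s w. ?e s w *\<^sub>R sigmay) ?e" by (simp only: mult_minus1 add.right_inverse)
 have "AE w in M. ALL s>=t. ?e s w = 0"
 proof (rule ito_linear_unique[OF p t0])
  fix T
  have "(?a s w)^2 <= (2 * muy\<^sup>2 + 2*N)*((?e s w)^2 + (LBINT u:{t..s}. (?e u w)^2))"
   if w: "w : space M" and s: "s : {t..T}" for s w
  proof -
   define J where "J = (LBINT u:{t..s}. (?e u w)^2)"
   have J: "0 <= J" by (auto simp: J_def sli_def intro!: integral_nonneg_AE)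
   define D where "D = dly y s w - dly y' s w"
   have d: "D^2 <= N*J" using dly_diff[OF h(1) h'(1) w, of s] s by (simp add: N_def J_def D_def)
   have "?a s w = muy*?e s w + D" by (simp add: algebra_simps D_def)
   hence "(?a s w)^2 <= 2*(muy*?e s w)^2 + 2*D^2"
    using sum_squares_bound[of "muy*?e s w" D] by (simp only: power2_sum)
   also have "... <= 2 * muy\<^sup>2*(?e s w)^2 + 2*(N*J)" using d by (simp add: power_mult_distrib)
   also have "... <= (2 * muy\<^sup>2 + 2*N)*((?e s w)^2 + J)"
   proof -
    have "0 <= 2 * muy\<^sup>2*J" "0 <= 2*N*(?e s w)^2" using N J by (auto intro!: mult_nonneg_nonneg)
    thus ?thesis by (simp only: distrib_left distrib_right)
   qed
   finally show ?thesis by (simp only: J_def)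
  qed
  thus "EX C>=0. AE w in M. ALL s:{t..T}. (?a s w)^2 <= C*((?e s w)^2 + (LBINT u:{t..s}. (?e u w)^2))"
   using N by (intro exI[of _ "2 * muy\<^sup>2 + 2*N"] conjI AE_I2 ballI) auto
 qed
 thus ?thesis by eventually_elim auto
qed

text \<open>The solution is delivered with its factorization, since that is what
  \<open>ito_exp_product\<close> consumes. A pathwise construction says nothing about adaptedness;
  this is proved for each Picard iterate and passes to the limit.\<close>

lemma labor_exists:
 "EX y v v'. income y \<and>
  (AE w in M. abs_cont t (v w) (v' w) & (ALL s>=t. y s w = stoch_exp sigmay t s w * v w s \<and>
   stoch_exp sigmay t s w * v' w s = muy*y s w + dly y s w))"
proof -
 obtain L where L: "cadapted t L" "!!s w. 0 < L s w" "!!w. L t w = 1"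
  "AE w in M. ALL s. L s w = stoch_exp sigmay t s w"
  by (rule stoch_exp_version[OF t0, of sigmay]) (rule that, assumption+)
 have pd: "picard_delay t d phi x1 (%s. L s w)" if "w : space M" for w
  using t0 d0 phi2 x12 L(2) cadapted_path[OF L(1) that] by unfold_locales auto
 define pc where "pc n s w = picard_delay.pic t d x0 muy phi x1 (%s. L s w) n s" for n s w
 define v where "v w s = picard_delay.sol t d x0 muy phi x1 (%s. L s w) s" for s w
 define y where "y s w = (if t <= s then L s w * v w s else x1 (s - t))" for s w
 have mult: "history (%s w. if t <= s then L s w*A s w else x1 (s - t))" if A: "cadapted t A" for A
  unfolding history_def continuous_adapted_def
 proof (intro conjI ballI allI impI)
  fix s assume "t <= s"
  thus "(%w. if t <= s then L s w*A s w else x1 (s - t)) : bm (F s)"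
   using cadapted_F[OF A, of s] cadapted_F[OF L(1), of s] by simp
 next
  fix w assume w: "w : space M"
  have "continuous_on {t..} (%s. L s w*A s w)" by (intro continuous_intros cadapted_path[OF A w] cadapted_path[OF L(1) w])
  thus "continuous_on {t..} (%s. if t <= s then L s w*A s w else x1 (s - t))"
   by (rule continuous_on_eq) simp
 qed auto
 have pc: "cadapted t (pc n)" for n
 proof (induction n)
  case 0
  have "pc 0 s w = x0" if "w : space M" for s w by (simp add: pc_def picard_delay.pic.simps[OF pd[OF that]])
  hence "pc 0 s : bm (F s) \<longleftrightarrow> (%_. x0) : bm (F s)" for s
   by (intro measurable_cong) simp
  thus ?case using picard_delay.pic_cont[OF pd] unfolding continuous_adapted_def pc_def by simp
 next
  case (Suc n)
  let ?y = "%s w. if t <= s then L s w*pc n s w else x1 (s - t)"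
  have "pc (Suc n) s : bm (F s)" if s: "t <= s" for s
  proof -
   have "(%w. x0 + (LBINT u:{t..s}. muy*pc n u w + dly ?y u w/L u w)) : bm (F s)"
    using drift_F[OF mult[OF Suc] s Suc L(1)] by measurable
   thus ?thesis
   proof (rule measurable_eqI)
    fix w assume "w : space (F s)"
    then interpret picard_delay t d x0 muy phi x1 "%s. L s w" by (intro pd) simp
    show "x0 + (LBINT u:{t..s}. muy*pc n u w + dly ?y u w/L u w) = pc (Suc n) s w"
     by (simp add: pc_def[abs_def] T_def rhs_def[abs_def] D_def yv_def cong: if_cong)
   qed
  qed
  thus ?case using picard_delay.pic_cont[OF pd] unfolding continuous_adapted_def pc_def by blast
 qed
 have vc: "cadapted t (%s w. v w s)"
  unfolding continuous_adapted_def
 proof (intro conjI allI impI ballI)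
  fix s assume s: "t <= s"
  show "(%w. v w s) : bm (F s)"
  proof (rule borel_measurable_LIMSEQ_real)
   show "pc n s : bm (F s)" for n by (rule cadapted_F[OF pc s])
   show "(%n. pc n s w) ----> v w s" if "w : space (F s)" for w
    unfolding pc_def v_def using that by (intro picard_delay.pic_tendsto[OF pd s]) simp
  qed
 next
  fix w assume "w : space M"
  thus "continuous_on {t..} (v w)" unfolding v_def by (rule picard_delay.sol_cont[OF pd])
 qed
 have hy: "history y" unfolding y_def by (rule mult[OF vc])
 define v' where "v' w = picard_delay.rhs t d muy phi x1 (%s. L s w) (v w)" for w
 have v: "abs_cont t (v w) (v' w)" "L s w * v' w s = muy*y s w + dly y s w" "v w t = x0"
  if w: "w : space M" and s: "t <= s" for w s
 proof -
  interpret picard_delay t d x0 muy phi x1 "%s. L s w" by (rule pd[OF w])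
  show "abs_cont t (v w) (v' w)" using sol_abs_cont by (simp only: v_def[abs_def] v'_def)
  show "L s w * v' w s = muy*y s w + dly y s w"
   using s L_pos[of s] by (simp add: v'_def rhs_def D_def yv_def y_def distrib_left)
  show "v w t = x0" using sol_initial by (simp add: v_def)
 qed
 define I where "I s w = y s w - y t w - (LBINT u:{t..s}. muy*y u w + dly y u w)" for s w
 have yc: "cadapted t y" using hy by (simp add: history_def)
 have di: "sint {t..s} (%u. muy*y u w + dly y u w)" if w: "w : space M" for s w
 proof -
  interpret delay_path t d phi x1 "%s. y s w" by (rule history_path[OF hy w])
  have "sint {t..s} (%u. muy*y u w + delay u)"
   by (intro set_integral_add(1) delay_set_integrable continuous_path_integrable continuous_intros y_cont)
  thus ?thesis by (simp only: delay_def)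
 qed
 have Ic: "cadapted t I"
  unfolding continuous_adapted_def
 proof (intro conjI allI impI ballI)
  fix s assume s: "t <= s"
  have one: "cadapted t (%s w. 1::real)" by (auto simp: continuous_adapted_def)
  have "(%w. LBINT u:{t..s}. muy*y u w + dly y u w) : bm (F s)"
   using drift_F[OF hy s yc one] by simp
  moreover have "y t : bm (F s)" using cadapted_F[OF yc] s by (auto intro: measurable_F_mono)
  ultimately show "I s : bm (F s)"
   unfolding I_def using cadapted_F[OF yc s] by measurable
 next
  fix w assume w: "w : space M"
  have "continuous_on {t..} (%s. LBINT u:{t..s}. muy*y u w + dly y u w)"
   by (rule abs_cont_continuous[OF abs_cont_integral[OF di[OF w]]])
  thus "continuous_on {t..} (%s. I s w)"
   unfolding I_def by (intro continuous_intros cadapted_path[OF yc w])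
 qed
 have path: "AE w in M. abs_cont t (v w) (v' w) & (ALL s>=t. y s w = stoch_exp sigmay t s w * v w s \<and>
   stoch_exp sigmay t s w * v' w s = muy*y s w + dly y s w)"
  using L(4) AE_space
 proof eventually_elim
  case (elim w)
  thus ?case using v[OF elim(2)] by (auto simp: y_def)
 qed
 have ito: "itoint t (%s w. y s w *\<^sub>R sigmay) I"
 proof (rule ito_exp_product[OF t0 yc Ic])
  show "AE w in M. EX v v'. abs_cont t v v' & (ALL s>=t. y s w = stoch_exp sigmay t s w * v s) \<and>
   (ALL s>=t. I s w = y s w - y t w - (LBINT u:{t..s}. stoch_exp sigmay t u w * v' u))"
   using path
  proof eventually_elim
   case (elim w)
   have "(LBINT u:{t..s}. stoch_exp sigmay t u w * v' w u) = (LBINT u:{t..s}. muy*y u w + dly y u w)" for s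
    by (rule set_lebesgue_integral_cong) (use elim in auto)
   thus ?case using elim by (intro exI[of _ "v w"] exI[of _ "v' w"]) (auto simp: I_def)
  qed
 qed
 have "AE w in M. ALL s>=t. sint {t..s} (%u. muy*y u w + dly y u w) \<and>
   y s w = x0 + (LBINT u:{t..s}. muy*y u w + dly y u w)+I s w"
  using AE_space
 proof eventually_elim
  case (elim w)
  have "y t w = x0" using v(3)[OF elim order_refl] L(3) by (simp add: y_def)
  thus ?case using di[OF elim] by (auto simp: I_def)
 qed
 hence "itoproc t x0 (%s w. muy*y s w + dly y s w) (%s w. y s w *\<^sub>R sigmay) y"
  unfolding ito_process_def using yc ito by blast
 moreover have "ALL w:space M. ALL ze:{-d..<0}. y (t + ze) w = x1 ze" by (simp add: y_def)
 ultimately have "income y" by (simp add: labor_income_def)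
 thus ?thesis using path by blast
qed

end

section \<open>Total wealth\<close>

text \<open>By uniqueness every income process shares the factorization of the constructed
  one.\<close>

lemma (in labor) labor_path:
 assumes y: "income y"
 shows "AE w in M. EX v v'. abs_cont t v v' & (ALL s>=t. y s w = stoch_exp sigmay t s w * v s \<and>
   stoch_exp sigmay t s w * v' s = muy*y s w + dly y s w)"
proof -
 obtain y0 v v' where y0: "income y0" and
  path: "AE w in M. abs_cont t (v w) (v' w) & (ALL s>=t. y0 s w = stoch_exp sigmay t s w * v w s \<and>
   stoch_exp sigmay t s w * v' w s = muy*y0 s w + dly y0 s w)"
  using labor_exists by blast
 from path labor_unique[OF y y0] AE_space show ?thesis
 proof eventually_elim
  case (elim w)
  \<comment> \<open>The delay term looks back to \<open>t - d\<close>: before \<open>t\<close> both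
    processes carry the prescribed history on every path, afterwards they agree almost
    surely.\<close>
  have "y u w = y0 u w" if "t - d <= u" for u
  proof (cases "t <= u")
   case False
   hence "u - t : {-d..<0}" using that by simp
   hence "y (t + (u - t)) w = x1 (u - t)" "y0 (t + (u - t)) w = x1 (u - t)"
    using labor_history(1)[OF y] labor_history(1)[OF y0] elim(3) unfolding history_def by blast+
   thus ?thesis by simp
  qed (use elim(2) in simp)
  hence "dly y s w = dly y0 s w" if "t <= s" for s
   using that by (intro set_lebesgue_integral_cong) auto
  thus ?case using elim by (intro exI[of _ "v w"] exI[of _ "v' w"]) auto
 qed
qed

lemma matrix_inv_inverse:
 fixes A :: "real^'n^'n"
 assumes "invertible A"
 shows "A ** matrix_inv A = mat 1" "matrix_inv A ** A = mat 1"
 using someI_ex[OF assms[unfolded invertible_def]] by (simp_all add: matrix_inv_def)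

section \<open>Human capital and the equation for total wealth\<close>

locale market = labor M Z t d muy x0 phi x1 sigmay
 for M :: "'a measure" and Z :: "real => 'a => real^'n" and t d muy x0 phi x1 sigmay +
 fixes r delta beta tauR :: real and g :: "real => real" and h :: "real => real => real"
  and mu kappa :: "real^'n" and sigma :: "real^'n^'n"
 assumes gh: "gh_solution r delta beta tauR d phi g h" and beta: "beta = r + delta - muy + sigmay \<bullet> kappa"
  and sigma: "invertible sigma" and kappa: "kappa = matrix_inv sigma *v (mu - r *\<^sub>R 1)"
begin

abbreviation "ker y s w \<equiv> LBINT ze:{-d..0}. h s ze*y (s + ze) w"

definition human :: "(real => 'a => real) => real => 'a => real" where
 "human y s w = g s*y s w + ker y s w"

text \<open>The return \<open>r + delta\<close> on human capital, plus the risk premium of its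
  exposure to \<open>sigmay\<close>, minus the income paid out before retirement.\<close>

definition human_drift :: "(real => 'a => real) => real => 'a => real" where
 "human_drift y s w = (r + delta)*human y s w + (sigmay \<bullet> kappa)*(g s*y s w) - (1 - retired tauR s)*y s w"

lemma history_kernel: "history y ==> w : space M ==> kernel_path t d phi x1 (%s. y s w) g h r delta beta tauR"
 using history_path gh by (simp add: kernel_path_def kernel_path_axioms_def)

lemma g_continuous: "continuous_on {t..} g"
 using gh t0 by (auto simp: gh_solution_def intro: continuous_on_subset)

lemma h_late: "tauR <= s ==> 0 <= s ==> ze : {-d..0} ==> h s ze = 0"
 using gh by (simp add: gh_solution_def)

lemma h_borel: "t <= s ==> set_borel_measurable lborel {-d..0} (h s)"
proof -
 assume s: "t <= s"
 have hc: "continuous_on ({0..} \<times> {-d..0}) (%(t, ze). h t ze)" using gh by (simp add: gh_solution_def)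
 have "continuous_on {-d..0} (%ze. case (s, ze) of (t, ze) => h t ze)"
  by (rule continuous_on_compose2[OF hc]) (use s t0 in "auto intro!: continuous_intros")
 thus ?thesis
  using borel_measurable_continuous_on_indicator[of "{-d..0}" "h s"] by (simp add: set_borel_measurable_def)
qed

lemma cadapted_times_g:
 assumes y: "cadapted t y"
 shows "cadapted t (%s w. g s*y s w)"
 using y g_continuous unfolding continuous_adapted_def
 by (auto intro!: continuous_intros borel_measurable_times)

lemma human_continuous:
 assumes y: "history y"
 shows "cadapted t (ker y)" "cadapted t (human y)"
proof -
 show k: "cadapted t (ker y)"
  unfolding continuous_adapted_def
 proof (intro conjI allI impI ballI)
  show "ker y s : bm (F s)" if "t <= s" for s
   by (rule weighted_history_F[OF y that h_borel[OF that]])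
  fix w assume w: "w : space M"
  interpret kernel_path t d phi x1 "%s. y s w" g h r delta beta tauR by (rule history_kernel[OF y w])
  show "continuous_on {t..} (%s. ker y s w)" using abs_cont_continuous[OF kernel_abs_cont] by (simp only: kernel_def[abs_def])
 qed
 have "cadapted t (%s w. g s*y s w)" using y by (intro cadapted_times_g) (simp add: history_def)
 with k show "cadapted t (human y)"
  unfolding human_def[abs_def] continuous_adapted_def by (auto intro!: continuous_on_add borel_measurable_add)
qed

lemma human_drift_predictable:
 assumes y: "history y"
 shows "pred t (human_drift y)"
proof -
 have yc: "cadapted t y" using y by (simp add: history_def)
 have [measurable]: "(%x. human y (fst x) (snd x)) : bm (palg t)"
  "(%x. y (fst x) (snd x)) : bm (palg t)"
  "(%x. g (fst x)*y (fst x) (snd x)) : bm (palg t)"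
  using cadapted_pred[OF human_continuous(2)[OF y]] cadapted_pred[OF yc]
   cadapted_pred[OF cadapted_times_g[OF yc]] by (simp_all add: predictable_alt)
 have "retired tauR : bm borel" unfolding retired_def[abs_def] by measurable
 hence [measurable]: "(%x. retired tauR (fst x)) : bm (palg t)"
  using predictable_deterministic[of "retired tauR" t] by (simp add: predictable_alt)
 show ?thesis unfolding predictable_alt human_drift_def by measurable
qed

lemma human_drift_integrable:
 assumes y: "history y" and w: "w : space M"
 shows "sint {t..s} (%u. human_drift y u w)"
proof -
 interpret kernel_path t d phi x1 "%s. y s w" g h r delta beta tauR by (rule history_kernel[OF y w])
 have yi: "sint {t..s} (%u. y u w)" by (rule continuous_path_integrable[OF y_cont])
 have "sint {t..s} (%u. (1 - retired tauR u)*y u w)"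
  unfolding set_integrable_def
  using integrable_mult_indicator[OF _ yi[unfolded set_integrable_def], of "{..<tauR}"]
  by (rule Bochner_Integration.integrable_cong[THEN iffD1, rotated 2]) (auto simp: indicator_def retired_def)
 moreover have "sint {t..s} (%u. (r + delta)*human y u w + (sigmay \<bullet> kappa)*(g u*y u w))"
  by (intro continuous_path_integrable continuous_intros g_continuous y_cont cadapted_path[OF human_continuous(2)[OF y] w])
 ultimately show ?thesis unfolding human_drift_def by (rule set_integral_diff(1)[rotated])
qed

text \<open>The delay terms of \<open>g y\<close> and of the kernel cancel, as do the terms with
  \<open>h s 0\<close>, and the choice of \<open>beta\<close> leaves the growth rate
  \<open>r + delta\<close>. The kernel is absolutely continuous, so all noise comes from
  \<open>g y\<close>, which is a stochastic exponential times an absolutely continuous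
  function.\<close>

lemma human_ito:
 assumes y: "income y"
 shows "itoproc t (total_wealth d g h t 0 (x0, x1)) (human_drift y) (%s w. (g s*y s w) *\<^sub>R sigmay) (human y)"
proof -
 note hy = labor_history(1)[OF y]
 have yc: "cadapted t y" using hy by (simp add: history_def)
 note gyc = cadapted_times_g[OF yc]
 define g' where "g' s = beta*g s - (if s < tauR then h s 0 + 1 else 0)" for s
 define I where "I s w = human y s w - human y t w - (LBINT u:{t..s}. human_drift y u w)" for s w
 have Ic: "cadapted t I"
  using human_continuous(2)[OF hy] human_drift_integrable[OF hy]
   cadapted_integral[OF human_drift_predictable[OF hy] t0]
  unfolding I_def[abs_def] continuous_adapted_def
  by (auto intro!: continuous_intros borel_measurable_diff intro: measurable_F_mono)
 have key: "I s w = g s*y s w - g t*y t w - (LBINT u:{t..s}. g' u*y u w + g u*(muy*y u w + dly y u w))"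
  if w: "w : space M" and s: "t <= s" for s w
 proof -
  interpret kernel_path t d phi x1 "%s. y s w" g h r delta beta tauR by (rule history_kernel[OF hy w])
  let ?k = "%p. (r + delta)*kernel p + h p 0*y p w - g p*delay p"
  have k: "sint {t..s} ?k" "kernel s = kernel t + (LBINT u:{t..s}. ?k u)"
   using abs_contD[OF kernel_abs_cont s] .
  have e: "g' u*y u w + g u*(muy*y u w + dly y u w) = human_drift y u w - ?k u" if "u : {t..s}" for u
  proof -
   \<comment> \<open>After retirement \<open>h\<close> vanishes, so one formula covers both cases;
     the 1 in the equation for \<open>g\<close> becomes the income stream.\<close>
   have e1: "(if u < tauR then h u 0 + 1 else 0) = h u 0 + (1 - retired tauR u)"
    using h_late[of u 0] that t0 d0 by (auto simp: retired_def)
   show ?thesis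
    unfolding g'_def e1 human_drift_def human_def beta kernel_def delay_def by (simp add: algebra_simps)
  qed
  have "(LBINT u:{t..s}. g' u*y u w + g u*(muy*y u w + dly y u w)) = (LBINT u:{t..s}. human_drift y u w - ?k u)"
   by (rule set_lebesgue_integral_cong) (use e in auto)
  also have "... = (LBINT u:{t..s}. human_drift y u w) - (kernel s - kernel t)"
   using set_integral_diff(2)[OF human_drift_integrable[OF hy w] k(1)] k(2) by simp
  finally show ?thesis by (simp add: I_def human_def kernel_def)
 qed
 have "itoint t (%s w. (g s*y s w) *\<^sub>R sigmay) I"
 proof (rule ito_exp_product[OF t0 gyc Ic])
  show "AE w in M. EX v v'. abs_cont t v v' & (ALL s>=t. g s*y s w = stoch_exp sigmay t s w * v s) \<and>
   (ALL s>=t. I s w = g s*y s w - g t*y t w - (LBINT u:{t..s}. stoch_exp sigmay t u w * v' u))"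
   using labor_path[OF y] AE_space
  proof eventually_elim
   case (elim w)
   interpret kernel_path t d phi x1 "%s. y s w" g h r delta beta tauR by (rule history_kernel[OF hy elim(2)])
   obtain v v' where v: "abs_cont t v v'" "!!s. t <= s ==> y s w = stoch_exp sigmay t s w * v s"
    "!!s. t <= s ==> stoch_exp sigmay t s w * v' s = muy*y s w + dly y s w" using elim(1) by blast
   have gv: "abs_cont t (%u. g u * v u) (%u. g' u * v u + g u * v' u)"
    unfolding g'_def by (rule abs_cont_mult[OF g_abs_cont v(1)])
   have "(LBINT u:{t..s}. stoch_exp sigmay t u w*(g' u * v u + g u * v' u))
     = (LBINT u:{t..s}. g' u*y u w + g u*(muy*y u w + dly y u w))" for s
   proof (rule set_lebesgue_integral_cong)
    have "stoch_exp sigmay t u w*(g' u * v u + g u * v' u) = g' u*(stoch_exp sigmay t u w * v u)+g u*(stoch_exp sigmay t u w * v' u)" for u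
     by (simp add: algebra_simps)
    thus "ALL u. u : {t..s} --> stoch_exp sigmay t u w*(g' u * v u + g u * v' u) = g' u*y u w + g u*(muy*y u w + dly y u w)"
     using v(2,3) by simp
   qed simp
   thus ?case using gv key[OF elim(2)] v(2)
    by (intro exI[of _ "%u. g u * v u"] exI[of _ "%u. g' u * v u + g u * v' u"]) auto
  qed
 qed
 moreover have "AE w in M. ALL s>=t. sint {t..s} (%u. human_drift y u w) \<and>
   human y s w = total_wealth d g h t 0 (x0, x1)+(LBINT u:{t..s}. human_drift y u w)+I s w"
  using ito_process_initial[OF labor_history(2)[OF y] t0] AE_space
 proof eventually_elim
  case (elim w)
  \<comment> \<open>The history is prescribed on \<open>{-d..<0}\<close> only; the remaining point 0
    does not affect the integral.\<close>
  have "ker y t w = (LBINT ze:{-d..0}. h t ze*x1 ze)"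
   unfolding sli_def
   by (rule integral_discrete_difference[where X="{0}"])
    (use hy elim(2) in "auto simp: indicator_def history_def")
  with elim(1) have "human y t w = total_wealth d g h t 0 (x0, x1)"
   by (simp add: human_def total_wealth_def)
  thus ?case using human_drift_integrable[OF hy elim(2)] by (simp add: I_def)
 qed
 ultimately show ?thesis
  unfolding ito_process_def using human_continuous(2)[OF hy] by blast
qed

lemma matrix_excess: "sigma *v kappa = mu - r *\<^sub>R 1"
 by (simp add: kappa matrix_vector_mul_assoc matrix_inv_inverse[OF sigma])

lemma excess_return: "theta \<bullet> (mu - r *\<^sub>R 1) = kappa \<bullet> (theta v* sigma)"
 unfolding matrix_excess[symmetric] by (metis dot_lmul_matrix inner_commute)

definition exposure :: "(real => 'a => real) => (real => 'a => real^'n) => real => 'a => real^'n" where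
 "exposure y theta s w = theta s w v* sigma + (g s*y s w) *\<^sub>R sigmay"

definition total :: "(real => 'a => real) => (real => 'a => real) => real => 'a => real" where
 "total y W s w = W s w + g s*y s w + ker y s w"

lemma total_human: "total y W s w = W s w + human y s w"
 by (simp add: total_def human_def)

lemma total_wealth_process: "total_wealth d g h s (W s w) (y s w, %ze. y (s + ze) w) = total y W s w"
 by (simp add: total_wealth_def total_def)

text \<open>The human capital equation is added or subtracted. The forward direction serves
  admissible strategies, the converse turns a prescribed total wealth into a wealth process.\<close>

lemma total_ito:
 assumes y: "income y"
 shows "wealth M Z r delta mu sigma tauR t w0 y (c, B, theta) W \<longleftrightarrow>
  itoproc t (total_wealth d g h t w0 (x0, x1))
   (%s w. (r + delta)*total y W s w + kappa \<bullet> exposure y theta s w - c s w - delta*B s w) (exposure y theta) (total y W)" (is "?A \<longleftrightarrow> ?B")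
proof
 let ?a = "%s w. (r + delta)*W s w + theta s w \<bullet> (mu - r *\<^sub>R 1)+(1 - retired tauR s)*y s w - c s w - delta*B s w"
 let ?b = "%s w. (r + delta)*total y W s w + kappa \<bullet> exposure y theta s w - c s w - delta*B s w"
 have e0: "w0 + total_wealth d g h t 0 (x0, x1) = total_wealth d g h t w0 (x0, x1)" by (simp add: total_wealth_def)
 have ab: "?a s w + 1*human_drift y s w = ?b s w" for s w
  unfolding human_drift_def total_human exposure_def excess_return by (simp add: algebra_simps inner_commute)
 {
  assume ?A
  hence "itoproc t w0 ?a (%s w. theta s w v* sigma) W" by (simp add: wealth_def)
  from ito_process_lincomb[OF this human_ito[OF y] t0, of 1] show ?B
   unfolding ab[unfolded mult_1] mult_1 e0 scaleR_one total_human[symmetric] exposure_def[symmetric] .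
 next
  assume ?B
  have ba: "?b s w + - 1*human_drift y s w = ?a s w" for s w using ab[of s w] by simp
  from ito_process_lincomb[OF \<open>?B\<close> human_ito[OF y] t0, of "- 1"]
  have "itoproc t w0 ?a (%s w. theta s w v* sigma) W"
   unfolding ba e0[symmetric] by (simp add: total_human exposure_def)
  thus ?A by (simp add: wealth_def)
 }
qed

end

section \<open>The budget inequality\<close>

lemma nn_integral_horizon:
 fixes tau :: "'b => real" and t :: real
 assumes [measurable]: "u : bm M" "tau : bm M"
 shows "(%n. \<integral>\<^sup>+x. u x*ind {t..t + real n} (tau x) \<partial>M) ----> (\<integral>\<^sup>+x. u x*ind {t..} (tau x) \<partial>M)"
proof (rule nn_integral_LIMSEQ)
 show "incseq (%n x. u x*ind {t..t + real n} (tau x))"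
  by (intro incseq_SucI le_funI mult_left_mono) (auto simp: indicator_def)
 fix x
 obtain n0 where "tau x - t <= real n0" using real_arch_simple by blast
 hence "u x*ind {t..t + real n} (tau x) = u x*ind {t..} (tau x)" if "n0 <= n" for n
  using of_nat_mono[OF that, where 'a=real] by (simp add: indicator_def)
 thus "(%n. u x*ind {t..t + real n} (tau x)) ----> u x*ind {t..} (tau x)"
  by (intro tendsto_eventually eventually_sequentiallyI)
qed measurable

context brownian
begin

sublocale LP: pair_sigma_finite lborel P ..

text \<open>Truncation of \<open>X\<close> extends the martingale property to nonnegative
  \<open>X\<close> of possibly infinite mean.\<close>

lemma nn_stoch_exp_martingale:
 assumes t: "0 <= t" "t <= s" "s <= T" and X: "X : bm (F s)" "!!w. 0 <= X w"
 shows "(NP w. ennreal (stoch_exp a t T w*X w)) = (NP w. ennreal (stoch_exp a t s w*X w))"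
proof -
 let ?X = "%n w. min (X w) (real n)"
 have lim: "(%n. (NP w. ennreal (stoch_exp a t u w*?X n w))) ----> (NP w. ennreal (stoch_exp a t u w*X w))"
  if "t <= u" for u
 proof (rule nn_integral_LIMSEQ)
  show "incseq (%n w. ennreal (stoch_exp a t u w*?X n w))"
   by (intro incseq_SucI le_funI ennreal_leI mult_left_mono) auto
  show "(%w. ennreal (stoch_exp a t u w*?X n w)) : bm P" for n
   using stoch_exp_P[OF t(1) that, of a] measurable_F_P[OF X(1)] by measurable
  fix w
  obtain N where N: "X w <= real N" using real_arch_simple by blast
  have "\<forall>\<^sub>F n in sequentially. ennreal (stoch_exp a t u w*?X n w) = ennreal (stoch_exp a t u w*X w)"
   using eventually_ge_at_top[of N] by eventually_elim (use N in "simp add: min_def")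
  thus "(%n. ennreal (stoch_exp a t u w*?X n w)) ----> ennreal (stoch_exp a t u w*X w)"
   by (rule tendsto_eventually)
 qed
 have eq: "(NP w. ennreal (stoch_exp a t T w*?X n w)) = (NP w. ennreal (stoch_exp a t s w*?X n w))" for n
 proof -
  have XF: "?X n : bm (F s)" using X(1) by measurable
  have m: "(%w. stoch_exp a t s w*?X n w) : bm (F s)"
   using XF stoch_exp_F[OF t(1,2) order_refl, of a] by measurable
  have i: "integrable P (%w. stoch_exp a t s w*?X n w)"
   by (rule bounded_mult_integrable[OF measurable_F_P[OF XF] _ stoch_exp_integrable(1)[OF t(1,2)], of "real n"]) (use X(2) in auto)
  have e: "stoch_exp a t T w*?X n w = stoch_exp a t s w*?X n w * stoch_exp a s T w" for w
   by (simp add: stoch_exp_mult[of a t s w T, symmetric])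
  have "(NP w. ennreal (stoch_exp a t T w*?X n w)) = ennreal (LINT w|P. stoch_exp a t s w*?X n w)"
   unfolding e
   by (subst nn_integral_eq_integral[OF stoch_exp_martingale(1)[OF order_trans[OF t(1,2)] t(3) m i]])
    (use X(2) stoch_exp_martingale(2)[OF order_trans[OF t(1,2)] t(3) m i] in "auto intro!: AE_I2 mult_nonneg_nonneg")
  also have "... = (NP w. ennreal (stoch_exp a t s w*?X n w))"
   using X(2) by (intro nn_integral_eq_integral[symmetric] i) auto
  finally show ?thesis .
 qed
 show ?thesis
  using lim[of T] lim[OF t(2)] t unfolding eq by (intro LIMSEQ_unique) auto
qed

context
 fixes t x a :: real and kappa :: "real^'n" and X q H
 assumes X: "itoproc t x (%s w. a*X s w + kappa \<bullet> H s w - q s w) H X"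
  and t0: "0 <= t" and fin: "!!T. t <= T ==> (NP w. qvar H t T w) < \<infinity>"
begin

text \<open>\<open>N\<close> is the stochastic integral of \<open>H\<close> plus the time integral
  of \<open>kappa \<bullet> H\<close>; by \<open>ito_girsanov\<close> with \<open>- kappa\<close>
  its mean under the density is zero. Since \<open>X - N\<close> is absolutely continuous, the
  ordinary product rule takes care of discounting.\<close>

lemma budget_path:
 obtains N where "cadapted t N"
  "AE w in M. ALL s>=t. sint {t..s} (%u. exp (- a*(u - t))*q u w) \<and>
   exp (- a*(s - t))*X s w + (LBINT u:{t..s}. exp (- a*(u - t))*q u w) =
   x + exp (- a*(s - t))*N s w + a*(LBINT u:{t..s}. exp (- a*(u - t))*N u w)"
  "!!T. t <= T ==> EX C. ALL s:{t..T}. integrable P (%w. (N s w)^2) & (LINT w|P. (N s w)^2) <= C & (LINT w|P. stoch_exp (- kappa) t T w*N s w) = 0"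
proof -
 obtain I where I: "itoint t H I" "AE w in M. ALL s>=t. sint {t..s} (%u. a*X u w + kappa \<bullet> H u w - q u w) \<and>
   X s w = x + (LBINT u:{t..s}. a*X u w + kappa \<bullet> H u w - q u w)+I s w"
  and Xc: "cadapted t X"
  using X unfolding ito_process_def by blast
 note Hp = ito_integralD[OF I(1)]
 define N0 where "N0 s w = I s w + (LBINT u:{t..s}. kappa \<bullet> H u w)" for s w
 \<comment> \<open>On a null set the energy of \<open>H\<close> may be infinite and the drift
   integral discontinuous; predictability of \<open>N\<close> is obtained from continuity of all its
   paths.\<close>
 define N where "N s w = (if continuous_on {t..} (%s. N0 s w) then N0 s w else 0)" for s w
 have path: "AE w in M. (ALL s. N s w = N0 s w) & (ALL s>=t. sint {t..s} (%u. exp (- a*(u - t))*q u w) \<and>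
   exp (- a*(s - t))*X s w + (LBINT u:{t..s}. exp (- a*(u - t))*q u w) =
   x + exp (- a*(s - t))*N s w + a*(LBINT u:{t..s}. exp (- a*(u - t))*N u w))"
  using I(2) Hp(3) AE_space
 proof eventually_elim
  case (elim w)
  have Xw: "continuous_on {t..} (%s. X s w)" by (rule cadapted_path[OF Xc elim(3)])
  have iX: "sint {t..s} (%u. a*X u w)" for s
   by (intro continuous_path_integrable continuous_intros Xw)
  have iH: "sint {t..s} (%u. kappa \<bullet> H u w)" if "t <= s" for s
   using path_drift_bound(1)[OF predictable_set_borel[OF Hp(1) t0 elim(3)] that] elim(2) that by blast
  have iq: "sint {t..s} (%u. a*X u w - q u w)" if "t <= s" for s
  proof -
   have "sint {t..s} (%u. (a*X u w + kappa \<bullet> H u w - q u w) - kappa \<bullet> H u w)"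
    using elim(1) that by (intro set_integral_diff(1)[OF _ iH]) auto
   thus ?thesis by (simp add: algebra_simps)
  qed
  have Y: "X s w - N0 s w = x + (LBINT u:{t..s}. a*X u w - q u w)" if s: "t <= s" for s
  proof -
   have "(LBINT u:{t..s}. a*X u w + kappa \<bullet> H u w - q u w) = (LBINT u:{t..s}. (a*X u w - q u w) + kappa \<bullet> H u w)"
    by (simp add: algebra_simps)
   also have "... = (LBINT u:{t..s}. a*X u w - q u w)+(LBINT u:{t..s}. kappa \<bullet> H u w)"
    by (rule set_integral_add(2)[OF iq[OF s] iH[OF s]])
   finally show ?thesis using elim(1) s by (simp add: N0_def)
  qed
  have ac: "abs_cont t (%s. X s w - N0 s w) (%u. a*X u w - q u w)"
   unfolding abs_cont_def using iq Y by simp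
  have "continuous_on {t..} (%s. X s w - (X s w - N0 s w))"
   by (intro continuous_on_diff Xw abs_cont_continuous[OF ac])
  hence Nc: "continuous_on {t..} (%s. N0 s w)" by simp
  hence N: "N s w = N0 s w" for s by (simp add: N_def)
  let ?D = "%u. exp (- a*(u - t))"
  have q: "sint {t..s} (%u. ?D u*q u w)" if "t <= s" for s
  proof -
   have "sint {t..s} (%u. a*X u w - (a*X u w - q u w))"
    by (rule set_integral_diff(1)[OF iX iq[OF that]])
   hence "sint {t..s} (%u. q u w)" by simp
   thus ?thesis by (intro set_integrable_continuous_mult continuous_intros)
  qed
  have ac2: "abs_cont t (%s. ?D s*(X s w - N0 s w)) (%u. a*(?D u*N0 u w) - ?D u*q u w)"
   by (rule abs_cont_cong[OF abs_cont_mult[OF abs_cont_exp[of t "- a" t] ac]]) (simp_all add: algebra_simps)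
  have iN: "sint {t..s} (%u. a*(?D u*N0 u w))" for s
   by (intro continuous_path_integrable continuous_intros Nc)
  have "?D s*X s w + (LBINT u:{t..s}. ?D u*q u w) = x + ?D s*N0 s w + a*(LBINT u:{t..s}. ?D u*N0 u w)" if s: "t <= s" for s
   using abs_contD(2)[OF ac2 s] set_integral_diff(2)[OF iN q[OF s]] Y[of t] by (simp add: right_diff_distrib)
  thus ?case using q N by simp
 qed
 have "cadapted t N"
  unfolding continuous_adapted_def
 proof (intro conjI allI impI ballI)
  fix s assume s: "t <= s"
  have "(%x. H (fst x) (snd x)) : bm (palg t)" using Hp(1) by (simp add: predictable_alt)
  hence "pred t (%s w. kappa \<bullet> H s w)" unfolding predictable_alt by measurable
  hence "N0 s : bm (F s)"
   unfolding N0_def using set_integral_F[OF _ t0] cadapted_F[OF Hp(2) s] by (intro borel_measurable_add) auto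
  thus "N s : bm (F s)" by (rule F_AE_eq) (use path in eventually_elim, simp)
 next
  show "continuous_on {t..} (%s. N s w)" for w by (cases "continuous_on {t..} (%s. N0 s w)") (simp_all add: N_def)
 qed
 moreover have "EX C. ALL s:{t..T}. integrable P (%w. (N s w)^2) & (LINT w|P. (N s w)^2) <= C & (LINT w|P. stoch_exp (- kappa) t T w*N s w) = 0"
  if T: "t <= T" for T
 proof -
  define B where "B = enn2real (NP w. qvar H t T w)"
  have B: "(NP w. qvar H t T w) = ennreal B" "0 <= B" using fin[OF T] by (simp_all add: B_def)
  show ?thesis
  proof (intro exI[of _ "(2 + 2*(kappa \<bullet> kappa)*(T - t))*(2*B + 1)"] ballI)
   fix s assume s: "s : {t..T}"
   have le: "(NP w. qvar H t s w) <= ennreal B"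
    unfolding B(1)[symmetric] using s by (intro nn_integral_mono mult_left_mono) (auto simp: indicator_def)
   note G = ito_girsanov[OF I(1) t0 _ _ le B(2), of T "- kappa"]
   have e: "I s w - (LBINT u:{t..s}. (- kappa) \<bullet> H u w) = N0 s w" for w
    by (simp add: N0_def sli_def)
   have NN: "AE w in P. N s w = N0 s w" unfolding AE_P_iff using path by eventually_elim simp
   note G' = G[unfolded e]
   have m: "N0 s : bm P" "N s : bm P"
    using G'(1) s cadapted_P[OF calculation, of s] by auto
   have 1: "integrable P (%w. (N s w)^2) \<longleftrightarrow> integrable P (%w. (N0 s w)^2)"
    by (rule integrable_cong_AE) (use m NN in auto)
   have 2: "(LINT w|P. (N s w)^2) = (LINT w|P. (N0 s w)^2)"
    by (rule integral_cong_AE) (use m NN in auto)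
   have 3: "(LINT w|P. stoch_exp (- kappa) t T w*N s w) = (LINT w|P. stoch_exp (- kappa) t T w*N0 s w)"
    by (rule integral_cong_AE) (use m NN stoch_exp_P[OF t0 T] in auto)
   have "(2 + 2*(kappa \<bullet> kappa)*(s - t))*(2*B + 1) <= (2 + 2*(kappa \<bullet> kappa)*(T - t))*(2*B + 1)"
    using s B(2) by (intro mult_right_mono add_left_mono mult_left_mono) auto
   thus "integrable P (%w. (N s w)^2) & (LINT w|P. (N s w)^2) <= (2 + 2*(kappa \<bullet> kappa)*(T - t))*(2*B + 1) \<and>
    (LINT w|P. stoch_exp (- kappa) t T w*N s w) = 0"
    unfolding 1 2 3 using G'(2-4) s by (simp add: inner_minus_left inner_minus_right)
  qed
 qed
 ultimately show thesis using path by (intro that[of N]) auto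
qed

text \<open>The path identity at \<open>T\<close> is multiplied by the density at \<open>T\<close>,
  not at \<open>s\<close>, so no stochastic product rule arises. Its terms in \<open>N\<close> have
  mean zero, the time integral by Fubini, and the discounted \<open>X T w\<close> is dropped because
  it is nonnegative.\<close>

lemma budget_horizon:
 assumes q: "AE w in M. ALL s>=t. 0 <= q s w" and pos: "AE w in M. ALL s>=t. 0 <= X s w" and T: "t <= T"
 shows "(NP w. (NS {t..T} (%s. ennreal (stoch_exp (- kappa) t T w*(exp (- a*(s - t))*q s w))))) <= ennreal x"
proof -
 obtain N where N: "cadapted t N" and
  path: "AE w in M. ALL s>=t. sint {t..s} (%u. exp (- a*(u - t))*q u w) \<and>
   exp (- a*(s - t))*X s w + (LBINT u:{t..s}. exp (- a*(u - t))*q u w) =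
   x + exp (- a*(s - t))*N s w + a*(LBINT u:{t..s}. exp (- a*(u - t))*N u w)"
  and mom: "!!T. t <= T ==> EX C. ALL s:{t..T}. integrable P (%w. (N s w)^2) & (LINT w|P. (N s w)^2) <= C & (LINT w|P. stoch_exp (- kappa) t T w*N s w) = 0"
  by (rule budget_path) (rule that, assumption+)
 let ?E = "stoch_exp (- kappa) t T" and ?D = "%u. exp (- a*(u - t))"
 obtain C where C: "!!s. s : {t..T} ==> integrable P (%w. (N s w)^2)" "!!s. s : {t..T} ==> (LINT w|P. (N s w)^2) <= C"
  "!!s. s : {t..T} ==> (LINT w|P. ?E w*N s w) = 0" using mom[OF T] by blast
 note E2 = stoch_exp_square_integrable[OF t0 T, of "- kappa"]
 have [measurable]: "?E : bm P" by (rule stoch_exp_P[OF t0 T])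
 have EN: "integrable P (%w. ?E w*N s w)" if "s : {t..T}" for s
  by (rule P.integrable_mult_L2[OF cadapted_P[OF N] _ C(1)[OF that] E2(1)]) (use that in auto)
 define Nt where "Nt x = (if fst x : {t..T} then N (fst x) (snd x) else 0)" for x
 have Nt: "u : {t..T} ==> Nt (u, w) = N u w" "u \<notin> {t..T} ==> Nt (u, w) = 0" for u w
  unfolding Nt_def by (simp_all del: atLeastAtMost_iff)
 note [measurable] = pred_joint_P[OF cadapted_pred[OF N] t0]
 have "(%x. if fst x <= T then if fst x : {t..} then N (fst x) (snd x) else 0 else 0) : bm (LxP)"
  by measurable
 hence [measurable]: "Nt : bm (LxP)" by (rule measurable_eqI) (auto simp: Nt_def)
 define f where "f = (%x. ?D (fst x)*(?E (snd x)*Nt x))"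
 have [measurable]: "f : bm (LxP)" unfolding f_def by measurable
 have f: "integrable (LxP) f"
 proof (rule LP.Fubini_integrable)
  have fi: "integrable P (%w. f (u, w))" for u
   using EN[of u] by (cases "u : {t..T}") (simp_all add: f_def Nt del: atLeastAtMost_iff)
  thus "AE u in lborel. integrable P (%w. f (u, w))" by simp
  \<comment> \<open>A bound for the mean of \<open>abs (f (u, w))\<close>, from
    \<open>abs (x*y) <= x^2 + y^2\<close> and a discount factor that grows if \<open>a\<close> is
    negative.\<close>
  define B where "B = exp (abs a*(T - t))*((LINT w|P. (?E w)^2)+C)"
  show "integrable lborel (%u. LINT w|P. norm (f (u, w)))"
  proof (rule Bochner_Integration.integrable_bound[where f="%u. ind {t..T} u*B"])
   show "AE u in lborel. norm (LINT w|P. norm (f (u, w))) <= norm (ind {t..T} u*B)"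
   proof (rule AE_I2)
    fix u
    show "norm (LINT w|P. norm (f (u, w))) <= norm (ind {t..T} u*B)"
    proof (cases "u : {t..T}")
     case True
     have "(LINT w|P. norm (f (u, w))) = ?D u*(LINT w|P. abs (?E w*N u w))"
      using True by (simp add: f_def Nt abs_mult del: atLeastAtMost_iff)
     also have "... <= exp (abs a*(T - t))*((LINT w|P. (?E w)^2)+C)"
     proof (rule mult_mono)
      have "- a*(u - t) <= abs a*(u - t)" using True by (intro mult_right_mono) auto
      also have "... <= abs a*(T - t)" using True by (intro mult_left_mono) auto
      finally show "?D u <= exp (abs a*(T - t))" by simp
      have "(LINT w|P. abs (?E w*N u w)) <= (LINT w|P. (?E w)^2 + (N u w)^2)"
      proof (rule integral_mono)
       show "abs (?E w*N u w) <= (?E w)^2 + (N u w)^2" for w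
        using abs_mult_le_squares[of "?E w" "N u w"] by linarith
      qed (use EN[OF True] E2(1) C(1)[OF True] in auto)
      thus "(LINT w|P. abs (?E w*N u w)) <= (LINT w|P. (?E w)^2)+C"
       using C(2)[OF True] E2(1) C(1)[OF True] by simp
     qed auto
     finally show ?thesis using True by (simp add: B_def)
    qed (simp add: f_def Nt del: atLeastAtMost_iff)
   qed
  qed (auto intro!: integrable_indicator_Icc)
 qed simp
 have f_w: "(LINT u|lborel. f (u, w)) = ?E w*(LBINT u:{t..T}. ?D u*N u w)" for w
  unfolding sli_def integral_mult_right_zero[symmetric]
  by (rule Bochner_Integration.integral_cong) (auto simp: f_def Nt indicator_def simp del: atLeastAtMost_iff)
 have f_snd: "integrable P (%w. LINT u|lborel. f (u, w))"
  using LP.integrable_snd[of "%u w. f (u, w)"] f by (simp add: split_beta')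
 have "(LINT w|P. (LINT u|lborel. f (u, w))) = (LINT u|lborel. (LINT w|P. f (u, w)))"
  using LP.integral_snd[of "%u w. f (u, w)"] LP.integral_fst'[OF f] f by (simp add: split_beta')
 also have "... = 0"
 proof (rule integral_eq_zero_AE, rule AE_I2)
  show "(LINT w|P. f (u, w)) = 0" for u
   using C(3)[of u] by (cases "u : {t..T}") (simp_all add: f_def Nt del: atLeastAtMost_iff)
 qed
 finally have f0: "(LINT w|P. (LINT u|lborel. f (u, w))) = 0" .
 define G where "G w = x*?E w + ?D T*(?E w*N T w)+a*(LINT u|lborel. f (u, w))" for w
 have Gi: "integrable P G"
  unfolding G_def using stoch_exp_integrable(1)[OF t0 T] EN[of T] T f_snd by simp
 have GE: "(LINT w|P. G w) = x"
  unfolding G_def using stoch_exp_integrable[OF t0 T] EN[of T] T f_snd f0 C(3)[of T] by simp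
 have AEG: "AE w in P. (NS {t..T} (%s. ennreal (?E w*(?D s*q s w)))) <= ennreal (G w) & 0 <= G w"
  unfolding AE_P_iff using path pos q
 proof eventually_elim
  case (elim w)
  let ?Q = "LBINT u:{t..T}. ?D u*q u w"
  have i: "sint {t..T} (%u. ?D u*q u w)" and e: "?D T*X T w + ?Q = x + ?D T*N T w + a*(LBINT u:{t..T}. ?D u*N u w)"
   using elim(1) T by blast+
  have "0 <= ?D T*X T w" using elim(2) T by simp
  hence "?E w*?Q <= ?E w*(?D T*X T w + ?Q)" by (intro mult_left_mono) auto
  also have "... = G w" unfolding e G_def f_w by (simp add: algebra_simps)
  finally have le: "?E w*?Q <= G w" .
  have p: "0 <= ind {t..T} u *\<^sub>R (?D u*q u w)" for u using elim(3) by (simp add: indicator_def)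
  have 0: "0 <= ?Q" unfolding sli_def by (rule Bochner_Integration.integral_nonneg[OF p])
  have "(NS {t..T} (%s. ennreal (?E w*(?D s*q s w)))) = (NL s. ennreal (?E w*(ind {t..T} s *\<^sub>R (?D s*q s w))))"
   by (rule nn_integral_cong) (simp add: indicator_def)
  also have "... = ennreal (?E w*?Q)"
   unfolding sli_def integral_mult_right_zero[symmetric]
   by (rule nn_integral_eq_integral[OF integrable_mult_right[OF i[unfolded set_integrable_def]]])
    (intro AE_I2 mult_nonneg_nonneg p stoch_exp_nonneg)
  finally show ?case using le 0 order_trans[OF mult_nonneg_nonneg[OF stoch_exp_nonneg 0] le] by (auto intro: ennreal_leI)
 qed
 have "(NP w. (NS {t..T} (%s. ennreal (?E w*(?D s*q s w))))) <= (NP w. ennreal (G w))"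
  by (rule nn_integral_mono_AE) (use AEG in eventually_elim, blast)
 also have "... = ennreal x"
  unfolding GE[symmetric] by (rule nn_integral_eq_integral[OF Gi]) (use AEG in eventually_elim, blast)
 finally show ?thesis .
qed

text \<open>For nonnegative integrands the density at \<open>T\<close> may be replaced by the one at
  \<open>s\<close>; the horizon then disappears from the integrand and monotone convergence
  applies.\<close>

lemma budget:
 assumes q: "pred t q" "AE w in M. ALL s>=t. 0 <= q s w" and pos: "AE w in M. ALL s>=t. 0 <= X s w"
 shows "(NP w. (NS {t..} (%s. ennreal (exp (- a*(s - t)) * stoch_exp (- kappa) t s w*q s w)))) <= ennreal x"
proof -
 obtain L where L: "cadapted t L" "!!s w. 0 < L s w" "AE w in M. ALL s. L s w = stoch_exp (- kappa) t s w"
  by (rule stoch_exp_version[OF t0, of "- kappa"]) (rule that, assumption+)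
 let ?D = "%u. exp (- a*(u - t))"
 \<comment> \<open>\<open>q\<close> is nonnegative only almost surely; \<open>max 0\<close> and the
   cut at \<open>t\<close> make the integrand nonnegative and measurable on the whole product
   space.\<close>
 define qp where "qp x = (if fst x : {t..} then ?D (fst x)*max 0 (q (fst x) (snd x)) else 0)" for x
 define Lp where "Lp x = (if fst x : {t..} then L (fst x) (snd x) else 0)" for x
 note [measurable] = pred_joint_P[OF cadapted_pred[OF L(1)] t0, folded Lp_def] pred_joint_P[OF q(1) t0]
 have "(%x. ?D (fst x)*max 0 (if fst x : {t..} then q (fst x) (snd x) else 0)) : bm (LxP)" by measurable
 hence [measurable]: "qp : bm (LxP)" by (rule measurable_eqI) (auto simp: qp_def)
 have qp0: "0 <= qp x" for x by (simp add: qp_def)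
 have qpF: "(%w. qp (s, w)) : bm (F s)" for s
  using predictable_section[OF q(1) t0, of s] by (cases "t <= s") (simp_all add: qp_def)
 let ?Phi = "%x. ennreal (Lp x*qp x)"
 have T: "(\<integral>\<^sup>+x. ?Phi x*ind {t..T} (fst x) \<partial>(LxP)) <= ennreal x" if T: "t <= T" for T
 proof -
  let ?E = "stoch_exp (- kappa) t T"
  have [measurable]: "?E : bm P" by (rule stoch_exp_P[OF t0 T])
  have "(\<integral>\<^sup>+x. ?Phi x*ind {t..T} (fst x) \<partial>(LxP)) = (NL s. (NP w. ?Phi (s, w)*ind {t..T} s))"
   by (subst P.nn_integral_fst[symmetric]) simp_all
  also have "... = (NL s. (NP w. ennreal (?E w*qp (s, w))*ind {t..T} s))"
  proof (rule nn_integral_cong)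
   fix s
   show "(NP w. ?Phi (s, w)*ind {t..T} s) = (NP w. ennreal (?E w*qp (s, w))*ind {t..T} s)"
   proof (cases "s : {t..T}")
    case True
    have "(NP w. ?Phi (s, w)) = (NP w. ennreal (stoch_exp (- kappa) t s w*qp (s, w)))"
     by (rule nn_integral_cong_AE, unfold AE_P_iff, use L(3) in eventually_elim) (use True in "simp add: Lp_def")
    also have "... = (NP w. ennreal (?E w*qp (s, w)))"
     using True by (intro nn_stoch_exp_martingale[OF t0 _ _ qpF qp0, symmetric]) auto
    finally show ?thesis using True by simp
   qed simp
  qed
  also have "... = (NP w. (NL s. ennreal (?E w*qp (s, w))*ind {t..T} s))"
   by (rule LP.Fubini'[symmetric]) (simp add: split_beta')
  also have "... = (NP w. (NS {t..T} (%s. ennreal (?E w*(?D s*q s w)))))"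
   by (rule nn_integral_cong_AE, unfold AE_P_iff, use q(2) in eventually_elim, rule nn_integral_cong) (auto simp: indicator_def qp_def)
  also have "... <= ennreal x" by (rule budget_horizon[OF q(2) pos T])
  finally show ?thesis .
 qed
 have "(%n. \<integral>\<^sup>+x. ?Phi x*ind {t..t + real n} (fst x) \<partial>(LxP)) ----> (\<integral>\<^sup>+x. ?Phi x*ind {t..} (fst x) \<partial>(LxP))"
  by (rule nn_integral_horizon) measurable
 hence lim: "(\<integral>\<^sup>+x. ?Phi x*ind {t..} (fst x) \<partial>(LxP)) <= ennreal x"
  by (rule LIMSEQ_le_const2) (use T in auto)
 have "(NP w. (NS {t..} (%s. ennreal (exp (- a*(s - t)) * stoch_exp (- kappa) t s w*q s w))))
   = (NP w. (NL s. ?Phi (s, w)*ind {t..} (fst (s, w))))"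
 proof (rule nn_integral_cong_AE, unfold AE_P_iff, use L(3) q(2) in eventually_elim)
  case (elim w)
  show ?case by (rule nn_integral_cong) (use elim in "auto simp: indicator_def Lp_def qp_def mult_ac")
 qed
 also have "... = (\<integral>\<^sup>+x. ?Phi x*ind {t..} (fst x) \<partial>(LxP))"
  by (rule LP.nn_integral_snd) measurable
 finally show ?thesis using lim by simp
qed

end

end

section \<open>Utility and the value factor\<close>

text \<open>Bernoulli's inequality, that is, the tangent at 1 of a concave or convex power: the
  first from Young's inequality, the second from the tangents of logarithm and exponential.\<close>

lemma powr_tangent:
 fixes x p :: real
 assumes x: "0 < x"
 shows "0 < p ==> p < 1 ==> x powr p <= 1 + p*(x - 1)" "p < 0 ==> 1 + p*(x - 1) <= x powr p"
proof -
 show "x powr p <= 1 + p*(x - 1)" if "0 < p" "p < 1"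
  using Youngs_inequality_0[of p "1 - p" x 1] that x by (simp add: algebra_simps)
 show "1 + p*(x - 1) <= x powr p" if "p < 0"
 proof -
  have "p*(x - 1) <= p*ln x" using that ln_le_minus_one[OF x] by (intro mult_left_mono_neg) auto
  also have "1 + p*ln x <= x powr p" using exp_ge_add_one_self[of "p*ln x"] x by (simp add: powr_def)
  finally show ?thesis by simp
 qed
qed

section \<open>Power utility and its tangents\<close>

context
 fixes gamma m z b :: real
 assumes gamma: "0 < gamma" "gamma ~= 1" and m: "0 < m" and z: "0 < z" and b: "b = 1 - 1 / gamma"
begin

text \<open>\<open>m powr (- b)*z\<close> is the consumption at which the slope of utility after
  scaling by \<open>m\<close> equals \<open>z powr (- gamma)\<close>; the variable \<open>c\<close>
  here is the ratio to that point.\<close>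

lemma crra_scale:
 "0 < c ==> (m*(m powr (- b)*(z*c))) powr (1 - gamma) = m powr (- b)*z powr (1 - gamma)*c powr (1 - gamma)"
proof -
 assume c: "0 < c"
 have "m*(m powr (- b)*(z*c)) = m powr (1 / gamma)*z*c"
  using m b powr_add[of m 1 "- b"] by (simp add: mult_ac)
 moreover have "(1 - gamma) / gamma = - b" using gamma by (simp add: b field_simps)
 hence "(m powr (1 / gamma)) powr (1 - gamma) = m powr (- b)" by (simp add: powr_powr)
 ultimately show ?thesis
  using m z c by (simp only: powr_mult powr_ge_zero less_imp_le mult_nonneg_nonneg)
qed

lemma crra_optimal: "crra gamma (m*(m powr (- b)*z)) = ereal (m powr (- b)*z powr (1 - gamma)/(1 - gamma))"
 using crra_scale[of 1] m z by (simp add: crra_def)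

text \<open>The right side is the tangent at \<open>m powr (- b)*z\<close>. Its slope
  \<open>z powr (- gamma)\<close> does not depend on \<open>m\<close>, so consumption and bequest
  are priced alike when both tangents are added.\<close>

lemma crra_tangent:
 assumes c: "0 <= c"
 shows "crra gamma (m*c) <= ereal (gamma/(1 - gamma)*(m powr (- b)*z powr (1 - gamma))+z powr (- gamma)*c)"
proof (cases "c = 0")
 case True
 show ?thesis
 proof (cases "gamma < 1")
  case True
  thus ?thesis using \<open>c = 0\<close> gamma by (simp add: crra_def)
 next
  case False
  thus ?thesis using \<open>c = 0\<close> gamma by (simp add: crra_def)
 qed
next
 case False
 define e where "e = c/(m powr (- b)*z)"
 have e: "0 < e" "c = m powr (- b)*(z*e)" using False c m z by (simp_all add: e_def)
 have 1: "(1/(1 - gamma))*e powr (1 - gamma) <= (1/(1 - gamma))*(1 + (1 - gamma)*(e - 1))"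
 proof (cases "gamma < 1")
  case True
  thus ?thesis using powr_tangent(1)[OF e(1), of "1 - gamma"] gamma by (intro mult_left_mono) auto
 next
  case False
  thus ?thesis using powr_tangent(2)[OF e(1), of "1 - gamma"] gamma by (intro mult_left_mono_neg) auto
 qed
 have 2: "(1/(1 - gamma))*(1 + (1 - gamma)*(e - 1)) = gamma/(1 - gamma)+e" using gamma by (simp add: field_simps)
 have zz: "z powr (- gamma)*z = z powr (1 - gamma)" using z powr_add[of z "- gamma" 1] by (simp add: add.commute)
 have "(m*c) powr (1 - gamma)/(1 - gamma) = m powr (- b)*z powr (1 - gamma)*((1/(1 - gamma))*e powr (1 - gamma))"
  unfolding e(2) crra_scale[OF e(1)] by simp
 also have "... <= m powr (- b)*z powr (1 - gamma)*(gamma/(1 - gamma)+e)"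
  using 1 unfolding 2 by (intro mult_left_mono) auto
 also have "... = gamma/(1 - gamma)*(m powr (- b)*z powr (1 - gamma))+z powr (- gamma)*c"
  unfolding e(2) zz[symmetric] by (simp add: algebra_simps)
 finally show ?thesis using m False by (simp add: crra_def)
qed

end

text \<open>The pieces have to match at \<open>tau\<close> only if \<open>tau\<close> lies at or
  after \<open>t\<close>; otherwise the first piece never occurs.\<close>

lemma abs_cont_glue:
 assumes f: "abs_cont t f f'" and g: "abs_cont t g g'" and eq: "t <= tau ==> f tau = g tau"
 shows "abs_cont t (%u. if u < tau then f u else g u) (%u. if u < tau then f' u else g' u)"
 unfolding abs_cont_def
proof (intro allI impI)
 fix s assume s: "t <= s"
 let ?k' = "%u. if u < tau then f' u else g' u" and ?k = "%u. if u < tau then f u else g u"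
 have i: "sint {t..s} ?k'"
 proof -
  have p: "sint {t..s} (%u. ind A u*w u)" if "sint {t..s} w" "A : sets lborel" for A and w :: "real => real"
   using integrable_mult_indicator[OF that(2) that(1)[unfolded set_integrable_def]]
   by (simp add: set_integrable_def mult.left_commute)
  have "sint {t..s} (%u. ind {..<tau} u*f' u + ind {tau..} u*g' u)"
   by (intro set_integral_add(1) p abs_contD(1)[OF f s] abs_contD(1)[OF g s]) simp_all
  thus ?thesis by (rule set_integrable_cong[THEN iffD1, rotated 3]) (auto simp: indicator_def)
 qed
 have pre: "(LBINT u:{t..a}. ?k' u) = f a - f t" if "t <= a" "a <= tau" for a
 proof -
  have "(LBINT u:{t..a}. ?k' u) = (LBINT u:{t..a}. f' u)"
   unfolding sli_def
   by (rule integral_discrete_difference[where X="{tau}"]) (use that in "auto simp: indicator_def")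
  thus ?thesis using abs_contD(2)[OF f that(1)] by simp
 qed
 have post: "(LBINT u:{a..s}. ?k' u) = g s - g a" if "t <= a" "tau <= a" "a <= s" for a
 proof -
  have "(LBINT u:{a..s}. ?k' u) = (LBINT u:{a..s}. g' u)"
   by (rule set_lebesgue_integral_cong) (use that in auto)
  thus ?thesis using abs_cont_diff[OF g that(1,3)] by simp
 qed
 have "?k s = ?k t + (LBINT u:{t..s}. ?k' u)"
 proof (cases "s < tau")
  case True
  thus ?thesis using pre[of s] s by simp
 next
  case sT: False
  show ?thesis
  proof (cases "t < tau")
   case True
   thus ?thesis
    using set_integral_split_at(1)[OF i, of tau] pre[of tau] post[of tau] eq sT by simp
  next
   case False
   thus ?thesis using post[of t] s sT by simp
  qed
 qed
 with i show "sint {t..s} ?k' & ?k s = ?k t + (LBINT u:{t..s}. ?k' u)" ..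
qed

section \<open>The deterministic factor \<open>f\<close>\<close>

locale preferences =
 fixes delta K k b tauR nu eta etahat :: real and f :: "real => real"
 assumes delta: "0 < delta" and K: "1 < K" and k: "0 < k" and nu: "0 < nu"
  and eta: "eta = (1 + delta*k powr (- b)) * nu" and etahat: "etahat = (K powr (- b) + delta*k powr (- b)) * nu"
  and f: "f = (%t. (etahat - eta)*exp (- (max 0 (tauR - t) / nu)) + eta)"
begin

text \<open>The outlay \<open>c + delta*B\<close> of the candidate per unit of total wealth divided
  by \<open>f\<close>; the same factor appears in its utility.\<close>

definition rate :: "real => real" where "rate s = K powr (- b*retired tauR s) + delta*k powr (- b)"

lemma rate_pos: "0 < rate s"
 using delta K k by (simp add: rate_def add_pos_nonneg)

lemma rate_measurable [measurable]: "rate : bm borel"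
 unfolding rate_def[abs_def] retired_def by measurable

lemma eta_pos: "0 < eta" "0 < etahat"
 using delta K k nu unfolding eta etahat by (auto intro!: mult_pos_pos add_pos_nonneg)

lemma f_bounds: "min eta etahat <= f s" "f s <= max eta etahat"
proof -
 let ?e = "exp (- (max 0 (tauR - s) / nu))"
 have e: "0 <= ?e" "?e <= 1" using nu by auto
 have fs: "f s = (1 - ?e) * eta + ?e * etahat" by (simp add: f algebra_simps)
 have m: "m = (1 - ?e)*m + ?e*m" for m by (simp add: algebra_simps)
 have "(1 - ?e)*min eta etahat + ?e*min eta etahat <= f s" "f s <= (1 - ?e)*max eta etahat + ?e*max eta etahat"
  unfolding fs using e by (auto intro!: add_mono mult_left_mono)
 thus "min eta etahat <= f s" "f s <= max eta etahat" unfolding m[symmetric] .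
qed

lemma f_pos: "0 < f s"
 using f_bounds(1)[of s] eta_pos by (simp add: min_def split: if_splits)

lemma f_continuous: "continuous_on S f"
 unfolding f by (intro continuous_intros) (use nu in auto)

text \<open>\<open>f\<close> solves a linear equation whose stationary values before and after
  retirement are \<open>eta\<close> and \<open>etahat\<close>; the two pieces meet at
  \<open>tauR\<close> in \<open>etahat\<close>.\<close>

lemma f_abs_cont: "abs_cont t f (%s. f s / nu - rate s)"
proof -
 let ?f = "%u. (etahat - eta)*exp ((u - tauR) / nu) + eta"
 have 1: "abs_cont t ?f (%u. (etahat - eta)*(exp ((u - tauR) / nu) / nu))"
  using abs_cont_add[OF abs_cont_cmult[OF abs_cont_exp[of t "1 / nu" tauR], of "etahat - eta"] abs_cont_const[of t eta]] by simp
 have "abs_cont t (%u. if u < tauR then ?f u else etahat) (%u. if u < tauR then (etahat - eta)*(exp ((u - tauR) / nu) / nu) else 0)"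
  by (rule abs_cont_glue[OF 1 abs_cont_const]) simp
 thus ?thesis
 proof (rule abs_cont_cong)
  fix u
  have e: "(u - tauR) / nu = - ((tauR - u) / nu)" by (simp add: diff_divide_distrib)
  show fu: "(if u < tauR then ?f u else etahat) = f u" unfolding f e by (simp add: max_def)
  show "(if u < tauR then (etahat - eta)*(exp ((u - tauR) / nu) / nu) else 0) = f u / nu - rate u"
  proof (cases "u < tauR")
   case True
   have "f u / nu = (etahat - eta)*(exp ((u - tauR) / nu) / nu) + eta / nu"
    using True fu[symmetric] by (simp add: add_divide_distrib)
   moreover have "eta / nu = rate u" using True K nu by (simp add: eta rate_def retired_def)
   ultimately show ?thesis using True by simp
  next
   case False
   hence "f u = etahat" by (simp add: f max_def)
   thus ?thesis using False nu by (simp add: etahat rate_def retired_def)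
  qed
 qed
qed

text \<open>\<open>f\<close> is the present value of the future \<open>rate\<close> at discount rate
  \<open>1 / nu\<close>: integrate its equation, and the boundary term vanishes at infinity because
  \<open>f\<close> is bounded.\<close>

lemma rate_discounted: "(NS {t..} (%s. ennreal (rate s*exp (- (s - t) / nu)))) = ennreal (f t)"
proof -
 let ?D = "%s. exp (- 1 / nu*(s - t))"
 have e: "exp (- (s - t) / nu) = ?D s" for s by (simp add: diff_divide_distrib)
 have "abs_cont t (%s. ?D s*f s) (%s. - 1*(rate s*?D s))"
  by (rule abs_cont_cong[OF abs_cont_mult[OF abs_cont_exp[of t "- 1 / nu" t] f_abs_cont]]) (simp_all add: algebra_simps)
 from abs_cont_cmult[OF this, of "- 1"]
 have ac: "abs_cont t (%s. - (?D s*f s)) (%s. rate s*?D s)" by simp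
 have T: "(NS {t..T} (%s. ennreal (rate s*?D s))) = ennreal (f t - ?D T*f T)" if "t <= T" for T
 proof -
  have "(NS {t..T} (%s. ennreal (rate s*?D s))) = (NL s. ennreal (ind {t..T} s *\<^sub>R (rate s*?D s)))"
   by (rule nn_integral_cong) (simp add: indicator_def)
  also have "... = ennreal (LBINT s:{t..T}. rate s*?D s)"
   unfolding sli_def using abs_contD(1)[OF ac that] rate_pos
   by (intro nn_integral_eq_integral) (auto simp: set_integrable_def less_imp_le)
  also have "?D t = 1" by simp
  hence "(LBINT s:{t..T}. rate s*?D s) = f t - ?D T*f T"
   using abs_contD(2)[OF ac that] by (simp only: mult_1)
  finally show ?thesis .
 qed
 have "(%n. (NS {t..t + real n} (%s. ennreal (rate s*?D s)))) ----> (NS {t..} (%s. ennreal (rate s*?D s)))"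
  by (rule nn_integral_horizon[where tau="%s. s"]) measurable
 moreover have "(%n. (NS {t..t + real n} (%s. ennreal (rate s*?D s)))) ----> ennreal (f t - 0)"
 proof -
  have "(%n. ?D (t + real n)*f (t + real n)) ----> 0"
  proof (rule tendsto_sandwich[OF _ _ tendsto_const])
   have "(%n. exp (- 1 / nu) ^ n) ----> 0" using nu by (intro LIMSEQ_power_zero) simp
   hence "(%n. exp (- 1 / nu) ^ n*max eta etahat) ----> 0" by (rule tendsto_mult_left_zero)
   moreover have "?D (t + real n) = exp (- 1 / nu) ^ n" for n
    by (simp add: exp_of_nat_mult[symmetric] mult.commute)
   ultimately show "(%n. ?D (t + real n)*max eta etahat) ----> 0" by (simp only:)
   show "\<forall>\<^sub>F n in sequentially. ?D (t + real n)*f (t + real n) <= ?D (t + real n)*max eta etahat"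
    using f_bounds(2) by (intro always_eventually allI mult_left_mono) auto
   show "\<forall>\<^sub>F n in sequentially. 0 <= ?D (t + real n)*f (t + real n)"
    using f_pos[THEN less_imp_le] by (intro always_eventually allI mult_nonneg_nonneg) auto
  qed
  hence "(%n. ennreal (f t - ?D (t + real n)*f (t + real n))) ----> ennreal (f t - 0)"
   by (intro tendsto_ennrealI tendsto_diff tendsto_const)
  thus ?thesis by (simp only: T[of "t + real _"] le_add_same_cancel1 of_nat_0_le_iff)
 qed
 ultimately show ?thesis unfolding e by (intro LIMSEQ_unique) simp_all
qed

end

section \<open>The optimal total wealth process\<close>

locale merton = market M Z t d muy x0 phi x1 sigmay r delta beta tauR g h mu kappa sigma + preferences delta K k b tauR nu eta etahat f
 for M :: "'a measure" and Z :: "real => 'a => real^'n" and t d muy x0 phi x1 sigmay r delta beta tauR g h mu kappa sigma K k b nu eta etahat f +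
 fixes rho gamma :: real
 assumes gamma: "0 < gamma" "gamma ~= 1" and b: "b = 1 - 1 / gamma"
  and nu_def: "gamma / nu = rho + delta - (1 - gamma)*(r + delta + (kappa \<bullet> kappa)/(2 * gamma))"
begin

text \<open>The exponential rate of candidate wealth divided by \<open>f\<close> once the stochastic
  exponential is split off. It arises from \<open>drift_rate\<close> by subtracting the logarithmic
  derivative \<open>1 / nu - rate s / f s\<close> of \<open>f\<close>.\<close>

definition growth :: real where "growth = r + delta + (kappa \<bullet> kappa) / gamma - 1 / nu"

text \<open>The derivative in \<open>x\<close> of the value claimed for total wealth
  \<open>x\<close> at time \<open>t\<close>, and the factor between marginal utility and state price
  density.\<close>

definition price :: "real => real" where "price x = exp (- (rho + delta)*t)*(f t/x) powr gamma"

definition drift_rate :: "real => real" where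
 "drift_rate s = r + delta + (1 / gamma)*(kappa \<bullet> kappa) - inverse (f s)*rate s"

abbreviation "E s w \<equiv> stoch_exp ((1 / gamma) *\<^sub>R kappa) t s w"

text \<open>Both rearrange the defining relation of \<open>nu\<close>: the first matches the
  exponents of marginal utility and state price density, the second gives the decay rate of the
  expected utility flow.\<close>

lemma growth_identities:
 "rho + delta + gamma*growth - (gamma^2 + gamma)/2*((kappa \<bullet> kappa) / gamma^2) = r + delta"
 "rho + delta - (1 - gamma)*growth - ((1 - gamma)^2 - (1 - gamma))/2*((kappa \<bullet> kappa) / gamma^2) = 1 / nu"
proof -
 define n X where "n = 1 / nu" and "X = kappa \<bullet> kappa"
 have n: "rho + delta = gamma*n + (1 - gamma)*(r + delta + X/(2 * gamma))"
  using nu_def by (simp add: n_def X_def)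
 show "rho + delta + gamma*growth - (gamma^2 + gamma)/2*((kappa \<bullet> kappa) / gamma^2) = r + delta"
  "rho + delta - (1 - gamma)*growth - ((1 - gamma)^2 - (1 - gamma))/2*((kappa \<bullet> kappa) / gamma^2) = 1 / nu"
  unfolding growth_def n X_def[symmetric] n_def[symmetric]
  using gamma(1) by (simp_all add: field_simps power2_eq_square)
qed

text \<open>The candidate is written down explicitly instead of being obtained from its equation,
  which shows its sign at once.\<close>

lemma reference:
 assumes x: "0 <= x"
 obtains G where "cadapted t G" "!!s w. 0 <= G s w" "!!s w. 0 < x ==> 0 < G s w"
  "itoproc t x (%s w. G s w*drift_rate s) (%s w. ((1 / gamma)*G s w) *\<^sub>R kappa) G"
  "AE w in M. ALL s. G s w = x*(f s/f t*exp (growth*(s - t)))*E s w"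
proof -
 obtain L where L: "cadapted t L" "!!s w. 0 < L s w" "!!w. L t w = 1" "AE w in M. ALL s. L s w = E s w"
  by (rule stoch_exp_version[OF t0, of "(1 / gamma) *\<^sub>R kappa"]) (rule that, assumption+)
 define v where "v s = x*(f s/f t*exp (growth*(s - t)))" for s
 define G where "G s w = L s w * v s" for s w
 have v0: "0 <= v s" "0 < x ==> 0 < v s" for s using f_pos[of s] f_pos[of t] x by (simp_all add: v_def)
 have vc: "continuous_on S v" for S
  unfolding v_def by (intro continuous_intros f_continuous) (use f_pos[of t] in simp)
 have Gc: "cadapted t G"
  using L(1) vc unfolding continuous_adapted_def G_def by (auto intro!: continuous_intros borel_measurable_times)
 have ac: "abs_cont t v (%s. v s*drift_rate s)"
 proof (rule abs_cont_cong[OF abs_cont_cmult[OF abs_cont_mult[OF f_abs_cont abs_cont_exp[of t growth t]], of "x/f t"]])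
  fix u
  show "x/f t*(f u*exp (growth*(u - t))) = v u" by (simp add: v_def)
  have "drift_rate u = 1 / nu + growth - inverse (f u)*rate u" by (simp add: drift_rate_def growth_def)
  moreover have "v u*inverse (f u) = x/f t*exp (growth*(u - t))" using f_pos[of u] by (simp add: v_def)
  ultimately have "v u*drift_rate u = v u*(1 / nu + growth) - x/f t*exp (growth*(u - t))*rate u"
   by (simp only: right_diff_distrib mult.assoc[symmetric])
  thus "x/f t*((f u / nu - rate u)*exp (growth*(u - t))+f u*(growth*exp (growth*(u - t)))) = v u*drift_rate u"
   by (simp add: v_def algebra_simps add_divide_distrib)
 qed
 have gi: "sint {t..s} (%u. G u w*drift_rate u)" if "w : space M" "t <= s" for s w
 proof -
  have "sint {t..s} (%u. L u w*(v u*drift_rate u))"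
   by (intro set_integrable_continuous_mult abs_contD(1)[OF ac that(2)] continuous_on_subset[OF cadapted_path[OF L(1) that(1)]]) auto
  thus ?thesis by (simp add: G_def mult.assoc)
 qed
 have "drift_rate : bm borel"
  using borel_measurable_continuous_onI[OF f_continuous] unfolding drift_rate_def[abs_def] by measurable
 hence [measurable]: "(%x. drift_rate (fst x)) : bm (palg t)"
  using predictable_deterministic[of drift_rate t] by (simp add: predictable_alt)
 have [measurable]: "(%x. G (fst x) (snd x)) : bm (palg t)"
  using cadapted_pred[OF Gc] by (simp add: predictable_alt)
 have gp: "pred t (%s w. G s w*drift_rate s)" unfolding predictable_alt by measurable
 define I where "I s w = G s w - G t w - (LBINT u:{t..s}. G u w*drift_rate u)" for s w
 have Ic: "cadapted t I"
  using Gc cadapted_integral[OF gp t0 gi] unfolding I_def[abs_def] continuous_adapted_def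
  by (auto intro!: continuous_intros borel_measurable_diff intro: measurable_F_mono)
 have AEG: "AE w in M. ALL s. G s w = v s*E s w"
  using L(4) by eventually_elim (simp add: G_def)
 have "itoint t (%s w. G s w *\<^sub>R ((1 / gamma) *\<^sub>R kappa)) I"
 proof (rule ito_exp_product[OF t0 Gc Ic])
  show "AE w in M. EX v v'. abs_cont t v v' & (ALL s>=t. G s w = E s w * v s) \<and>
   (ALL s>=t. I s w = G s w - G t w - (LBINT u:{t..s}. E u w * v' u))"
   using AEG
  proof eventually_elim
   case (elim w)
   thus ?case using ac
    by (intro exI[of _ v] exI[of _ "%s. v s*drift_rate s"]) (simp add: I_def mult_ac)
  qed
 qed
 hence ito: "itoint t (%s w. ((1 / gamma)*G s w) *\<^sub>R kappa) I" by (simp add: mult.commute)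
 have Gt: "G t w = x" for w using f_pos[of t] by (simp add: G_def L(3) v_def)
 have p: "itoproc t x (%s w. G s w*drift_rate s) (%s w. ((1 / gamma)*G s w) *\<^sub>R kappa) G"
  unfolding ito_process_def using Gc ito gi
  by (intro conjI exI[of _ I] AE_I2) (auto simp: I_def Gt)
 show thesis
  by (rule that[OF Gc _ _ p AEG[unfolded v_def]])
   (use v0 L(2) in \<open>auto simp: G_def intro!: mult_nonneg_nonneg mult_pos_pos less_imp_le[of 0 "L _ _"]\<close>)
qed

lemma E_powr: "E s w powr p = stoch_exp ((p / gamma) *\<^sub>R kappa) t s w*exp ((p^2 - p)/2*((kappa \<bullet> kappa) / gamma^2)*(s - t))"
 unfolding stoch_exp_powr by (simp add: power2_eq_square)

lemma reference_powr:
 assumes x: "0 < x" and G: "G = x*(f s/f t*exp (growth*(s - t)))*E s w"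
 shows "(G/f s) powr p = (x/f t) powr p*exp (p*growth*(s - t))*(E s w powr p)"
proof -
 have 1: "G/f s = (x/f t)*exp (growth*(s - t))*E s w" unfolding G using f_pos[of s] by (simp add: field_simps)
 have "(a*e*q) powr p = a powr p*e powr p*(q powr p)" if "0 <= a" "0 <= e" "0 <= q" for a e q :: real
  using that by (simp add: powr_mult)
 from this[of "x/f t" "exp (growth*(s - t))" "E s w"] show ?thesis
  unfolding 1 using x f_pos[of t] by (simp add: exp_powr_real mult_ac)
qed

lemma reference_price:
 assumes x: "0 < x" and G: "G = x*(f s/f t*exp (growth*(s - t)))*E s w"
 shows "exp (- (rho + delta) * s)*(G/f s) powr (- gamma) = price x*(exp (- (r + delta)*(s - t)) * stoch_exp (- kappa) t s w)"
proof -
 have "exp (- (rho + delta) * s)*exp (- gamma*growth*(s - t))*exp (((- gamma)^2 - (- gamma))/2*((kappa \<bullet> kappa) / gamma^2)*(s - t))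
  = exp (- (rho + delta)*t)*exp (- (r + delta)*(s - t))"
  unfolding growth_identities(1)[symmetric] exp_add[symmetric] by (intro arg_cong[of _ _ exp]) (simp add: algebra_simps)
 moreover have "(x/f t) powr (- gamma) = (f t/x) powr gamma" using x f_pos[of t] by (simp add: powr_minus powr_divide field_simps)
 moreover have "(- gamma / gamma) *\<^sub>R kappa = - kappa" using gamma(1) by simp
 ultimately show ?thesis
  unfolding reference_powr[OF x G] E_powr price_def by (simp only: mult_ac)
qed

lemma price_value: "0 < x ==> price x*x = exp (- (rho + delta)*t)*(f t powr gamma*x powr (1 - gamma))"
 using f_pos[of t] by (simp add: price_def powr_divide powr_diff)

text \<open>After Fubini the remaining stochastic exponential has mean one, and what is left is the
  deterministic integral of \<open>rate_discounted\<close>. The factor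
  \<open>1 / (1 - gamma)\<close> is left out to stay with nonnegative integrals.\<close>

lemma reference_utility:
 assumes x: "0 < x" and G: "cadapted t G" "AE w in M. ALL s. G s w = x*(f s/f t*exp (growth*(s - t)))*E s w"
 shows "(NP w. (NS {t..} (%s. ennreal (exp (- (rho + delta) * s)*(rate s*(G s w/f s) powr (1 - gamma)))))) = ennreal (price x*x)"
proof -
 let ?p = "1 - gamma"
 let ?U = "%s w. exp (- (rho + delta) * s)*(rate s*(G s w/f s) powr ?p)"
 let ?c = "exp (- (rho + delta)*t)*(x/f t) powr ?p"
 note [measurable] = pred_joint_P[OF cadapted_pred[OF G(1)] t0]
 have [measurable]: "f : bm borel" by (rule borel_measurable_continuous_onI[OF f_continuous])
 have "(%x. ennreal (exp (- (rho + delta)*fst x)*(rate (fst x)*((if fst x : {t..} then G (fst x) (snd x) else 0)/f (fst x)) powr ?p))*ind {t..} (fst x)) : bm (LxP)"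
  by measurable
 hence m: "(%(s, w). ennreal (?U s w)*ind {t..} s) : bm (LxP)"
  by (rule measurable_eqI) (auto simp: indicator_def)
 have "(NP w. (NS {t..} (%s. ennreal (?U s w)))) = (NL s. (NP w. ennreal (?U s w)*ind {t..} s))"
  by (rule LP.Fubini'[OF m])
 also have "... = (NS {t..} (%s. ennreal ?c*ennreal (rate s*exp (- (s - t) / nu))))"
 proof (rule nn_integral_cong)
  fix s
  show "(NP w. ennreal (?U s w)*ind {t..} s) = ennreal ?c*ennreal (rate s*exp (- (s - t) / nu))*ind {t..} s"
  proof (cases "t <= s")
   case True
   have e: "exp (- (rho + delta) * s)*exp (?p*growth*(s - t))*exp ((?p^2 - ?p)/2*((kappa \<bullet> kappa) / gamma^2)*(s - t))
    = exp (- (rho + delta)*t)*exp (- (s - t) / nu)"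
   proof -
    have n: "- (s - t) / nu = - (1 / nu)*(s - t)" by (simp add: diff_divide_distrib)
    show ?thesis
     unfolding n growth_identities(2)[symmetric] exp_add[symmetric] by (intro arg_cong[of _ _ exp]) (simp add: algebra_simps)
   qed
   have "(NP w. ennreal (?U s w)) = (NP w. ennreal (?c*(rate s*exp (- (s - t) / nu)))*ennreal (stoch_exp ((?p / gamma) *\<^sub>R kappa) t s w))"
   proof (rule nn_integral_cong_AE, unfold AE_P_iff, use G(2) in eventually_elim)
    case (elim w)
    have "?U s w = ?c*(rate s*exp (- (s - t) / nu)) * stoch_exp ((?p / gamma) *\<^sub>R kappa) t s w"
     unfolding reference_powr[OF x elim[rule_format]] E_powr
    proof -
     have "a1*(q*(y*a2*(z*a3))) = y*q*z*(a1*a2*a3)" for a1 a2 a3 q y z :: real by simp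
     from this[of "exp (- (rho + delta) * s)" "rate s" "(x/f t) powr ?p" "exp (?p*growth*(s - t))" "stoch_exp ((?p / gamma) *\<^sub>R kappa) t s w" "exp ((?p^2 - ?p)/2*((kappa \<bullet> kappa) / gamma^2)*(s - t))"]
     show "exp (- (rho + delta) * s)*(rate s*((x/f t) powr ?p*exp (?p*growth*(s - t)) *
       (stoch_exp ((?p / gamma) *\<^sub>R kappa) t s w*exp ((?p^2 - ?p)/2*((kappa \<bullet> kappa) / gamma^2)*(s - t))))) =
      ?c*(rate s*exp (- (s - t) / nu)) * stoch_exp ((?p / gamma) *\<^sub>R kappa) t s w"
      unfolding e by (simp only: mult_ac)
    qed
    thus ?case by (simp only: ennreal_mult'' stoch_exp_nonneg)
   qed
   also have "... = ennreal (?c*(rate s*exp (- (s - t) / nu)))*(NP w. ennreal (stoch_exp ((?p / gamma) *\<^sub>R kappa) t s w))"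
    using t0 True by (intro nn_integral_cmult) simp
   also have "(NP w. ennreal (stoch_exp ((?p / gamma) *\<^sub>R kappa) t s w)) = 1"
    using stoch_exp_integrable[OF t0 True] by (subst nn_integral_eq_integral) auto
   finally show ?thesis using True rate_pos[of s] by (simp add: ennreal_mult'' less_imp_le)
  qed simp
 qed
 also have "... = ennreal ?c*ennreal (f t)"
  unfolding rate_discounted[symmetric] mult.assoc by (rule nn_integral_cmult) measurable
 also have "... = ennreal (price x*x)"
  unfolding price_value[OF x] ennreal_mult''[OF f_pos[THEN less_imp_le], symmetric]
  using x f_pos[of t] powr_add[of "f t" gamma "1 - gamma"] by (intro arg_cong[of _ _ ennreal]) (simp add: powr_divide field_simps)
 finally show ?thesis .
qed

end

section \<open>Verification\<close>

context brownian
begin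

text \<open>The objective integrates over time first and over \<open>P\<close> second; linearity of
  this iterated integral is obtained through the product measure.\<close>

lemma iterated_add:
 fixes u v :: "real \<times> 'a => ennreal"
 assumes "u : bm (LxP)" "v : bm (LxP)"
 shows "(NP w. (NL s. u (s, w)+v (s, w))) = (NP w. (NL s. u (s, w)))+(NP w. (NL s. v (s, w)))"
 using LP.nn_integral_snd[of "%x. u x + v x"] LP.nn_integral_snd[of u] LP.nn_integral_snd[of v] assms
 by (simp add: nn_integral_add)

lemma iterated_cmult:
 fixes u :: "real \<times> 'a => ennreal"
 assumes "u : bm (LxP)"
 shows "(NP w. (NL s. c*u (s, w))) = c*(NP w. (NL s. u (s, w)))"
 using LP.nn_integral_snd[of "%x. c*u x"] LP.nn_integral_snd[of u] assms by (simp add: nn_integral_cmult)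

lemma square_moment_integral:
 assumes X: "cadapted t X" and t: "0 <= t" "t <= T"
  and K: "!!s. s : {t..T} ==> (NP w. ennreal ((X s w)^2)) <= ennreal K"
 shows "(NP w. (NS {t..T} (%s. ennreal ((X s w)^2)))) < \<infinity>"
proof -
 note [measurable] = pred_joint_P[OF cadapted_pred[OF X] t(1)]
 have "(%x. ennreal ((if fst x : {t..} then X (fst x) (snd x) else 0)^2)*ind {t..T} (fst x)) : bm (LxP)"
  by measurable
 hence m: "(%(s, w). ennreal ((X s w)^2)*ind {t..T} s) : bm (LxP)"
  by (rule measurable_eqI) (auto simp: indicator_def)
 have "(NP w. (NS {t..T} (%s. ennreal ((X s w)^2)))) = (NL s. (NP w. ennreal ((X s w)^2)*ind {t..T} s))"
  by (rule LP.Fubini'[OF m])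
 also have "... <= (NS {t..T} (%s. ennreal K))"
  by (rule nn_integral_mono) (use K in "auto simp: indicator_def")
 also have "... = ennreal K*ennreal (T - t)" using t by (simp add: nn_integral_cmult_indicator)
 also have "... < \<infinity>" by (simp add: ennreal_mult_less_top)
 finally show ?thesis .
qed

end

lemma crra_measurable [measurable]: "crra gamma : bm borel"
 unfolding crra_def[abs_def] by measurable

lemma crra_sign: "gamma < 1 ==> 0 <= crra gamma a" "1 < gamma ==> crra gamma a <= 0"
 by (auto simp: crra_def divide_nonneg_neg)

context merton
begin

definition util :: "(real => 'a => real) => (real => 'a => real) => real => 'a => ereal" where
 "util c B s w = ereal (exp (- (rho + delta) * s))*(crra gamma (K powr retired tauR s*c s w)+ereal delta*crra gamma (k*B s w))"

abbreviation "gain c B \<equiv> (NP w. (NS {t..} (%s. e2ennreal (util c B s w))))"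
abbreviation "loss c B \<equiv> (NP w. (NS {t..} (%s. e2ennreal (- util c B s w))))"
abbreviation "value0 \<equiv> total_wealth d g h t"

lemma objective_util: "objective M rho delta K k gamma tauR t (c, B, theta) = enn2ereal (gain c B) - enn2ereal (loss c B)"
 by (simp add: objective_def util_def Let_def)

lemma util_sign: "gamma < 1 ==> 0 <= util c B s w" "1 < gamma ==> util c B s w <= 0"
proof -
 show "0 <= util c B s w" if "gamma < 1"
  using crra_sign(1)[OF that] delta by (auto simp: util_def intro!: mult_nonneg_nonneg add_nonneg_nonneg)
 show "util c B s w <= 0" if "1 < gamma"
  using crra_sign(2)[OF that] delta by (auto simp: util_def intro!: ereal_mult_le_0_iff[THEN iffD2] add_nonpos_nonpos)
qed

lemma objective_low: "gamma < 1 ==> objective M rho delta K k gamma tauR t (c, B, theta) = enn2ereal (gain c B)"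
 using util_sign(1) by (simp add: objective_util e2ennreal_neg ereal_uminus_le_reorder zero_ereal_def[symmetric] zero_ennreal.rep_eq)

lemma objective_high: "1 < gamma ==> objective M rho delta K k gamma tauR t (c, B, theta) = - enn2ereal (loss c B)"
 using util_sign(2) by (simp add: objective_util e2ennreal_neg zero_ereal_def[symmetric] zero_ennreal.rep_eq)

lemma retired_powr: "(K powr retired tauR s) powr (- b) = K powr (- b*retired tauR s)"
 by (simp add: powr_powr mult.commute)

lemma util_tangent:
 assumes z: "0 < z" and c: "0 <= c s w" "0 <= B s w"
 shows "util c B s w <= ereal (gamma/(1 - gamma)*(exp (- (rho + delta) * s)*(rate s*z powr (1 - gamma)))
  + exp (- (rho + delta) * s)*z powr (- gamma)*(c s w + delta*B s w))"
proof -
 let ?e = "exp (- (rho + delta) * s)" and ?m = "K powr retired tauR s"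
 note 1 = crra_tangent[OF gamma _ z b c(1), of ?m, unfolded retired_powr] and 2 = crra_tangent[OF gamma k z b c(2)]
 have "crra gamma (?m*c s w)+ereal delta*crra gamma (k*B s w)
  <= ereal (gamma/(1 - gamma)*(K powr (- b*retired tauR s)*z powr (1 - gamma))+z powr (- gamma)*c s w)
   + ereal delta*ereal (gamma/(1 - gamma)*(k powr (- b)*z powr (1 - gamma))+z powr (- gamma)*B s w)"
  using delta K by (intro add_mono 1 ereal_mult_left_mono 2) auto
 hence "util c B s w <= ereal ?e * ..."
  unfolding util_def by (intro ereal_mult_left_mono) auto
 also have "... = ereal (gamma/(1 - gamma)*(?e*(rate s*z powr (1 - gamma))) + ?e*z powr (- gamma)*(c s w + delta*B s w))"
  by (simp add: rate_def algebra_simps)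
 finally show ?thesis .
qed

lemma util_optimal:
 assumes z: "0 < z" and c: "c s w = K powr (- b*retired tauR s)*z" "B s w = k powr (- b)*z"
 shows "util c B s w = ereal (exp (- (rho + delta) * s)*(rate s*z powr (1 - gamma))/(1 - gamma))"
proof -
 have "0 < K powr retired tauR s" using K by simp
 from crra_optimal[OF gamma this z b] crra_optimal[OF gamma k z b] show ?thesis
  unfolding util_def c retired_powr by (simp add: rate_def algebra_simps add_divide_distrib)
qed

lemma income_moment:
 assumes y: "income y" and T: "t <= T"
 shows "cadapted t (%s w. g s*y s w)"
  and "(NP w. (NS {t..T} (%s. ennreal ((g s*y s w)^2)))) < \<infinity>"
proof -
 have yc: "cadapted t y" using labor_history(1)[OF y] by (simp add: history_def)
 show gy: "cadapted t (%s w. g s*y s w)" by (rule cadapted_times_g[OF yc])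
 obtain Ky where Ky: "!!s. s : {t..T} ==> (NP w. ennreal ((y s w)^2)) <= ennreal Ky" using labor_moment[OF y T] by blast
 obtain G where G: "!!s. s : {t..T} ==> abs (g s) <= G"
  by (rule continuous_Icc_bounded[OF continuous_on_subset[OF g_continuous, of "{t..T}"]]) auto
 have "(NP w. ennreal ((g s*y s w)^2)) <= ennreal (G^2*Ky)" if s: "s : {t..T}" for s
 proof -
  have [measurable]: "y s : bm P" using s by (intro cadapted_P[OF yc]) auto
  have "(NP w. ennreal ((g s*y s w)^2)) = ennreal ((g s)^2)*(NP w. ennreal ((y s w)^2))"
   by (simp add: power_mult_distrib ennreal_mult nn_integral_cmult)
  also have "... <= ennreal (G^2)*ennreal Ky"
   using power_mono[OF G[OF s], of 2] by (intro mult_mono Ky[OF s] ennreal_leI) auto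
  finally show ?thesis by (simp add: ennreal_mult')
 qed
 thus "(NP w. (NS {t..T} (%s. ennreal ((g s*y s w)^2)))) < \<infinity>"
  by (rule square_moment_integral[OF gy t0 T])
qed

text \<open>The integrand of \<open>reference_utility\<close> in a form that is jointly measurable
  on the whole product space.\<close>

definition u_ref :: "(real => 'a => real) => real \<times> 'a => ennreal" where
 "u_ref G x = ennreal (exp (- (rho + delta)*fst x)*(rate (fst x) *
  ((if fst x : {t..} then G (fst x) (snd x) else 0)/f (fst x)) powr (1 - gamma)))*ind {t..} (fst x)"

lemma u_ref:
 assumes x: "0 < x" and G: "cadapted t G" "AE w in M. ALL s. G s w = x*(f s/f t*exp (growth*(s - t)))*E s w"
 shows "u_ref G : bm (LxP)" "(NP w. (NL s. u_ref G (s, w))) = ennreal (price x*x)"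
proof -
 note [measurable] = pred_joint_P[OF cadapted_pred[OF G(1)] t0] borel_measurable_continuous_onI[OF f_continuous]
 show "u_ref G : bm (LxP)" unfolding u_ref_def[abs_def] by measurable
 show "(NP w. (NL s. u_ref G (s, w))) = ennreal (price x*x)"
  unfolding reference_utility[OF x G, symmetric] by (intro nn_integral_cong) (auto simp: u_ref_def indicator_def)
qed

section \<open>Upper bound for an arbitrary admissible strategy\<close>

context
 fixes w0 c B theta y W
 assumes adm: "pred t c" "pred t B" "pred t theta"
  "AE w in M. ALL s>=t. 0 <= c s w & 0 <= B s w"
  "!!T. t < T ==> (NP w. (NS {t..T} (%s. ennreal (c s w + B s w + (norm (theta s w))^2)))) < \<infinity>"
  and y: "income y"
  and W: "wealth M Z r delta mu sigma tauR t w0 y (c, B, theta) W"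
  and pos: "AE w in M. ALL s>=t. 0 <= total y W s w"
begin

lemma exposure_moment:
 assumes T: "t <= T"
 shows "(NP w. qvar (exposure y theta) t T w) < \<infinity>"
proof -
 note gy = income_moment(1)[OF y T] and m1 = income_moment(2)[OF y T]
 obtain C where C: "!!v. norm (v v* sigma) <= norm v * C"
  using bounded_linear.bounded[OF matrix_vector_mul_bounded_linear[of "transpose sigma"]] by auto
 \<comment> \<open>Admissibility gives finiteness for horizons strictly after \<open>t\<close>,
   while \<open>T = t\<close> is allowed here.\<close>
 define T' where "T' = T + 1"
 note [measurable] = adm(1-3)[THEN pred_joint_P[OF _ t0]] pred_joint_P[OF cadapted_pred[OF gy] t0]
 let ?J = "%H x. if fst x : {t..} then H (fst x) (snd x) else 0"
 let ?U = "%x. ennreal (?J c x + ?J B x + (norm (?J theta x))^2)*ind {t..T'} (fst x)"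
 let ?V = "%x. ennreal ((?J (%s w. g s*y s w) x)^2)*ind {t..T} (fst x)"
 have "(NP w. qvar (exposure y theta) t T w)
  <= (NP w. (NL s. ennreal (2*C^2)*?U (s, w)+ennreal (2*(norm sigmay)^2)*?V (s, w)))"
 proof (rule nn_integral_mono_AE, unfold AE_P_iff, use adm(4) in eventually_elim, rule nn_integral_mono)
  fix w s assume cB: "ALL s>=t. 0 <= c s w & 0 <= B s w"
  show "ennreal ((norm (exposure y theta s w))^2)*ind {t..T} s <= ennreal (2*C^2)*?U (s, w)+ennreal (2*(norm sigmay)^2)*?V (s, w)"
  proof (cases "s : {t..T}")
   case True
   let ?a = "norm (theta s w v* sigma)" and ?b = "abs (g s*y s w)*norm sigmay"
   have "?a^2 <= (norm (theta s w)*C)^2" by (intro power_mono C) auto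
   also have "... <= C^2*(c s w + B s w + (norm (theta s w))^2)"
    unfolding power_mult_distrib mult.commute[of _ "C^2"] using cB True by (intro mult_left_mono) auto
   finally have a: "?a^2 <= C^2*(c s w + B s w + (norm (theta s w))^2)" .
   have "norm (exposure y theta s w) <= ?a + ?b" unfolding exposure_def by (rule norm_triangle_le) simp
   hence "(norm (exposure y theta s w))^2 <= (?a + ?b)^2" by (intro power_mono) auto
   also have "... <= 2*?a^2 + 2*?b^2" using sum_squares_bound[of ?a ?b] by (simp add: power2_sum)
   also have "... <= 2*C^2*(c s w + B s w + (norm (theta s w))^2)+2*(norm sigmay)^2*(g s*y s w)^2"
    using a by (simp add: power_mult_distrib mult_ac)
   finally have "ennreal ((norm (exposure y theta s w))^2) <= ennreal (2*C^2*(c s w + B s w + (norm (theta s w))^2)+2*(norm sigmay)^2*(g s*y s w)^2)"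
    by (rule ennreal_leI)
   thus ?thesis using True cB by (simp add: T'_def ennreal_plus ennreal_mult)
  qed simp
 qed
 also have "... = ennreal (2*C^2)*(NP w. (NL s. ?U (s, w)))+ennreal (2*(norm sigmay)^2)*(NP w. (NL s. ?V (s, w)))"
  by (subst iterated_add, measurable, subst (1 2) iterated_cmult, measurable)
 also have "(NP w. (NL s. ?U (s, w))) = (NP w. (NS {t..T'} (%s. ennreal (c s w + B s w + (norm (theta s w))^2))))"
  by (intro nn_integral_cong) (auto simp: indicator_def)
 also have "(NP w. (NL s. ?V (s, w))) = (NP w. (NS {t..T} (%s. ennreal ((g s*y s w)^2))))"
  by (intro nn_integral_cong) (auto simp: indicator_def)
 also have "ennreal (2*C^2)*(NP w. (NS {t..T'} (%s. ennreal (c s w + B s w + (norm (theta s w))^2))))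
  + ennreal (2*(norm sigmay)^2)*(NP w. (NS {t..T} (%s. ennreal ((g s*y s w)^2)))) < \<infinity>"
  using adm(5)[of T'] m1 T by (simp add: T'_def ennreal_mult_less_top)
 finally show ?thesis .
qed

lemma admissible_budget:
 "(NP w. (NS {t..} (%s. ennreal (exp (- (r + delta)*(s - t)) * stoch_exp (- kappa) t s w*(c s w + delta*B s w)))))
  <= ennreal (value0 w0 (x0, x1))"
proof (rule budget[where H="exposure y theta" and X="total y W"])
 have "itoproc t (value0 w0 (x0, x1))
   (%s w. (r + delta)*total y W s w + kappa \<bullet> exposure y theta s w - c s w - delta*B s w) (exposure y theta) (total y W)"
  using total_ito[OF y] W by blast
 thus "itoproc t (value0 w0 (x0, x1))
   (%s w. (r + delta)*total y W s w + kappa \<bullet> exposure y theta s w - (c s w + delta*B s w)) (exposure y theta) (total y W)"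
  by (simp only: diff_diff_eq)
 have [measurable]: "(%x. c (fst x) (snd x)) : bm (palg t)"
  "(%x. B (fst x) (snd x)) : bm (palg t)"
  using adm(1,2) by (simp_all add: predictable_alt)
 show "pred t (%s w. c s w + delta*B s w)" unfolding predictable_alt by measurable
 show "AE w in M. ALL s>=t. 0 <= c s w + delta*B s w" using adm(4) by eventually_elim (use delta in auto)
qed (use t0 exposure_moment pos in auto)

text \<open>The tangent inequality is integrated along the candidate started from \<open>x'\<close>;
  the linear part is at most \<open>price x'\<close> times the budget. For \<open>gamma > 1\<close>
  the bound is stated for the loss, with the linear part on the other side, to avoid differences of
  possibly infinite integrals.\<close>

lemma utility_bound:
 assumes x': "0 < x'"
 shows "gamma < 1 ==> gain c B <= ennreal (price x' * value0 w0 (x0, x1))+ennreal (gamma/(1 - gamma)*(price x'*x'))"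
  and "1 < gamma ==> ennreal (gamma/(gamma - 1)*(price x'*x')) <= loss c B + ennreal (price x' * value0 w0 (x0, x1))"
proof -
 obtain G where G: "cadapted t G" "!!s w. 0 < x' ==> 0 < G s w"
  "AE w in M. ALL s. G s w = x'*(f s/f t*exp (growth*(s - t)))*E s w"
  by (rule reference[OF less_imp_le[OF x']]) (rule that, assumption+)
 note [measurable] = adm(1,2)[THEN pred_joint_P[OF _ t0]] pred_joint_P[OF cadapted_pred[OF G(1)] t0]
  borel_measurable_continuous_onI[OF f_continuous]
 let ?J = "%H x. if fst x : {t..} then H (fst x) (snd x) else 0"
 let ?e = "%s. exp (- (rho + delta) * s)"
 let ?a = "%s w. ?e s*(rate s*(G s w/f s) powr (1 - gamma))" and ?b = "%s w. ?e s*(G s w/f s) powr (- gamma)*(c s w + delta*B s w)"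
 let ?R = "%w. ALL s>=t. util c B s w <= ereal (gamma/(1 - gamma)*?a s w + ?b s w) & 0 <= c s w + delta*B s w"
 define u2 where "u2 x = ennreal (?e (fst x)*(?J G x/f (fst x)) powr (- gamma)*(?J c x + delta*?J B x))*ind {t..} (fst x)" for x
 let ?u1 = "u_ref G"
 note u1 = u_ref[OF x' G(1,3)] and [measurable] = u_ref(1)[OF x' G(1,3)]
 have [measurable]: "u2 : bm (LxP)" unfolding u2_def by measurable
 have p0: "0 < price x'" using x' f_pos[of t] by (simp add: price_def)
 \<comment> \<open>Divided by \<open>price x'\<close>, the linear part of the tangent is the
   integrand of the budget inequality.\<close>
 have "ennreal (1/price x')*(NP w. (NL s. u2 (s, w))) = (NP w. (NL s. ennreal (1/price x')*u2 (s, w)))"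
  by (rule iterated_cmult[symmetric]) measurable
 also have "... = (NP w. (NS {t..} (%s. ennreal (exp (- (r + delta)*(s - t)) * stoch_exp (- kappa) t s w*(c s w + delta*B s w)))))"
 proof (rule nn_integral_cong_AE, unfold AE_P_iff, use G(3) in eventually_elim, rule nn_integral_cong)
  fix w s assume "ALL s. G s w = x'*(f s/f t*exp (growth*(s - t)))*E s w"
  from reference_price[OF x' this[rule_format]]
  show "ennreal (1/price x')*u2 (s, w) = ennreal (exp (- (r + delta)*(s - t)) * stoch_exp (- kappa) t s w*(c s w + delta*B s w))*ind {t..} s"
   using p0 by (auto simp: u2_def indicator_def ennreal_mult'[symmetric] simp flip: mult.assoc)
 qed
 also have "... <= ennreal (value0 w0 (x0, x1))" by (rule admissible_budget)
 finally have "ennreal (price x')*(ennreal (1/price x')*(NP w. (NL s. u2 (s, w)))) <= ennreal (price x')*ennreal (value0 w0 (x0, x1))"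
  by (rule mult_left_mono) simp
 hence I2: "(NP w. (NL s. u2 (s, w))) <= ennreal (price x' * value0 w0 (x0, x1))"
  using p0 by (simp add: mult.assoc[symmetric] ennreal_mult'[symmetric])
 have tan: "AE w in P. ?R w"
  unfolding AE_P_iff using adm(4)
 proof eventually_elim
  case (elim w)
  thus ?case using delta G(2)[OF x'] f_pos by (intro allI impI conjI util_tangent divide_pos_pos) auto
 qed
 {
  assume gamma1: "gamma < 1"
  have "gain c B <= (NP w. (NL s. ennreal (gamma/(1 - gamma))*?u1 (s, w)+u2 (s, w)))"
  proof (rule nn_integral_mono_AE, use tan in eventually_elim, rule nn_integral_mono)
   fix w s
   assume t: "?R w"
   show "e2ennreal (util c B s w)*ind {t..} s <= ennreal (gamma/(1 - gamma))*?u1 (s, w)+u2 (s, w)"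
   proof (cases "t <= s")
    case True
    have "e2ennreal (util c B s w) <= ennreal (gamma/(1 - gamma)*?a s w + ?b s w)"
     using e2ennreal_mono[OF t[rule_format, OF True, THEN conjunct1]] by (simp add: e2ennreal_ereal)
    also have "... = ennreal (gamma/(1 - gamma))*?u1 (s, w)+u2 (s, w)"
     using t[rule_format, OF True] gamma1 gamma rate_pos[of s] True by (subst ennreal_plus) (simp_all add: u_ref_def u2_def ennreal_mult'[symmetric] less_imp_le)
    finally show ?thesis using True by simp
   qed simp
  qed
  also have "... = ennreal (gamma/(1 - gamma))*ennreal (price x'*x')+(NP w. (NL s. u2 (s, w)))"
   by (subst iterated_add[of "%x. ennreal (gamma/(1 - gamma))*?u1 x" u2], measurable, subst iterated_cmult, measurable) (simp only: u1(2))
  also have "... <= ennreal (price x' * value0 w0 (x0, x1))+ennreal (gamma/(1 - gamma)*(price x'*x'))"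
   using I2 gamma1 gamma by (simp add: ennreal_mult'[symmetric] add.commute add_left_mono)
  finally show "gain c B <= ennreal (price x' * value0 w0 (x0, x1))+ennreal (gamma/(1 - gamma)*(price x'*x'))" .
 next
  assume gamma1: "1 < gamma"
  define u3 where "u3 x = e2ennreal (- (ereal (?e (fst x))*(crra gamma (K powr retired tauR (fst x)*?J c x)+ereal delta*crra gamma (k*?J B x))))*ind {t..} (fst x)" for x
  have [measurable]: "retired tauR : bm borel" unfolding retired_def[abs_def] by measurable
  have [measurable]: "u3 : bm (LxP)" unfolding u3_def by measurable
  have "ennreal (gamma/(gamma - 1))*ennreal (price x'*x') = (NP w. (NL s. ennreal (gamma/(gamma - 1))*?u1 (s, w)))"
   by (subst iterated_cmult, measurable) (simp only: u1(2))
  also have "... <= (NP w. (NL s. u3 (s, w)+u2 (s, w)))"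
  proof (rule nn_integral_mono_AE, use tan in eventually_elim, rule nn_integral_mono)
   fix w s
   assume t: "?R w"
   show "ennreal (gamma/(gamma - 1))*?u1 (s, w) <= u3 (s, w)+u2 (s, w)"
   proof (cases "t <= s")
    case True
    define A where "A = gamma/(gamma - 1)*?a s w"
    have b0: "0 <= ?b s w" using t True by simp
    have n: "gamma/(1 - gamma) = - (gamma/(gamma - 1))" by (simp add: minus_divide_right)
    have "gamma/(1 - gamma)*?a s w = - A" unfolding n A_def by (rule mult_minus_left)
    hence "util c B s w <= ereal (- (A - ?b s w))" using t[rule_format, OF True] by simp
    hence "ereal (A - ?b s w) <= - util c B s w"
     using ereal_minus_le_minus[of "- util c B s w" "ereal (A - ?b s w)"] by simp
    from e2ennreal_mono[OF this] have "ennreal (A - ?b s w) <= e2ennreal (- util c B s w)" by (simp add: e2ennreal_ereal)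
    \<comment> \<open>\<open>A - ?b s w\<close> may be negative, where \<open>ennreal\<close> gives
      0; \<open>max 0\<close> keeps the addition rule for \<open>ennreal\<close> applicable.\<close>
    moreover have "ennreal A <= ennreal (max 0 (A - ?b s w) + ?b s w)" by (intro ennreal_leI) simp
    hence "ennreal A <= ennreal (A - ?b s w)+ennreal (?b s w)" using b0 by (simp add: ennreal_plus ennreal_max_0)
    ultimately have "ennreal A <= e2ennreal (- util c B s w)+ennreal (?b s w)"
     by (meson add_right_mono order_trans)
    thus ?thesis
     using True gamma1 rate_pos[of s] by (simp add: A_def u_ref_def u2_def u3_def util_def ennreal_mult'[symmetric] less_imp_le)
   qed (simp add: u_ref_def)
  qed
  also have "... = (NP w. (NL s. u3 (s, w)))+(NP w. (NL s. u2 (s, w)))"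
   by (rule iterated_add) measurable
  also have "(NP w. (NL s. u3 (s, w))) = loss c B"
   by (intro nn_integral_cong) (auto simp: u3_def util_def indicator_def)
  also have "loss c B + (NP w. (NL s. u2 (s, w))) <= loss c B + ennreal (price x' * value0 w0 (x0, x1))"
   by (intro add_left_mono I2)
  finally show "ennreal (gamma/(gamma - 1)*(price x'*x')) <= loss c B + ennreal (price x' * value0 w0 (x0, x1))"
   using gamma1 by (simp add: ennreal_mult'[symmetric])
 }
qed

text \<open>Starting points \<open>x' = 1/real (Suc n)\<close> for initial total wealth zero:
  \<open>price x' * x'\<close> is a constant times \<open>x' powr (1 - gamma)\<close>, which tends
  to 0 or to infinity according to the sign of \<open>1 - gamma\<close>. This forces zero gain or
  infinite loss.\<close>

lemma price_limit: "((%n. price (1/real (Suc n))*(1/real (Suc n))) ----> 0) \<or> 1 < gamma"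
 "1 < gamma ==> filterlim (%n. price (1/real (Suc n))*(1/real (Suc n))) at_top sequentially"
proof -
 let ?C = "exp (- (rho + delta)*t)*f t powr gamma"
 have C: "0 < ?C" using f_pos[of t] by simp
 have e: "price (1/real (Suc n))*(1/real (Suc n)) = ?C*real (Suc n) powr (gamma - 1)" for n
  using price_value[of "1/real (Suc n)"] by (simp add: powr_divide powr_minus_divide[symmetric] del: of_nat_Suc)
 show "((%n. price (1/real (Suc n))*(1/real (Suc n))) ----> 0) \<or> 1 < gamma"
 proof (cases "1 < gamma")
  case False
  have "filterlim (%n. real (Suc n)) at_top sequentially"
   by (rule filterlim_compose[OF filterlim_real_sequentially filterlim_Suc])
  from tendsto_neg_powr[OF _ this, of "gamma - 1"] have "(%n. real (Suc n) powr (gamma - 1)) ----> 0" using False gamma by simp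
  hence "(%n. ?C*real (Suc n) powr (gamma - 1)) ----> 0" by (rule tendsto_mult_right_zero)
  thus ?thesis unfolding e ..
 qed simp
 show "filterlim (%n. price (1/real (Suc n))*(1/real (Suc n))) at_top sequentially" if "1 < gamma"
 proof -
  have "real (Suc n) powr (gamma - 1) = exp ((gamma - 1)*ln (real (Suc n)))" for n by (simp add: powr_def)
  moreover have "filterlim (%n. exp ((gamma - 1)*ln (real (Suc n)))) at_top sequentially"
   using that
   by (intro filterlim_compose[OF exp_at_top] filterlim_tendsto_pos_mult_at_top[OF tendsto_const]
    filterlim_compose[OF ln_at_top filterlim_compose[OF filterlim_real_sequentially filterlim_Suc]]) auto
  ultimately show ?thesis unfolding e using C by (intro filterlim_tendsto_pos_mult_at_top[OF tendsto_const]) auto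
 qed
qed

text \<open>For \<open>gamma < 1\<close> and positive total wealth \<open>v\<close>, the two parts
  of the bound at \<open>x' = v\<close> add up to the value because
  \<open>1 + gamma/(1 - gamma) = 1/(1 - gamma)\<close>; for \<open>gamma > 1\<close> the finite
  linear part cancels on both sides.\<close>

lemma objective_upper:
 assumes v: "0 <= value0 w0 (x0, x1)"
 shows "objective M rho delta K k gamma tauR t (c, B, theta) <=
  (if value0 w0 (x0, x1) = 0 then (if gamma < 1 then 0 else -\<infinity>) else ereal (price (value0 w0 (x0, x1)) * value0 w0 (x0, x1)/(1 - gamma)))"
proof (cases "gamma < 1")
 case True
 note o = objective_low[OF True]
 have "gain c B <= ennreal (if value0 w0 (x0, x1) = 0 then 0 else price (value0 w0 (x0, x1)) * value0 w0 (x0, x1)/(1 - gamma))"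
 proof (cases "value0 w0 (x0, x1) = 0")
  case z: True
  let ?p = "%n. price (1/real (Suc n))*(1/real (Suc n))"
  have "gain c B <= ennreal (gamma/(1 - gamma)*?p n)" for n using utility_bound(1)[of "1/real (Suc n)"] True z by simp
  moreover have "(%n. ennreal (gamma/(1 - gamma)*?p n)) ----> ennreal (gamma/(1 - gamma)*0)"
   using price_limit(1) True by (intro tendsto_ennrealI tendsto_mult tendsto_const) auto
  ultimately have "gain c B <= ennreal (gamma/(1 - gamma)*0)" by (intro LIMSEQ_le_const) auto
  thus ?thesis using z by simp
 next
  case False
  define v where "v = value0 w0 (x0, x1)"
  have p: "0 <= price v" by (simp add: price_def)
  have "gain c B <= ennreal (price v * v)+ennreal (gamma/(1 - gamma)*(price v * v))"
   using utility_bound(1)[of v] False assms True by (simp add: v_def)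
  also have "... = ennreal (price v * v + gamma/(1 - gamma)*(price v * v))"
   using p assms True gamma by (intro ennreal_plus[symmetric]) (auto simp: v_def)
  also have "price v * v + gamma/(1 - gamma)*(price v * v) = price v * v/(1 - gamma)" using True by (simp add: field_simps)
  finally show ?thesis using False by (simp add: v_def)
 qed
 hence "enn2ereal (gain c B) <= enn2ereal (ennreal (if value0 w0 (x0, x1) = 0 then 0 else price (value0 w0 (x0, x1)) * value0 w0 (x0, x1)/(1 - gamma)))"
  by (simp only: less_eq_ennreal.rep_eq)
 moreover have "0 <= price (value0 w0 (x0, x1)) * value0 w0 (x0, x1)/(1 - gamma)" using True v by (auto simp: price_def)
 ultimately show ?thesis unfolding o using True by (simp add: enn2ereal_ennreal zero_ennreal.rep_eq zero_ereal_def split: if_splits)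
next
 case False
 hence gamma1: "1 < gamma" using gamma by simp
 note o = objective_high[OF gamma1]
 show ?thesis
 proof (cases "value0 w0 (x0, x1) = 0")
  case z: True
  let ?p = "%n. price (1/real (Suc n))*(1/real (Suc n))"
  have le: "ennreal (gamma/(gamma - 1)*?p n) <= loss c B" for n using utility_bound(2)[of "1/real (Suc n)"] gamma1 z by simp
  have "loss c B = \<infinity>"
  proof (rule ccontr)
   assume "loss c B ~= \<infinity>"
   then obtain l where l: "loss c B = ennreal l" "0 <= l" by (cases "loss c B") auto
   have "filterlim (%n. gamma/(gamma - 1)*?p n) at_top sequentially"
    using gamma1 by (intro filterlim_tendsto_pos_mult_at_top[OF tendsto_const _ price_limit(2)[OF gamma1]]) auto
   hence "\<forall>\<^sub>F n in sequentially. l + 1 <= gamma/(gamma - 1)*?p n" unfolding filterlim_at_top by blast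
   then obtain n where "l + 1 <= gamma/(gamma - 1)*?p n" unfolding eventually_sequentially by blast
   moreover have "gamma/(gamma - 1)*?p n <= l" using le[of n] l by (simp only: ennreal_le_iff)
   ultimately show False by linarith
  qed
  thus ?thesis unfolding o using z False by (simp add: top_ennreal.rep_eq top_ereal_def)
 next
  case nz: False
  define v where "v = value0 w0 (x0, x1)"
  have p: "0 <= price v * v" using assms by (simp add: price_def v_def)
  have q: "gamma/(gamma - 1)*(price v * v) = price v * v/(gamma - 1)+price v * v" using gamma1 by (simp add: field_simps)
  have "ennreal (price v * v/(gamma - 1))+ennreal (price v * v) <= loss c B + ennreal (price v * v)"
   using utility_bound(2)[of v] nz assms gamma1 p unfolding q by (simp add: v_def ennreal_plus)
  hence "ennreal (price v * v/(gamma - 1)) <= loss c B" by (simp add: ennreal_add_left_cancel_le add.commute)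
  hence "ereal (price v * v/(gamma - 1)) <= enn2ereal (loss c B)"
   using p gamma1 by (simp add: less_eq_ennreal.rep_eq enn2ereal_ennreal)
  hence "- enn2ereal (loss c B) <= - ereal (price v * v/(gamma - 1))" by (simp only: ereal_minus_le_minus)
  also have "- ereal (price v * v/(gamma - 1)) = ereal (price v * v/(1 - gamma))"
   using minus_divide_right[of "price v * v" "gamma - 1"] by simp
  finally show ?thesis unfolding o using nz by (simp add: v_def)
 qed
qed

end

end

section \<open>The feedback strategy attains the bound\<close>

context merton
begin

definition c_opt :: "(real => 'a => real) => real => 'a => real" where
 "c_opt X s w = K powr (- b*retired tauR s)*inverse (f s)*X s w"

definition B_opt :: "(real => 'a => real) => real => 'a => real" where
 "B_opt X s w = k powr (- b)*inverse (f s)*X s w"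

definition theta_opt :: "(real => 'a => real) => (real => 'a => real) => real => 'a => real^'n" where
 "theta_opt y X s w = X s w *\<^sub>R (matrix_inv (sigma ** transpose sigma) *v ((1 / gamma) *\<^sub>R (mu - r *\<^sub>R 1)))
  - (g s*y s w) *\<^sub>R (matrix_inv (transpose sigma) *v sigmay)"

text \<open>The feedback equation written for total wealth: labor income is gone and the equation is
  linear, so \<open>ito_linear_unique\<close> and \<open>ito_moment_bound\<close> apply.\<close>

definition closed_loop :: "real => (real => 'a => real) => bool" where
 "closed_loop x X \<longleftrightarrow> itoproc t x (%s w. X s w*drift_rate s) (%s w. ((1 / gamma)*X s w) *\<^sub>R kappa) X"

text \<open>The first part of the portfolio is a multiple of the solution of
  \<open>transpose sigma *v z = kappa\<close>; the second cancels the exposure of human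
  capital.\<close>

lemma exposure_opt: "exposure y (theta_opt y X) s w = ((1 / gamma)*X s w) *\<^sub>R kappa"
proof -
 have tr: "invertible (transpose sigma)" by (rule transpose_invertible[OF sigma])
 define z where "z = matrix_inv (transpose sigma) *v kappa"
 have z: "transpose sigma *v z = kappa"
  unfolding z_def by (simp only: matrix_vector_mul_assoc matrix_inv_inverse[OF tr] matrix_vector_mul_lid)
 have "(sigma ** transpose sigma) *v z = mu - r *\<^sub>R 1"
  by (simp only: matrix_vector_mul_assoc[symmetric] z matrix_excess)
 hence "matrix_inv (sigma ** transpose sigma) *v (mu - r *\<^sub>R 1) = matrix_inv (sigma ** transpose sigma) *v ((sigma ** transpose sigma) *v z)"
  by simp
 also have "... = z"
  by (simp only: matrix_vector_mul_assoc matrix_inv_inverse[OF invertible_mult[OF sigma tr]] matrix_vector_mul_lid)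
 finally have m: "matrix_inv (sigma ** transpose sigma) *v (mu - r *\<^sub>R 1) = z" .
 have "transpose sigma *v theta_opt y X s w = (X s w*(1 / gamma)) *\<^sub>R kappa - (g s*y s w) *\<^sub>R (transpose sigma *v (matrix_inv (transpose sigma) *v sigmay))"
  unfolding theta_opt_def matrix_vector_mult_scaleR m by (simp only: matrix_vector_mult_diff_distrib matrix_vector_mult_scaleR scaleR_scaleR z)
 also have "transpose sigma *v (matrix_inv (transpose sigma) *v sigmay) = sigmay"
  by (simp only: matrix_vector_mul_assoc matrix_inv_inverse[OF tr] matrix_vector_mul_lid)
 finally show ?thesis by (simp add: exposure_def mult.commute)
qed

lemma wealth_closed_loop:
 assumes "income y"
 shows "wealth M Z r delta mu sigma tauR t w0 y (c_opt (total y W), B_opt (total y W), theta_opt y (total y W)) W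
  \<longleftrightarrow> closed_loop (value0 w0 (x0, x1)) (total y W)"
proof -
 have "(r + delta)*X + kappa \<bullet> (((1 / gamma)*X) *\<^sub>R kappa) - K powr (- b*retired tauR s)*inverse (f s)*X - delta*(k powr (- b)*inverse (f s)*X) = X*drift_rate s"
  for X s unfolding drift_rate_def rate_def by (simp add: algebra_simps)
 thus ?thesis
  unfolding total_ito[OF assms] closed_loop_def exposure_opt[abs_def] c_opt_def B_opt_def by simp
qed

lemma inverse_f_bound: "inverse (f s) <= inverse (min eta etahat)" "0 < inverse (f s)"
 using f_bounds(1)[of s] eta_pos f_pos[of s] by (auto intro!: le_imp_inverse_le)

lemma retired_bound: "0 <= K powr (- b*retired tauR s)" "K powr (- b*retired tauR s) <= 1 + K powr (- b)"
 using K by (auto simp: retired_def)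

lemma drift_rate_bound: "EX D>=0. ALL s. (drift_rate s)^2 <= D"
proof -
 define A where "A = abs (r + delta + (1 / gamma)*(kappa \<bullet> kappa))"
 define Q where "Q = inverse (min eta etahat)*(1 + K powr (- b) + delta*k powr (- b))"
 have "abs (drift_rate s) <= A + Q" for s
 proof -
  have "inverse (f s)*rate s <= Q"
   unfolding Q_def rate_def using inverse_f_bound[of s] retired_bound[of s] delta eta_pos
   by (intro mult_mono) (auto intro!: add_nonneg_nonneg)
  moreover have "0 <= inverse (f s)*rate s" using inverse_f_bound(2)[of s] rate_pos[of s] by simp
  ultimately show ?thesis unfolding drift_rate_def A_def by linarith
 qed
 hence "(drift_rate s)^2 <= (A + Q)^2" for s by (metis abs_ge_zero power2_abs power_mono)
 thus ?thesis by (intro exI[of _ "(A + Q)^2"]) auto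
qed

text \<open>The energy term is added to fit the hypotheses of \<open>ito_linear_unique\<close> and
  \<open>ito_moment_bound\<close>.\<close>

lemma drift_square_bound: "EX D>=0. ALL x s. ALL e :: real => real. (x*drift_rate s)^2 <= D*(x^2 + (LBINT u:{t..s}. (e u)^2))"
proof -
 obtain D where D: "0 <= D" "!!s. (drift_rate s)^2 <= D" using drift_rate_bound by blast
 have "(x*drift_rate s)^2 <= D*(x^2 + (LBINT u:{t..s}. (e u)^2))" for x s and e :: "real => real"
 proof -
  have "(x*drift_rate s)^2 <= D*x^2" using mult_right_mono[OF D(2), of "x^2" s] by (simp add: power_mult_distrib mult.commute)
  also have "... <= D*(x^2 + (LBINT u:{t..s}. (e u)^2))"
   using D(1) by (intro mult_left_mono) (auto simp: sli_def intro!: integral_nonneg_AE)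
  finally show ?thesis .
 qed
 thus ?thesis using D(1) by blast
qed

lemma closed_loop_unique:
 assumes X: "closed_loop x X" and X': "closed_loop x X'"
 shows "AE w in M. ALL s>=t. X s w = X' s w"
proof -
 let ?e = "%s w. X s w + (-1)*X' s w"
 obtain D where D: "0 <= D" "!!x s (e :: real => real). (x*drift_rate s)^2 <= D*(x^2 + (LBINT u:{t..s}. (e u)^2))" using drift_square_bound by blast
 have H: "((1 / gamma)*X s w) *\<^sub>R kappa + (-1) *\<^sub>R (((1 / gamma)*X' s w) *\<^sub>R kappa) = ?e s w *\<^sub>R ((1 / gamma) *\<^sub>R kappa)" for s w
  by (simp add: algebra_simps)
 have a: "X s w*drift_rate s + (-1)*(X' s w*drift_rate s) = ?e s w*drift_rate s" for s w by (simp add: algebra_simps)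
 have "itoproc t (x + (-1)*x) (%s w. ?e s w*drift_rate s) (%s w. ?e s w *\<^sub>R ((1 / gamma) *\<^sub>R kappa)) ?e"
  using ito_process_lincomb[OF X[unfolded closed_loop_def] X'[unfolded closed_loop_def] t0, of "-1"] unfolding H a .
 hence p: "itoproc t 0 (%s w. ?e s w*drift_rate s) (%s w. ?e s w *\<^sub>R ((1 / gamma) *\<^sub>R kappa)) ?e"
  by (simp only: mult_minus1 add.right_inverse)
 have "AE w in M. ALL s>=t. ?e s w = 0"
 proof (rule ito_linear_unique[OF p t0])
  fix T
  show "EX C>=0. AE w in M. ALL s:{t..T}. (?e s w*drift_rate s)^2 <= C*((?e s w)^2 + (LBINT u:{t..s}. (?e u w)^2))"
   by (intro exI[of _ D] conjI AE_I2 ballI D)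
 qed
 thus ?thesis by eventually_elim auto
qed

lemma closed_loop_moment:
 assumes X: "closed_loop x X" and T: "t <= T"
 shows "cadapted t X" "(NP w. (NS {t..T} (%s. ennreal ((X s w)^2)))) < \<infinity>"
proof -
 show Xc: "cadapted t X" using X by (simp add: closed_loop_def ito_process_def)
 obtain D where D: "0 <= D" "!!x s (e :: real => real). (x*drift_rate s)^2 <= D*(x^2 + (LBINT u:{t..s}. (e u)^2))" using drift_square_bound by blast
 have "(%s w. ((1 / gamma)*X s w) *\<^sub>R kappa) = (%s w. X s w *\<^sub>R ((1 / gamma) *\<^sub>R kappa))" by (simp add: mult.commute)
 with X have p: "itoproc t x (%s w. X s w*drift_rate s) (%s w. X s w *\<^sub>R ((1 / gamma) *\<^sub>R kappa)) X"
  unfolding closed_loop_def by (simp only:)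
 have "EX K>=0. ALL s:{t..T}. (NP w. ennreal ((X s w)^2)) <= ennreal (K*(x^2 + 0))"
  by (rule ito_moment_bound[OF p t0 T D(1)], simp, intro AE_I2 ballI) (simp add: D(2))
 thus "(NP w. (NS {t..T} (%s. ennreal ((X s w)^2)))) < \<infinity>"
  using square_moment_integral[OF Xc t0 T] by blast
qed

lemma closed_loop_formula:
 assumes X: "closed_loop x X" and x: "0 <= x"
 shows "AE w in M. ALL s>=t. 0 <= X s w & X s w = x*(f s/f t*exp (growth*(s - t)))*E s w"
proof -
 obtain G where G: "!!s w. 0 <= G s w"
  "itoproc t x (%s w. G s w*drift_rate s) (%s w. ((1 / gamma)*G s w) *\<^sub>R kappa) G"
  "AE w in M. ALL s. G s w = x*(f s/f t*exp (growth*(s - t)))*E s w"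
  by (rule reference[OF x]) (rule that, assumption+)
 show ?thesis
  using closed_loop_unique[OF X G(2)[folded closed_loop_def]] G(3)
 proof eventually_elim
  case (elim w)
  thus ?case using G(1) by metis
 qed
qed

text \<open>Nonnegativity is read off the explicit formula for the solution; integrability of the
  controls reduces to second moments of total wealth and of \<open>g y\<close>.\<close>

lemma closed_loop_admissible:
 assumes y: "income y" and X: "closed_loop (value0 w0 (x0, x1)) (total y W)"
  and v: "0 <= value0 w0 (x0, x1)"
 shows "(c_opt (total y W), B_opt (total y W), theta_opt y (total y W)) : admissible M Z r delta mu sigma tauR d muy sigmay phi g h t w0 (x0, x1)"
proof -
 let ?X = "total y W"
 have Xc: "cadapted t ?X" using closed_loop_moment(1)[OF X order_refl] .
 note gy = income_moment(1)[OF y order_refl]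
 have [measurable]: "retired tauR : bm borel" "f : bm borel"
  unfolding retired_def[abs_def] by (measurable, rule borel_measurable_continuous_onI[OF f_continuous])
 have d: "(%x. q (fst x)) : bm (palg t)" if "q : bm borel" for q :: "real => real"
  using predictable_deterministic[OF that, of t] by (simp add: predictable_alt)
 have [measurable]: "(%x. K powr (- b*retired tauR (fst x))*inverse (f (fst x))) : bm (palg t)"
  "(%x. inverse (f (fst x))) : bm (palg t)"
  using d[of "%s. K powr (- b*retired tauR s)*inverse (f s)"] d[of "%s. inverse (f s)"] by measurable
 have [measurable]: "(%x. ?X (fst x) (snd x)) : bm (palg t)"
  "(%x. g (fst x)*y (fst x) (snd x)) : bm (palg t)"
  using cadapted_pred[OF Xc] cadapted_pred[OF gy] by (simp_all add: predictable_alt)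
 have p: "pred t (c_opt ?X)" "pred t (B_opt ?X)" "pred t (theta_opt y ?X)"
  unfolding predictable_alt c_opt_def B_opt_def theta_opt_def by measurable
 have pos: "AE w in M. ALL s>=t. 0 <= ?X s w" using closed_loop_formula[OF X v] by eventually_elim blast
 have cB: "AE w in M. ALL s>=t. 0 <= c_opt ?X s w & 0 <= B_opt ?X s w"
  using pos by eventually_elim (use f_pos in "auto simp: c_opt_def B_opt_def less_imp_le")
 define C where "C = (1 + K powr (- b)+k powr (- b))*inverse (min eta etahat)"
 define m1 m2 where "m1 = norm (matrix_inv (sigma ** transpose sigma) *v ((1 / gamma) *\<^sub>R (mu - r *\<^sub>R 1)))"
  and "m2 = norm (matrix_inv (transpose sigma) *v sigmay)"
 have C0: "0 <= C" using eta_pos by (simp add: C_def)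
 have fin: "(NP w. (NS {t..T} (%s. ennreal (c_opt ?X s w + B_opt ?X s w + (norm (theta_opt y ?X s w))^2)))) < \<infinity>" if T: "t < T" for T
 proof -
  note [measurable] = pred_joint_P[OF cadapted_pred[OF gy] t0] pred_joint_P[OF cadapted_pred[OF Xc] t0]
  let ?J = "%H x. if fst x : {t..} then H (fst x) (snd x) else 0"
  let ?I = "%x. ennreal C*ind {t..T} (fst x)"
  let ?U = "%x. ennreal ((?J ?X x)^2)*ind {t..T} (fst x)"
  let ?V = "%x. ennreal ((?J (%s w. g s*y s w) x)^2)*ind {t..T} (fst x)"
  have "(NP w. (NS {t..T} (%s. ennreal (c_opt ?X s w + B_opt ?X s w + (norm (theta_opt y ?X s w))^2))))
   <= (NP w. (NL s. ?I (s, w)+(ennreal (C + 2*m1^2)*?U (s, w)+ennreal (2*m2^2)*?V (s, w))))"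
  proof (rule nn_integral_mono_AE, unfold AE_P_iff, use pos in eventually_elim, rule nn_integral_mono)
   fix w s assume pos: "ALL s>=t. 0 <= ?X s w"
   show "ennreal (c_opt ?X s w + B_opt ?X s w + (norm (theta_opt y ?X s w))^2)*ind {t..T} s
    <= ?I (s, w)+(ennreal (C + 2*m1^2)*?U (s, w)+ennreal (2*m2^2)*?V (s, w))"
   proof (cases "s : {t..T}")
    case True
    define X Y where "X = ?X s w" and "Y = g s*y s w"
    have X0: "0 <= X" using pos True by (simp add: X_def)
    have "(K powr (- b*retired tauR s)+k powr (- b))*inverse (f s) <= C"
     unfolding C_def using inverse_f_bound[of s] retired_bound[of s] by (intro mult_mono) auto
    from mult_right_mono[OF this X0] have 1: "c_opt ?X s w + B_opt ?X s w <= C*X"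
     by (simp add: c_opt_def B_opt_def X_def algebra_simps)
    \<comment> \<open>Consumption and bequest are linear in wealth; this puts them under the second
      moment as well.\<close>
    have "X <= 1 + X^2" using sum_squares_bound[of X 1] X0 by simp
    from mult_left_mono[OF this C0] have 2: "C*X <= C + C*X^2" by (simp add: distrib_left)
    have "norm (theta_opt y ?X s w) <= X*m1 + abs Y*m2"
     unfolding theta_opt_def m1_def m2_def X_def[symmetric] Y_def[symmetric] by (rule norm_triangle_le_diff) (simp add: X0)
    hence "(norm (theta_opt y ?X s w))^2 <= (X*m1 + abs Y*m2)^2" by (rule power_mono) simp
    also have "... <= 2*(X*m1)^2 + 2*(abs Y*m2)^2" using sum_squares_bound[of "X*m1" "abs Y*m2"] by (simp add: power2_sum)
    also have "... = 2*m1^2*X^2 + 2*m2^2*Y^2" by (simp add: power_mult_distrib)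
    finally have "c_opt ?X s w + B_opt ?X s w + (norm (theta_opt y ?X s w))^2 <= C + ((C + 2*m1^2)*X^2 + 2*m2^2*Y^2)"
     using 1 2 by (simp only: distrib_right)
    from ennreal_leI[OF this] show ?thesis
     using True C0 by (simp add: ennreal_plus ennreal_mult X_def Y_def)
   qed simp
  qed
  also have "... = (NP w. (NL s. ?I (s, w)))+(ennreal (C + 2*m1^2)*(NP w. (NL s. ?U (s, w)))
    + ennreal (2*m2^2)*(NP w. (NL s. ?V (s, w))))"
   by (subst iterated_add[of ?I], measurable, subst iterated_add, measurable, subst (1 2) iterated_cmult, measurable)
  also have "(NP w. (NL s. ?I (s, w))) = ennreal C*ennreal (T - t)"
   using T by (simp add: nn_integral_cmult_indicator emeasure_space_1)
  also have "(NP w. (NL s. ?U (s, w))) = (NP w. (NS {t..T} (%s. ennreal ((?X s w)^2))))"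
   by (intro nn_integral_cong) (auto simp: indicator_def)
  also have "(NP w. (NL s. ?V (s, w))) = (NP w. (NS {t..T} (%s. ennreal ((g s*y s w)^2))))"
   by (intro nn_integral_cong) (auto simp: indicator_def)
  finally show ?thesis
   using closed_loop_moment(2)[OF X less_imp_le[OF T]] income_moment(2)[OF y less_imp_le[OF T]]
   by (auto simp: ennreal_mult_less_top intro: le_less_trans)
 qed
 have "wealth M Z r delta mu sigma tauR t w0 y (c_opt ?X, B_opt ?X, theta_opt y ?X) W" using wealth_closed_loop[OF y] X by blast
 thus ?thesis
  using p cB fin y pos by (auto simp: admissible_def total_wealth_process)
qed

lemma closed_loop_objective:
 assumes X: "closed_loop v X" and v: "0 < v"
 shows "objective M rho delta K k gamma tauR t (c_opt X, B_opt X, theta) = ereal (price v * v/(1 - gamma))"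
proof -
 have Xc: "cadapted t X" using closed_loop_moment(1)[OF X order_refl] .
 obtain G where G: "cadapted t G" "!!s w. 0 < v ==> 0 < G s w"
  "itoproc t v (%s w. G s w*drift_rate s) (%s w. ((1 / gamma)*G s w) *\<^sub>R kappa) G"
  "AE w in M. ALL s. G s w = v * (f s/f t*exp (growth*(s - t)))*E s w"
  by (rule reference[OF less_imp_le[OF v]]) (rule that, assumption+)
 note u = u_ref[OF v G(1,4)] and [measurable] = u_ref(1)[OF v G(1,4)]
 have p: "0 <= price v * v" using v by (simp add: price_def)
 have ut: "AE w in P. ALL s>=t. util (c_opt X) (B_opt X) s w = ereal (exp (- (rho + delta) * s)*(rate s*(G s w/f s) powr (1 - gamma))/(1 - gamma))"
  unfolding AE_P_iff using closed_loop_unique[OF X G(3)[folded closed_loop_def]]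
 proof eventually_elim
  case (elim w)
  thus ?case using G(2)[OF v] f_pos
   by (intro allI impI util_optimal) (auto simp: c_opt_def B_opt_def field_simps)
 qed
 show ?thesis
 proof (cases "gamma < 1")
  case True
  have "gain (c_opt X) (B_opt X) = (NP w. (NL s. ennreal (1/(1 - gamma))*u_ref G (s, w)))"
   by (rule nn_integral_cong_AE, use ut in eventually_elim, rule nn_integral_cong)
    (use True in "auto simp: u_ref_def indicator_def e2ennreal_ereal ennreal_mult'[symmetric]")
  also have "... = ennreal (price v * v/(1 - gamma))"
   using True by (subst iterated_cmult, measurable) (simp add: u(2) ennreal_mult'[symmetric])
  finally show ?thesis unfolding objective_low[OF True] using p True by (simp add: enn2ereal_ennreal)
 next
  case False
  hence gamma1: "1 < gamma" using gamma by simp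
  have n: "a/(1 - gamma) = - (a/(gamma - 1))" for a by (simp add: minus_divide_right)
  have "loss (c_opt X) (B_opt X) = (NP w. (NL s. ennreal (1/(gamma - 1))*u_ref G (s, w)))"
   by (rule nn_integral_cong_AE, use ut in eventually_elim, rule nn_integral_cong)
    (use gamma1 in "auto simp: n u_ref_def indicator_def e2ennreal_ereal ennreal_mult'[symmetric]")
  also have "... = ennreal (price v * v/(gamma - 1))"
   using gamma1 by (subst iterated_cmult, measurable) (simp add: u(2) ennreal_mult'[symmetric])
  finally show ?thesis unfolding objective_high[OF gamma1] using p gamma1 by (simp add: enn2ereal_ennreal n)
 qed
qed

text \<open>With zero total wealth nothing has to be computed: the objective is nonnegative for
  \<open>gamma < 1\<close>, and for \<open>gamma > 1\<close> the left side is
  \<open>-\<infinity>\<close>.\<close>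

lemma closed_loop_lower:
 assumes X: "closed_loop v X" and v: "0 <= v"
 shows "(if v = 0 then (if gamma < 1 then 0 else -\<infinity>) else ereal (price v * v/(1 - gamma))) <= objective M rho delta K k gamma tauR t (c_opt X, B_opt X, theta)"
proof (cases "v = 0")
 case True
 thus ?thesis by (simp add: objective_low)
next
 case False
 thus ?thesis using v by (simp add: closed_loop_objective[OF X])
qed

text \<open>Subtracting human capital from the explicit reference process gives a solution of the
  feedback equation.\<close>

lemma closed_loop_wealth:
 assumes y: "income y" and v: "0 <= value0 w0 (x0, x1)"
 obtains W where "closed_loop (value0 w0 (x0, x1)) (total y W)"
proof -
 obtain G where "itoproc t (value0 w0 (x0, x1)) (%s w. G s w*drift_rate s) (%s w. ((1 / gamma)*G s w) *\<^sub>R kappa) G"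
  by (rule reference[OF v]) (rule that, assumption+)
 moreover have "total y (%s w. G s w - human y s w) = G" by (simp add: fun_eq_iff total_human)
 ultimately show thesis by (intro that[of "%s w. G s w - human y s w"]) (simp add: closed_loop_def)
qed

lemma value_eq:
 assumes v: "0 <= value0 w0 (x0, x1)"
 shows "value_function M Z r delta mu sigma tauR d muy sigmay phi g h rho K k gamma t w0 (x0, x1) =
  (if value0 w0 (x0, x1) = 0 then (if gamma < 1 then 0 else -\<infinity>) else ereal (price (value0 w0 (x0, x1)) * value0 w0 (x0, x1)/(1 - gamma)))"
  (is "?V = ?R")
proof (rule antisym)
 show "?V <= ?R"
  unfolding value_function_def
 proof (rule SUP_least)
  fix \<pi> assume a: "\<pi> : admissible M Z r delta mu sigma tauR d muy sigmay phi g h t w0 (x0, x1)"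
  obtain c B theta where \<pi>: "\<pi> = (c, B, theta)" by (cases \<pi>) auto
  from a obtain y W where y: "pred t c" "pred t B" "pred t theta"
   "AE w in M. ALL s>=t. 0 <= c s w & 0 <= B s w"
   "ALL T>t. (NP w. (NS {t..T} (%s. ennreal (c s w + B s w + (norm (theta s w))^2)))) < \<infinity>"
   "income y" "wealth M Z r delta mu sigma tauR t w0 y (c, B, theta) W"
   "AE w in M. ALL s>=t. 0 <= total y W s w"
   unfolding \<pi> admissible_def total_wealth_process by auto
  show "objective M rho delta K k gamma tauR t \<pi> <= ?R"
   unfolding \<pi> by (rule objective_upper[OF y(1-4) y(5)[rule_format] y(6-8) v])
 qed
 obtain y where y: "income y" using labor_exists by blast
 obtain W where X: "closed_loop (value0 w0 (x0, x1)) (total y W)" by (rule closed_loop_wealth[OF y v])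
 let ?\<pi> = "(c_opt (total y W), B_opt (total y W), theta_opt y (total y W))"
 have "?R <= objective M rho delta K k gamma tauR t ?\<pi>" by (rule closed_loop_lower[OF X v])
 also have "... <= ?V"
  unfolding value_function_def by (rule SUP_upper[OF closed_loop_admissible[OF y X v]])
 finally show "?R <= ?V" .
qed

lemma closed_loop_optimal:
 assumes y: "income y" and X: "closed_loop (value0 w0 (x0, x1)) (total y W)"
  and v: "0 <= value0 w0 (x0, x1)"
 shows "objective M rho delta K k gamma tauR t (c_opt (total y W), B_opt (total y W), theta_opt y (total y W)) =
  value_function M Z r delta mu sigma tauR d muy sigmay phi g h rho K k gamma t w0 (x0, x1)" (is "?J = ?V")
proof (rule antisym)
 show "?J <= ?V" unfolding value_function_def by (rule SUP_upper[OF closed_loop_admissible[OF y X v]])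
 show "?V <= ?J" unfolding value_eq[OF v] by (rule closed_loop_lower[OF X v])
qed

end

theorem theorem7p1:
  fixes M :: "'a measure" and Z :: "real \<Rightarrow> 'a \<Rightarrow> real^'n"
    and r \<delta> \<rho> K k \<gamma> \<tau>R d \<mu>y \<beta> b \<nu> \<eta> \<eta>hat :: real
    and \<mu> \<sigma>y \<kappa> :: "real^'n" and \<sigma> :: "real^'n^'n"
    and \<phi> g f F :: "real \<Rightarrow> real" and h :: "real \<Rightarrow> real \<Rightarrow> real"
    and \<Gamma>s cf Bf :: "(real \<Rightarrow> 'a \<Rightarrow> real) \<Rightarrow> (real \<Rightarrow> 'a \<Rightarrow> real) \<Rightarrow> real \<Rightarrow> 'a \<Rightarrow> real"
    and \<theta>f :: "(real \<Rightarrow> 'a \<Rightarrow> real) \<Rightarrow> (real \<Rightarrow> 'a \<Rightarrow> real) \<Rightarrow> real \<Rightarrow> 'a \<Rightarrow> real^'n"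
  assumes "prob_space M" and "brownian_motion M Z"
    and "invertible \<sigma>" and "\<delta> > 0" and "\<rho> > 0" and "K > 1" and "k > 0"
    and "\<gamma> > 0" and "\<gamma> \<noteq> 1" and "\<tau>R > 0" and "d > 0" and "\<phi> \<in> L2_space d"
    and "\<kappa> = matrix_inv \<sigma> *v (\<mu> - r *\<^sub>R 1)"
    and "\<beta> = r + \<delta> - \<mu>y + \<sigma>y \<bullet> \<kappa>" and "\<beta> > 0"
    and "gh_solution r \<delta> \<beta> \<tau>R d \<phi> g h"
    and "\<rho> + \<delta> - (1 - \<gamma>) * (r + \<delta> + (\<kappa> \<bullet> \<kappa>) / (2 * \<gamma>)) > 0"
    and "b = 1 - 1 / \<gamma>"
    and "\<nu> = \<gamma> / (\<rho> + \<delta> - (1 - \<gamma>) * (r + \<delta> + (\<kappa> \<bullet> \<kappa>) / (2 * \<gamma>)))"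
    and "\<eta> = (1 + \<delta> * k powr (- b)) * \<nu>"
    and "\<eta>hat = (K powr (- b) + \<delta> * k powr (- b)) * \<nu>"
    and "f = (\<lambda>t. (\<eta>hat - \<eta>) * exp (- (max 0 (\<tau>R - t) / \<nu>)) + \<eta>)"
    and "F = (\<lambda>t. exp (- ((\<rho> + \<delta>) * t / \<gamma>)) * f t)"
    and "\<Gamma>s = (\<lambda>y W s \<omega>. W s \<omega> + g s * y s \<omega> + (LBINT \<zeta>:{-d..0}. h s \<zeta> * y (s + \<zeta>) \<omega>))"
    and "cf = (\<lambda>y W s \<omega>. K powr (- b * retired \<tau>R s) * inverse (f s) * \<Gamma>s y W s \<omega>)"
    and "Bf = (\<lambda>y W s \<omega>. k powr (- b) * inverse (f s) * \<Gamma>s y W s \<omega>)"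
    and "\<theta>f = (\<lambda>y W s \<omega>.
           \<Gamma>s y W s \<omega> *\<^sub>R (matrix_inv (\<sigma> ** transpose \<sigma>) *v ((1 / \<gamma>) *\<^sub>R (\<mu> - r *\<^sub>R 1)))
           - (g s * y s \<omega>) *\<^sub>R (matrix_inv (transpose \<sigma>) *v \<sigma>y))"
  shows
    \<comment> \<open>(1)\<close>
    "(\<forall>t\<ge>0. \<forall>w. \<forall>x\<in>M2_space d. total_wealth d g h t w x \<ge> 0 \<longrightarrow>
        value_function M Z r \<delta> \<mu> \<sigma> \<tau>R d \<mu>y \<sigma>y \<phi> g h \<rho> K k \<gamma> t w x =
          (if total_wealth d g h t w x = 0 then (if \<gamma> < 1 then 0 else -\<infinity>)
           else ereal (F t powr \<gamma> * (total_wealth d g h t w x powr (1 - \<gamma>) / (1 - \<gamma>))))) \<and>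
     (\<forall>w. \<forall>x\<in>M2_space d. total_wealth d g h 0 w x \<ge> 0 \<longrightarrow>
        (\<exists>y. labor_income M Z d \<mu>y \<sigma>y \<phi> 0 x y) \<and>
        (\<forall>y. labor_income M Z d \<mu>y \<sigma>y \<phi> 0 x y \<longrightarrow>
           \<comment> \<open>the closed-loop equation has a solution, unique up to indistinguishability\<close>
           (\<exists>W. wealth M Z r \<delta> \<mu> \<sigma> \<tau>R 0 w y (cf y W, Bf y W, \<theta>f y W) W \<and>
                (\<forall>W'. wealth M Z r \<delta> \<mu> \<sigma> \<tau>R 0 w y (cf y W', Bf y W', \<theta>f y W') W' \<longrightarrow>
                   (AE \<omega> in M. \<forall>s\<ge>0. W' s \<omega> = W s \<omega>))) \<and>
           (\<forall>W. wealth M Z r \<delta> \<mu> \<sigma> \<tau>R 0 w y (cf y W, Bf y W, \<theta>f y W) W \<longrightarrow>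
              \<comment> \<open>(2)\<close>
              optimal_strategy M Z r \<delta> \<mu> \<sigma> \<tau>R d \<mu>y \<sigma>y \<phi> g h \<rho> K k \<gamma> w x
                (cf y W, Bf y W, \<theta>f y W) \<and>
              \<comment> \<open>(3)\<close>
              ito_process M (augmented_filtration M Z) Z 0 (total_wealth d g h 0 w x)
                (\<lambda>s \<omega>. \<Gamma>s y W s \<omega> *
                   (r + \<delta> + (1 / \<gamma>) * (\<kappa> \<bullet> \<kappa>)
                    - inverse (f s) * (K powr (- b * retired \<tau>R s) + \<delta> * k powr (- b))))
                (\<lambda>s \<omega>. ((1 / \<gamma>) * \<Gamma>s y W s \<omega>) *\<^sub>R \<kappa>)
                (\<Gamma>s y W))))"
proof -
 interpret prob_space M by fact
 have D: "\<gamma> / \<nu> = \<rho> + \<delta> - (1 - \<gamma>)*(r + \<delta> + (\<kappa> \<bullet> \<kappa>)/(2 * \<gamma>))" and nu: "0 < \<nu>"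
  using assms(8,17) unfolding assms(19) by simp_all
 have mer: "merton M Z t d \<mu>y \<phi> x1 \<sigma>y r \<delta> \<beta> \<tau>R g h \<mu> \<kappa> \<sigma> K k b \<nu> \<eta> \<eta>hat f \<rho> \<gamma>"
  if "0 <= t" "x1 : L2_space d" for t x1
  by unfold_locales (use assms(2-18,20-22) that D nu in simp_all)
 have val: "value_function M Z r \<delta> \<mu> \<sigma> \<tau>R d \<mu>y \<sigma>y \<phi> g h \<rho> K k \<gamma> t w0 x =
   (if total_wealth d g h t w0 x = 0 then (if \<gamma> < 1 then 0 else -\<infinity>)
    else ereal (F t powr \<gamma>*(total_wealth d g h t w0 x powr (1 - \<gamma>)/(1 - \<gamma>))))"
  if t: "0 <= t" and x: "x : M2_space d" and v: "0 <= total_wealth d g h t w0 x" for t w0 x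
 proof -
  obtain x0 x1 where x01: "x = (x0, x1)" "x1 : L2_space d" using x by (auto simp: M2_space_def)
  interpret merton M Z t d \<mu>y x0 \<phi> x1 \<sigma>y r \<delta> \<beta> \<tau>R g h \<mu> \<kappa> \<sigma> K k b \<nu> \<eta> \<eta>hat f \<rho> \<gamma> by (rule mer[OF t x01(2)])
  define u where "u = total_wealth d g h t w0 x"
  \<comment> \<open>The discount exponent in \<open>F\<close> is divided by \<open>\<gamma>\<close>,
    so the power restores the full discount that \<open>price\<close> contains.\<close>
  have "F t powr \<gamma> = exp (- (\<rho> + \<delta>)*t)*f t powr \<gamma>"
   using f_pos[of t] gamma(1) unfolding assms(23) minus_mult_left[symmetric] by (simp add: powr_mult exp_powr_real)
  hence "price u*u/(1 - \<gamma>) = F t powr \<gamma>*(u powr (1 - \<gamma>)/(1 - \<gamma>))" if "0 < u"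
   by (simp add: price_value[OF that])
  thus ?thesis using value_eq[OF v[unfolded x01(1)]] v unfolding x01(1)[symmetric] u_def[symmetric] by simp
 qed
 have loop: "(EX y. labor_income M Z d \<mu>y \<sigma>y \<phi> 0 x y) \<and>
    (ALL y. labor_income M Z d \<mu>y \<sigma>y \<phi> 0 x y -->
      (EX W. wealth M Z r \<delta> \<mu> \<sigma> \<tau>R 0 w0 y (cf y W, Bf y W, \<theta>f y W) W \<and>
        (ALL W'. wealth M Z r \<delta> \<mu> \<sigma> \<tau>R 0 w0 y (cf y W', Bf y W', \<theta>f y W') W' -->
          (AE w in M. ALL s>=0. W' s w = W s w))) \<and>
      (ALL W. wealth M Z r \<delta> \<mu> \<sigma> \<tau>R 0 w0 y (cf y W, Bf y W, \<theta>f y W) W -->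
       optimal_strategy M Z r \<delta> \<mu> \<sigma> \<tau>R d \<mu>y \<sigma>y \<phi> g h \<rho> K k \<gamma> w0 x
        (cf y W, Bf y W, \<theta>f y W) \<and>
       ito_process M (augmented_filtration M Z) Z 0 (total_wealth d g h 0 w0 x)
        (%s w. \<Gamma>s y W s w *
          (r + \<delta> + (1 / \<gamma>)*(\<kappa> \<bullet> \<kappa>)
          - inverse (f s)*(K powr (- b*retired \<tau>R s) + \<delta>*k powr (- b))))
        (%s w. ((1 / \<gamma>) * \<Gamma>s y W s w) *\<^sub>R \<kappa>)
        (\<Gamma>s y W)))"
  if x: "x : M2_space d" and v: "0 <= total_wealth d g h 0 w0 x" for w0 x
 proof -
  obtain x0 x1 where x01: "x = (x0, x1)" "x1 : L2_space d" using x by (auto simp: M2_space_def)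
  interpret merton M Z 0 d \<mu>y x0 \<phi> x1 \<sigma>y r \<delta> \<beta> \<tau>R g h \<mu> \<kappa> \<sigma> K k b \<nu> \<eta> \<eta>hat f \<rho> \<gamma> by (rule mer[OF order_refl x01(2)])
  have \<Gamma>: "\<Gamma>s y W = total y W" for y W by (simp add: assms(24) fun_eq_iff total_def)
  have cf: "cf y W = c_opt (total y W)" "Bf y W = B_opt (total y W)" "\<theta>f y W = theta_opt y (total y W)" for y W
   by (simp_all add: assms(25-27) \<Gamma> fun_eq_iff c_opt_def B_opt_def theta_opt_def)
  note v = v[unfolded x01(1)]
  show ?thesis
   unfolding x01(1) cf \<Gamma> rate_def[symmetric] drift_rate_def[symmetric] closed_loop_def[symmetric]
  proof (intro conjI allI impI)
   show "EX y. labor_income M Z d \<mu>y \<sigma>y \<phi> 0 (x0, x1) y" using labor_exists by blast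
  next
   fix y assume y: "labor_income M Z d \<mu>y \<sigma>y \<phi> 0 (x0, x1) y"
   obtain W where W: "closed_loop (value0 w0 (x0, x1)) (total y W)" by (rule closed_loop_wealth[OF y v])
   have "AE w in M. ALL s>=0. W' s w = W s w" if "closed_loop (value0 w0 (x0, x1)) (total y W')" for W'
    using closed_loop_unique[OF that W] by eventually_elim (simp add: total_human)
   thus "EX W. wealth M Z r \<delta> \<mu> \<sigma> \<tau>R 0 w0 y (c_opt (total y W), B_opt (total y W), theta_opt y (total y W)) W \<and>
     (ALL W'. wealth M Z r \<delta> \<mu> \<sigma> \<tau>R 0 w0 y (c_opt (total y W'), B_opt (total y W'), theta_opt y (total y W')) W' -->
      (AE w in M. ALL s>=0. W' s w = W s w))"
    unfolding wealth_closed_loop[OF y] using W by blast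
   fix W assume "wealth M Z r \<delta> \<mu> \<sigma> \<tau>R 0 w0 y (c_opt (total y W), B_opt (total y W), theta_opt y (total y W)) W"
   \<comment> \<open>After the unfolding above, part (3) is \<open>closed_loop\<close> itself;
     optimality then rests on it.\<close>
   thus W: "closed_loop (value0 w0 (x0, x1)) (total y W)" unfolding wealth_closed_loop[OF y] .
   show "optimal_strategy M Z r \<delta> \<mu> \<sigma> \<tau>R d \<mu>y \<sigma>y \<phi> g h \<rho> K k \<gamma> w0 (x0, x1)
     (c_opt (total y W), B_opt (total y W), theta_opt y (total y W))"
    unfolding optimal_strategy_def using closed_loop_admissible[OF y W v] closed_loop_optimal[OF y W v] by blast
  qed
 qed
 show ?thesis using val loop by blast
qed

end
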